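(* Let $a_1,\dots,a_m\in\mathbb{C}$ be distinct points and let $X=\overline{\mathbb{C}}\setminus\{\infty,a_1,\dots,a_m\}$ be the punctured Riemann sphere, with $A=\mathbb{C}[z,(z-a_1)^{-1},\dots,(z-a_m)^{-1}]$ and $V=\operatorname{Der}(A)=A\frac{\partial}{\partial z}$. Let $W$ be a finite-dimensional $\mathcal{L}_+$-module, and let $M=A\otimes W$ be the corresponding tensor $AV$-module. Then for every $k$ $$H^k_{\mathrm{GF}}(V,A\otimes W)\cong H^k(\mathcal{L}_+,W)\oplus\left(\mathbb{C}^m\otimes H^{k-1}(\mathcal{L}_+,W)\right).$$
   Context: Everything is over $\mathbb{C}$; unadorned tensor products, $\operatorname{Hom}$ and exterior powers are over $\mathbb{C}$. $\mathcal{L}_+=\bigoplus_{d\ge0}\mathbb{C}\,Z^{d+1}\frac{\partial}{\partial Z}\subset\operatorname{Der}(\mathbb{C}[Z])$ is the Lie algebra of polynomial vector fields on the affine line vanishing at the origin. On a finite-dimensional $\mathcal{L}_+$-module, $Z^{d+1}\frac{\partial}{\partial Z}$ acts as zero for all large $d$. $H^*(\mathcal{L}_+,W)$ is ordinary Chevalley–Eilenberg cohomology, with $H^{-1}=0$. Tensor module $A\otimes W$: $A$ acts by multiplication on the left factor, and for $f,s\in A$, $w\in W$, $$f\tfrac{\partial}{\partial z}(s\otimes w)=\left(f\tfrac{\partial s}{\partial z}\right)\otimes w+\sum_{j\ge1}\frac1{j!}\frac{\partial^jf}{\partial z^j}\,s\otimes\left(Z^j\tfrac{\partial}{\partial Z}\right)w$$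 (a finite sum). Algebraic Gelfand–Fuks cohomology: $C^k(V,M)=\operatorname{Hom}(\bigwedge^kV,M)$ is the Chevalley–Eilenberg complex, with $$(d\varphi)(\eta_1,\dots,\eta_{k+1})=\sum_{s<t}(-1)^{s+t-1}\varphi([\eta_s,\eta_t],\eta_1,\dots,\hat\eta_s,\dots,\hat\eta_t,\dots,\eta_{k+1})+\sum_s(-1)^s\eta_s\varphi(\eta_1,\dots,\hat\eta_s,\dots,\eta_{k+1}).$$ $C^0_{\mathrm{GF}}(V,M)=M$, and for $k\ge1$, $C^k_{\mathrm{GF}}(V,M)$ is the set of $\varphi\in C^k(V,M)$ for which there is $p>0$ with $\sum_{i=0}^p(-1)^i\binom pi f^{p-i}\varphi(f^i\eta_1,\eta_2,\dots,\eta_k)=0$ for all $f\in A$, $\eta_1,\dots,\eta_k\in V$. For $M=A\otimes W$ these form a subcomplex, and $H^*_{\mathrm{GF}}(V,M)$ is its cohomology. *)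

theory Defs
  imports
    "HOL-Algebra.AbelCoset"
    "HOL-Computational_Algebra.Fraction_Field"
    "Jordan_Normal_Form.VS_Connect"
begin

section \<open>Complex vector spaces\<close>

text \<open>
  Complex vector spaces are records of type \<open>(complex, 'b) module\<close> satisfying
  \<open>vectorspace class_ring\<close>.  The fields \<open>mult\<close> and \<open>one\<close>, inherited from the
  ring record, carry no meaning.
\<close>

definition quotient_space :: "(complex, 'b, 'c) module_scheme \<Rightarrow> 'b set \<Rightarrow> (complex, 'b set) module" where
  "quotient_space M N =
    \<lparr>carrier = a_rcosets\<^bsub>M\<^esub> N, mult = undefined, one = undefined,
     zero = N, add = set_add M,
     smult = (\<lambda>c X. \<Union>x\<in>X. N +>\<^bsub>M\<^esub> (c \<odot>\<^bsub>M\<^esub> x))\<rparr>"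

definition free_space :: "'b set \<Rightarrow> (complex, 'b \<Rightarrow> complex) module" where
  "free_space S =
    \<lparr>carrier = {r. finite {x. r x \<noteq> 0} \<and> {x. r x \<noteq> 0} \<subseteq> S}, mult = undefined, one = undefined,
     zero = (\<lambda>_. 0), add = (\<lambda>r r' x. r x + r' x), smult = (\<lambda>c r x. c * r x)\<rparr>"

definition delta :: "'b \<Rightarrow> 'b \<Rightarrow> complex" where
  "delta x = (\<lambda>y. if y = x then 1 else 0)"

definition tensor_relators ::
    "(complex, 'b, 'd) module_scheme \<Rightarrow> (complex, 'c, 'e) module_scheme \<Rightarrow> ('b \<times> 'c \<Rightarrow> complex) set" where
  "tensor_relators M N =
     {\<lambda>p. delta (x \<oplus>\<^bsub>M\<^esub> x', y) p - delta (x, y) p - delta (x', y) p | x x' y.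
        x \<in> carrier M \<and> x' \<in> carrier M \<and> y \<in> carrier N}
   \<union> {\<lambda>p. delta (x, y \<oplus>\<^bsub>N\<^esub> y') p - delta (x, y) p - delta (x, y') p | x y y'.
        x \<in> carrier M \<and> y \<in> carrier N \<and> y' \<in> carrier N}
   \<union> {\<lambda>p. delta (c \<odot>\<^bsub>M\<^esub> x, y) p - c * delta (x, y) p | c x y.
        x \<in> carrier M \<and> y \<in> carrier N}
   \<union> {\<lambda>p. delta (x, c \<odot>\<^bsub>N\<^esub> y) p - c * delta (x, y) p | c x y.
        x \<in> carrier M \<and> y \<in> carrier N}"

definition tensor_kernel ::
    "(complex, 'b, 'd) module_scheme \<Rightarrow> (complex, 'c, 'e) module_scheme \<Rightarrow> ('b \<times> 'c \<Rightarrow> complex) set" where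
  "tensor_kernel M N =
     LinearCombinations.module.span class_ring (free_space (carrier M \<times> carrier N)) (tensor_relators M N)"

definition tensor_space ::
    "(complex, 'b, 'd) module_scheme \<Rightarrow> (complex, 'c, 'e) module_scheme \<Rightarrow>
     (complex, ('b \<times> 'c \<Rightarrow> complex) set) module" where
  "tensor_space M N = quotient_space (free_space (carrier M \<times> carrier N)) (tensor_kernel M N)"

definition pure_tensor ::
    "(complex, 'b, 'd) module_scheme \<Rightarrow> (complex, 'c, 'e) module_scheme \<Rightarrow> 'b \<Rightarrow> 'c \<Rightarrow>
     ('b \<times> 'c \<Rightarrow> complex) set" where
  "pure_tensor M N x y = tensor_kernel M N +>\<^bsub>free_space (carrier M \<times> carrier N)\<^esub> delta (x, y)"

definition tensor_lift ::
    "(complex, 'b, 'd) module_scheme \<Rightarrow> (complex, 'c, 'e) module_scheme \<Rightarrow>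
     (complex, 'p, 'f) module_scheme \<Rightarrow> ('b \<Rightarrow> 'c \<Rightarrow> 'p) \<Rightarrow> ('b \<times> 'c \<Rightarrow> complex) set \<Rightarrow> 'p" where
  "tensor_lift M N P b =
     (THE T. T \<in> extensional (carrier (tensor_space M N))
           \<and> linear_map class_ring (tensor_space M N) P T
           \<and> (\<forall>x\<in>carrier M. \<forall>y\<in>carrier N. T (pure_tensor M N x y) = b x y))"


section \<open>Lie algebras, modules and cochains\<close>

record ('a, 'b) lie_algebra = "('a, 'b) module" +
  bracket :: "'b \<Rightarrow> 'b \<Rightarrow> 'b"

text \<open>
  The Lie algebra of derivations of the algebra with underlying set \<open>A\<close> inside a ring
  that is a complex algebra through the structure map \<open>\<iota>\<close>.  Derivations are
  made \<open>undefined\<close> outside \<open>A\<close> so that equality is equality on \<open>A\<close>.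
\<close>

definition der_algebra :: "(complex \<Rightarrow> 'r::comm_ring_1) \<Rightarrow> 'r set \<Rightarrow> (complex, 'r \<Rightarrow> 'r) lie_algebra" where
  "der_algebra \<iota> A =
    \<lparr>carrier = {D \<in> A \<rightarrow>\<^sub>E A.
        (\<forall>s\<in>A. \<forall>t\<in>A. D (s + t) = D s + D t) \<and>
        (\<forall>c. \<forall>s\<in>A. D (\<iota> c * s) = \<iota> c * D s) \<and>
        (\<forall>s\<in>A. \<forall>t\<in>A. D (s * t) = D s * t + s * D t)},
     mult = undefined, one = undefined,
     zero = (\<lambda>s\<in>A. 0), add = (\<lambda>D E. \<lambda>s\<in>A. D s + E s), smult = (\<lambda>c D. \<lambda>s\<in>A. \<iota> c * D s),
     bracket = (\<lambda>D E. \<lambda>s\<in>A. D (E s) - E (D s))\<rparr>"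

locale lie_module =
  vectorspace "class_ring :: complex ring" M
  for L :: "(complex, 'l, 'e) lie_algebra_scheme" and M :: "(complex, 'b, 'c) module_scheme" +
  fixes act :: "'l \<Rightarrow> 'b \<Rightarrow> 'b"
  assumes act_closed: "\<lbrakk>x \<in> carrier L; v \<in> carrier M\<rbrakk> \<Longrightarrow> act x v \<in> carrier M"
    and act_add_left: "\<lbrakk>x \<in> carrier L; y \<in> carrier L; v \<in> carrier M\<rbrakk> \<Longrightarrow>
      act (x \<oplus>\<^bsub>L\<^esub> y) v = act x v \<oplus>\<^bsub>M\<^esub> act y v"
    and act_smult_left: "\<lbrakk>x \<in> carrier L; v \<in> carrier M\<rbrakk> \<Longrightarrow>
      act (c \<odot>\<^bsub>L\<^esub> x) v = c \<odot>\<^bsub>M\<^esub> act x v"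
    and act_add_right: "\<lbrakk>x \<in> carrier L; v \<in> carrier M; w \<in> carrier M\<rbrakk> \<Longrightarrow>
      act x (v \<oplus>\<^bsub>M\<^esub> w) = act x v \<oplus>\<^bsub>M\<^esub> act x w"
    and act_smult_right: "\<lbrakk>x \<in> carrier L; v \<in> carrier M\<rbrakk> \<Longrightarrow>
      act x (c \<odot>\<^bsub>M\<^esub> v) = c \<odot>\<^bsub>M\<^esub> act x v"
    and act_bracket: "\<lbrakk>x \<in> carrier L; y \<in> carrier L; v \<in> carrier M\<rbrakk> \<Longrightarrow>
      act (bracket L x y) v = act x (act y v) \<ominus>\<^bsub>M\<^esub> act y (act x v)"

text \<open>
  A cochain in \<open>Hom(\<Lambda>\<^sup>k L, M)\<close> is an alternating \<open>k\<close>-linear map, applied to the list of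
  its arguments.  The degree \<open>k\<close> is an integer: for \<open>k < 0\<close> there are no argument
  lists, the cochain space is zero, and so is the cohomology.
\<close>

definition tuples :: "(complex, 'l, 'e) lie_algebra_scheme \<Rightarrow> int \<Rightarrow> 'l list set" where
  "tuples L k = {xs \<in> lists (carrier L). int (length xs) = k}"

definition cochain_space ::
    "(complex, 'l, 'e) lie_algebra_scheme \<Rightarrow> (complex, 'b, 'c) module_scheme \<Rightarrow> int \<Rightarrow>
     (complex, 'l list \<Rightarrow> 'b) module" where
  "cochain_space L M k =
    \<lparr>carrier = {\<phi> \<in> tuples L k \<rightarrow>\<^sub>E carrier M.
        (\<forall>xs\<in>tuples L k. \<forall>i<length xs. \<forall>x\<in>carrier L. \<forall>y\<in>carrier L.
           \<phi> (xs[i := x \<oplus>\<^bsub>L\<^esub> y]) = \<phi> (xs[i := x]) \<oplus>\<^bsub>M\<^esub> \<phi> (xs[i := y])) \<and>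
        (\<forall>xs\<in>tuples L k. \<forall>i<length xs. \<forall>c. \<forall>x\<in>carrier L.
           \<phi> (xs[i := c \<odot>\<^bsub>L\<^esub> x]) = c \<odot>\<^bsub>M\<^esub> \<phi> (xs[i := x])) \<and>
        (\<forall>xs\<in>tuples L k. \<not> distinct xs \<longrightarrow> \<phi> xs = \<zero>\<^bsub>M\<^esub>)},
     mult = undefined, one = undefined,
     zero = (\<lambda>xs\<in>tuples L k. \<zero>\<^bsub>M\<^esub>),
     add = (\<lambda>\<phi> \<psi>. \<lambda>xs\<in>tuples L k. \<phi> xs \<oplus>\<^bsub>M\<^esub> \<psi> xs),
     smult = (\<lambda>c \<phi>. \<lambda>xs\<in>tuples L k. c \<odot>\<^bsub>M\<^esub> \<phi> xs)\<rparr>"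

text \<open>
  Arguments are numbered from \<open>0\<close>; the signs are \<open>(-1)\<^sup>s\<^sup>+\<^sup>t\<^sup>-\<^sup>1\<close> and \<open>(-1)\<^sup>s\<close> for arguments
  numbered from \<open>1\<close>.
\<close>

definition coboundary ::
    "(complex, 'l, 'e) lie_algebra_scheme \<Rightarrow> (complex, 'b, 'c) module_scheme \<Rightarrow> ('l \<Rightarrow> 'b \<Rightarrow> 'b) \<Rightarrow>
     int \<Rightarrow> ('l list \<Rightarrow> 'b) \<Rightarrow> 'l list \<Rightarrow> 'b" where
  "coboundary L M act k \<phi> = (\<lambda>xs\<in>tuples L (k + 1).
      (\<Oplus>\<^bsub>M\<^esub>p\<in>{(s, t). s < t \<and> t < length xs}.
         (-1) ^ (fst p + snd p + 1) \<odot>\<^bsub>M\<^esub>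
           \<phi> (bracket L (xs ! fst p) (xs ! snd p) # nths xs (- {fst p, snd p})))
    \<oplus>\<^bsub>M\<^esub>
      (\<Oplus>\<^bsub>M\<^esub>s\<in>{..<length xs}. (-1) ^ (s + 1) \<odot>\<^bsub>M\<^esub> act (xs ! s) (\<phi> (nths xs (- {s})))))"

definition cohomology ::
    "(int \<Rightarrow> (complex, 'x) module) \<Rightarrow> (int \<Rightarrow> 'x \<Rightarrow> 'x) \<Rightarrow> int \<Rightarrow> (complex, 'x set) module" where
  "cohomology C d k =
     quotient_space ((C k)\<lparr>carrier := {\<phi> \<in> carrier (C k). d k \<phi> = \<zero>\<^bsub>C (k + 1)\<^esub>}\<rparr>)
       (d (k - 1) ` carrier (C (k - 1)))"

definition lie_cohomology ::
    "(complex, 'l, 'e) lie_algebra_scheme \<Rightarrow> (complex, 'b, 'c) module_scheme \<Rightarrow> ('l \<Rightarrow> 'b \<Rightarrow> 'b) \<Rightarrow>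
     int \<Rightarrow> (complex, ('l list \<Rightarrow> 'b) set) module" where
  "lie_cohomology L M act k = cohomology (cochain_space L M) (coboundary L M act) k"

text \<open>
  Gelfand--Fuks cochains: differential operators in the first argument, hence, being
  alternating, in each argument.  The set \<open>A\<close> is a set of scalars, acting on \<open>L\<close> by \<open>actL\<close> and on \<open>M\<close> by \<open>actM\<close>.
\<close>

definition gf_cochain_space ::
    "'r::comm_ring_1 set \<Rightarrow> ('r \<Rightarrow> 'l \<Rightarrow> 'l) \<Rightarrow> ('r \<Rightarrow> 'b \<Rightarrow> 'b) \<Rightarrow>
     (complex, 'l, 'e) lie_algebra_scheme \<Rightarrow> (complex, 'b, 'c) module_scheme \<Rightarrow> int \<Rightarrow>
     (complex, 'l list \<Rightarrow> 'b) module" where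
  "gf_cochain_space A actL actM L M k =
     (cochain_space L M k)\<lparr>carrier := {\<phi> \<in> carrier (cochain_space L M k).
        1 \<le> k \<longrightarrow> (\<exists>p::nat. p > 0 \<and> (\<forall>f\<in>A. \<forall>x xs. x # xs \<in> tuples L k \<longrightarrow>
          (\<Oplus>\<^bsub>M\<^esub>i\<in>{0..p}. ((-1) ^ i * of_nat (p choose i)) \<odot>\<^bsub>M\<^esub>
             actM (f ^ (p - i)) (\<phi> (actL (f ^ i) x # xs))) = \<zero>\<^bsub>M\<^esub>))}\<rparr>"


section \<open>The punctured sphere\<close>

text \<open>All rational functions live in the field \<open>complex poly fract\<close>, i.e. in \<open>\<complex>(z)\<close>.\<close>

definition rat_const :: "complex \<Rightarrow> complex poly fract" where
  "rat_const c = Fract [:c:] 1"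

definition rat_z :: "complex poly fract" where
  "rat_z = Fract [:0, 1:] 1"

definition rat_deriv :: "complex poly fract \<Rightarrow> complex poly fract" where
  "rat_deriv f = (THE g. \<forall>p q. q \<noteq> 0 \<longrightarrow> f = Fract p q \<longrightarrow>
     g = Fract (pderiv p * q - p * pderiv q) (q * q))"

lemma rat_deriv_Fract:
  assumes "q \<noteq> 0"
  shows "rat_deriv (Fract p q) = Fract (pderiv p * q - p * pderiv q) (q * q)"
proof -
  have *: "Fract (pderiv r * s - r * pderiv s) (s * s) = Fract (pderiv p * q - p * pderiv q) (q * q)"
    if s: "s \<noteq> 0" and eq: "Fract p q = Fract r s" for r s :: "complex poly"
  proof -
    have e: "p * s = r * q"
      using eq s assms by (simp add: eq_fract)
    have e': "pderiv p * s + p * pderiv s = pderiv r * q + r * pderiv q"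
      using arg_cong[OF e, of pderiv] by (simp add: pderiv_mult algebra_simps)
    have "(pderiv p * q - p * pderiv q) * (s * s) - (pderiv r * s - r * pderiv s) * (q * q)
       = q * s * ((pderiv p * s + p * pderiv s) - (pderiv r * q + r * pderiv q))
         - (p * s - r * q) * (q * pderiv s + s * pderiv q)"
      by (simp add: algebra_simps)
    then have "(pderiv p * q - p * pderiv q) * (s * s) = (pderiv r * s - r * pderiv s) * (q * q)"
      using e e' by simp
    then show ?thesis
      using s assms by (simp add: eq_fract)
  qed
  show ?thesis
    unfolding rat_deriv_def
  proof (rule the_equality)
    show "\<forall>r s. s \<noteq> 0 \<longrightarrow> Fract p q = Fract r s \<longrightarrow>
        Fract (pderiv p * q - p * pderiv q) (q * q) = Fract (pderiv r * s - r * pderiv s) (s * s)"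
      using * by metis
  next
    fix g
    assume "\<forall>r s. s \<noteq> 0 \<longrightarrow> Fract p q = Fract r s \<longrightarrow>
        g = Fract (pderiv r * s - r * pderiv s) (s * s)"
    then show "g = Fract (pderiv p * q - p * pderiv q) (q * q)"
      using assms by simp
  qed
qed

inductive_set coord_ring :: "(nat \<Rightarrow> complex) \<Rightarrow> nat \<Rightarrow> complex poly fract set"
  for a :: "nat \<Rightarrow> complex" and m :: nat
  where
    const: "rat_const c \<in> coord_ring a m"
  | var: "rat_z \<in> coord_ring a m"
  | pole: "j \<in> {1..m} \<Longrightarrow> inverse (rat_z - rat_const (a j)) \<in> coord_ring a m"
  | add: "f \<in> coord_ring a m \<Longrightarrow> g \<in> coord_ring a m \<Longrightarrow> f + g \<in> coord_ring a m"
  | mult: "f \<in> coord_ring a m \<Longrightarrow> g \<in> coord_ring a m \<Longrightarrow> f * g \<in> coord_ring a m"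

definition coord_space :: "(nat \<Rightarrow> complex) \<Rightarrow> nat \<Rightarrow> (complex, complex poly fract) module" where
  "coord_space a m =
    \<lparr>carrier = coord_ring a m, mult = undefined, one = undefined,
     zero = 0, add = (+), smult = (\<lambda>c f. rat_const c * f)\<rparr>"

definition vector_fields ::
    "(nat \<Rightarrow> complex) \<Rightarrow> nat \<Rightarrow> (complex, complex poly fract \<Rightarrow> complex poly fract) lie_algebra" where
  "vector_fields a m = der_algebra rat_const (coord_ring a m)"

definition field_scale ::
    "(nat \<Rightarrow> complex) \<Rightarrow> nat \<Rightarrow> complex poly fract \<Rightarrow>
     (complex poly fract \<Rightarrow> complex poly fract) \<Rightarrow> complex poly fract \<Rightarrow> complex poly fract" where
  "field_scale a m f D = (\<lambda>s\<in>coord_ring a m. f * D s)"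

text \<open>
  \<open>poly_field p\<close> is the vector field \<open>p \<partial>/\<partial>Z\<close> on the affine line.  The condition
  \<open>p(0) = 0\<close> below cuts out the span of the fields \<open>Z\<^sup>d\<^sup>+\<^sup>1 \<partial>/\<partial>Z\<close> with \<open>d \<ge> 0\<close>.
\<close>

definition poly_field :: "complex poly \<Rightarrow> complex poly \<Rightarrow> complex poly" where
  "poly_field p = (\<lambda>q. p * pderiv q)"

definition L_plus :: "(complex, complex poly \<Rightarrow> complex poly) lie_algebra" where
  "L_plus = (der_algebra (\<lambda>c. [:c:]) UNIV)\<lparr>carrier := {poly_field p | p. poly p 0 = 0}\<rparr>"


section \<open>Tensor modules and their Gelfand--Fuks cohomology\<close>

definition tensor_module ::
    "(nat \<Rightarrow> complex) \<Rightarrow> nat \<Rightarrow> (complex, 'w) module \<Rightarrow>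
     (complex, (complex poly fract \<times> 'w \<Rightarrow> complex) set) module" where
  "tensor_module a m W = tensor_space (coord_space a m) W"

definition tensor_scale ::
    "(nat \<Rightarrow> complex) \<Rightarrow> nat \<Rightarrow> (complex, 'w) module \<Rightarrow> complex poly fract \<Rightarrow>
     (complex poly fract \<times> 'w \<Rightarrow> complex) set \<Rightarrow> (complex poly fract \<times> 'w \<Rightarrow> complex) set" where
  "tensor_scale a m W f =
     tensor_lift (coord_space a m) W (tensor_module a m W)
       (\<lambda>s w. pure_tensor (coord_space a m) W (f * s) w)"

text \<open>
  The vector field is \<open>D = f \<partial>/\<partial>z\<close> with \<open>f = D z\<close>, so \<open>f \<partial>s/\<partial>z = D s\<close>.
  The sum over \<open>j\<close> is restricted to the (finitely many) nonzero terms because \<open>finsum\<close>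
  over an infinite set is \<open>\<zero>\<close>.
\<close>

definition tensor_act ::
    "(nat \<Rightarrow> complex) \<Rightarrow> nat \<Rightarrow> (complex, 'w) module \<Rightarrow>
     ((complex poly \<Rightarrow> complex poly) \<Rightarrow> 'w \<Rightarrow> 'w) \<Rightarrow> (complex poly fract \<Rightarrow> complex poly fract) \<Rightarrow>
     (complex poly fract \<times> 'w \<Rightarrow> complex) set \<Rightarrow> (complex poly fract \<times> 'w \<Rightarrow> complex) set" where
  "tensor_act a m W \<rho> D =
     tensor_lift (coord_space a m) W (tensor_module a m W)
       (\<lambda>s w. pure_tensor (coord_space a m) W (D s) w
          \<oplus>\<^bsub>tensor_module a m W\<^esub>
          (\<Oplus>\<^bsub>tensor_module a m W\<^esub>j\<in>{j. 1 \<le> j \<and> \<rho> (poly_field (monom 1 j)) w \<noteq> \<zero>\<^bsub>W\<^esub>}.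
             pure_tensor (coord_space a m) W
               (rat_const (1 / fact j) * (rat_deriv ^^ j) (D rat_z) * s)
               (\<rho> (poly_field (monom 1 j)) w)))"

definition gf_cohomology ::
    "(nat \<Rightarrow> complex) \<Rightarrow> nat \<Rightarrow> (complex, 'w) module \<Rightarrow>
     ((complex poly \<Rightarrow> complex poly) \<Rightarrow> 'w \<Rightarrow> 'w) \<Rightarrow> int \<Rightarrow>
     (complex, ((complex poly fract \<Rightarrow> complex poly fract) list \<Rightarrow>
                (complex poly fract \<times> 'w \<Rightarrow> complex) set) set) module" where
  "gf_cohomology a m W \<rho> k =
     cohomology
       (gf_cochain_space (coord_ring a m) (field_scale a m) (tensor_scale a m W)
          (vector_fields a m) (tensor_module a m W))
       (coboundary (vector_fields a m) (tensor_module a m W) (tensor_act a m W \<rho>)) k"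

definition linear_isomorphic ::
    "(complex, 'b) module \<Rightarrow> (complex, 'c) module \<Rightarrow> bool" where
  "linear_isomorphic M N \<longleftrightarrow>
     (\<exists>h. linear_map class_ring M N h \<and> bij_betw h (carrier M) (carrier N))"

end

theory Submission
  imports Defs "HOL-Library.Function_Algebras" "HOL-Library.Product_Plus"
begin

text \<open>
  In a basis of \<open>W\<close>, a Gelfand--Fuks cochain is a differential operator in each argument, so
  it is determined by its coefficients:
  \<open>\<phi>(f\<^sub>1, \<dots>, f\<^sub>k) = \<Sum> (f\<^sub>1\<^bsup>(j\<^sub>1)\<^esup> / j\<^sub>1!) \<cdots> (f\<^sub>k\<^bsup>(j\<^sub>k)\<^esup> / j\<^sub>k!) c(j\<^sub>1, \<dots>, j\<^sub>k)\<close>, where \<open>c\<close> is alternating,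
  finitely supported and has values in \<open>A \<otimes> W\<close>. Under this correspondence the differential becomes the
  Chevalley--Eilenberg differential of the Lie algebra \<open>\<complex> \<partial>/\<partial>z \<oplus> L\<^sub>+\<close>, where \<open>\<partial>/\<partial>z\<close> (the index \<open>j = 0\<close>)
  commutes with \<open>L\<^sub>+\<close> and acts on the factor \<open>A\<close>, while \<open>L\<^sub>+\<close> acts on the factor \<open>W\<close>.
  The complex is therefore the product of the de Rham complex of \<open>A\<close> with the complex of finitely supported
  cochains of \<open>L\<^sub>+\<close>. By partial fractions, \<open>\<partial>/\<partial>z\<close> has kernel \<open>\<complex>\<close> on \<open>A\<close> and its
  cokernel has the basis \<open>1/(z - a\<^sub>i)\<close>, detected by the residues; this yields the two summands.
  Finally, finitely supported and arbitrary cochains of \<open>L\<^sub>+\<close> have the same cohomology: the Euler field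
  \<open>Z \<partial>/\<partial>Z\<close> acts on the part of large weight invertibly, because \<open>W\<close> is finite-dimensional.

  Spaces given as records are compared through linear bijections onto subsets of types that carry their own vector space
  operations, and all computations with cochains take place there.
\<close>

text \<open>The order condition is used for the function z alone: on A, a complex-linear map that
  commutes with multiplication by z is already A-linear, so iterated commutators with z determine a
  differential operator (\<open>expand_order\<close>). Since cochains alternate, the one bound p for
  the first argument bounds every index of the coefficient function; this is where finite support
  comes from.

  The obstacle in passing to coefficients is that they are multiplied by functions, which the vector
  fields differentiate. The comparison map does not commute with Lie derivatives, but only up to
  wedge products with the differentials of jets, and exactly these cancel in Cartan's formula
  (\<open>LV_Phi\<close>, \<open>DV_Phi\<close>). The index 0 commutes with the others because the
  terms of a bracket that contain an undifferentiated factor merely differentiate jets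
  (\<open>F_bracket\<close>).

  The passage to cohomology is made by linear maps whose kernel is the space of boundaries. Both
  sides then acquire one and the same model, and no quotient has to be compared with
  another.\<close>

text \<open>
  Coordinate vectors with respect to a basis of \<open>W\<close>: elements of \<open>W\<close> have constant coordinates,
  elements of \<open>A \<otimes> W\<close> have coordinates in \<open>A\<close>.
\<close>

datatype 'k val = Val (coo: "nat \<Rightarrow> 'k")

instantiation val :: (ab_group_add) ab_group_add
begin

definition "0 = Val (\<lambda>_. 0)"
definition "v + w = Val (\<lambda>a. coo v a + coo w a)"
definition "v - w = Val (\<lambda>a. coo v a - coo w a)"
definition "- v = Val (\<lambda>a. - coo v a)"

instance
  by standard (simp_all add: zero_val_def plus_val_def minus_val_def uminus_val_def algebra_simps)

end

lemma coo_simps [simp]: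
  "coo 0 a = 0" "coo (v + w) a = coo v a + coo w a" "coo (v - w) a = coo v a - coo w a"
  "coo (- v) a = - coo v a"
  by (simp_all add: zero_val_def plus_val_def minus_val_def uminus_val_def)

lemma val_eqI: "(\<And>a. coo v a = coo w a) \<Longrightarrow> v = w"
  by (cases v; cases w) auto

lemma coo_sum [simp]: "coo (\<Sum>i\<in>I. f i) a = (\<Sum>i\<in>I. coo (f i) a)"
  by (induction I rule: infinite_finite_induct) auto

lemma sum_fun_apply: "(\<Sum>i\<in>I. f i) x = (\<Sum>i\<in>I. f i x)" for f :: "'i \<Rightarrow> 'x \<Rightarrow> 'y::comm_monoid_add"
  by (induction I rule: infinite_finite_induct) simp_all

section \<open>Contraction and antisymmetry\<close>

definition con :: "'l \<Rightarrow> ('l list \<Rightarrow> 'b) \<Rightarrow> 'l list \<Rightarrow> 'b" where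
  "con x \<phi> = (\<lambda>xs. \<phi> (x # xs))"

lemma con_apply: "con x \<phi> xs = \<phi> (x # xs)"
  by (simp add: con_def)

text \<open>
  Lie derivative and differential, computed by contraction with the first argument: the second equation of \<open>dee\<close> is
  Cartan's formula, with the sign convention in which the differential is minus the usual one. The operator \<open>bc x y\<close>
  is contraction with the bracket of \<open>x\<close> and \<open>y\<close>.
\<close>

fun lied :: "('l \<Rightarrow> 'l \<Rightarrow> ('l list \<Rightarrow> 'b) \<Rightarrow> 'l list \<Rightarrow> 'b) \<Rightarrow> ('l \<Rightarrow> 'b \<Rightarrow> 'b) \<Rightarrow> 'l \<Rightarrow>
    ('l list \<Rightarrow> 'b) \<Rightarrow> 'l list \<Rightarrow> 'b::ab_group_add" where
  "lied bc act x \<phi> [] = act x (\<phi> [])"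
| "lied bc act x \<phi> (y # ys) = lied bc act x (con y \<phi>) ys - bc x y \<phi> ys"

fun dee :: "('l \<Rightarrow> 'l \<Rightarrow> ('l list \<Rightarrow> 'b) \<Rightarrow> 'l list \<Rightarrow> 'b) \<Rightarrow> ('l \<Rightarrow> 'b \<Rightarrow> 'b) \<Rightarrow>
    ('l list \<Rightarrow> 'b) \<Rightarrow> 'l list \<Rightarrow> 'b::ab_group_add" where
  "dee bc act \<phi> [] = 0"
| "dee bc act \<phi> (x # xs) = - lied bc act x \<phi> xs - dee bc act (con x \<phi>) xs"

text \<open>Adjacent transpositions generate all permutations, so this is antisymmetry in all
  arguments. It is imposed on lists of every length at once, which spares the inductions below any
  bookkeeping of the degree.\<close>

definition antisym_fun :: "('l list \<Rightarrow> 'b::ab_group_add) \<Rightarrow> bool" where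
  "antisym_fun \<phi> \<longleftrightarrow> (\<forall>xs x y ys. \<phi> (xs @ x # y # ys) = - \<phi> (xs @ y # x # ys))"

lemma antisym_fun_con: "antisym_fun \<phi> \<Longrightarrow> antisym_fun (con x \<phi>)"
  unfolding antisym_fun_def con_def by (metis append_Cons[of x])

lemma antisym_fun_swap: "antisym_fun \<phi> \<Longrightarrow> \<phi> (x # y # ys) = - \<phi> (y # x # ys)"
  unfolding antisym_fun_def by (metis append_Nil)

text \<open>The sign of moving an entry to the front. It reduces questions about a list that
  contains a given entry to lists that begin with it.\<close>

lemma antisym_fun_append:
  assumes "antisym_fun (\<phi> :: 'l list \<Rightarrow> 'b::ab_group_add)"
  shows "\<phi> (xs @ x # ys) = (if even (length xs) then \<phi> (x # xs @ ys) else - \<phi> (x # xs @ ys))"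
  using assms
proof (induction xs arbitrary: \<phi>)
  case Nil
  then show ?case by simp
next
  case (Cons z zs)
  have "\<phi> ((z # zs) @ x # ys) = con z \<phi> (zs @ x # ys)" by (simp add: con_apply)
  also have "\<dots> = (if even (length zs) then con z \<phi> (x # zs @ ys) else - con z \<phi> (x # zs @ ys))"
    by (rule Cons.IH[OF antisym_fun_con[OF Cons.prems]])
  also have "\<dots> = (if even (length (z # zs)) then \<phi> (x # (z # zs) @ ys) else - \<phi> (x # (z # zs) @ ys))"
    using antisym_fun_swap[OF Cons.prems, of z x "zs @ ys"] by (simp add: con_apply)
  finally show ?case .
qed

lemma antisym_funD: "antisym_fun \<phi> \<Longrightarrow> \<phi> (xs @ x # y # ys) = - \<phi> (xs @ y # x # ys)"
  unfolding antisym_fun_def by blast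

lemma antisym_fun_add:
  assumes "antisym_fun \<phi>" "antisym_fun \<psi>"
  shows "antisym_fun (\<phi> + \<psi>)"
  unfolding antisym_fun_def
proof (intro allI)
  fix xs x y ys
  show "(\<phi> + \<psi>) (xs @ x # y # ys) = - (\<phi> + \<psi>) (xs @ y # x # ys)"
    using antisym_funD[OF assms(1), of xs x y ys] antisym_funD[OF assms(2), of xs x y ys] by simp
qed

lemma antisym_fun_minus:
  assumes "antisym_fun \<phi>"
  shows "antisym_fun (- \<phi>)"
  unfolding antisym_fun_def
proof (intro allI)
  fix xs x y ys
  show "(- \<phi>) (xs @ x # y # ys) = - (- \<phi>) (xs @ y # x # ys)"
    using antisym_funD[OF assms, of xs x y ys] by simp
qed

lemma antisym_fun_comp:
  assumes "antisym_fun \<phi>" "\<And>v. h (- v) = - h v"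
  shows "antisym_fun (\<lambda>xs. h (\<phi> xs))"
  unfolding antisym_fun_def
proof (intro allI)
  fix xs x y ys
  show "h (\<phi> (xs @ x # y # ys)) = - h (\<phi> (xs @ y # x # ys))"
    using antisym_funD[OF assms(1), of xs x y ys] assms(2) by simp
qed

subsection \<open>Scalars\<close>

definition sc :: "'k::field_char_0 \<Rightarrow> 'k val \<Rightarrow> 'k val" where
  "sc k v = Val (\<lambda>a. k * coo v a)"

lemma coo_sc [simp]: "coo (sc k v) a = k * coo v a"
  by (simp add: sc_def)

lemma sc_simps [simp]:
  "sc k (v + w) = sc k v + sc k w" "sc k (v - w) = sc k v - sc k w" "sc k (- v) = - sc k v"
  "sc k 0 = 0" "sc 0 v = 0" "sc 1 v = v" "sc k (sc l v) = sc (k * l) v"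
  by (auto intro: val_eqI simp: algebra_simps)

lemma sc_left:
  "sc (k + l) v = sc k v + sc l v" "sc (k - l) v = sc k v - sc l v" "sc (- k) v = - sc k v"
  by (auto intro: val_eqI simp: algebra_simps)

lemma sc_sum: "sc k (\<Sum>i\<in>I. f i) = (\<Sum>i\<in>I. sc k (f i))"
  by (rule val_eqI) (simp add: sum_distrib_left)

lemma sc_sum_left: "sc (\<Sum>i\<in>I. k i) v = (\<Sum>i\<in>I. sc (k i) v)"
  by (rule val_eqI) (simp add: sum_distrib_right)

lemma sc_eq_0_iff: "sc k v = 0 \<longleftrightarrow> k = 0 \<or> v = 0"
proof
  assume "sc k v = 0"
  then have "k * coo v a = 0" for a by (metis coo_sc coo_simps(1))
  then show "k = 0 \<or> v = 0" by (auto intro: val_eqI)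
qed auto

text \<open>Additivity alone gives compatibility with integers. That is all an action can be asked
  for here, since index 0 acts by differentiation, and it is enough, since the structure constants
  are integers.\<close>

lemma additive_sc_of_int:
  fixes h :: "'k::field_char_0 val \<Rightarrow> 'k val"
  assumes h: "\<And>v w. h (v + w) = h v + h w"
  shows "h (sc (of_int i) v) = sc (of_int i) (h v)"
proof -
  interpret h: additive h by unfold_locales (rule h)
  have nat: "h (sc (of_nat n) v) = sc (of_nat n) (h v)" for n
  proof (induction n)
    case 0
    show "h (sc (of_nat 0) v) = sc (of_nat 0) (h v)" by (simp add: h.zero)
  next
    case (Suc n)
    have "h (sc (of_nat n) v) = sc (of_nat n) (h v)" by (rule Suc.IH)
    then show "h (sc (of_nat (Suc n)) v) = sc (of_nat (Suc n)) (h v)"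
      by (simp add: sc_left h.add)
  qed
  show ?thesis
  proof (cases "i \<ge> 0")
    case True
    then show ?thesis using nat[of "nat i"] by simp
  next
    case False
    then have "h (- sc (of_nat (nat (-i))) v) = - sc (of_nat (nat (-i))) (h v)"
      using nat[of "nat (-i)"] by (simp add: h.minus)
    then show ?thesis using False by (simp add: sc_left(3))
  qed
qed

subsection \<open>The complex of coefficient functions\<close>

text \<open>
  Index \<open>j \<ge> 1\<close> stands for \<open>Z\<^sup>j \<partial>/\<partial>Z\<close> and index \<open>0\<close> for \<open>\<partial>/\<partial>z\<close>, which commutes with all others.
\<close>

definition brn :: "nat \<Rightarrow> nat \<Rightarrow> (nat list \<Rightarrow> 'k val) \<Rightarrow> nat list \<Rightarrow> 'k::field_char_0 val" where
  "brn i j c = (\<lambda>js. if i = 0 \<or> j = 0 then 0 else sc (of_int (int j - int i)) (c ((i + j - 1) # js)))"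

text \<open>The Jacobi identity for [Z^i d/dZ, Z^j d/dZ] = (j - i) Z^(i+j-1) d/dZ, contracted into a
  cochain. It comes down to an identity between products of two structure constants.\<close>

lemma brn_jacobi:
  assumes "i > 0" "j > 0"
  shows "sc (of_int (int j - int i) :: 'k::field_char_0) (brn (i + j - 1) y c js) =
    (if y = 0 then 0 else sc (of_int (int y - int j)) (brn i (j + y - 1) c js)
     - sc (of_int (int y - int i)) (brn j (i + y - 1) c js))"
proof (cases "y = 0")
  case False
  \<comment> \<open>Positivity of the indices makes the truncated subtractions exact, so that the
    three double brackets land on one index.\<close>
  have e: "i + j - 1 + y - 1 = i + y + j - 2" "i + (j + y - 1) - 1 = i + y + j - 2"
    "j + (i + y - 1) - 1 = i + y + j - 2"
    using assms False by auto
  have "of_int (int j - int i) * of_int (int y - int (i + j - 1)) =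
      of_int (int y - int j) * of_int (int (j + y - 1) - int i)
      - (of_int (int y - int i) * of_int (int (i + y - 1) - int j) :: 'k)"
    using assms False unfolding of_int_mult[symmetric] of_int_diff[symmetric]
    by (intro arg_cong[where f = of_int]) (simp add: of_nat_diff algebra_simps)
  then have "sc (of_int (int j - int i) * of_int (int y - int (i + j - 1))) v =
      sc (of_int (int y - int j) * of_int (int (j + y - 1) - int i)) v
      - sc (of_int (int y - int i) * of_int (int (i + y - 1) - int j)) v" for v :: "'k val"
    by (simp only: sc_left(2))
  note * = this[of "c ((i + y + j - 2) # js)"]
  show ?thesis
    using assms False * unfolding brn_def e by (simp del: of_int_diff of_int_of_nat_eq)
qed (simp add: brn_def)

text \<open>A representation of the Lie algebra with one basis element for each index. Only
  additivity is asked, so that \<open>act 0\<close> can be a derivation.\<close>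

locale basis_act =
  fixes act :: "nat \<Rightarrow> 'k::field_char_0 val \<Rightarrow> 'k val"
  assumes act_add: "act i (v + w) = act i v + act i w"
    and act_comm: "act i (act j v) - act j (act i v) =
      (if i = 0 \<or> j = 0 then 0 else sc (of_int (int j - int i)) (act (i + j - 1) v))"
begin

abbreviation "LN \<equiv> lied brn act"
abbreviation "DN \<equiv> dee brn act"

lemma act_0 [simp]: "act i 0 = 0"
  using act_add[of i 0 0] by simp

lemma act_minus: "act i (- v) = - act i v"
  using act_add[of i v "- v"] by (simp add: eq_neg_iff_add_eq_0 add.commute)

lemma act_sc: "act i (sc (of_int k) v) = sc (of_int k) (act i v)"
  by (rule additive_sc_of_int) (rule act_add)

lemma con_add: "con i (c + c') = con i c + con i c'"
  by (simp_all add: fun_eq_iff con_apply)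

lemma brn_add: "brn i j (c + c') = brn i j c + brn i j c'"
  by (auto simp: brn_def fun_eq_iff)

lemma LN_add: "LN i (c + c') js = LN i c js + LN i c' js"
  by (induction js arbitrary: c c') (simp_all add: act_add con_add brn_add)

lemma DN_add: "DN (c + c') js = DN c js + DN c' js"
  by (induction js arbitrary: c c') (simp_all add: LN_add con_add)

lemma LN_0: "LN i 0 js = 0"
  using LN_add[of i 0 0 js] by simp

lemma DN_0: "DN 0 js = 0"
  using DN_add[of 0 0 js] by simp

lemma LN_minus: "LN i (- c) js = - LN i c js"
  using LN_add[of i c "- c" js] by (simp add: eq_neg_iff_add_eq_0 add.commute LN_0)

lemma DN_minus: "DN (- c) js = - DN c js"
  using DN_add[of c "- c" js] by (simp add: eq_neg_iff_add_eq_0 add.commute DN_0)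

lemma LN_diff: "LN i (c - c') js = LN i c js - LN i c' js"
  using LN_add[of i c "- c'" js] by (simp add: LN_minus)

lemma DN_diff: "DN (c - c') js = DN c js - DN c' js"
  using DN_add[of c "- c'" js] by (simp add: DN_minus)

lemma brn_scale: "brn i j (\<lambda>js. sc (of_int k) (c js)) js = sc (of_int k) (brn i j c js)"
  by (simp add: brn_def mult.commute)

lemma con_scale: "con y (\<lambda>js. sc k (c js)) = (\<lambda>js. sc k (con y c js))"
  by (simp add: fun_eq_iff con_apply)

lemma LN_scale: "LN i (\<lambda>js. sc (of_int k) (c js)) js = sc (of_int k) (LN i c js)"
proof (induction js arbitrary: c)
  case Nil
  show "LN i (\<lambda>js. sc (of_int k) (c js)) [] = sc (of_int k) (LN i c [])" by (simp add: act_sc)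
next
  case (Cons y ys)
  show "LN i (\<lambda>js. sc (of_int k) (c js)) (y # ys) = sc (of_int k) (LN i c (y # ys))"
    unfolding lied.simps con_scale Cons.IH brn_scale sc_simps ..
qed

lemma DN_scale: "DN (\<lambda>js. sc (of_int k) (c js)) js = sc (of_int k) (DN c js)"
proof (induction js arbitrary: c)
  case Nil
  show "DN (\<lambda>js. sc (of_int k) (c js)) [] = sc (of_int k) (DN c [])" by simp
next
  case (Cons y ys)
  show "DN (\<lambda>js. sc (of_int k) (c js)) (y # ys) = sc (of_int k) (DN c (y # ys))"
    unfolding dee.simps con_scale Cons.IH LN_scale sc_simps ..
qed

text \<open>The commutation relation of contraction and Lie derivative. Together with
  \<open>con_DN\<close>, which is Cartan's formula, it lets every operator identity be proved by
  induction on the argument list: contract both sides with the first argument.\<close>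

lemma con_LN: "con j (LN i c) = LN i (con j c) - brn i j c"
  by (simp add: fun_eq_iff con_apply)

lemma con_DN: "con j (DN c) = - LN j c - DN (con j c)"
  by (simp add: fun_eq_iff con_apply)

lemma LN_brn: "LN x (brn i j c) js =
    (if i = 0 \<or> j = 0 then 0 else sc (of_int (int j - int i)) (LN x (con (i + j - 1) c) js))"
proof (cases "i = 0 \<or> j = 0")
  case True
  then have "brn i j c = 0" by (auto simp: brn_def fun_eq_iff)
  then show ?thesis using True LN_0 by simp
next
  case False
  then have "brn i j c = (\<lambda>js. sc (of_int (int j - int i)) (con (i + j - 1) c js))"
    by (auto simp: brn_def fun_eq_iff con_apply)
  then show ?thesis using False LN_scale by metis
qed

lemma DN_brn: "DN (brn i j c) js =
    (if i = 0 \<or> j = 0 then 0 else sc (of_int (int j - int i)) (DN (con (i + j - 1) c) js))"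
proof (cases "i = 0 \<or> j = 0")
  case True
  then have "brn i j c = 0" by (auto simp: brn_def fun_eq_iff)
  then show ?thesis using True DN_0 by simp
next
  case False
  then have "brn i j c = (\<lambda>js. sc (of_int (int j - int i)) (con (i + j - 1) c js))"
    by (auto simp: brn_def fun_eq_iff con_apply)
  then show ?thesis using False DN_scale by metis
qed

lemma brn_LN: "brn i j (LN x c) js =
    (if i = 0 \<or> j = 0 then 0
     else sc (of_int (int j - int i)) (LN x (con (i + j - 1) c) js - brn x (i + j - 1) c js))"
  by (simp add: brn_def con_apply)

lemma brn_DN: "brn i j (DN c) js =
    (if i = 0 \<or> j = 0 then 0
     else - sc (of_int (int j - int i)) (LN (i + j - 1) c js + DN (con (i + j - 1) c) js))"
  by (simp add: brn_def con_apply algebra_simps)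

text \<open>The Lie derivative is a representation. After the first argument y is split off, the
  terms in which a bracket has hit y combine by \<open>brn_jacobi\<close>, and the rest is the
  induction hypothesis.\<close>

lemma LN_comm: "LN i (LN j c) js - LN j (LN i c) js =
    (if i = 0 \<or> j = 0 then 0 else sc (of_int (int j - int i)) (LN (i + j - 1) c js))"
proof (induction js arbitrary: c)
  case Nil
  show "LN i (LN j c) [] - LN j (LN i c) [] =
    (if i = 0 \<or> j = 0 then 0 else sc (of_int (int j - int i)) (LN (i + j - 1) c []))"
    by (simp add: act_comm)
next
  case (Cons y ys)
  have "LN i (LN j c) (y # ys) - LN j (LN i c) (y # ys) =
     (LN i (LN j (con y c)) ys - LN j (LN i (con y c)) ys)
      - (LN i (brn j y c) ys + brn i y (LN j c) ys)
      + (LN j (brn i y c) ys + brn j y (LN i c) ys)"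
    by (simp add: con_LN LN_diff)
  also have "\<dots> = (if i = 0 \<or> j = 0 then 0 else
      sc (of_int (int j - int i)) (LN (i + j - 1) (con y c) ys - brn (i + j - 1) y c ys))"
  proof (cases "i = 0 \<or> j = 0")
    case True
    then show ?thesis
      unfolding Cons.IH LN_brn brn_LN by (auto simp: brn_def)
  next
    case False
    then show ?thesis
      unfolding Cons.IH LN_brn brn_LN using brn_jacobi[of i j y c ys]
      by (cases "y = 0") (simp_all add: algebra_simps)
  qed
  finally show "LN i (LN j c) (y # ys) - LN j (LN i c) (y # ys) =
    (if i = 0 \<or> j = 0 then 0 else sc (of_int (int j - int i)) (LN (i + j - 1) c (y # ys)))"
    unfolding lied.simps(2)[of brn act "i + j - 1"] .
qed

text \<open>Contraction with the first argument leaves the commutator of two Lie derivatives, the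
  same claim for one argument fewer, and bracket terms. By \<open>LN_comm\<close> the commutator
  cancels the bracket terms.\<close>

lemma DN_LN: "DN (LN i c) js = LN i (DN c) js"
proof (induction js arbitrary: c)
  case Nil
  show "DN (LN i c) [] = LN i (DN c) []" by simp
next
  case (Cons y ys)
  have "DN (LN i c) (y # ys) - LN i (DN c) (y # ys) =
     (LN i (LN y c) ys - LN y (LN i c) ys) + (LN i (DN (con y c)) ys - DN (LN i (con y c)) ys)
     + DN (brn i y c) ys + brn i y (DN c) ys"
    unfolding dee.simps lied.simps con_LN con_DN DN_diff LN_diff LN_minus by simp
  also have "\<dots> = 0"
    unfolding Cons.IH LN_comm DN_brn brn_DN by simp
  finally show "DN (LN i c) (y # ys) = LN i (DN c) (y # ys)"
    unfolding right_minus_eq .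
qed

text \<open>Contracted with y, the two occurrences of the Lie derivative along y cancel by
  \<open>DN_LN\<close>, which leaves the claim for the contracted cochain.\<close>

lemma DN_DN: "DN (DN c) js = 0"
proof (induction js arbitrary: c)
  case Nil
  show "DN (DN c) [] = 0" by simp
next
  case (Cons y ys)
  have "DN (DN c) (y # ys) = DN (DN (con y c)) ys"
    unfolding dee.simps con_DN DN_diff DN_minus DN_LN by simp
  then show "DN (DN c) (y # ys) = 0" using Cons.IH[of "con y c"] by simp
qed

lemma brn_flip: "brn i j c js = - brn j i c js"
  by (rule val_eqI) (simp add: brn_def add.commute[of i j] left_diff_distrib)

lemma antisym_LN: "antisym_fun c \<Longrightarrow> LN i c (xs @ x # y # ys) = - LN i c (xs @ y # x # ys)"
proof (induction xs arbitrary: c)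
  case Nil
  have "con y (con x c) = - con x (con y c)"
    using antisym_fun_swap[OF Nil, of x y] by (simp add: fun_eq_iff con_apply)
  moreover have "brn i x c (y # ys) = - brn i x (con y c) ys"
    "brn i y c (x # ys) = - brn i y (con x c) ys"
    using antisym_fun_swap[OF Nil, of "i + x - 1" y ys] antisym_fun_swap[OF Nil, of "i + y - 1" x ys]
    by (auto simp: brn_def con_apply)
  ultimately show ?case by (simp add: LN_minus)
next
  case (Cons z zs)
  have "brn i z c (zs @ x # y # ys) = - brn i z c (zs @ y # x # ys)"
  proof -
    have "c ((i + z - 1) # zs @ x # y # ys) = - c ((i + z - 1) # zs @ y # x # ys)"
      using Cons.prems[unfolded antisym_fun_def, rule_format, of "(i + z - 1) # zs" x y ys] by simp
    then show ?thesis by (auto simp: brn_def)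
  qed
  then show ?case using Cons.IH[OF antisym_fun_con[OF Cons.prems, of z]] by simp
qed

text \<open>Exchanging the first two arguments exposes the contraction with their bracket, which is
  itself antisymmetric; deeper positions follow by induction.\<close>

lemma antisym_DN: "antisym_fun c \<Longrightarrow> DN c (xs @ x # y # ys) = - DN c (xs @ y # x # ys)"
proof (induction xs arbitrary: c)
  case Nil
  have "con y (con x c) = - con x (con y c)"
    using antisym_fun_swap[OF Nil, of x y] by (simp add: fun_eq_iff con_apply)
  then show ?case using brn_flip[of x y c ys] by (simp add: DN_minus)
next
  case (Cons z zs)
  then show ?case
    using Cons.IH[OF antisym_fun_con[OF Cons.prems, of z]] antisym_LN[OF Cons.prems, of z zs x y ys]
    by simp
qed

lemma antisym_fun_DN: "antisym_fun c \<Longrightarrow> antisym_fun (DN c)"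
  by (subst antisym_fun_def) (intro allI antisym_DN)

end

subsection \<open>Jets and the comparison map\<close>

locale derivation =
  fixes d :: "'k::field_char_0 \<Rightarrow> 'k"
  assumes d_add: "d (f + g) = d f + d g"
    and d_mult: "d (f * g) = d f * g + f * d g"
begin

lemma d_0 [simp]: "d 0 = 0"
  using d_add[of 0 0] by simp

lemma d_1 [simp]: "d 1 = 0"
  using d_mult[of 1 1] by simp

lemma d_minus: "d (- f) = - d f"
  using d_add[of f "- f"] by (simp add: eq_neg_iff_add_eq_0 add.commute)

lemma d_diff: "d (f - g) = d f - d g"
  using d_add[of f "- g"] by (simp add: d_minus)

lemma d_of_nat [simp]: "d (of_nat n) = 0"
  by (induction n) (simp_all add: d_add)

lemma d_sum: "d (\<Sum>i\<in>I. f i) = (\<Sum>i\<in>I. d (f i))"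
  by (induction I rule: infinite_finite_induct) (auto simp: d_add)

lemma d_divide_nat: "d (f / of_nat n) = d f / of_nat n"
proof (cases "n = 0")
  case False
  have "d f = d (of_nat n * (f / of_nat n))" using False by simp
  also have "\<dots> = of_nat n * d (f / of_nat n)" by (simp only: d_mult d_of_nat) simp
  finally show ?thesis using False by simp
qed simp

lemma d_power: "d (f ^ n) = of_nat n * f ^ (n - 1) * d f"
proof (induction n)
  case (Suc n)
  then show ?case by (cases n) (simp_all add: d_mult algebra_simps)
qed simp

text \<open>Divided derivatives, the Taylor coefficients of f. Dividing by j! removes the binomials
  from the Leibniz rule and matches the factor 1/j! in the action on a tensor module.\<close>

definition F :: "nat \<Rightarrow> 'k \<Rightarrow> 'k" where
  "F j f = (d ^^ j) f / of_nat (fact j)"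

lemma F_0 [simp]: "F 0 f = f"
  by (simp add: F_def)

lemma funpow_d_add: "(d ^^ j) (f + g) = (d ^^ j) f + (d ^^ j) g"
  by (induction j) (simp_all add: d_add)

lemma F_add: "F j (f + g) = F j f + F j g"
  by (simp add: F_def funpow_d_add add_divide_distrib)

lemma F_zero [simp]: "F j 0 = 0"
  using F_add[of j 0 0] by simp

lemma F_minus: "F j (- f) = - F j f"
  using F_add[of j f "- f"] by (simp add: eq_neg_iff_add_eq_0 add.commute)

lemma F_diff: "F j (f - g) = F j f - F j g"
  using F_add[of j f "- g"] by (simp add: F_minus)

lemma F_Suc: "of_nat (Suc n) * F (Suc n) f = d ((d ^^ n) f) / of_nat (fact n)"
proof -
  have "of_nat (fact (Suc n)) = of_nat (Suc n) * (of_nat (fact n) :: 'k)"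
    by (simp only: fact_Suc of_nat_mult of_nat_id)
  moreover have "of_nat (Suc n) \<noteq> (0::'k)" by (rule of_nat_neq_0)
  ultimately show ?thesis unfolding F_def by (simp del: of_nat_Suc of_nat_fact)
qed

lemma d_F: "d (F n f) = of_nat (Suc n) * F (Suc n) f"
  unfolding F_Suc by (simp add: F_def d_divide_nat del: of_nat_fact)

lemma F_d: "F n (d f) = of_nat (Suc n) * F (Suc n) f"
  unfolding F_Suc by (simp add: F_def funpow_swap1)

text \<open>Differentiating the formula for n and re-indexing both halves to i \<le> n + 1 yields
  the weights i and n + 1 - i; they add up to n + 1, which is the factor in
  \<open>d_F\<close>.\<close>

lemma F_mult: "F n (f * g) = (\<Sum>i\<le>n. F i f * F (n - i) g)"
proof (induction n)
  case (Suc n)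
  have "of_nat (Suc n) * F (Suc n) (f * g) = d (\<Sum>i\<le>n. F i f * F (n - i) g)"
    by (simp only: d_F[symmetric] Suc.IH)
  also have "\<dots> = (\<Sum>i\<le>n. of_nat (Suc i) * F (Suc i) f * F (n - i) g)
      + (\<Sum>i\<le>n. of_nat (Suc (n - i)) * F i f * F (Suc n - i) g)"
    unfolding d_sum d_mult d_F sum.distrib
    by (intro arg_cong2[where f = "(+)"] sum.cong) (auto simp: Suc_diff_le mult_ac simp del: of_nat_Suc)
  also have "(\<Sum>i\<le>n. of_nat (Suc i) * F (Suc i) f * F (n - i) g)
      = (\<Sum>i\<le>Suc n. of_nat i * F i f * F (Suc n - i) g)"
    unfolding sum.atMost_Suc_shift by simp
  also have "(\<Sum>i\<le>n. of_nat (Suc (n - i)) * F i f * F (Suc n - i) g)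
      = (\<Sum>i\<le>Suc n. of_nat (Suc n - i) * F i f * F (Suc n - i) g)"
    by (auto simp: Suc_diff_le algebra_simps)
  also have "(\<Sum>i\<le>Suc n. of_nat i * F i f * F (Suc n - i) g) + (\<Sum>i\<le>Suc n. of_nat (Suc n - i) * F i f * F (Suc n - i) g)
     = (\<Sum>i\<le>Suc n. of_nat (Suc n) * (F i f * F (Suc n - i) g))"
    unfolding sum.distrib[symmetric]
    by (intro sum.cong) (auto simp: of_nat_diff algebra_simps)
  finally show ?case
    by (simp add: sum_distrib_left[symmetric] del: of_nat_Suc sum.atMost_Suc)
qed simp

text \<open>The jets of f g' - g f'. In the sum over i + j = n + 1 the two end terms contain f or g
  undifferentiated and give derivatives of jets; the inner terms have the coefficient j - i, the
  structure constant of Z^i d/dZ and Z^j d/dZ. This is where the commuting index 0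
  originates.\<close>

lemma F_bracket: "F n (f * d g - g * d f) = f * d (F n g) - g * d (F n f) +
    (\<Sum>i=1..n. of_int (int (n + 1) - 2 * int i) * (F i f * F (n + 1 - i) g))"
proof -
  have "F n (f * d g) = (\<Sum>i\<le>n. of_nat (n + 1 - i) * (F i f * F (n + 1 - i) g))"
    by (simp add: F_mult F_d Suc_diff_le algebra_simps del: of_nat_Suc)
  also have "\<dots> = (\<Sum>i\<le>n+1. of_nat (n + 1 - i) * (F i f * F (n + 1 - i) g))"
    by simp
  finally have 1: "F n (f * d g) = \<dots>" .
  have "F n (g * d f) = (\<Sum>i\<le>n. of_nat (n + 1 - i) * (F i g * F (n + 1 - i) f))"
    by (simp add: F_mult F_d Suc_diff_le algebra_simps del: of_nat_Suc)
  also have "\<dots> = (\<Sum>i\<le>n+1. of_nat (n + 1 - i) * (F i g * F (n + 1 - i) f))"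
    by simp
  also have "\<dots> = (\<Sum>i\<le>n+1. of_nat i * (F i f * F (n + 1 - i) g))"
    by (rule sum.reindex_bij_witness[of _ "\<lambda>i. n + 1 - i" "\<lambda>i. n + 1 - i"]) auto
  finally have 2: "F n (g * d f) = \<dots>" .
  have "{..n+1} = insert 0 (insert (n+1) {1..n})" by auto
  then have split: "(\<Sum>i\<le>n+1. h i) = h 0 + (h (n + 1) + (\<Sum>i=1..n. h i))" for h :: "nat \<Rightarrow> 'k"
    by simp
  have "F n (f * d g - g * d f) = (\<Sum>i\<le>n+1. of_int (int (n + 1) - 2 * int i) * (F i f * F (n + 1 - i) g))"
    unfolding F_diff 1 2 sum_subtractf[symmetric]
    by (intro sum.cong) (auto simp: of_nat_diff algebra_simps)
  also have "\<dots> = f * d (F n g) - g * d (F n f) +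
    (\<Sum>i=1..n. of_int (int (n + 1) - 2 * int i) * (F i f * F (n + 1 - i) g))"
    unfolding split by (simp add: d_F algebra_simps)
  finally show ?thesis .
qed

definition dval :: "'k val \<Rightarrow> 'k val" where
  "dval v = Val (\<lambda>a. d (coo v a))"

lemma coo_dval [simp]: "coo (dval v) a = d (coo v a)"
  by (simp add: dval_def)

end

text \<open>Exterior multiplication by the de Rham differential of k, that is, by the 1-form that
  sends the field f d/dz to f k'. It measures how the differential fails to be linear over
  functions.\<close>

fun wed :: "('k \<Rightarrow> 'k) \<Rightarrow> 'k::field_char_0 \<Rightarrow> ('k list \<Rightarrow> 'k val) \<Rightarrow> 'k list \<Rightarrow> 'k val" where
  "wed d k \<psi> [] = 0"
| "wed d k \<psi> (x # xs) = sc (x * d k) (\<psi> xs) - wed d k (con x \<psi>) xs"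

text \<open>In a fixed degree this is finiteness of the support. The bound refers to each index
  separately, so that it survives contraction.\<close>

definition supp_below :: "nat \<Rightarrow> (nat list \<Rightarrow> 'b::zero) \<Rightarrow> bool" where
  "supp_below N c \<longleftrightarrow> (\<forall>js. (\<exists>j\<in>set js. N \<le> j) \<longrightarrow> c js = 0)"

lemma supp_belowD: "supp_below N c \<Longrightarrow> j \<in> set js \<Longrightarrow> N \<le> j \<Longrightarrow> c js = 0"
  by (auto simp: supp_below_def)

lemma supp_below_mono: "supp_below N c \<Longrightarrow> N \<le> N' \<Longrightarrow> supp_below N' c"
  unfolding supp_below_def by (meson le_trans)

lemma supp_below_con: "supp_below N c \<Longrightarrow> supp_below N (con j c)"
  by (auto simp: supp_below_def con_apply)

lemma supp_below_con_0: "supp_below N c \<Longrightarrow> N \<le> j \<Longrightarrow> con j c = 0"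
  by (auto simp: supp_below_def con_apply fun_eq_iff)

locale jet_act = basis_act act + derivation d
  for act :: "nat \<Rightarrow> 'k::field_char_0 val \<Rightarrow> 'k val" and d :: "'k \<Rightarrow> 'k" +
  assumes act_zero: "act 0 v = dval v"
    and act_lin: "j > 0 \<Longrightarrow> act j (sc f v) = sc f (act j v)"
begin

text \<open>The action of f d/dz on a tensor module, with the jets of f cut off at order N. The
  cut-off is harmless once \<open>act j\<close> vanishes for j \<ge> N.\<close>

definition actv :: "nat \<Rightarrow> 'k \<Rightarrow> 'k val \<Rightarrow> 'k val" where
  "actv N f v = (\<Sum>j<N. sc (F j f) (act j v))"

definition brv :: "'k \<Rightarrow> 'k \<Rightarrow> ('k list \<Rightarrow> 'k val) \<Rightarrow> 'k list \<Rightarrow> 'k val" where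
  "brv f g \<psi> = con (f * d g - g * d f) \<psi>"

text \<open>The differential operator with coefficients c, expanded one argument at a time. Because
  of the cut-off at N it represents c faithfully under \<open>supp_below N c\<close>.\<close>

fun Phi :: "nat \<Rightarrow> (nat list \<Rightarrow> 'k val) \<Rightarrow> 'k list \<Rightarrow> 'k val" where
  "Phi N c [] = c []"
| "Phi N c (f # fs) = (\<Sum>j<N. sc (F j f) (Phi N (con j c) fs))"

abbreviation "LV N \<equiv> lied brv (actv N)"
abbreviation "DV N \<equiv> dee brv (actv N)"

lemma brv_apply: "brv f g \<psi> fs = \<psi> ((f * d g - g * d f) # fs)"
  by (simp add: brv_def con_apply)

lemma Phi_add: "Phi N (c + c') fs = Phi N c fs + Phi N c' fs"
  by (induction fs arbitrary: c c') (simp_all add: con_add sum.distrib)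

lemma Phi_0: "Phi N 0 fs = 0"
  using Phi_add[of N 0 0 fs] by simp

lemma Phi_minus: "Phi N (- c) fs = - Phi N c fs"
  using Phi_add[of N c "- c" fs] by (simp add: eq_neg_iff_add_eq_0 add.commute Phi_0)

lemma Phi_diff: "Phi N (c - c') fs = Phi N c fs - Phi N c' fs"
  using Phi_add[of N c "- c'" fs] by (simp add: Phi_minus)

lemma Phi_scale: "Phi N (\<lambda>js. sc k (c js)) fs = sc k (Phi N c fs)"
  by (induction fs arbitrary: c) (simp_all add: con_scale sc_sum mult.commute)

lemma Phi_brn: "Phi N (brn i j c) fs =
    (if i = 0 \<or> j = 0 then 0 else sc (of_int (int j - int i)) (Phi N (con (i + j - 1) c) fs))"
proof (cases "i = 0 \<or> j = 0")
  case True
  then have "brn i j c = 0" by (auto simp: brn_def fun_eq_iff)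
  then show ?thesis using True Phi_0 by simp
next
  case False
  then have "brn i j c = (\<lambda>js. sc (of_int (int j - int i)) (con (i + j - 1) c js))"
    by (auto simp: brn_def fun_eq_iff con_apply)
  then show ?thesis using False Phi_scale by metis
qed

lemma actv_add: "actv N f (v + w) = actv N f v + actv N f w"
  by (simp add: actv_def act_add sum.distrib)

lemma actv_0 [simp]: "actv N f 0 = 0"
  using actv_add[of N f 0 0] by simp

lemma dval_sc: "dval (sc k v) = sc k (dval v) + sc (d k) v"
  by (rule val_eqI) (simp add: d_mult)

text \<open>Leibniz rule: of all indices only 0 differentiates k, and \<open>N > 0\<close> keeps it
  in the sum.\<close>

lemma actv_sc: "N > 0 \<Longrightarrow> actv N f (sc k v) = sc k (actv N f v) + sc (f * d k) v"
proof -
  assume "N > 0"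
  then obtain M where N: "N = Suc M" by (cases N) auto
  have "(\<Sum>j<M. sc (F (Suc j) f) (act (Suc j) (sc k v))) = sc k (\<Sum>j<M. sc (F (Suc j) f) (act (Suc j) v))"
    by (simp add: sc_sum act_lin mult.commute)
  then show ?thesis
    unfolding actv_def N sum.lessThan_Suc_shift
    by (simp add: act_zero dval_sc mult.commute)
qed

lemma LV_add: "LV N f (\<psi> + \<psi>') fs = LV N f \<psi> fs + LV N f \<psi>' fs"
proof (induction fs arbitrary: \<psi> \<psi>')
  case (Cons g gs)
  show "LV N f (\<psi> + \<psi>') (g # gs) = LV N f \<psi> (g # gs) + LV N f \<psi>' (g # gs)"
    unfolding lied.simps con_add Cons.IH brv_apply by simp
qed (simp add: actv_add)

lemma DV_add: "DV N (\<psi> + \<psi>') fs = DV N \<psi> fs + DV N \<psi>' fs"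
proof (induction fs arbitrary: \<psi> \<psi>')
  case (Cons g gs)
  show "DV N (\<psi> + \<psi>') (g # gs) = DV N \<psi> (g # gs) + DV N \<psi>' (g # gs)"
    unfolding dee.simps con_add Cons.IH LV_add by simp
qed simp

lemma LV_0: "LV N f 0 fs = 0"
  using LV_add[of N f 0 0 fs] by simp

lemma DV_0: "DV N 0 fs = 0"
  using DV_add[of N 0 0 fs] by simp

lemma LV_sum: "LV N f (\<lambda>fs. \<Sum>j<(n::nat). \<psi> j fs) fs = (\<Sum>j<n. LV N f (\<psi> j) fs)"
proof (induction n)
  case 0
  have "(\<lambda>fs. \<Sum>j<0. \<psi> j fs) = 0" by (auto simp: fun_eq_iff)
  then show ?case using LV_0[of N f fs] by simp
next
  case (Suc n)
  have "(\<lambda>fs. \<Sum>j<Suc n. \<psi> j fs) = (\<lambda>fs. \<Sum>j<n. \<psi> j fs) + \<psi> n" by (auto simp: fun_eq_iff)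
  then show "LV N f (\<lambda>fs. \<Sum>j<Suc n. \<psi> j fs) fs = (\<Sum>j<Suc n. LV N f (\<psi> j) fs)"
    using Suc.IH by (simp only: LV_add sum.lessThan_Suc)
qed

lemma DV_sum: "DV N (\<lambda>fs. \<Sum>j<(n::nat). \<psi> j fs) fs = (\<Sum>j<n. DV N (\<psi> j) fs)"
proof (induction n)
  case 0
  have "(\<lambda>fs. \<Sum>j<0. \<psi> j fs) = 0" by (auto simp: fun_eq_iff)
  then show ?case using DV_0[of N fs] by simp
next
  case (Suc n)
  have "(\<lambda>fs. \<Sum>j<Suc n. \<psi> j fs) = (\<lambda>fs. \<Sum>j<n. \<psi> j fs) + \<psi> n" by (auto simp: fun_eq_iff)
  then show "DV N (\<lambda>fs. \<Sum>j<Suc n. \<psi> j fs) fs = (\<Sum>j<Suc n. DV N (\<psi> j) fs)"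
    using Suc.IH by (simp only: DV_add sum.lessThan_Suc)
qed

lemma LV_scale: "N > 0 \<Longrightarrow> LV N f (\<lambda>fs. sc k (\<psi> fs)) fs = sc k (LV N f \<psi> fs) + sc (f * d k) (\<psi> fs)"
proof (induction fs arbitrary: \<psi>)
  case Nil
  then show "LV N f (\<lambda>fs. sc k (\<psi> fs)) [] = sc k (LV N f \<psi> []) + sc (f * d k) (\<psi> [])"
    by (simp add: actv_sc)
next
  case (Cons g gs)
  show "LV N f (\<lambda>fs. sc k (\<psi> fs)) (g # gs) = sc k (LV N f \<psi> (g # gs)) + sc (f * d k) (\<psi> (g # gs))"
    unfolding lied.simps con_scale Cons.IH[OF Cons.prems] brv_apply by (simp add: con_apply[of g \<psi> gs])
qed

text \<open>Leibniz rule d(k \<psi>) = k d\<psi> + dk \<and> \<psi>; the wedge term has the opposite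
  sign because \<open>dee\<close> is minus the usual differential.\<close>

lemma DV_scale: "N > 0 \<Longrightarrow> DV N (\<lambda>fs. sc k (\<psi> fs)) fs = sc k (DV N \<psi> fs) - wed d k \<psi> fs"
proof (induction fs arbitrary: \<psi>)
  case Nil
  show "DV N (\<lambda>fs. sc k (\<psi> fs)) [] = sc k (DV N \<psi> []) - wed d k \<psi> []"
    by simp
next
  case (Cons g gs)
  show "DV N (\<lambda>fs. sc k (\<psi> fs)) (g # gs) = sc k (DV N \<psi> (g # gs)) - wed d k \<psi> (g # gs)"
    unfolding dee.simps con_scale Cons.IH[OF Cons.prems] LV_scale[OF Cons.prems] by simp
qed

lemma wed_scale: "wed d k (\<lambda>fs. sc l (\<psi> fs)) fs = sc l (wed d k \<psi> fs)"
proof (induction fs arbitrary: \<psi>)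
  case (Cons g gs)
  show "wed d k (\<lambda>fs. sc l (\<psi> fs)) (g # gs) = sc l (wed d k \<psi> (g # gs))"
    unfolding wed.simps con_scale Cons.IH by (simp add: mult.commute)
qed simp

lemma wed_add: "wed d k (\<psi> + \<psi>') fs = wed d k \<psi> fs + wed d k \<psi>' fs"
proof (induction fs arbitrary: \<psi> \<psi>')
  case (Cons g gs)
  show "wed d k (\<psi> + \<psi>') (g # gs) = wed d k \<psi> (g # gs) + wed d k \<psi>' (g # gs)"
    unfolding wed.simps con_add Cons.IH by simp
qed simp

lemma wed_0: "wed d k 0 fs = 0"
  using wed_add[of k 0 0 fs] by simp

lemma wed_minus: "wed d k (- \<psi>) fs = - wed d k \<psi> fs"
  using wed_add[of k \<psi> "- \<psi>" fs] by (simp add: eq_neg_iff_add_eq_0 add.commute wed_0)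

lemma wed_sum: "wed d k (\<lambda>fs. \<Sum>j<(n::nat). \<psi> j fs) fs = (\<Sum>j<n. wed d k (\<psi> j) fs)"
proof (induction n)
  case 0
  have "(\<lambda>fs. \<Sum>j<0. \<psi> j fs) = 0" by (auto simp: fun_eq_iff)
  then show ?case using wed_0[of k fs] by simp
next
  case (Suc n)
  have "(\<lambda>fs. \<Sum>j<Suc n. \<psi> j fs) = (\<lambda>fs. \<Sum>j<n. \<psi> j fs) + \<psi> n" by (auto simp: fun_eq_iff)
  then show "wed d k (\<lambda>fs. \<Sum>j<Suc n. \<psi> j fs) fs = (\<Sum>j<Suc n. wed d k (\<psi> j) fs)"
    using Suc.IH by (simp only: wed_add sum.lessThan_Suc)
qed

lemma con_Phi: "con g (Phi N c) = (\<lambda>fs. \<Sum>j<N. sc (F j g) (Phi N (con j c) fs))"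
  by (simp add: fun_eq_iff con_apply)

text \<open>Collecting the pairs with i + j - 1 = n turns the structure constants into the inner sum
  of \<open>F_bracket\<close>. The pairs with i + j - 1 \<ge> N contribute nothing because P
  vanishes there.\<close>

lemma sum_brn:
  fixes P :: "nat \<Rightarrow> 'k val"
  assumes P: "\<And>n. N \<le> n \<Longrightarrow> P n = 0"
  shows "(\<Sum>i<N. \<Sum>j<N. sc (F i f * F j g)
      (if i = 0 \<or> j = 0 then 0 else sc (of_int (int j - int i)) (P (i + j - 1)))) =
    (\<Sum>n<N. sc (\<Sum>i=1..n. of_int (int (n + 1) - 2 * int i) * (F i f * F (n + 1 - i) g)) (P n))"
proof -
  let ?h = "\<lambda>(i, j). sc (F i f * F j g)
      (if i = 0 \<or> j = 0 then 0 else sc (of_int (int j - int i)) (P (i + j - 1)))"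
  have "(\<Sum>i<N. \<Sum>j<N. ?h (i, j)) = sum ?h ({..<N} \<times> {..<N})"
    by (simp add: sum.cartesian_product)
  also have "\<dots> = sum ?h {(i, j). 1 \<le> i \<and> 1 \<le> j \<and> i + j \<le> N}"
  proof (rule sum.mono_neutral_right)
    have "?h p = 0" if "p \<in> {..<N} \<times> {..<N} - {(i, j). 1 \<le> i \<and> 1 \<le> j \<and> i + j \<le> N}" for p
      using that P[of "fst p + snd p - 1"] by (cases p) auto
    then show "\<forall>p\<in>{..<N} \<times> {..<N} - {(i, j). 1 \<le> i \<and> 1 \<le> j \<and> i + j \<le> N}. ?h p = 0"
      by blast
  qed auto
  also have "\<dots> = (\<Sum>(n, i)\<in>Sigma {..<N} (\<lambda>n. {1..n}).
      sc (of_int (int (n + 1) - 2 * int i) * (F i f * F (n + 1 - i) g)) (P n))"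
    by (rule sum.reindex_bij_witness[of _ "\<lambda>(n, i). (i, n + 1 - i)" "\<lambda>(i, j). (i + j - 1, i)"])
      (auto simp: of_nat_diff algebra_simps)
  also have "\<dots> = (\<Sum>n<N. sc (\<Sum>i=1..n. of_int (int (n + 1) - 2 * int i) * (F i f * F (n + 1 - i) g)) (P n))"
    by (simp add: sum.Sigma[symmetric] sc_sum_left)
  finally show ?thesis by simp
qed

text \<open>The coefficients \<open>F j g\<close> inside \<open>Phi\<close> are functions and are
  differentiated as well, so the Lie derivative does not commute with \<open>Phi\<close>. The error
  is a sum of wedge products with the differentials of the jets of f.\<close>

lemma LV_Phi:
  assumes "N > 0" "supp_below N c" "antisym_fun c"
  shows "LV N f (Phi N c) fs = (\<Sum>j<N. sc (F j f) (Phi N (LN j c) fs))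
    + (\<Sum>j<N. wed d (F j f) (Phi N (con j c)) fs)"
  using assms(2,3)
proof (induction fs arbitrary: c)
  case Nil
  show "LV N f (Phi N c) [] = (\<Sum>j<N. sc (F j f) (Phi N (LN j c) []))
    + (\<Sum>j<N. wed d (F j f) (Phi N (con j c)) [])"
    by (simp add: actv_def)
next
  case (Cons g gs)
  let ?P = "\<lambda>n. Phi N (con n c) gs"
  have IH: "LV N f (Phi N (con j c)) gs = (\<Sum>i<N. sc (F i f) (Phi N (LN i (con j c)) gs))
    + (\<Sum>i<N. wed d (F i f) (Phi N (con i (con j c))) gs)" for j
    by (rule Cons.IH[OF supp_below_con[OF Cons.prems(1)] antisym_fun_con[OF Cons.prems(2)]])
  \<comment> \<open>The induction hypothesis and the goal contract with i and j in opposite orders;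
    antisymmetry of c supplies the sign that lets their wedge terms match.\<close>
  have anti: "con i (con j c) = - con j (con i c)" for i j
    using antisym_fun_swap[OF Cons.prems(2), of j i] by (simp add: fun_eq_iff con_apply)
  have PhiM: "Phi N (- c) = - Phi N c" for c
    using Phi_minus[of N c] by (simp add: fun_eq_iff)
  have W: "wed d k (Phi N (con i (con j c))) gs = - wed d k (Phi N (con j (con i c))) gs" for i j k
    using wed_minus[of k "Phi N (con j (con i c))" gs] by (simp only: anti[of i j] PhiM)
  have IH': "LV N f (Phi N (con j c)) gs = (\<Sum>i<N. sc (F i f) (Phi N (LN i (con j c)) gs))
    - (\<Sum>i<N. wed d (F i f) (Phi N (con j (con i c))) gs)" for j
  proof -
    have "(\<Sum>i<N. wed d (F i f) (Phi N (con i (con j c))) gs)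
        = - (\<Sum>i<N. wed d (F i f) (Phi N (con j (con i c))) gs)"
      unfolding sum_negf[symmetric] by (rule sum.cong[OF refl W])
    then show ?thesis unfolding IH by simp
  qed
  have L: "LV N f (Phi N c) (g # gs) = (\<Sum>j<N. sc (F j g) (LV N f (Phi N (con j c)) gs) + sc (f * d (F j g)) (?P j))
      - (\<Sum>n<N. sc (F n (f * d g - g * d f)) (?P n))"
    unfolding lied.simps con_Phi LV_sum LV_scale[OF assms(1)] brv_apply by simp
  have s1: "(\<Sum>j<N. \<Sum>i<N. sc (F j g * F i f) (X i j)) = (\<Sum>i<N. \<Sum>j<N. sc (F i f * F j g) (X i j))"
    for X by (subst sum.swap) (simp add: mult.commute)
  have s2: "(\<Sum>j<N. \<Sum>i<N. sc (F j g) (X i j)) = (\<Sum>i<N. \<Sum>j<N. sc (F j g) (X i j))" for X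
    by (rule sum.swap)
  have "(\<Sum>j<N. sc (F j f) (Phi N (LN j c) (g # gs))) =
     (\<Sum>i<N. \<Sum>j<N. sc (F i f * F j g) (Phi N (LN i (con j c)) gs))
     - (\<Sum>i<N. \<Sum>j<N. sc (F i f * F j g) (Phi N (brn i j c) gs))"
    by (simp add: con_LN Phi_diff sum_subtractf sc_sum)
  moreover have "(\<Sum>j<N. wed d (F j f) (Phi N (con j c)) (g # gs)) =
     (\<Sum>n<N. sc (g * d (F n f)) (?P n))
      - (\<Sum>i<N. \<Sum>j<N. sc (F j g) (wed d (F i f) (Phi N (con j (con i c))) gs))"
    unfolding wed.simps con_Phi wed_sum wed_scale by (simp add: sum_subtractf)
  \<comment> \<open>The two correction terms are the end terms of \<open>F_bracket\<close>; one is
    matched by the Leibniz rule for the coefficients \<open>F n g\<close>, the other by the first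
    slot of the wedge terms.\<close>
  moreover have "(\<Sum>i<N. \<Sum>j<N. sc (F i f * F j g) (Phi N (brn i j c) gs)) =
      (\<Sum>n<N. sc (F n (f * d g - g * d f) - f * d (F n g) + g * d (F n f)) (?P n))"
  proof -
    have "?P n = 0" if "N \<le> n" for n
      using supp_below_con_0[OF Cons.prems(1) that] Phi_0[of N gs] by simp
    from sum_brn[of N ?P f g, OF this] show ?thesis
      unfolding Phi_brn F_bracket by simp
  qed
  ultimately show "LV N f (Phi N c) (g # gs) = (\<Sum>j<N. sc (F j f) (Phi N (LN j c) (g # gs)))
    + (\<Sum>j<N. wed d (F j f) (Phi N (con j c)) (g # gs))"
    unfolding L IH'
    by (simp add: sum.distrib sum_subtractf sc_left sc_sum s1[of "\<lambda>i j. Phi N (LN i (con j c)) gs"]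
        s2[of "\<lambda>i j. wed d (F i f) (Phi N (con j (con i c))) gs"])
qed

text \<open>In Cartan's formula the wedge terms of \<open>LV_Phi\<close> cancel those that
  \<open>DV_scale\<close> produces for the coefficients \<open>F j f\<close>.\<close>

theorem DV_Phi:
  assumes "N > 0" "supp_below N c" "antisym_fun c"
  shows "DV N (Phi N c) fs = Phi N (DN c) fs"
  using assms(2,3)
proof (induction fs arbitrary: c)
  case Nil
  show "DV N (Phi N c) [] = Phi N (DN c) []" by simp
next
  case (Cons f fs)
  have IH: "DV N (Phi N (con j c)) fs = Phi N (DN (con j c)) fs" for j
    by (rule Cons.IH[OF supp_below_con[OF Cons.prems(1)] antisym_fun_con[OF Cons.prems(2)]])
  have "DV N (Phi N c) (f # fs) = - (\<Sum>j<N. sc (F j f) (Phi N (LN j c) fs)) - (\<Sum>j<N. sc (F j f) (Phi N (DN (con j c)) fs))"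
    unfolding dee.simps con_Phi DV_sum DV_scale[OF assms(1)] LV_Phi[OF assms(1) Cons.prems] IH
    by (simp add: sum_subtractf)
  also have "\<dots> = Phi N (DN c) (f # fs)"
    unfolding Phi.simps con_DN Phi_diff Phi_minus by (simp add: sum_subtractf sum_negf)
  finally show "DV N (Phi N c) (f # fs) = Phi N (DN c) (f # fs)" .
qed

end

subsection \<open>Gelfand--Fuks cochains are differential operators\<close>

text \<open>\<open>A_linear\<close> abstracts from the localization: an operator that commutes with
  z commutes with the inverses of the functions z - a_i, too. It is what makes commutators with z
  suffice.\<close>

locale jet_ring = jet_act act d
  for act :: "nat \<Rightarrow> 'k::field_char_0 val \<Rightarrow> 'k val" and d :: "'k \<Rightarrow> 'k" +
  fixes A :: "'k set" and z :: 'k and \<iota> :: "complex \<Rightarrow> 'k" and n :: nat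
  assumes A_const: "\<iota> c \<in> A" and A_z: "z \<in> A"
    and A_add: "f \<in> A \<Longrightarrow> g \<in> A \<Longrightarrow> f + g \<in> A"
    and A_mult: "f \<in> A \<Longrightarrow> g \<in> A \<Longrightarrow> f * g \<in> A"
    and A_d: "f \<in> A \<Longrightarrow> d f \<in> A"
    and \<iota>_add: "\<iota> (c + e) = \<iota> c + \<iota> e" and \<iota>_mult: "\<iota> (c * e) = \<iota> c * \<iota> e"
    and \<iota>_1: "\<iota> 1 = 1" and d_\<iota>: "d (\<iota> c) = 0" and d_z: "d z = 1"
    and A_linear: "\<lbrakk>\<And>f g. f \<in> A \<Longrightarrow> g \<in> A \<Longrightarrow> T (f + g) = T f + T g;
       \<And>c f. f \<in> A \<Longrightarrow> T (\<iota> c * f) = sc (\<iota> c) (T f); \<And>f. f \<in> A \<Longrightarrow> T (z * f) = sc z (T f);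
       f \<in> A\<rbrakk> \<Longrightarrow> T f = sc f (T 1)"
begin

lemma \<iota>_0: "\<iota> 0 = 0"
  using \<iota>_add[of 0 0] by simp

lemma \<iota>_minus: "\<iota> (- c) = - \<iota> c"
  using \<iota>_add[of c "- c"] by (simp add: \<iota>_0 eq_neg_iff_add_eq_0 add.commute)

lemma \<iota>_of_nat: "\<iota> (of_nat j) = of_nat j"
  by (induction j) (simp_all add: \<iota>_0 \<iota>_1 \<iota>_add)

lemma \<iota>_divide: "\<iota> (c / e) = \<iota> c / \<iota> e"
proof (cases "e = 0")
  case False
  have "\<iota> e * \<iota> (1 / e) = 1" using False by (simp add: \<iota>_mult[symmetric] \<iota>_1)
  moreover from this have "\<iota> e \<noteq> 0" by auto
  ultimately have "\<iota> (1 / e) = 1 / \<iota> e" by (simp add: nonzero_eq_divide_eq mult.commute)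
  then show ?thesis using \<iota>_mult[of c "1 / e"] by simp
qed (simp add: \<iota>_0)

lemma A_0: "0 \<in> A" and A_1: "1 \<in> A"
  using A_const[of 0] A_const[of 1] by (simp_all add: \<iota>_0 \<iota>_1)

lemma A_of_nat: "of_nat j \<in> A"
  using A_const[of "of_nat j"] by (simp add: \<iota>_of_nat)

lemma A_minus: "f \<in> A \<Longrightarrow> - f \<in> A"
  using A_mult[OF A_const[of "-1"], of f] by (simp add: \<iota>_minus \<iota>_1)

lemma A_diff: "f \<in> A \<Longrightarrow> g \<in> A \<Longrightarrow> f - g \<in> A"
  using A_add[of f "- g"] A_minus by simp

lemma A_power: "f \<in> A \<Longrightarrow> f ^ i \<in> A"
  by (induction i) (simp_all add: A_1 A_mult)

lemma A_sum: "(\<And>i. i \<in> I \<Longrightarrow> f i \<in> A) \<Longrightarrow> (\<Sum>i\<in>I. f i) \<in> A"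
  by (induction I rule: infinite_finite_induct) (auto simp: A_0 A_add)

lemma A_divide_nat: "f \<in> A \<Longrightarrow> f / of_nat j \<in> A"
  using A_mult[OF A_const[of "1 / of_nat j"], of f] by (simp add: \<iota>_divide \<iota>_1 \<iota>_of_nat)

lemma A_F: "f \<in> A \<Longrightarrow> F j f \<in> A"
proof -
  assume f: "f \<in> A"
  have "(d ^^ j) f \<in> A" by (induction j) (simp_all add: f A_d)
  then show ?thesis unfolding F_def by (rule A_divide_nat)
qed

lemma d_\<iota>_mult: "d (\<iota> c * f) = \<iota> c * d f"
  by (simp add: d_mult d_\<iota>)

lemma F_\<iota>: "F j (\<iota> c * f) = \<iota> c * F j f"
proof -
  have "(d ^^ j) (\<iota> c * f) = \<iota> c * (d ^^ j) f" by (induction j) (simp_all add: d_\<iota>_mult)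
  then show ?thesis by (simp add: F_def)
qed

text \<open>The space A \<otimes> W for dim W = n. Coordinates from n on are forced to vanish, so
  that a tensor has one representation only.\<close>

definition VA :: "'k val set" where
  "VA = {v. (\<forall>a<n. coo v a \<in> A) \<and> (\<forall>a\<ge>n. coo v a = 0)}"

lemma VA_0: "0 \<in> VA" by (simp add: VA_def A_0)
lemma VA_add: "v \<in> VA \<Longrightarrow> w \<in> VA \<Longrightarrow> v + w \<in> VA" by (simp add: VA_def A_add)
lemma VA_minus: "v \<in> VA \<Longrightarrow> - v \<in> VA" by (simp add: VA_def A_minus)
lemma VA_diff: "v \<in> VA \<Longrightarrow> w \<in> VA \<Longrightarrow> v - w \<in> VA" by (simp add: VA_def A_diff)
lemma VA_sc: "f \<in> A \<Longrightarrow> v \<in> VA \<Longrightarrow> sc f v \<in> VA" by (simp add: VA_def A_mult)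
lemma VA_sum: "(\<And>i. i \<in> I \<Longrightarrow> v i \<in> VA) \<Longrightarrow> (\<Sum>i\<in>I. v i) \<in> VA"
  by (simp add: VA_def A_sum)

text \<open>The value 0 is prescribed off A and off degree k, so that a cochain is determined as a
  total function. Linearity and the order condition are stated for the first argument; antisymmetry
  transfers them to the others. For k \<le> 0 the order condition holds trivially.\<close>

definition gfc :: "int \<Rightarrow> ('k list \<Rightarrow> 'k val) set" where
  "gfc k = {\<psi>. (\<forall>fs. \<psi> fs \<in> VA) \<and> (\<forall>fs. \<not> (int (length fs) = k \<and> set fs \<subseteq> A) \<longrightarrow> \<psi> fs = 0) \<and>
     antisym_fun \<psi> \<and>
     (\<forall>f\<in>A. \<forall>g\<in>A. \<forall>fs. set fs \<subseteq> A \<longrightarrow> \<psi> ((f + g) # fs) = \<psi> (f # fs) + \<psi> (g # fs)) \<and>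
     (\<forall>c. \<forall>f\<in>A. \<forall>fs. set fs \<subseteq> A \<longrightarrow> \<psi> ((\<iota> c * f) # fs) = sc (\<iota> c) (\<psi> (f # fs))) \<and>
     (\<exists>p>0. \<forall>f\<in>A. \<forall>x\<in>A. \<forall>fs. set fs \<subseteq> A \<longrightarrow>
       (\<Sum>i\<in>{0..p}. sc ((-1) ^ i * of_nat (p choose i) * f ^ (p - i)) (\<psi> ((f ^ i * x) # fs))) = 0)}"

definition coc :: "int \<Rightarrow> (nat list \<Rightarrow> 'k val) set" where
  "coc k = {c. (\<forall>js. c js \<in> VA) \<and> (\<forall>js. int (length js) \<noteq> k \<longrightarrow> c js = 0) \<and>
     antisym_fun c \<and> (\<exists>N. supp_below N c)}"

definition PhiA :: "nat \<Rightarrow> (nat list \<Rightarrow> 'k val) \<Rightarrow> 'k list \<Rightarrow> 'k val" where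
  "PhiA N c fs = (if set fs \<subseteq> A then Phi N c fs else 0)"

text \<open>
  The \<open>p\<close>-fold commutator of \<open>T\<close> with multiplication by \<open>f\<close>.
\<close>

definition AD :: "'k \<Rightarrow> nat \<Rightarrow> ('k \<Rightarrow> 'k val) \<Rightarrow> 'k \<Rightarrow> 'k val" where
  "AD f p T x = (\<Sum>i\<le>p. sc ((-1) ^ (p - i) * of_nat (p choose i) * f ^ (p - i)) (T (f ^ i * x)))"

lemma AD_0: "AD f 0 T x = T x"
  by (simp add: AD_def)

text \<open>Pascal's rule: one more commutator on the outside. \<open>AD_Suc'\<close> puts it on the
  inside instead, which is the form that suits an induction over T.\<close>

lemma AD_Suc: "AD f (Suc p) T x = AD f p T (f * x) - sc f (AD f p T x)"
proof -
  let ?k = "\<lambda>p i. (-1) ^ (p - i) * of_nat (p choose i) * f ^ (p - i)"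
  have k: "?k (Suc p) (Suc i) = ?k p i - (if Suc i \<le> p then f * ?k p (Suc i) else 0)" if "i \<le> p" for i
  proof (cases "Suc i \<le> p")
    case True
    then obtain l where "p = Suc i + l" using le_Suc_ex by blast
    then show ?thesis by (simp add: algebra_simps)
  next
    case False
    then have "i = p" using that by simp
    then show ?thesis by simp
  qed
  have "AD f (Suc p) T x = sc (?k (Suc p) 0) (T x) + (\<Sum>i\<le>p. sc (?k (Suc p) (Suc i)) (T (f ^ Suc i * x)))"
    unfolding AD_def sum.atMost_Suc_shift by simp
  also have "(\<Sum>i\<le>p. sc (?k (Suc p) (Suc i)) (T (f ^ Suc i * x))) =
     (\<Sum>i\<le>p. sc (?k p i) (T (f ^ Suc i * x)))
      - (\<Sum>i\<le>p. if Suc i \<le> p then sc (f * ?k p (Suc i)) (T (f ^ Suc i * x)) else 0)"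
    unfolding sum_subtractf[symmetric]
  proof (rule sum.cong[OF refl])
    fix i assume "i \<in> {..p}"
    then have i: "i \<le> p" by simp
    show "sc (?k (Suc p) (Suc i)) (T (f ^ Suc i * x)) = sc (?k p i) (T (f ^ Suc i * x))
        - (if Suc i \<le> p then sc (f * ?k p (Suc i)) (T (f ^ Suc i * x)) else 0)"
      unfolding k[OF i] by (simp add: sc_left)
  qed
  also have "(\<Sum>i\<le>p. if Suc i \<le> p then sc (f * ?k p (Suc i)) (T (f ^ Suc i * x)) else 0) =
      sc f (AD f p T x) - sc (f * ?k p 0) (T x)"
  proof -
    have "(\<Sum>i\<le>p. if Suc i \<le> p then sc (f * ?k p (Suc i)) (T (f ^ Suc i * x)) else 0) =
      (\<Sum>i<p. sc (f * ?k p (Suc i)) (T (f ^ Suc i * x)))"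
      by (rule sum.mono_neutral_cong_right) auto
    moreover have "sc f (AD f p T x) = sc (f * ?k p 0) (T x) + (\<Sum>i<p. sc (f * ?k p (Suc i)) (T (f ^ Suc i * x)))"
      unfolding AD_def sc_sum by (cases p) (simp_all add: sum.atMost_Suc_shift lessThan_Suc_atMost mult.assoc del: sum.atMost_Suc)
    ultimately show ?thesis by simp
  qed
  also have "sc (?k (Suc p) 0) (T x) = - sc (f * ?k p 0) (T x)"
    by (simp add: sc_left(3)[symmetric] mult.left_commute)
  also have "(\<Sum>i\<le>p. sc (?k p i) (T (f ^ Suc i * x))) = AD f p T (f * x)"
    by (simp add: AD_def algebra_simps)
  finally show ?thesis by simp
qed

lemma AD_Suc': "AD f (Suc p) T x = AD f p (\<lambda>x. T (f * x) - sc f (T x)) x"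
proof (induction p arbitrary: x)
  case 0
  then show ?case by (simp add: AD_Suc AD_0)
next
  case (Suc p)
  have "AD f (Suc (Suc p)) T x = AD f (Suc p) T (f * x) - sc f (AD f (Suc p) T x)"
    by (rule AD_Suc)
  also have "\<dots> = AD f (Suc p) (\<lambda>x. T (f * x) - sc f (T x)) x"
    unfolding Suc.IH AD_Suc[symmetric] ..
  finally show ?case .
qed

text \<open>The sum in the Gelfand--Fuks condition counts its signs from the other end, hence the
  factor (-1)^p.\<close>

lemma AD_sign: "(\<Sum>i\<in>{0..p}. sc ((-1) ^ i * of_nat (p choose i) * f ^ (p - i)) (T (f ^ i * x))) =
    sc ((-1) ^ p) (AD f p T x)"
  unfolding AD_def sc_sum atLeast0AtMost
proof (rule sum.cong[OF refl])
  fix i assume "i \<in> {..p}"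
  then obtain l where "p = i + l" using le_Suc_ex by auto
  then have "(-1 :: 'k) ^ p * (-1) ^ (p - i) = (-1) ^ i"
    by (simp add: power_add)
  then show "sc ((-1) ^ i * of_nat (p choose i) * f ^ (p - i)) (T (f ^ i * x)) =
     sc ((-1) ^ p) (sc ((-1) ^ (p - i) * of_nat (p choose i) * f ^ (p - i)) (T (f ^ i * x)))"
    by (simp add: mult.assoc[symmetric])
qed

text \<open>A commutator with f lowers the order of a differential operator: by the Leibniz rule the
  top term \<open>f * F j x\<close> cancels, and only terms \<open>F l x\<close> with l < j
  remain.\<close>

lemma AD_sum_F: "AD f p (\<lambda>x. \<Sum>j<p. sc (F j x) (v j)) x = 0"
proof (induction p arbitrary: v x)
  case 0
  then show ?case by (simp add: AD_0)
next
  case (Suc p)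
  have "(\<Sum>j<Suc p. sc (F j (f * x)) (v j)) - sc f (\<Sum>j<Suc p. sc (F j x) (v j)) =
      (\<Sum>l<p. sc (F l x) (\<Sum>j\<in>{Suc l..p}. sc (F (j - l) f) (v j)))" for x
  proof -
    have e: "F j (f * x) - f * F j x = (\<Sum>l<j. F (j - l) f * F l x)" for j
    proof -
      have "F j (f * x) = (\<Sum>l\<le>j. F l x * F (j - l) f)"
        by (subst mult.commute) (rule F_mult)
      also have "\<dots> = (\<Sum>l<j. F l x * F (j - l) f) + F j x * f"
        by (simp add: lessThan_Suc_atMost[symmetric])
      finally show ?thesis by (simp add: mult.commute)
    qed
    have "(\<Sum>j<Suc p. sc (F j (f * x)) (v j)) - sc f (\<Sum>j<Suc p. sc (F j x) (v j)) =
       (\<Sum>j<Suc p. sc (F j (f * x) - f * F j x) (v j))"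
      by (simp only: sc_sum sc_simps sc_left sum_subtractf)
    also have "\<dots> = (\<Sum>j<Suc p. \<Sum>l<j. sc (F (j - l) f * F l x) (v j))"
      unfolding e sc_sum_left ..
    also have "\<dots> = (\<Sum>l<p. \<Sum>j\<in>{Suc l..p}. sc (F (j - l) f * F l x) (v j))"
      unfolding sum.Sigma[OF finite_lessThan ballI[OF finite_lessThan]]
        sum.Sigma[OF finite_lessThan ballI[OF finite_atLeastAtMost]]
      by (rule sum.reindex_bij_witness[of _ "\<lambda>(l, j). (j, l)" "\<lambda>(j, l). (l, j)"]) auto
    finally show ?thesis by (simp add: sc_sum mult.commute)
  qed
  then show ?case unfolding AD_Suc' using Suc.IH by simp
qed

lemma F_z: "F (Suc j) (z * f) = z * F (Suc j) f + F j f"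
proof -
  have Fz: "F (Suc (Suc i)) z = 0" for i
  proof -
    have "(d ^^ Suc (Suc i)) z = 0"
      by (induction i) (simp_all add: d_z)
    then show ?thesis by (simp add: F_def del: funpow.simps)
  qed
  have F1: "F (Suc 0) z = 1" by (simp add: F_def d_z)
  have "F (Suc j) (z * f) = z * F (Suc j) f + (\<Sum>i\<le>j. F (Suc i) z * F (j - i) f)"
    by (simp add: F_mult sum.atMost_Suc_shift del: sum.atMost_Suc)
  also have "(\<Sum>i\<le>j. F (Suc i) z * F (j - i) f) = F j f"
    by (cases j) (simp_all add: F1 sum.atMost_Suc_shift Fz del: sum.atMost_Suc)
  finally show ?thesis .
qed

lemma F_Suc_1: "F (Suc j) 1 = 0"
proof -
  have "(d ^^ j) 0 = 0" by (induction j) simp_all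
  then show ?thesis by (simp only: F_def funpow_Suc_right comp_apply d_1) simp
qed

text \<open>Triangular duality between the powers of z and the divided derivatives, used to read off
  coefficients one after another.\<close>

lemma F_z_power: "i \<le> j \<Longrightarrow> F j (z ^ i) = (if i = j then 1 else 0)"
proof (induction i arbitrary: j)
  case 0
  then show ?case by (cases j) (simp_all add: F_Suc_1)
next
  case (Suc i)
  then obtain l where j: "j = Suc l" by (cases j) auto
  then show ?case using Suc by (simp add: F_z)
qed

text \<open>An operator killed by p commutators with z is a differential operator. The commutator
  [T, z] is killed by one fewer and is known by induction; subtracting from T the sum with all
  indices raised by one leaves an operator that commutes with z, hence multiplication by a vector,
  by \<open>A_linear\<close>.\<close>

lemma expand_order:
  assumes "\<And>f g. f \<in> A \<Longrightarrow> g \<in> A \<Longrightarrow> T (f + g) = T f + T g"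
    and "\<And>c f. f \<in> A \<Longrightarrow> T (\<iota> c * f) = sc (\<iota> c) (T f)"
    and "\<And>x. x \<in> A \<Longrightarrow> AD z p T x = 0" and "f \<in> A"
  shows "T f = (\<Sum>j<p. sc (F j f) (AD z j T 1))"
  using assms
proof (induction p arbitrary: T f)
  case 0
  then show ?case by (simp add: AD_0)
next
  case (Suc p)
  let ?T = "\<lambda>x. T (z * x) - sc z (T x)"
  have T': "?T x = (\<Sum>j<p. sc (F j x) (AD z (Suc j) T 1))" if x: "x \<in> A" for x
    unfolding AD_Suc'
  proof (rule Suc.IH[OF _ _ _ x])
    fix f g assume "f \<in> A" "g \<in> A"
    then show "?T (f + g) = ?T f + ?T g"
      using Suc.prems(1)[of "z * f" "z * g"] Suc.prems(1)[of f g] by (simp add: A_mult A_z distrib_left)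
  next
    fix c f assume "f \<in> A"
    then show "?T (\<iota> c * f) = sc (\<iota> c) (?T f)"
      using Suc.prems(2)[of "z * f" c] Suc.prems(2)[of f c] by (simp add: A_mult A_z mult.left_commute mult.commute)
  next
    fix x assume "x \<in> A"
    then show "AD z p ?T x = 0" using Suc.prems(3) unfolding AD_Suc' by simp
  qed
  \<comment> \<open>By \<open>F_z\<close> the commutator of \<open>F (Suc j)\<close> with z is
    \<open>F j\<close>; therefore S commutes with z.\<close>
  define S where "S x = T x - (\<Sum>j<p. sc (F (Suc j) x) (AD z (Suc j) T 1))" for x
  have "S f = sc f (S 1)"
  proof (rule A_linear)
    fix f g assume "f \<in> A" "g \<in> A"
    then show "S (f + g) = S f + S g"
      unfolding S_def Suc.prems(1)[OF \<open>f \<in> A\<close> \<open>g \<in> A\<close>] F_add by (simp add: sc_left sum.distrib)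
  next
    fix c f assume "f \<in> A"
    then show "S (\<iota> c * f) = sc (\<iota> c) (S f)"
      unfolding S_def Suc.prems(2)[OF \<open>f \<in> A\<close>] F_\<iota> by (simp add: sc_sum)
  next
    fix f assume f: "f \<in> A"
    have "T (z * f) = sc z (T f) + (\<Sum>j<p. sc (F j f) (AD z (Suc j) T 1))"
      using T'[OF f] by (simp add: algebra_simps)
    then show "S (z * f) = sc z (S f)"
      unfolding S_def F_z by (simp add: sc_left sc_sum sum.distrib)
  qed (rule Suc.prems)
  moreover have "S 1 = T 1" by (simp add: S_def F_Suc_1)
  ultimately have "T f = sc f (T 1) + (\<Sum>j<p. sc (F (Suc j) f) (AD z (Suc j) T 1))"
    unfolding S_def by (simp add: algebra_simps)
  then show ?case by (simp only: sum.lessThan_Suc_shift AD_0 F_0)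
qed

section \<open>Coefficients of a cochain\<close>

definition cj :: "('k list \<Rightarrow> 'k val) \<Rightarrow> nat \<Rightarrow> 'k list \<Rightarrow> 'k val" where
  "cj \<psi> j = (\<lambda>fs. AD z j (\<lambda>f. \<psi> (f # fs)) 1)"

text \<open>The inverse of \<open>Phi\<close>: by \<open>expand_order\<close>,
  \<open>cj \<psi> j\<close> is the coefficient of \<open>F j f\<close> when \<psi> is expanded in
  its first argument f.\<close>

fun coef :: "('k list \<Rightarrow> 'k val) \<Rightarrow> nat list \<Rightarrow> 'k val" where
  "coef \<psi> [] = \<psi> []"
| "coef \<psi> (j # js) = coef (cj \<psi> j) js"

lemma con_coef: "con j (coef \<psi>) = coef (cj \<psi> j)"
  by (simp add: fun_eq_iff con_apply)

text \<open>As \<open>gfc\<close>, but with the order p fixed and the commutator condition kept for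
  z only. In this form the condition passes to the coefficients with the same p, which makes
  induction on the number of arguments possible.\<close>

definition ordc :: "nat \<Rightarrow> int \<Rightarrow> ('k list \<Rightarrow> 'k val) set" where
  "ordc p k = {\<psi>. (\<forall>fs. \<psi> fs \<in> VA) \<and> (\<forall>fs. \<not> (int (length fs) = k \<and> set fs \<subseteq> A) \<longrightarrow> \<psi> fs = 0) \<and>
     antisym_fun \<psi> \<and>
     (\<forall>f\<in>A. \<forall>g\<in>A. \<forall>fs. set fs \<subseteq> A \<longrightarrow> \<psi> ((f + g) # fs) = \<psi> (f # fs) + \<psi> (g # fs)) \<and>
     (\<forall>c. \<forall>f\<in>A. \<forall>fs. set fs \<subseteq> A \<longrightarrow> \<psi> ((\<iota> c * f) # fs) = sc (\<iota> c) (\<psi> (f # fs))) \<and>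
     (\<forall>x\<in>A. \<forall>fs. set fs \<subseteq> A \<longrightarrow> AD z p (\<lambda>f. \<psi> (f # fs)) x = 0)}"

lemma gfc_ordc:
  assumes "\<psi> \<in> gfc k"
  shows "\<exists>p>0. \<psi> \<in> ordc p k"
proof -
  obtain p where p: "p > 0" "\<And>f x fs. f \<in> A \<Longrightarrow> x \<in> A \<Longrightarrow> set fs \<subseteq> A \<Longrightarrow>
      (\<Sum>i\<in>{0..p}. sc ((-1) ^ i * of_nat (p choose i) * f ^ (p - i)) (\<psi> ((f ^ i * x) # fs))) = 0"
    using assms unfolding gfc_def by blast
  have "AD z p (\<lambda>f. \<psi> (f # fs)) x = 0" if "x \<in> A" "set fs \<subseteq> A" for x fs
    using p(2)[OF A_z that] unfolding AD_sign[of _ _ "\<lambda>f. \<psi> (f # fs)"] sc_eq_0_iff by simp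
  then have "\<psi> \<in> ordc p k" using assms unfolding gfc_def ordc_def by blast
  then show ?thesis using p(1) by blast
qed

lemma ordcD:
  assumes "\<psi> \<in> ordc p k"
  shows "\<psi> fs \<in> VA" "\<not> (int (length fs) = k \<and> set fs \<subseteq> A) \<Longrightarrow> \<psi> fs = 0" "antisym_fun \<psi>"
    "f \<in> A \<Longrightarrow> g \<in> A \<Longrightarrow> set fs \<subseteq> A \<Longrightarrow> \<psi> ((f + g) # fs) = \<psi> (f # fs) + \<psi> (g # fs)"
    "f \<in> A \<Longrightarrow> set fs \<subseteq> A \<Longrightarrow> \<psi> ((\<iota> c * f) # fs) = sc (\<iota> c) (\<psi> (f # fs))"
    "f \<in> A \<Longrightarrow> set fs \<subseteq> A \<Longrightarrow> AD z p (\<lambda>f. \<psi> (f # fs)) f = 0"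
  using assms unfolding ordc_def by blast+

lemma sum_uminus_cong:
  assumes "\<And>i. i \<in> I \<Longrightarrow> f i = - g i"
  shows "sum f I = - (sum g I :: 'k val)"
  unfolding sum_negf[symmetric] using assms by (rule sum.cong[OF refl])

text \<open>The coefficient is a combination of values with a power of z in front. Antisymmetry
  moves the next argument to the front, so it inherits linearity and the order p.\<close>

lemma cj_ordc:
  assumes \<psi>: "\<psi> \<in> ordc p k"
  shows "cj \<psi> j \<in> ordc p (k - 1)"
proof -
  let ?k = "\<lambda>i. (-1) ^ (j - i) * of_nat (j choose i) * z ^ (j - i)"
  have kA: "?k i \<in> A" for i
  proof -
    show ?thesis by (rule A_mult[OF A_mult[OF A_power[OF A_minus[OF A_1]] A_of_nat] A_power[OF A_z]])
  qed
  have zA: "z ^ i \<in> A" for i by (rule A_power[OF A_z])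
  have cj: "cj \<psi> j fs = (\<Sum>i\<le>j. sc (?k i) (\<psi> (z ^ i # fs)))" for fs
    by (simp add: cj_def AD_def)
  have sw: "\<psi> (z ^ i # f # fs) = - \<psi> (f # z ^ i # fs)" for i f fs
    by (rule antisym_fun_swap[OF ordcD(3)[OF \<psi>]])
  show ?thesis
    unfolding ordc_def
  proof (intro CollectI conjI allI ballI impI)
    fix fs show "cj \<psi> j fs \<in> VA"
      unfolding cj by (intro VA_sum VA_sc kA ordcD(1)[OF \<psi>])
  next
    fix fs assume "\<not> (int (length fs) = k - 1 \<and> set fs \<subseteq> A)"
    then have "\<not> (int (length (z ^ i # fs)) = k \<and> set (z ^ i # fs) \<subseteq> A)" for i by auto
    then have "\<psi> (z ^ i # fs) = 0" for i by (rule ordcD(2)[OF \<psi>])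
    then show "cj \<psi> j fs = 0" unfolding cj by simp
  next
    have "cj \<psi> j (xs @ x # y # ys) = - cj \<psi> j (xs @ y # x # ys)" for xs x y ys
      unfolding cj
    proof (rule sum_uminus_cong)
      fix i
      show "sc (?k i) (\<psi> (z ^ i # xs @ x # y # ys)) = - sc (?k i) (\<psi> (z ^ i # xs @ y # x # ys))"
        using antisym_funD[OF ordcD(3)[OF \<psi>], of "z ^ i # xs" x y ys] by simp
    qed
    then show "antisym_fun (cj \<psi> j)" unfolding antisym_fun_def by blast
  next
    fix f g fs assume "f \<in> A" "g \<in> A" "set fs \<subseteq> A"
    then show "cj \<psi> j ((f + g) # fs) = cj \<psi> j (f # fs) + cj \<psi> j (g # fs)"
      unfolding cj sw sum.distrib[symmetric]
      using ordcD(4)[OF \<psi>, of f g "z ^ _ # fs"] zA by (intro sum.cong) auto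
  next
    fix c f fs assume "f \<in> A" "set fs \<subseteq> A"
    then show "cj \<psi> j ((\<iota> c * f) # fs) = sc (\<iota> c) (cj \<psi> j (f # fs))"
      unfolding cj sw sc_sum
      using ordcD(5)[OF \<psi>, of f "z ^ _ # fs" c] zA by (intro sum.cong) (auto simp: mult.commute)
  next
    fix x fs assume x: "x \<in> A" and fs: "set fs \<subseteq> A"
    have z0: "AD z p (\<lambda>f. \<psi> (f # z ^ i # fs)) x = 0" for i
      using fs zA by (intro ordcD(6)[OF \<psi> x]) auto
    have "AD z p (\<lambda>f. cj \<psi> j (f # fs)) x = (\<Sum>i\<le>j. sc (- ?k i) (AD z p (\<lambda>f. \<psi> (f # z ^ i # fs)) x))"
      unfolding AD_def cj sw sc_sum
      by (subst sum.swap) (intro sum.cong refl, simp add: sc_left mult.commute)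
    then show "AD z p (\<lambda>f. cj \<psi> j (f # fs)) x = 0"
      unfolding z0 by simp
  qed
qed

lemma AD_zero_ge:
  assumes "\<And>x. x \<in> A \<Longrightarrow> AD z p T x = 0" "p \<le> j" "x \<in> A"
  shows "AD z j T x = 0"
  using assms(2,3)
proof (induction j arbitrary: x rule: dec_induct)
  case (step j)
  then show ?case by (simp add: AD_Suc A_mult A_z)
qed (rule assms(1))

text \<open>With p common to all slots, this bounds every index of
  \<open>coef \<psi>\<close>.\<close>

lemma cj_ge:
  assumes \<psi>: "\<psi> \<in> ordc p k" and "p \<le> j"
  shows "cj \<psi> j = 0"
proof
  fix fs show "cj \<psi> j fs = 0 fs"
  proof (cases "set fs \<subseteq> A")
    case True
    then show ?thesis
      using AD_zero_ge[OF ordcD(6)[OF \<psi>] \<open>p \<le> j\<close> A_1] by (simp add: cj_def)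
  next
    case False
    then show ?thesis using ordcD(2)[OF cj_ordc[OF \<psi>]] by simp
  qed
qed

lemma coef_0: "coef 0 js = 0"
proof (induction js)
  case (Cons j js)
  have "cj 0 j = 0" by (simp add: cj_def AD_def fun_eq_iff)
  then show "coef 0 (j # js) = 0" unfolding coef.simps by (simp only: Cons.IH)
qed simp

lemma coef_add: "coef (\<phi> + \<psi>) js = coef \<phi> js + coef \<psi> js"
proof (induction js arbitrary: \<phi> \<psi>)
  case (Cons j js)
  have "cj (\<phi> + \<psi>) j = cj \<phi> j + cj \<psi> j" by (simp add: cj_def AD_def fun_eq_iff sum.distrib)
  then show "coef (\<phi> + \<psi>) (j # js) = coef \<phi> (j # js) + coef \<psi> (j # js)"
    unfolding coef.simps by (simp only: Cons.IH)
qed simp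

lemma coef_minus: "coef (- \<psi>) js = - coef \<psi> js"
  using coef_add[of \<psi> "- \<psi>" js] by (simp add: eq_neg_iff_add_eq_0 add.commute coef_0)

lemma coef_scale: "coef (\<lambda>fs. sc k (\<psi> fs)) js = sc k (coef \<psi> js)"
proof (induction js arbitrary: \<psi>)
  case (Cons j js)
  have "cj (\<lambda>fs. sc k (\<psi> fs)) j = (\<lambda>fs. sc k (cj \<psi> j fs))"
    by (simp add: cj_def AD_def fun_eq_iff sc_sum mult.commute)
  then show "coef (\<lambda>fs. sc k (\<psi> fs)) (j # js) = sc k (coef \<psi> (j # js))"
    unfolding coef.simps by (simp only: Cons.IH)
qed simp

lemma Phi_coef: "\<psi> \<in> ordc p k \<Longrightarrow> set fs \<subseteq> A \<Longrightarrow> Phi p (coef \<psi>) fs = \<psi> fs"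
proof (induction fs arbitrary: \<psi> k)
  case (Cons f fs)
  have "\<psi> (f # fs) = (\<Sum>j<p. sc (F j f) (cj \<psi> j fs))"
    unfolding cj_def using Cons.prems(2)
    by (intro expand_order[of "\<lambda>f. \<psi> (f # fs)"]) (auto intro!: ordcD(4-6)[OF Cons.prems(1)])
  also have "\<dots> = Phi p (coef \<psi>) (f # fs)"
    using Cons.IH[OF cj_ordc[OF Cons.prems(1)]] Cons.prems(2) by (simp add: con_coef)
  finally show ?case by simp
qed simp

lemma coef_coc: 
  assumes "\<psi> \<in> ordc p k"
  shows "coef \<psi> \<in> coc k" "supp_below p (coef \<psi>)"
proof -
  have VA: "\<psi> \<in> ordc p k \<Longrightarrow> coef \<psi> js \<in> VA" for js \<psi> k
    by (induction js arbitrary: \<psi> k) (auto intro: ordcD(1) cj_ordc)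
  have len: "\<psi> \<in> ordc p k \<Longrightarrow> int (length js) \<noteq> k \<Longrightarrow> coef \<psi> js = 0" for js \<psi> k
  proof (induction js arbitrary: \<psi> k)
    case Nil
    then show ?case using ordcD(2)[OF Nil(1), of "[]"] by auto
  next
    case (Cons j js)
    then show ?case using Cons.IH[OF cj_ordc[OF Cons.prems(1), of j]] by auto
  qed
  \<comment> \<open>Both sides are double sums over powers of z; exchanging the sums and the first
    two arguments produces the sign.\<close>
  have cs: "coef \<psi> (x # y # ys) = - coef \<psi> (y # x # ys)" if "antisym_fun \<psi>" for \<psi> x y ys
  proof -
    have "cj (cj \<psi> x) y = - cj (cj \<psi> y) x"
    proof
      fix fs
      have "cj (cj \<psi> x) y fs = (\<Sum>b\<le>y. \<Sum>a\<le>x. sc ((-1) ^ (y - b) * of_nat (y choose b) * z ^ (y - b) *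
          ((-1) ^ (x - a) * of_nat (x choose a) * z ^ (x - a))) (\<psi> (z ^ a # z ^ b # fs)))"
        by (simp add: cj_def AD_def sc_sum)
      also have "\<dots> = - (\<Sum>b\<le>y. \<Sum>a\<le>x. sc ((-1) ^ (x - a) * of_nat (x choose a) * z ^ (x - a) *
          ((-1) ^ (y - b) * of_nat (y choose b) * z ^ (y - b))) (\<psi> (z ^ b # z ^ a # fs)))"
      proof (rule sum_uminus_cong, rule sum_uminus_cong)
        fix a b
        show "sc ((-1) ^ (y - b) * of_nat (y choose b) * z ^ (y - b) *
          ((-1) ^ (x - a) * of_nat (x choose a) * z ^ (x - a))) (\<psi> (z ^ a # z ^ b # fs)) =
          - sc ((-1) ^ (x - a) * of_nat (x choose a) * z ^ (x - a) *
          ((-1) ^ (y - b) * of_nat (y choose b) * z ^ (y - b))) (\<psi> (z ^ b # z ^ a # fs))"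
          unfolding antisym_fun_swap[OF that, of "z ^ a" "z ^ b" fs] by (simp add: mult_ac)
      qed
      also have "(\<Sum>b\<le>y. \<Sum>a\<le>x. sc ((-1) ^ (x - a) * of_nat (x choose a) * z ^ (x - a) *
          ((-1) ^ (y - b) * of_nat (y choose b) * z ^ (y - b))) (\<psi> (z ^ b # z ^ a # fs))) = cj (cj \<psi> y) x fs"
        by (subst sum.swap) (simp add: cj_def AD_def sc_sum)
      finally show "cj (cj \<psi> x) y fs = (- cj (cj \<psi> y) x) fs" by simp
    qed
    then show ?thesis using coef_minus[of "cj (cj \<psi> y) x" ys] by simp
  qed
  have anti: "\<psi> \<in> ordc p k \<Longrightarrow> coef \<psi> (xs @ x # y # ys) = - coef \<psi> (xs @ y # x # ys)" for xs x y ys \<psi> k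
  proof (induction xs arbitrary: \<psi> k)
    case Nil
    then show ?case using cs[OF ordcD(3)[OF Nil], of x y ys] by simp
  next
    case (Cons j js)
    then show ?case using Cons.IH[OF cj_ordc[OF Cons.prems, of j]] by simp
  qed
  have supp: "\<psi> \<in> ordc p k \<Longrightarrow> j \<in> set js \<Longrightarrow> p \<le> j \<Longrightarrow> coef \<psi> js = 0" for js j \<psi> k
  proof (induction js arbitrary: \<psi> k)
    case (Cons i js)
    show ?case
    proof (cases "i = j")
      case True
      then show ?thesis using cj_ge[OF Cons.prems(1,3)] coef_0[of js] by simp
    next
      case False
      then show ?thesis using Cons.IH[OF cj_ordc[OF Cons.prems(1), of i]] Cons.prems by simp
    qed
  qed simp
  show s: "supp_below p (coef \<psi>)"
    unfolding supp_below_def using supp[OF assms] by blast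
  have "antisym_fun (coef \<psi>)" unfolding antisym_fun_def using anti[OF assms] by blast
  then show "coef \<psi> \<in> coc k"
    unfolding coc_def using VA[OF assms] len[OF assms] s by blast
qed

lemma Phi_mono:
  assumes "supp_below N c" "N \<le> N'"
  shows "Phi N' c fs = Phi N c fs"
  using assms(1)
proof (induction fs arbitrary: c)
  case (Cons f fs)
  have "Phi N' c (f # fs) = (\<Sum>j<N'. sc (F j f) (Phi N (con j c) fs))"
    using Cons.IH[OF supp_below_con[OF Cons.prems]] by simp
  also have "\<dots> = (\<Sum>j<N. sc (F j f) (Phi N (con j c) fs))"
  proof (rule sum.mono_neutral_right)
    show "\<forall>j\<in>{..<N'} - {..<N}. sc (F j f) (Phi N (con j c) fs) = 0"
      using supp_below_con_0[OF Cons.prems] by (simp add: Phi_0)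
  qed (use assms(2) in auto)
  finally show ?case by simp
qed simp

text \<open>Inserting 1, z, z^2, ... for the first argument isolates the coefficients in turn, by
  \<open>F_z_power\<close>; the remaining arguments follow by induction.\<close>

lemma Phi_inject:
  assumes "supp_below N c" "\<And>fs. set fs \<subseteq> A \<Longrightarrow> Phi N c fs = 0"
  shows "c js = 0"
  using assms
proof (induction js arbitrary: c)
  case Nil
  then show ?case using Nil(2)[of "[]"] by simp
next
  case (Cons j js)
  have P: "Phi N (con i c) fs = 0" if "i < N" "set fs \<subseteq> A" for i fs
    using that(1)
  proof (induction i rule: less_induct)
    case (less i)
    have "0 = Phi N c (z ^ i # fs)"
      using Cons.prems(2)[of "z ^ i # fs"] that(2) A_power[OF A_z] by simp
    also have "\<dots> = (\<Sum>l<N. if l = i then Phi N (con i c) fs else 0)"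
      unfolding Phi.simps
    proof (rule sum.cong[OF refl])
      fix l assume "l \<in> {..<N}"
      then show "sc (F l (z ^ i)) (Phi N (con l c) fs) = (if l = i then Phi N (con i c) fs else 0)"
        using less.IH[of l] F_z_power[of i l] by (cases "l < i") auto
    qed
    also have "\<dots> = Phi N (con i c) fs" using less.prems by simp
    finally show ?case by simp
  qed
  show ?case
  proof (cases "j < N")
    case True
    have "con j c js = 0"
      by (rule Cons.IH[OF supp_below_con[OF Cons.prems(1)] P[OF True]])
    then show ?thesis by (simp add: con_apply)
  next
    case False
    then show ?thesis using supp_belowD[OF Cons.prems(1), of j "j # js"] by simp
  qed
qed

lemma cocD:
  assumes "c \<in> coc k"
  shows "c js \<in> VA" "int (length js) \<noteq> k \<Longrightarrow> c js = 0" "antisym_fun c"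
  using assms unfolding coc_def by blast+

lemma Phi_antisym: "antisym_fun c \<Longrightarrow> Phi N c (xs @ x # y # ys) = - Phi N c (xs @ y # x # ys)"
proof (induction xs arbitrary: c)
  case Nil
  have m: "Phi N (con i (con j c)) ys = - Phi N (con j (con i c)) ys" for i j
  proof -
    have "con i (con j c) = - con j (con i c)"
      using antisym_fun_swap[OF Nil, of j i] by (simp add: fun_eq_iff con_apply)
    then show ?thesis by (simp only: Phi_minus)
  qed
  have "Phi N c (x # y # ys) = (\<Sum>i<N. \<Sum>j<N. sc (F i x * F j y) (Phi N (con j (con i c)) ys))"
    by (simp add: sc_sum)
  also have "\<dots> = - (\<Sum>i<N. \<Sum>j<N. sc (F j y * F i x) (Phi N (con i (con j c)) ys))"
    unfolding sum_negf[symmetric] by (intro sum.cong refl, subst m) (simp add: mult.commute)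
  also have "(\<Sum>i<N. \<Sum>j<N. sc (F j y * F i x) (Phi N (con i (con j c)) ys)) = Phi N c (y # x # ys)"
    by (subst sum.swap) (simp add: sc_sum)
  finally show ?case by simp
next
  case (Cons w ws)
  show ?case
    unfolding append_Cons Phi.simps
  proof (rule sum_uminus_cong)
    fix j
    show "sc (F j w) (Phi N (con j c) (ws @ x # y # ys)) = - sc (F j w) (Phi N (con j c) (ws @ y # x # ys))"
      using Cons.IH[OF antisym_fun_con[OF Cons.prems, of j]] by simp
  qed
qed

lemma Phi_VA: "(\<And>js. c js \<in> VA) \<Longrightarrow> set fs \<subseteq> A \<Longrightarrow> Phi N c fs \<in> VA"
  by (induction fs arbitrary: c) (auto intro!: VA_sum VA_sc A_F simp: con_apply)

lemma Phi_length: "(\<And>js. int (length js) \<noteq> k \<Longrightarrow> c js = 0) \<Longrightarrow> int (length fs) \<noteq> k \<Longrightarrow> Phi N c fs = 0"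
proof (induction fs arbitrary: c k)
  case (Cons f fs)
  have "Phi N (con j c) fs = 0" for j
    using Cons.prems by (intro Cons.IH[of "k - 1"]) (auto simp: con_apply)
  then show ?case by simp
qed simp

lemma PhiA_gfc:
  assumes c: "c \<in> coc k" and N: "supp_below N c" "N > 0"
  shows "PhiA N c \<in> gfc k"
  unfolding gfc_def
proof (intro CollectI conjI allI ballI impI exI[of _ N])
  fix fs show "PhiA N c fs \<in> VA"
    using Phi_VA[of c fs N] cocD(1)[OF c] by (simp add: PhiA_def VA_0)
next
  fix fs assume "\<not> (int (length fs) = k \<and> set fs \<subseteq> A)"
  then show "PhiA N c fs = 0" using Phi_length[of k c fs N] cocD(2)[OF c] by (auto simp: PhiA_def)
next
  show "antisym_fun (PhiA N c)"
    unfolding antisym_fun_def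
  proof (intro allI)
    fix xs x y ys
    have "(set (xs @ x # y # ys) \<subseteq> A) = (set (xs @ y # x # ys) \<subseteq> A)" by auto
    then show "PhiA N c (xs @ x # y # ys) = - PhiA N c (xs @ y # x # ys)"
      using Phi_antisym[OF cocD(3)[OF c], of N xs x y ys] unfolding PhiA_def by simp
  qed
next
  fix f g fs assume "f \<in> A" "g \<in> A" "set fs \<subseteq> A"
  then show "PhiA N c ((f + g) # fs) = PhiA N c (f # fs) + PhiA N c (g # fs)"
    by (simp add: PhiA_def A_add F_add sc_left sum.distrib)
next
  fix e f fs assume "f \<in> A" "set fs \<subseteq> A"
  then show "PhiA N c ((\<iota> e * f) # fs) = sc (\<iota> e) (PhiA N c (f # fs))"
    by (simp add: PhiA_def A_mult A_const F_\<iota> sc_sum)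
next
  show "N > 0" by (rule N)
next
  fix f x fs assume f: "f \<in> A" and x: "x \<in> A" and fs: "set fs \<subseteq> A"
  have "(\<Sum>i\<in>{0..N}. sc ((-1) ^ i * of_nat (N choose i) * f ^ (N - i)) (PhiA N c ((f ^ i * x) # fs))) =
    (\<Sum>i\<in>{0..N}. sc ((-1) ^ i * of_nat (N choose i) * f ^ (N - i))
        ((\<lambda>x. \<Sum>j<N. sc (F j x) (Phi N (con j c) fs)) (f ^ i * x)))"
    using f x fs by (simp add: PhiA_def A_mult A_power)
  also have "\<dots> = 0" unfolding AD_sign[of _ _ "\<lambda>x. \<Sum>j<N. sc (F j x) (Phi N (con j c) fs)"] AD_sum_F by simp
  finally show "(\<Sum>i\<in>{0..N}. sc ((-1) ^ i * of_nat (N choose i) * f ^ (N - i)) (PhiA N c ((f ^ i * x) # fs))) = 0" .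
qed

end

subsection \<open>Cohomology of the coefficient complex\<close>

text \<open>
  Exterior multiplication by the form dual to the index \<open>0\<close>.
\<close>

fun eps :: "(nat list \<Rightarrow> 'b::ab_group_add) \<Rightarrow> nat list \<Rightarrow> 'b" where
  "eps b [] = 0"
| "eps b (i # js) = (if i = 0 then b js else - eps (con i b) js)"

lemma eps_add: "eps (b + b') js = eps b js + eps b' js"
proof (induction js arbitrary: b b')
  case (Cons i js)
  have "con i (b + b') = con i b + con i b'" by (simp add: fun_eq_iff con_apply)
  then show "eps (b + b') (i # js) = eps b (i # js) + eps b' (i # js)"
    unfolding eps.simps by (simp only: Cons.IH) simp
qed simp

lemma eps_0: "eps 0 js = 0"
  using eps_add[of 0 0 js] by simp

lemma eps_minus: "eps (- b) js = - eps b js"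
  using eps_add[of b "- b" js] by (simp add: eps_0 eq_neg_iff_add_eq_0 add.commute)

lemma eps_positive: "0 \<notin> set js \<Longrightarrow> eps b js = 0"
  by (induction js arbitrary: b) auto

text \<open>For the entry 0 the recursion of \<open>eps\<close> drops the contraction of b with 0.
  It is therefore exterior multiplication for those b that do not involve this index, which is the
  second hypothesis.\<close>

lemma eps_antisym:
  assumes "antisym_fun b" "\<And>js. 0 \<in> set js \<Longrightarrow> b js = 0"
  shows "antisym_fun (eps b)"
proof -
  have "eps b (xs @ x # y # ys) = - eps b (xs @ y # x # ys)" for xs x y ys
    using assms
  proof (induction xs arbitrary: b)
    case Nil
    have "con y (con x b) = - con x (con y b)"
      using antisym_fun_swap[OF Nil(1), of x y] by (simp add: fun_eq_iff con_apply)
    then have "eps (con y (con x b)) ys = - eps (con x (con y b)) ys"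
      by (simp only: eps_minus)
    then show ?case using Nil(2) by (auto simp: con_apply)
  next
    case (Cons w ws)
    have "eps (con w b) (ws @ x # y # ys) = - eps (con w b) (ws @ y # x # ys)"
      by (rule Cons.IH[OF antisym_fun_con[OF Cons.prems(1)]]) (simp add: con_apply Cons.prems(2))
    moreover have "b (ws @ x # y # ys) = - b (ws @ y # x # ys)"
      by (rule antisym_funD[OF Cons.prems(1)])
    ultimately show ?case by simp
  qed
  then show ?thesis unfolding antisym_fun_def by blast
qed

section \<open>Components with and without the index 0\<close>

lemma val_self_neg: "v = - v \<Longrightarrow> v = (0::'k::field_char_0 val)"
proof (rule val_eqI)
  fix a assume "v = - v"
  then have "coo v a = - coo v a" by (metis coo_simps(4))
  then show "coo v a = coo 0 a" by simp
qed

lemma antisym_double_zero: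
  fixes c :: "nat list \<Rightarrow> 'k::field_char_0 val"
  assumes "antisym_fun c" "0 \<in> set js"
  shows "c (0 # js) = 0"
proof -
  obtain xs ys where js: "js = xs @ 0 # ys" using assms(2) by (meson split_list)
  have "con 0 c (xs @ 0 # ys) = (if even (length xs) then con 0 c (0 # xs @ ys) else - con 0 c (0 # xs @ ys))"
    by (rule antisym_fun_append[OF antisym_fun_con[OF assms(1)]])
  moreover have "c (0 # 0 # xs @ ys) = 0"
    by (rule val_self_neg) (rule antisym_fun_swap[OF assms(1)])
  ultimately show ?thesis unfolding js by (simp add: con_apply split: if_splits)
qed

text \<open>The index 0 can occur at most once, by \<open>antisym_double_zero\<close>. A cochain
  thus has two components, of de Rham degree 0 and 1, both indexed by lists of positive
  indices.\<close>

lemma antisym_eqI: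
  fixes c c' :: "nat list \<Rightarrow> 'k::field_char_0 val"
  assumes "antisym_fun c" "antisym_fun c'"
    and pos: "\<And>js. 0 \<notin> set js \<Longrightarrow> c js = c' js"
    and zero: "\<And>js. 0 \<notin> set js \<Longrightarrow> c (0 # js) = c' (0 # js)"
  shows "c = c'"
proof
  fix js
  show "c js = c' js"
  proof (cases "0 \<in> set js")
    case True
    then obtain xs ys where js: "js = xs @ 0 # ys" by (meson split_list)
    have "c (0 # xs @ ys) = c' (0 # xs @ ys)"
      using zero antisym_double_zero[OF assms(1)] antisym_double_zero[OF assms(2)] by metis
    then show ?thesis
      unfolding js antisym_fun_append[OF assms(1)] antisym_fun_append[OF assms(2)] by simp
  qed (rule pos)
qed

definition pos :: "(nat list \<Rightarrow> 'b::zero) \<Rightarrow> nat list \<Rightarrow> 'b" where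
  "pos c js = (if 0 \<in> set js then 0 else c js)"

lemma antisym_pos: "antisym_fun c \<Longrightarrow> antisym_fun (pos c)"
  unfolding antisym_fun_def pos_def
proof (intro allI)
  fix xs x y ys
  assume *: "\<forall>xs x y ys. c (xs @ x # y # ys) = - c (xs @ y # x # ys)"
  show "(if 0 \<in> set (xs @ x # y # ys) then 0 else c (xs @ x # y # ys)) =
     - (if 0 \<in> set (xs @ y # x # ys) then 0 else c (xs @ y # x # ys))"
    using spec[OF spec[OF spec[OF spec[OF *, of xs], of x], of y], of ys] by auto
qed

text \<open>The positive indices span a subalgebra, i + j - 1 being positive again. Hence on lists
  of positive indices the Lie derivative, and with it the differential, depends only on the
  component of de Rham degree 0.\<close>

lemma (in basis_act) LN_cong_pos:
  assumes "\<And>js. 0 \<notin> set js \<Longrightarrow> c js = c' js" "0 < i" "0 \<notin> set js"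
  shows "LN i c js = LN i c' js"
  using assms
proof (induction js arbitrary: c c')
  case Nil
  then show ?case by simp
next
  case (Cons y ys)
  have "LN i (con y c) ys = LN i (con y c') ys"
    using Cons.prems by (intro Cons.IH) (auto simp: con_apply)
  moreover have "brn i y c ys = brn i y c' ys"
    using Cons.prems by (simp add: brn_def)
  ultimately show ?case by simp
qed

lemma (in basis_act) DN_cong_pos:
  assumes "\<And>js. 0 \<notin> set js \<Longrightarrow> c js = c' js" "0 \<notin> set js"
  shows "DN c js = DN c' js"
  using assms
proof (induction js arbitrary: c c')
  case Nil
  then show ?case by simp
next
  case (Cons y ys)
  have "DN (con y c) ys = DN (con y c') ys"
    using Cons.prems by (intro Cons.IH) (auto simp: con_apply)
  then show ?case using Cons.prems LN_cong_pos[of c c' y ys] by simp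
qed

section \<open>Supports under the differential\<close>

lemma brn_zero: "(0 < i \<Longrightarrow> 0 < j \<Longrightarrow> c ((i + j - 1) # js) = 0) \<Longrightarrow> brn i j c js = 0"
  by (simp add: brn_def)

text \<open>A bracket with a positive index never lowers an index: i + y - 1 \<ge> y. So an index at
  or above the bound stays there.\<close>

lemma (in basis_act) LN_supp:
  assumes "supp_below N c" "\<exists>j\<in>set js. N \<le> j"
  shows "LN i c js = 0"
  using assms
proof (induction js arbitrary: c)
  case Nil
  then show ?case by simp
next
  case (Cons y ys)
  have b: "brn i y c ys = 0"
  proof (rule brn_zero)
    assume "0 < i" "0 < y"
    then have "\<exists>j\<in>set ((i + y - 1) # ys). N \<le> j" using Cons.prems(2) by auto
    then show "c ((i + y - 1) # ys) = 0" using Cons.prems(1) unfolding supp_below_def by blast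
  qed
  show ?case
  proof (cases "N \<le> y")
    case True
    then show ?thesis using supp_below_con_0[OF Cons.prems(1) True] b by (simp add: LN_0)
  next
    case False
    then show ?thesis using Cons.IH[OF supp_below_con[OF Cons.prems(1)], of y] Cons.prems(2) b by auto
  qed
qed

lemma (in basis_act) LN_supp':
  assumes "supp_below N c" "N \<le> i" "\<And>v. act i v = 0"
  shows "LN i c js = 0"
  using assms(1)
proof (induction js arbitrary: c)
  case Nil
  then show ?case by (simp add: assms(3))
next
  case (Cons y ys)
  have "brn i y c ys = 0"
    using assms(2) by (intro brn_zero supp_belowD[OF Cons.prems, of "i + y - 1"]) auto
  then show ?case using Cons.IH[OF supp_below_con[OF Cons.prems], of y] by simp
qed

text \<open>An index \<ge> N may also be the one along which the Lie derivative is taken. Then its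
  brackets lie outside the support of c, and its action is zero by hypothesis.\<close>

lemma (in basis_act) DN_supp:
  assumes "supp_below N c" and act: "\<And>i v. N \<le> i \<Longrightarrow> act i v = 0"
  shows "supp_below N (DN c)"
proof -
  have "(\<exists>j\<in>set js. N \<le> j) \<Longrightarrow> DN c js = 0" for js
    using assms(1)
  proof (induction js arbitrary: c)
    case Nil
    then show ?case by simp
  next
    case (Cons y ys)
    show ?case
    proof (cases "N \<le> y")
      case True
      then show ?thesis
        using supp_below_con_0[OF Cons.prems(2) True] LN_supp'[OF Cons.prems(2) True act[OF True]]
        by (simp add: DN_0)
    next
      case False
      then show ?thesis
        using Cons.IH[OF _ supp_below_con[OF Cons.prems(2)], of y] LN_supp[OF Cons.prems(2)] Cons.prems(1) by auto
    qed
  qed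
  then show ?thesis unfolding supp_below_def by blast
qed

lemma (in jet_act) LN_zero: "LN 0 c js = dval (c js)"
  by (induction js arbitrary: c) (simp_all add: act_zero con_apply brn_def)

lemma (in jet_act) DN_zero: "DN c (0 # js) = - dval (c js) - DN (con 0 c) js"
  by (simp add: LN_zero)

text \<open>What the computation needs to know of A and W. The positive indices act by constant
  matrices M. \<open>d_prim\<close>, \<open>res_d\<close> and \<open>res_u\<close> say that A splits
  into derivatives and the span of the functions \<open>u i\<close>, with \<open>prim\<close> a
  linear antiderivative up to residues; \<open>weight_solve\<close> says that the Euler field minus
  a large weight is invertible on W.\<close>

locale lie_jet = jet_ring act d A z \<iota> n
  for act :: "nat \<Rightarrow> 'k::field_char_0 val \<Rightarrow> 'k val" and d :: "'k \<Rightarrow> 'k"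
    and A :: "'k set" and z :: 'k and \<iota> :: "complex \<Rightarrow> 'k" and n :: nat +
  fixes M :: "nat \<Rightarrow> nat \<Rightarrow> nat \<Rightarrow> complex"
    and prim :: "'k \<Rightarrow> 'k" and res :: "nat \<Rightarrow> 'k \<Rightarrow> complex" and u :: "nat \<Rightarrow> 'k" and m :: nat
  assumes act_mat: "0 < j \<Longrightarrow> act j v = Val (\<lambda>a. if a < n then \<Sum>b<n. \<iota> (M j a b) * coo v b else 0)"
    and act_large: "\<exists>J. \<forall>j\<ge>J. \<forall>v. act j v = 0"
    and weight_solve: "\<exists>w0. \<forall>w\<ge>w0. \<forall>v. (\<forall>a<n. coo v a \<in> range \<iota>) \<and> (\<forall>a\<ge>n. coo v a = 0) \<longrightarrow>
       (\<exists>!x. (\<forall>a<n. coo x a \<in> range \<iota>) \<and> (\<forall>a\<ge>n. coo x a = 0) \<and> act 1 x - sc (of_nat w) x = v)"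
    and u_A: "i \<in> {1..m} \<Longrightarrow> u i \<in> A"
    and res_add: "f \<in> A \<Longrightarrow> g \<in> A \<Longrightarrow> res i (f + g) = res i f + res i g"
    and res_scale: "f \<in> A \<Longrightarrow> res i (\<iota> c * f) = c * res i f"
    and res_d: "f \<in> A \<Longrightarrow> i \<in> {1..m} \<Longrightarrow> res i (d f) = 0"
    and res_u: "i \<in> {1..m} \<Longrightarrow> j \<in> {1..m} \<Longrightarrow> res i (u j) = (if i = j then 1 else 0)"
    and prim_A: "f \<in> A \<Longrightarrow> prim f \<in> A"
    and prim_add: "f \<in> A \<Longrightarrow> g \<in> A \<Longrightarrow> prim (f + g) = prim f + prim g"
    and prim_scale: "f \<in> A \<Longrightarrow> prim (\<iota> c * f) = \<iota> c * prim f"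
    and d_prim: "f \<in> A \<Longrightarrow> d (prim f) = f - (\<Sum>i=1..m. \<iota> (res i f) * u i)"
    and d_kernel: "f \<in> A \<Longrightarrow> d f = 0 \<Longrightarrow> f \<in> range \<iota>"
begin

section \<open>Cochains with constant values\<close>

definition VC :: "'k val set" where
  "VC = {v. (\<forall>a<n. coo v a \<in> range \<iota>) \<and> (\<forall>a\<ge>n. coo v a = 0)}"

lemma range_\<iota>:
  "0 \<in> range \<iota>" "f \<in> range \<iota> \<Longrightarrow> g \<in> range \<iota> \<Longrightarrow> f + g \<in> range \<iota>"
  "f \<in> range \<iota> \<Longrightarrow> g \<in> range \<iota> \<Longrightarrow> f * g \<in> range \<iota>"
  by (metis \<iota>_0 rangeI, metis (no_types) \<iota>_add image_iff rangeI, metis (no_types) \<iota>_mult image_iff rangeI)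

lemma \<iota>_of_int: "\<iota> (of_int i) = of_int i"
proof (cases "i \<ge> 0")
  case True
  then show ?thesis using \<iota>_of_nat[of "nat i"] by simp
next
  case False
  then show ?thesis using \<iota>_of_nat[of "nat (- i)"] \<iota>_minus[of "of_nat (nat (- i))"] by simp
qed

lemma VC_VA: "VC \<subseteq> VA"
  unfolding VC_def VA_def using A_const by auto

lemma VC_0: "0 \<in> VC"
  unfolding VC_def using range_\<iota>(1) by simp

lemma VC_add: "v \<in> VC \<Longrightarrow> w \<in> VC \<Longrightarrow> v + w \<in> VC"
  unfolding VC_def using range_\<iota>(2) by simp

lemma VC_sc: "v \<in> VC \<Longrightarrow> sc (\<iota> c) v \<in> VC"
  unfolding VC_def using range_\<iota>(3)[of "\<iota> c"] by simp

lemma VC_minus: "v \<in> VC \<Longrightarrow> - v \<in> VC"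
  using VC_sc[of v "-1"] by (simp add: \<iota>_minus \<iota>_1 sc_left)

lemma VC_diff: "v \<in> VC \<Longrightarrow> w \<in> VC \<Longrightarrow> v - w \<in> VC"
  using VC_add[of v "- w"] VC_minus by simp

lemma range_\<iota>_sum: "(\<And>i. i \<in> I \<Longrightarrow> f i \<in> range \<iota>) \<Longrightarrow> (\<Sum>i\<in>I. f i) \<in> range \<iota>"
  by (induction I rule: infinite_finite_induct) (auto intro: range_\<iota>)

lemma act_VC: "0 < j \<Longrightarrow> v \<in> VC \<Longrightarrow> act j v \<in> VC"
  unfolding VC_def act_mat by (auto intro!: range_\<iota>_sum range_\<iota>(3))

lemma dval_VC: "v \<in> VC \<Longrightarrow> dval v = 0"
proof (rule val_eqI)
  fix a assume "v \<in> VC"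
  then show "coo (dval v) a = coo 0 a"
    unfolding VC_def by (cases "a < n") (auto simp: d_\<iota> not_less)
qed

lemma act_VA: "v \<in> VA \<Longrightarrow> act j v \<in> VA"
proof (cases "j = 0")
  case True
  then show "v \<in> VA \<Longrightarrow> act j v \<in> VA" by (simp add: act_zero VA_def A_d)
next
  case False
  then show "v \<in> VA \<Longrightarrow> act j v \<in> VA" by (simp add: act_mat VA_def) (auto intro!: A_sum A_mult A_const)
qed

lemma brn_in:
  assumes "S = VA \<or> S = VC" "\<And>js. c js \<in> S"
  shows "brn i j c js \<in> S"
proof -
  have "sc (of_int l) v \<in> S" if "v \<in> S" for v l
    using that assms(1) VC_sc[of v "of_int l"] VA_sc[of "of_int l" v] A_const[of "of_int l"]
    unfolding \<iota>_of_int by blast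
  moreover have "0 \<in> S" using assms(1) VC_0 VA_0 by blast
  ultimately show ?thesis unfolding brn_def using assms(2) by presburger
qed

lemma LN_VA: "(\<And>js. c js \<in> VA) \<Longrightarrow> LN i c js \<in> VA"
  by (induction js arbitrary: c) (auto intro!: act_VA VA_diff brn_in simp: con_apply)

lemma LN_VC: "(\<And>js. c js \<in> VC) \<Longrightarrow> 0 < i \<Longrightarrow> 0 \<notin> set js \<Longrightarrow> LN i c js \<in> VC"
  by (induction js arbitrary: c) (auto intro!: act_VC VC_diff brn_in simp: con_apply)

lemma DN_VA: "(\<And>js. c js \<in> VA) \<Longrightarrow> DN c js \<in> VA"
proof (induction js arbitrary: c)
  case (Cons y ys)
  then show ?case using LN_VA[of c y ys] by (auto intro!: VA_diff VA_minus simp: con_apply)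
qed (simp add: VA_0)

lemma DN_VC: "(\<And>js. c js \<in> VC) \<Longrightarrow> 0 \<notin> set js \<Longrightarrow> DN c js \<in> VC"
proof (induction js arbitrary: c)
  case (Cons y ys)
  then show ?case using LN_VC[of c y ys] by (auto intro!: VC_diff VC_minus simp: con_apply)
qed (simp add: VC_0)

lemma (in basis_act) LN_length: "(\<And>js. int (length js) \<noteq> k \<Longrightarrow> c js = 0) \<Longrightarrow> int (length js) \<noteq> k \<Longrightarrow> LN i c js = 0"
proof (induction js arbitrary: c k)
  case (Cons y ys)
  have "LN i (con y c) ys = 0"
    using Cons.prems by (intro Cons.IH[of "k - 1"]) (auto simp: con_apply)
  moreover have "brn i y c ys = 0" using Cons.prems by (intro brn_zero) auto
  ultimately show ?case by simp
qed simp

lemma (in basis_act) DN_length: "(\<And>js. int (length js) \<noteq> k \<Longrightarrow> c js = 0) \<Longrightarrow> int (length js) \<noteq> k + 1 \<Longrightarrow> DN c js = 0"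
proof (induction js arbitrary: c k)
  case (Cons y ys)
  have "DN (con y c) ys = 0"
    using Cons.prems by (intro Cons.IH[of "k - 1"]) (auto simp: con_apply)
  moreover have "LN y c ys = 0" using Cons.prems by (intro LN_length[of k]) auto
  ultimately show ?case by simp
qed simp

text \<open>All cochains of \<open>L_plus\<close> with values in W. The support is unrestricted,
  because a multilinear form may take any values on the infinite basis of monomial fields. Lists
  with the index 0 receive 0.\<close>

definition cocC :: "int \<Rightarrow> (nat list \<Rightarrow> 'k val) set" where
  "cocC k = {c. (\<forall>js. c js \<in> VC) \<and> (\<forall>js. int (length js) \<noteq> k \<longrightarrow> c js = 0) \<and>
     antisym_fun c \<and> (\<forall>js. 0 \<in> set js \<longrightarrow> c js = 0)}"

lemma cocCD:
  assumes "c \<in> cocC k"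
  shows "c js \<in> VC" "int (length js) \<noteq> k \<Longrightarrow> c js = 0" "antisym_fun c" "0 \<in> set js \<Longrightarrow> c js = 0"
  using assms unfolding cocC_def by blast+

lemma ex_supp_DN: 
  assumes "\<exists>N. supp_below N c" shows "\<exists>N. supp_below N (DN c)"
proof -
  obtain N J where "supp_below N c" "\<And>j v. J \<le> j \<Longrightarrow> act j v = 0" using act_large assms by blast
  then show ?thesis
    using DN_supp[of "max N J" c] supp_below_mono[of N c "max N J"] by auto
qed

lemma DN_coc: "c \<in> coc k \<Longrightarrow> DN c \<in> coc (k + 1)"
  unfolding coc_def using DN_VA DN_length[of k c] antisym_fun_DN ex_supp_DN by auto

lemma DN_cocC:
  assumes "c \<in> cocC k"
  shows "DN c \<in> cocC (k + 1)"
proof -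
  note a = antisym_fun_DN[OF cocCD(3)[OF assms]]
  have con0: "con 0 c = 0" using cocCD(4)[OF assms] by (simp add: fun_eq_iff con_apply)
  \<comment> \<open>No component of de Rham degree 1 arises, since the values are constant.\<close>
  have z: "DN c (0 # js) = 0" for js
    unfolding DN_zero con0 using dval_VC[OF cocCD(1)[OF assms]] by (simp add: DN_0)
  have z': "DN c js = 0" if "0 \<in> set js" for js
  proof -
    from that obtain xs ys where js: "js = xs @ 0 # ys" by (meson split_list)
    show ?thesis unfolding js antisym_fun_append[OF a] z by simp
  qed
  then have "DN c js \<in> VC" for js
    using DN_VC[of c js] cocCD(1)[OF assms] VC_0 by (cases "0 \<in> set js") auto
  then show ?thesis
    unfolding cocC_def using z' a DN_length[of k c] cocCD(2)[OF assms] by auto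
qed

lemma coc_pos: "c \<in> coc k \<Longrightarrow> pos c \<in> coc k"
  unfolding coc_def using antisym_pos VA_0
  by (auto simp: pos_def) (metis (mono_tags, lifting) pos_def supp_below_def)

lemma coc_con: "c \<in> coc k \<Longrightarrow> con i c \<in> coc (k - 1)"
  unfolding coc_def by (auto simp: con_apply intro: antisym_fun_con supp_below_con)

lemma con0_positive: "c \<in> coc k \<Longrightarrow> 0 \<in> set js \<Longrightarrow> con 0 c js = 0"
  using antisym_double_zero[OF cocD(3)] by (simp add: con_apply)

subsubsection \<open>Coefficientwise linear maps\<close>

definition vmap :: "('k \<Rightarrow> 'k) \<Rightarrow> 'k val \<Rightarrow> 'k val" where
  "vmap h v = Val (\<lambda>a. if a < n then h (coo v a) else 0)"

lemma coo_vmap [simp]: "coo (vmap h v) a = (if a < n then h (coo v a) else 0)"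
  by (simp add: vmap_def)

text \<open>Linearity over the complex numbers is asked on A only; the locale says nothing about
  residues and antiderivatives elsewhere.\<close>

definition linA :: "('k \<Rightarrow> 'k) \<Rightarrow> bool" where
  "linA h \<longleftrightarrow> (\<forall>f\<in>A. \<forall>g\<in>A. h (f + g) = h f + h g) \<and> (\<forall>c. \<forall>f\<in>A. h (\<iota> c * f) = \<iota> c * h f)"

lemma linA_0: "linA h \<Longrightarrow> h 0 = 0"
  unfolding linA_def using A_0 \<iota>_0 by (metis mult_zero_left)

lemma linA_add: "linA h \<Longrightarrow> f \<in> A \<Longrightarrow> g \<in> A \<Longrightarrow> h (f + g) = h f + h g"
  unfolding linA_def by blast

lemma linA_scale: "linA h \<Longrightarrow> f \<in> A \<Longrightarrow> h (\<iota> c * f) = \<iota> c * h f"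
  unfolding linA_def by blast

lemma linA_sum: "linA h \<Longrightarrow> (\<And>i. i \<in> I \<Longrightarrow> f i \<in> A) \<Longrightarrow> h (\<Sum>i\<in>I. f i) = (\<Sum>i\<in>I. h (f i))"
  by (induction I rule: infinite_finite_induct) (auto simp: linA_0 linA_add A_sum)

lemma vmap_0: "linA h \<Longrightarrow> vmap h 0 = 0"
  by (rule val_eqI) (simp add: linA_0)

lemma vmap_add: "linA h \<Longrightarrow> v \<in> VA \<Longrightarrow> w \<in> VA \<Longrightarrow> vmap h (v + w) = vmap h v + vmap h w"
  by (rule val_eqI) (simp add: linA_add VA_def)

lemma vmap_scale: "linA h \<Longrightarrow> v \<in> VA \<Longrightarrow> vmap h (sc (\<iota> c) v) = sc (\<iota> c) (vmap h v)"
  by (rule val_eqI) (simp add: linA_scale VA_def)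

lemma vmap_minus: "linA h \<Longrightarrow> v \<in> VA \<Longrightarrow> vmap h (- v) = - vmap h v"
  using vmap_scale[of h v "-1"] by (simp add: \<iota>_minus \<iota>_1 sc_left)

lemma vmap_diff: "linA h \<Longrightarrow> v \<in> VA \<Longrightarrow> w \<in> VA \<Longrightarrow> vmap h (v - w) = vmap h v - vmap h w"
  using vmap_add[of h v "- w"] vmap_minus[of h w] VA_minus[of w] by simp

text \<open>The matrices of the positive indices are constant, so they commute with every
  complex-linear map of the coefficients. Consequently such a map of A is compatible with the
  differential on lists of positive indices (\<open>vmap_DN\<close>).\<close>

lemma vmap_act: "linA h \<Longrightarrow> v \<in> VA \<Longrightarrow> 0 < j \<Longrightarrow> act j (vmap h v) = vmap h (act j v)"
proof (rule val_eqI)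
  fix a assume h: "linA h" and v: "v \<in> VA" and j: "0 < j"
  have "h (\<Sum>b<n. \<iota> (M j a b) * coo v b) = (\<Sum>b<n. h (\<iota> (M j a b) * coo v b))"
    using v by (intro linA_sum h) (simp add: VA_def A_mult A_const)
  also have "\<dots> = (\<Sum>b<n. \<iota> (M j a b) * h (coo v b))"
    using v by (intro sum.cong refl linA_scale h) (simp add: VA_def)
  finally show "coo (act j (vmap h v)) a = coo (vmap h (act j v)) a"
    by (simp add: act_mat[OF j])
qed

lemma vmap_brn:
  assumes "linA h" "\<And>js. c js \<in> VA"
  shows "brn i j (\<lambda>js. vmap h (c js)) js = vmap h (brn i j c js)"
  using vmap_scale[OF assms(1) assms(2), of "of_int (int j - int i)" "(i + j - 1) # js"]
  unfolding brn_def \<iota>_of_int by (simp add: vmap_0[OF assms(1)])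

lemma con_vmap: "con y (\<lambda>js. vmap h (c js)) = (\<lambda>js. vmap h (con y c js))"
  by (simp add: fun_eq_iff con_apply)

lemma vmap_LN:
  assumes h: "linA h" and "\<And>js. c js \<in> VA" "0 < i" "0 \<notin> set js"
  shows "LN i (\<lambda>js. vmap h (c js)) js = vmap h (LN i c js)"
  using assms(2-)
proof (induction js arbitrary: c)
  case Nil
  then show "LN i (\<lambda>js. vmap h (c js)) [] = vmap h (LN i c [])" by (simp add: vmap_act h)
next
  case (Cons y ys)
  have 1: "LN i (\<lambda>js. vmap h (con y c js)) ys = vmap h (LN i (con y c) ys)"
    using Cons.prems by (intro Cons.IH) (auto simp: con_apply)
  have "LN i (con y c) ys \<in> VA" "brn i y c ys \<in> VA"
    using Cons.prems(1) by (auto intro!: LN_VA brn_in simp: con_apply)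
  then show "LN i (\<lambda>js. vmap h (c js)) (y # ys) = vmap h (LN i c (y # ys))"
    unfolding lied.simps con_vmap 1 vmap_brn[OF h Cons.prems(1)] by (simp add: vmap_diff h)
qed

lemma vmap_DN:
  assumes h: "linA h" and "\<And>js. c js \<in> VA" "0 \<notin> set js"
  shows "DN (\<lambda>js. vmap h (c js)) js = vmap h (DN c js)"
  using assms(2-)
proof (induction js arbitrary: c)
  case Nil
  then show "DN (\<lambda>js. vmap h (c js)) [] = vmap h (DN c [])" by (simp add: vmap_0 h)
next
  case (Cons y ys)
  have 1: "DN (\<lambda>js. vmap h (con y c js)) ys = vmap h (DN (con y c) ys)"
    using Cons.prems by (intro Cons.IH) (auto simp: con_apply)
  have 2: "LN y (\<lambda>js. vmap h (c js)) ys = vmap h (LN y c ys)"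
    using Cons.prems by (intro vmap_LN h) auto
  have "DN (con y c) ys \<in> VA" "LN y c ys \<in> VA"
    using Cons.prems(1) by (auto intro!: LN_VA DN_VA simp: con_apply)
  then show "DN (\<lambda>js. vmap h (c js)) (y # ys) = vmap h (DN c (y # ys))"
    unfolding dee.simps con_vmap 1 2 by (simp add: vmap_diff vmap_minus VA_minus h)
qed

subsubsection \<open>Continuous and arbitrary cochains\<close>

text \<open>The index 1 is the Euler field, and its bracket with the index j multiplies by j - 1;
  these multiples add up to the weight of the list. All entries are positive, so the subtraction of
  naturals is exact.\<close>

lemma LN_weight:
  "0 \<notin> set js \<Longrightarrow> LN 1 c js = act 1 (c js) - sc (of_nat (sum_list js - length js)) (c js)"
proof (induction js arbitrary: c)
  case Nil
  show "LN 1 c [] = act 1 (c []) - sc (of_nat (sum_list [] - length [])) (c [])" by simp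
next
  case (Cons y ys)
  have le: "length ys \<le> sum_list ys" using Cons.prems by (induction ys) auto
  have "LN 1 c (y # ys) = act 1 (c (y # ys)) - sc (of_nat (sum_list ys - length ys)) (c (y # ys))
      - sc (of_int (int y - 1)) (c (y # ys))"
  proof -
    have b: "brn 1 y c ys = sc (of_int (int y - 1)) (c (y # ys))"
      using Cons.prems by (simp add: brn_def)
    have "0 \<notin> set ys" using Cons.prems by simp
    from Cons.IH[OF this, of "con y c"] show ?thesis
      unfolding lied.simps b con_apply[of y c ys] by (simp only:)
  qed
  also have "\<dots> = act 1 (c (y # ys)) - sc (of_nat (sum_list ys - length ys) + of_int (int y - 1)) (c (y # ys))"
    unfolding sc_left by (simp only: diff_diff_eq)
  also have "of_nat (sum_list ys - length ys) + of_int (int y - 1) =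
      (of_nat (sum_list (y # ys) - length (y # ys)) :: 'k)"
    using Cons.prems le by (simp add: of_nat_diff)
  finally show "LN 1 c (y # ys) = act 1 (c (y # ys)) - sc (of_nat (sum_list (y # ys) - length (y # ys))) (c (y # ys))" .
qed

text \<open>A list of small weight has only small indices. Whatever lives in weights below a fixed
  bound is therefore finitely supported.\<close>

lemma le_weight: "0 \<notin> set js \<Longrightarrow> j \<in> set js \<Longrightarrow> j \<le> Suc (sum_list js - length js)"
proof -
  have le: "0 \<notin> set ys \<Longrightarrow> length ys \<le> sum_list ys" for ys :: "nat list"
    by (induction ys) auto
  assume js: "0 \<notin> set js" "j \<in> set js"
  then obtain xs ys where "js = xs @ j # ys" by (meson split_list)
  then show ?thesis using js le[of xs] le[of ys] by auto
qed

lemma VC_iff: "v \<in> VC \<longleftrightarrow> (\<forall>a<n. coo v a \<in> range \<iota>) \<and> (\<forall>a\<ge>n. coo v a = 0)"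
  by (simp add: VC_def)

lemma weight_solve_VC:
  obtains w0 where "\<And>w v. w0 \<le> w \<Longrightarrow> v \<in> VC \<Longrightarrow> \<exists>!x. x \<in> VC \<and> act 1 x - sc (of_nat w) x = v"
  using weight_solve unfolding VC_iff[symmetric] conj_assoc[symmetric] by blast

text \<open>
  The contracting homotopy for large weights is contraction with the index \<open>1\<close>: the Lie derivative \<open>LN 1\<close> acts on the
  component \<open>js\<close> as \<open>act 1 - w\<close>, where \<open>w\<close> is the weight of \<open>js\<close>.
\<close>

theorem cocC_continuous:
  assumes zc: "zc \<in> cocC k" and fin: "\<exists>N. supp_below N (DN zc)"
  shows "\<exists>y\<in>cocC (k - 1). \<exists>N. supp_below N (zc - DN y)"
proof -
  obtain w0 where w0: "\<And>w v. w0 \<le> w \<Longrightarrow> v \<in> VC \<Longrightarrow> \<exists>!x. x \<in> VC \<and> act 1 x - sc (of_nat w) x = v"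
    using weight_solve_VC by blast
  let ?w = "\<lambda>js. sum_list js - length js"
  \<comment> \<open>In large weight the equation \<open>LN 1 y = zc\<close> is solved in each
    component separately; in small weight y is 0.\<close>
  define y where "y js = (if 0 \<notin> set js \<and> int (length js) = k \<and> w0 \<le> ?w js
    then (THE x. x \<in> VC \<and> act 1 x - sc (of_nat (?w js)) x = zc js) else 0)" for js
  have y: "y js \<in> VC \<and> act 1 (y js) - sc (of_nat (?w js)) (y js) = zc js"
    if "0 \<notin> set js" "int (length js) = k" "w0 \<le> ?w js" for js
    using theI'[OF w0[OF that(3) cocCD(1)[OF zc]]] that unfolding y_def by simp
  have uniq: "x = x'" if "w0 \<le> w" "x \<in> VC" "x' \<in> VC"
      "act 1 x - sc (of_nat w) x = act 1 x' - sc (of_nat w) x'" for w x x'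
    using w0[OF that(1), of "act 1 x - sc (of_nat w) x"] that
      VC_diff[OF act_VC[OF _ that(2), of 1] VC_sc[OF that(2), of "of_nat w"]]
    unfolding \<iota>_of_nat by auto
  have yVC: "y js \<in> VC" for js
  proof (cases "0 \<notin> set js \<and> int (length js) = k \<and> w0 \<le> ?w js")
    case True
    then show ?thesis using y by blast
  next
    case False
    then have "y js = 0" unfolding y_def by (rule if_not_P)
    then show ?thesis using VC_0 by simp
  qed
  \<comment> \<open>Uniqueness of the solution carries the antisymmetry of zc over to y.\<close>
  have anti: "y (xs @ p # q # ys) = - y (xs @ q # p # ys)" for xs p q ys
  proof -
    let ?a = "xs @ p # q # ys" and ?b = "xs @ q # p # ys"
    have same: "(0 \<in> set ?a) = (0 \<in> set ?b)" "length ?a = length ?b" "?w ?a = ?w ?b" by auto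
    show ?thesis
    proof (cases "0 \<notin> set ?b \<and> int (length ?b) = k \<and> w0 \<le> ?w ?b")
      case True
      have "act 1 (y ?a) - sc (of_nat (?w ?a)) (y ?a) = zc ?a"
        using True same y[of ?a] by simp
      also have "\<dots> = - zc ?b" by (rule antisym_funD[OF cocCD(3)[OF zc]])
      also have "\<dots> = - (act 1 (y ?b) - sc (of_nat (?w ?b)) (y ?b))"
        using True y[of ?b] by simp
      also have "\<dots> = act 1 (- y ?b) - sc (of_nat (?w ?a)) (- y ?b)"
        unfolding same(3) by (simp only: act_minus sc_simps minus_diff_eq) simp
      finally have e: "act 1 (y ?a) - sc (of_nat (?w ?a)) (y ?a)
          = act 1 (- y ?b) - sc (of_nat (?w ?a)) (- y ?b)" .
      have "w0 \<le> ?w ?a" unfolding same(3) using True by blast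
      then show ?thesis by (rule uniq[OF _ yVC VC_minus[OF yVC] e])
    next
      case False
      then have "y ?b = 0" unfolding y_def by (rule if_not_P)
      moreover have "y ?a = 0" unfolding y_def using False same by (intro if_not_P) simp
      ultimately show ?thesis by simp
    qed
  qed
  have yC: "y \<in> cocC k"
  proof -
    have "antisym_fun y" unfolding antisym_fun_def using anti by blast
    moreover have "y js = 0" if "int (length js) \<noteq> k \<or> 0 \<in> set js" for js
      using that unfolding y_def by auto
    ultimately show ?thesis unfolding cocC_def using yVC by blast
  qed
  \<comment> \<open>The part of zc that y does not account for; it lives in small weight.\<close>
  define r where "r = zc - LN 1 y"
  have r: "supp_below (Suc (Suc w0)) r"
    unfolding supp_below_def
  proof (intro allI impI)
    fix js assume ex: "\<exists>j\<in>set js. Suc (Suc w0) \<le> j"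
    show "r js = 0"
    proof (cases "0 \<in> set js")
      case True
      have "LN 1 y js = - DN y (1 # js) - DN (con 1 y) js" by simp
      moreover have "DN y (1 # js) = 0" by (rule cocCD(4)[OF DN_cocC[OF yC]]) (use True in simp)
      moreover have "DN (con 1 y) js = 0"
      proof -
        have "con 1 y \<in> cocC (k - 1)"
          unfolding cocC_def using cocCD[OF yC] antisym_fun_con[OF cocCD(3)[OF yC]] by (auto simp: con_apply)
        then show ?thesis using True cocCD(4)[OF DN_cocC] by blast
      qed
      ultimately have "LN 1 y js = 0" by simp
      then show ?thesis using cocCD(4)[OF zc True] by (simp add: r_def)
    next
      case False
      then have w: "w0 \<le> ?w js" using ex le_weight[OF False] by fastforce
      show ?thesis
      proof (cases "int (length js) = k")
        case True
        then show ?thesis using y[OF False True w] LN_weight[OF False, of y] by (simp add: r_def)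
      next
        case l: False
        then show ?thesis using LN_weight[OF False, of y] cocCD(2)[OF zc l] cocCD(2)[OF yC l] by (simp add: r_def)
      qed
    qed
  qed
  obtain N1 where N1: "supp_below N1 (DN zc)" using fin by blast
  obtain N2 where N2: "supp_below N2 (DN r)" using ex_supp_DN r by blast
  \<comment> \<open>Far out, \<open>LN 1\<close> annihilates \<open>DN y\<close>: it commutes with
    the differential, and both zc and r have differentials of bounded support. As
    \<open>act 1\<close> minus the weight is injective there, \<open>DN y\<close> vanishes.\<close>
  have Dy: "supp_below (max (Suc (Suc w0)) (max N1 N2)) (DN y)"
    unfolding supp_below_def
  proof (intro allI impI)
    fix js assume ex: "\<exists>j\<in>set js. max (Suc (Suc w0)) (max N1 N2) \<le> j"
    show "DN y js = 0"
    proof (cases "0 \<in> set js")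
      case True
      then show ?thesis using cocCD(4)[OF DN_cocC[OF yC]] by blast
    next
      case False
      have w: "w0 \<le> ?w js" using ex le_weight[OF False] by fastforce
      have "LN 1 (DN y) js = DN (LN 1 y) js" by (simp add: DN_LN)
      also have "\<dots> = DN zc js - DN r js" unfolding r_def DN_diff by simp
      also have "\<dots> = 0"
      proof -
        obtain j where j: "j \<in> set js" "N1 \<le> j" "N2 \<le> j" using ex by auto
        show ?thesis using supp_belowD[OF N1 j(1,2)] supp_belowD[OF N2 j(1,3)] by simp
      qed
      finally have "act 1 (DN y js) - sc (of_nat (?w js)) (DN y js) = act 1 0 - sc (of_nat (?w js)) 0"
        unfolding LN_weight[OF False] by simp
      then show ?thesis using uniq[OF w cocCD(1)[OF DN_cocC[OF yC]] VC_0] by blast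
    qed
  qed
  \<comment> \<open>The witness is minus the contraction of y with the Euler field: by Cartan's
    formula its differential is \<open>LN 1 y\<close> plus the contraction of
    \<open>DN y\<close>.\<close>
  have y1: "- con 1 y \<in> cocC (k - 1)"
  proof -
    have "antisym_fun (- con 1 y)"
      by (intro antisym_fun_minus antisym_fun_con cocCD(3)[OF yC])
    then show ?thesis
      unfolding cocC_def using cocCD(1,2,4)[OF yC] by (auto simp: con_apply VC_minus)
  qed
  have eq: "(zc - DN (- con 1 y)) js = r js - DN y (1 # js)" for js
  proof -
    have "DN (- con 1 y) js = - DN (con 1 y) js" by (rule DN_minus)
    moreover have "LN 1 y js = - DN y (1 # js) - DN (con 1 y) js" by simp
    moreover have "r js = zc js - LN 1 y js" by (simp only: r_def minus_apply)
    ultimately show ?thesis by (simp only: minus_apply) simp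
  qed
  have "supp_below (max (Suc (Suc w0)) (max N1 N2)) (zc - DN (- con 1 y))"
    unfolding supp_below_def
  proof (intro allI impI)
    fix js assume "\<exists>j\<in>set js. max (Suc (Suc w0)) (max N1 N2) \<le> j"
    then obtain j where j: "j \<in> set js" "max (Suc (Suc w0)) (max N1 N2) \<le> j" by blast
    have "r js = 0" by (rule supp_belowD[OF r j(1)]) (use j(2) in simp)
    moreover have "DN y (1 # js) = 0" by (rule supp_belowD[OF Dy _ j(2)]) (use j(1) in simp)
    ultimately show "(zc - DN (- con 1 y)) js = 0" unfolding eq by simp
  qed
  from exI[of "\<lambda>N. supp_below N (zc - DN (- con 1 y))", OF this] y1 show ?thesis
    by (rule bexI)
qed

end

context lie_jet
begin

subsubsection \<open>Splitting off the de Rham part\<close>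

text \<open>A projection of A onto the constants: f and the antiderivative of f' chosen by
  \<open>prim\<close> differ by a constant.\<close>

definition ev :: "'k \<Rightarrow> 'k" where
  "ev f = f - prim (d f)"

definition cocF :: "int \<Rightarrow> (nat list \<Rightarrow> 'k val) set" where
  "cocF k = {c \<in> cocC k. \<exists>N. supp_below N c}"

text \<open>
  \<open>H0\<close> takes the de Rham class of degree 0 of a cocycle, \<open>Hr i\<close> the residue at the \<open>i\<close>-th puncture of its part
  of de Rham degree 1.
\<close>

definition H0 :: "(nat list \<Rightarrow> 'k val) \<Rightarrow> nat list \<Rightarrow> 'k val" where
  "H0 c js = vmap ev (pos c js)"

definition Hr :: "nat \<Rightarrow> (nat list \<Rightarrow> 'k val) \<Rightarrow> nat list \<Rightarrow> 'k val" where
  "Hr i c js = vmap (\<lambda>f. \<iota> (res i f)) (c (0 # js))"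

lemma linA_prim: "linA prim"
  unfolding linA_def using prim_add prim_scale by blast

lemma linA_ev: "linA ev"
  unfolding linA_def ev_def by (simp add: prim_add prim_scale d_add d_\<iota>_mult A_d right_diff_distrib)

lemma linA_res: "linA (\<lambda>f. \<iota> (res i f))"
  unfolding linA_def by (simp add: res_add res_scale \<iota>_add \<iota>_mult)

lemma linA_mult: "linA (\<lambda>f. g * f)"
  unfolding linA_def by (simp add: algebra_simps)

lemma ev_A: "f \<in> A \<Longrightarrow> ev f \<in> A"
  unfolding ev_def by (intro A_diff prim_A A_d)

lemma ev_range: "f \<in> A \<Longrightarrow> ev f \<in> range \<iota>"
proof (rule d_kernel[OF ev_A])
  assume f: "f \<in> A"
  have "(\<Sum>i=1..m. \<iota> (res i (d f)) * u i) = 0"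
    using res_d[OF f] by (intro sum.neutral) (auto simp: \<iota>_0)
  then show "d (ev f) = 0" using d_prim[OF A_d[OF f]] by (simp add: ev_def d_diff)
qed

lemma ev_\<iota>: "ev (\<iota> c) = \<iota> c"
  using linA_0[OF linA_prim] by (simp add: ev_def d_\<iota>)

lemma vmap_in_VA: "(\<And>f. f \<in> A \<Longrightarrow> h f \<in> A) \<Longrightarrow> v \<in> VA \<Longrightarrow> vmap h v \<in> VA"
  by (simp add: VA_def)

lemma vmap_in_VC: "(\<And>f. f \<in> A \<Longrightarrow> h f \<in> range \<iota>) \<Longrightarrow> v \<in> VA \<Longrightarrow> vmap h v \<in> VC"
  by (simp add: VA_def VC_def)

lemma antisym_vmap:
  assumes "linA h" "antisym_fun c" "\<And>js. c js \<in> VA"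
  shows "antisym_fun (\<lambda>js. vmap h (c js))"
  unfolding antisym_fun_def
proof (intro allI)
  fix xs x y ys
  show "vmap h (c (xs @ x # y # ys)) = - vmap h (c (xs @ y # x # ys))"
    unfolding antisym_funD[OF assms(2), of xs x y ys] by (rule vmap_minus[OF assms(1,3)])
qed

lemma coc_supp: "c \<in> coc k \<Longrightarrow> \<exists>N. supp_below N c"
  unfolding coc_def by blast

lemma cocI:
  assumes "\<And>js. c js \<in> VA" "\<And>js. int (length js) \<noteq> k \<Longrightarrow> c js = 0" "antisym_fun c" "supp_below N c"
  shows "c \<in> coc k"
  using assms unfolding coc_def by blast

lemma coc_vmap:
  assumes "c \<in> coc k" "linA h" "\<And>f. f \<in> A \<Longrightarrow> h f \<in> A"
  shows "(\<lambda>js. vmap h (c js)) \<in> coc k"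
proof -
  obtain N where N: "supp_below N c" using coc_supp[OF assms(1)] by blast
  show ?thesis
  proof (rule cocI)
    show "supp_below N (\<lambda>js. vmap h (c js))"
      using N vmap_0[OF assms(2)] by (simp add: supp_below_def)
  qed (simp_all add: vmap_in_VA[OF assms(3)] cocD[OF assms(1)] vmap_0[OF assms(2)] antisym_vmap[OF assms(2)])
qed

lemma coc_add:
  assumes "c \<in> coc k" "c' \<in> coc k"
  shows "c + c' \<in> coc k"
proof -
  obtain N N' where N: "supp_below N c" "supp_below N' c'"
    using coc_supp[OF assms(1)] coc_supp[OF assms(2)] by blast
  show ?thesis
  proof (rule cocI)
    show "supp_below (max N N') (c + c')"
      unfolding supp_below_def
    proof (intro allI impI)
      fix js assume "\<exists>j\<in>set js. max N N' \<le> j"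
      then obtain j where j: "j \<in> set js" "N \<le> j" "N' \<le> j" by auto
      show "(c + c') js = 0"
        using supp_belowD[OF N(1) j(1,2)] supp_belowD[OF N(2) j(1,3)] by simp
    qed
  qed (simp_all add: cocD[OF assms(1)] cocD[OF assms(2)] VA_add antisym_fun_add)
qed

lemma coc_minus: "c \<in> coc k \<Longrightarrow> - c \<in> coc k"
  unfolding coc_def supp_below_def by (auto simp: VA_minus antisym_fun_minus)

lemma coc_diff: "c \<in> coc k \<Longrightarrow> c' \<in> coc k \<Longrightarrow> c - c' \<in> coc k"
  using coc_add[of c k "- c'"] coc_minus by simp

lemma coc_0: "0 \<in> coc k"
  by (rule cocI[of _ _ 0]) (simp_all add: VA_0 antisym_fun_def supp_below_def)

lemma coc_sum: "(\<And>i. i \<in> I \<Longrightarrow> f i \<in> coc k) \<Longrightarrow> (\<Sum>i\<in>I. f i) \<in> coc k"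
  by (induction I rule: infinite_finite_induct) (auto simp: coc_0 coc_add)

lemma DN_sum: "DN (\<Sum>i\<in>I. f i) js = (\<Sum>i\<in>I. DN (f i) js)"
proof (induction I rule: infinite_finite_induct)
  case (infinite I)
  then show "DN (\<Sum>i\<in>I. f i) js = (\<Sum>i\<in>I. DN (f i) js)"
    by (simp only: sum.infinite DN_0 simp_thms)
next
  case empty
  show "DN (\<Sum>i\<in>{}. f i) js = (\<Sum>i\<in>{}. DN (f i) js)"
    by (simp only: sum.empty DN_0)
next
  case (insert x I)
  then show "DN (\<Sum>i\<in>insert x I. f i) js = (\<Sum>i\<in>insert x I. DN (f i) js)"
    by (simp only: sum.insert DN_add simp_thms)
qed

lemma eps_coc:
  assumes "b \<in> coc k" and z: "\<And>js. 0 \<in> set js \<Longrightarrow> b js = 0"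
  shows "eps b \<in> coc (k + 1)"
proof -
  obtain N where N: "supp_below N b" using coc_supp[OF assms(1)] by blast
  have VA: "(\<And>js. b js \<in> VA) \<Longrightarrow> eps b js \<in> VA" for js and b :: "nat list \<Rightarrow> 'k val"
    by (induction js arbitrary: b) (auto simp: VA_0 VA_minus con_apply)
  have len: "(\<And>js. int (length js) \<noteq> k \<Longrightarrow> b js = 0) \<Longrightarrow> int (length js) \<noteq> k + 1 \<Longrightarrow> eps b js = 0"
    for js k and b :: "nat list \<Rightarrow> 'k val"
  proof (induction js arbitrary: b k)
    case (Cons y ys)
    have "eps (con y b) ys = 0"
      by (rule Cons.IH[of "k - 1"]) (use Cons.prems in \<open>auto simp: con_apply\<close>)
    then show ?case using Cons.prems by auto
  qed simp
  have supp: "supp_below N b \<Longrightarrow> j \<in> set js \<Longrightarrow> N \<le> j \<Longrightarrow> 0 < N \<Longrightarrow> eps b js = 0" for N j js and b :: "nat list \<Rightarrow> 'k val"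
  proof (induction js arbitrary: b)
    case (Cons y ys)
    show ?case
    proof (cases "j = y")
      case True
      then show ?thesis using Cons.prems supp_below_con_0[OF Cons.prems(1), of y] eps_0[of ys] by auto
    next
      case False
      then have j: "j \<in> set ys" using Cons.prems(2) by simp
      have "eps (con y b) ys = 0" by (rule Cons.IH[OF supp_below_con[OF Cons.prems(1)] j Cons.prems(3,4)])
      moreover have "b ys = 0" by (rule supp_belowD[OF Cons.prems(1) j Cons.prems(3)])
      ultimately show ?thesis by simp
    qed
  qed simp
  \<comment> \<open>The bound is raised to be positive because \<open>eps\<close> brings in the
    index 0: a cochain of degree 0 has the bound 0, yet its image under \<open>eps\<close> need not
    vanish on the list [0].\<close>
  have "supp_below (Suc N) (eps b)"
    unfolding supp_below_def using supp[OF supp_below_mono[OF N, of "Suc N"]] by auto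
  then show ?thesis
    using VA[OF cocD(1)[OF assms(1)]] len[OF cocD(2)[OF assms(1)]] eps_antisym[OF cocD(3)[OF assms(1)] z]
    by (intro cocI)
qed

lemma cocF_coc: "c \<in> cocF k \<Longrightarrow> c \<in> coc k"
  using VC_VA unfolding cocF_def cocC_def coc_def by blast

lemma cocFD:
  assumes "c \<in> cocF k"
  shows "c js \<in> VC" "0 \<in> set js \<Longrightarrow> c js = 0" "c \<in> cocC k"
  using assms unfolding cocF_def cocC_def by blast+

lemma H0_cocF:
  assumes c: "c \<in> coc k"
  shows "H0 c \<in> cocF k"
proof -
  note p = coc_pos[OF c]
  have v: "(\<lambda>js. vmap ev (pos c js)) \<in> coc k"
    by (rule coc_vmap[OF p linA_ev ev_A])
  then show ?thesis
    unfolding cocF_def cocC_def H0_def[abs_def]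
    using cocD[OF v] coc_supp[OF v] vmap_in_VC[OF ev_range cocD(1)[OF p]]
    by (auto simp: pos_def vmap_0[OF linA_ev])
qed

lemma Hr_cocF:
  assumes c: "c \<in> coc k"
  shows "Hr i c \<in> cocF (k - 1)"
proof -
  note b = coc_con[OF c, of 0]
  have v: "(\<lambda>js. vmap (\<lambda>f. \<iota> (res i f)) (con 0 c js)) \<in> coc (k - 1)"
    by (rule coc_vmap[OF b linA_res A_const])
  moreover have "vmap (\<lambda>f. \<iota> (res i f)) (con 0 c js) \<in> VC" for js
    by (rule vmap_in_VC[OF _ cocD(1)[OF b]]) simp
  moreover have "vmap (\<lambda>f. \<iota> (res i f)) (con 0 c js) = 0" if "0 \<in> set js" for js
    using con0_positive[OF c that] vmap_0[OF linA_res] by simp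
  moreover have "Hr i c = (\<lambda>js. vmap (\<lambda>f. \<iota> (res i f)) (con 0 c js))"
    by (simp add: fun_eq_iff Hr_def con_apply)
  ultimately show ?thesis
    unfolding cocF_def cocC_def using cocD[OF v] coc_supp[OF v] by auto
qed

text \<open>A chain map, since restriction to positive indices respects the differential and
  \<open>ev\<close> is a linear map of the coefficients.\<close>

lemma H0_DN:
  assumes c: "c \<in> coc k"
  shows "H0 (DN c) = DN (H0 c)"
proof
  fix js
  show "H0 (DN c) js = DN (H0 c) js"
  proof (cases "0 \<in> set js")
    case True
    then show ?thesis
      using cocCD(4)[OF DN_cocC[OF cocFD(3)[OF H0_cocF[OF c]]]] by (simp add: H0_def pos_def vmap_0[OF linA_ev])
  next
    case False
    have "DN (H0 c) js = vmap ev (DN (pos c) js)"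
      unfolding H0_def[abs_def] by (rule vmap_DN[OF linA_ev cocD(1)[OF coc_pos[OF c]] False])
    also have "DN (pos c) js = DN c js"
      using False by (intro DN_cong_pos) (auto simp: pos_def)
    finally have "DN (H0 c) js = vmap ev (DN c js)" .
    moreover have "H0 (DN c) js = vmap ev (DN c js)" using False by (simp add: H0_def pos_def)
    ultimately show ?thesis by (simp only:)
  qed
qed

text \<open>The derivative in z has no residue, so only the differential of the contracted cochain
  survives; the sign is that of contracting with the index 0 first.\<close>

lemma Hr_DN:
  assumes c: "c \<in> coc k" and i: "i \<in> {1..m}"
  shows "Hr i (DN c) = - DN (Hr i c)"
proof
  fix js
  note b = coc_con[OF c, of 0]
  have Hr: "Hr i c = (\<lambda>js. vmap (\<lambda>f. \<iota> (res i f)) (con 0 c js))"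
    by (simp add: fun_eq_iff Hr_def con_apply)
  show "Hr i (DN c) js = (- DN (Hr i c)) js"
  proof (cases "0 \<in> set js")
    case True
    have "con 0 (DN c) js = 0" by (rule con0_positive[OF DN_coc[OF c] True])
    then show ?thesis
      using cocCD(4)[OF DN_cocC[OF cocFD(3)[OF Hr_cocF[OF c]]] True]
      by (simp add: Hr_def con_apply vmap_0[OF linA_res] del: dee.simps)
  next
    case False
    have dv: "dval (c js) \<in> VA" using cocD(1)[OF c] by (simp add: VA_def A_d)
    have "vmap (\<lambda>f. \<iota> (res i f)) (dval (c js)) = 0"
      using cocD(1)[OF c, of js] by (intro val_eqI) (simp add: VA_def res_d[OF _ i] \<iota>_0)
    moreover have "DN (Hr i c) js = vmap (\<lambda>f. \<iota> (res i f)) (DN (con 0 c) js)"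
      unfolding Hr by (rule vmap_DN[OF linA_res cocD(1)[OF b] False])
    ultimately show ?thesis
      unfolding Hr_def DN_zero uminus_apply
      by (simp add: vmap_diff[OF linA_res] vmap_minus[OF linA_res] VA_minus dv DN_VA[OF cocD(1)[OF b]])
  qed
qed

text \<open>The cocycle equation, contracted with 0, says that the differential of b =
  \<open>con 0 c\<close> is minus the z-derivative of c. Integrating b in z therefore gives a
  primitive of c, up to the residues of b, which the \<open>\<beta> i\<close> remove, and up to the
  constants lost in the integration, which \<alpha> restores.\<close>

theorem coc_injective:
  assumes c: "c \<in> coc k" and Dc: "DN c = 0"
    and al: "\<alpha> \<in> cocF (k - 1)" "H0 c = DN \<alpha>"
    and be: "\<And>i. i \<in> {1..m} \<Longrightarrow> \<beta> i \<in> cocF (k - 2)" "\<And>i. i \<in> {1..m} \<Longrightarrow> Hr i c = DN (\<beta> i)"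
  shows "\<exists>c'\<in>coc (k - 1). DN c' = c"
proof -
  define b where "b = con 0 c"
  have b: "b \<in> coc (k - 1)" unfolding b_def by (rule coc_con[OF c])
  \<comment> \<open>x and y become the components of de Rham degree 0 and 1 of the primitive
    \<open>c'\<close>.\<close>
  define x where "x = \<alpha> - (\<lambda>js. vmap prim (b js))"
  define y where "y = - (\<Sum>i\<in>{1..m}. (\<lambda>js. vmap (\<lambda>f. u i * f) (\<beta> i js)))"
  have pb: "(\<lambda>js. vmap prim (b js)) \<in> coc (k - 1)"
    by (rule coc_vmap[OF b linA_prim prim_A])
  have x: "x \<in> coc (k - 1)" unfolding x_def by (rule coc_diff[OF cocF_coc[OF al(1)] pb])
  have ub: "(\<lambda>js. vmap (\<lambda>f. u i * f) (\<beta> i js)) \<in> coc (k - 2)" if "i \<in> {1..m}" for i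
    by (rule coc_vmap[OF cocF_coc[OF be(1)[OF that]] linA_mult A_mult[OF u_A[OF that]]])
  have y: "y \<in> coc (k - 2)" unfolding y_def by (rule coc_minus[OF coc_sum[OF ub]])
  have yz: "y js = 0" if "0 \<in> set js" for js
    unfolding y_def using cocFD(2)[OF be(1) that]
    by (simp add: sum_fun_apply vmap_0[OF linA_mult])
  have xz: "x js = 0" if "0 \<in> set js" for js
    using cocFD(2)[OF al(1) that] con0_positive[OF c that] vmap_0[OF linA_prim]
    by (simp add: x_def b_def)
  have "eps y \<in> coc (k - 2 + 1)" by (rule eps_coc[OF y yz])
  moreover have "k - 2 + 1 = k - 1" by simp
  ultimately have ey: "eps y \<in> coc (k - 1)" by metis
  define c' where "c' = x + eps y"
  have c': "c' \<in> coc (k - 1)" unfolding c'_def by (rule coc_add[OF x ey])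
  have c'0: "con 0 c' = y"
  proof
    fix js
    have "x (0 # js) = 0" by (rule xz) simp
    then show "con 0 c' js = y js" by (simp add: c'_def con_apply)
  qed
  have Db: "DN b js = - dval (c js)" for js
  proof -
    have "DN c (0 # js) = 0" using Dc by (simp del: dee.simps)
    then show ?thesis unfolding DN_zero b_def by (simp add: eq_neg_iff_add_eq_0 add.commute)
  qed
  have "DN c' = c"
  proof (rule antisym_eqI[OF antisym_fun_DN[OF cocD(3)[OF c']] cocD(3)[OF c]])
    fix js :: "nat list" assume js: "0 \<notin> set js"
    have dv: "dval (c js) \<in> VA" using cocD(1)[OF c] by (simp add: VA_def A_d)
    \<comment> \<open>In de Rham degree 0, \<open>DN \<alpha>\<close> contributes \<open>ev\<close>
      of c, and the integral of the z-derivative of c contributes the rest.\<close>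
    have "DN c' js = DN x js"
      using js by (intro DN_cong_pos) (auto simp: c'_def eps_positive)
    also have "\<dots> = DN \<alpha> js - vmap prim (DN b js)"
      unfolding x_def DN_diff vmap_DN[OF linA_prim cocD(1)[OF b] js] ..
    also have "DN \<alpha> js = vmap ev (c js)"
    proof -
      have "H0 c js = vmap ev (c js)" using js by (simp add: H0_def pos_def)
      then show ?thesis by (simp only: al(2))
    qed
    also have "vmap prim (DN b js) = - vmap prim (dval (c js))"
      unfolding Db by (rule vmap_minus[OF linA_prim dv])
    also have "vmap ev (c js) - - vmap prim (dval (c js)) = c js"
      using cocD(1)[OF c, of js] by (intro val_eqI) (simp add: ev_def VA_def)
    finally show "DN c' js = c js" .
    have bV: "coo (b js) a \<in> A" if "a < n" for a using cocD(1)[OF b, of js] that by (simp add: VA_def)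
    have Dy: "DN y js = - (\<Sum>i=1..m. vmap (\<lambda>f. u i * f) (vmap (\<lambda>f. \<iota> (res i f)) (b js)))"
    proof -
      have "DN (\<lambda>js. vmap (\<lambda>f. u i * f) (\<beta> i js)) js = vmap (\<lambda>f. u i * f) (vmap (\<lambda>f. \<iota> (res i f)) (b js))"
        if i: "i \<in> {1..m}" for i
      proof -
        have "DN (\<lambda>js. vmap (\<lambda>f. u i * f) (\<beta> i js)) js = vmap (\<lambda>f. u i * f) (DN (\<beta> i) js)"
          by (rule vmap_DN[OF linA_mult cocD(1)[OF cocF_coc[OF be(1)[OF i]]] js])
        also have "DN (\<beta> i) js = vmap (\<lambda>f. \<iota> (res i f)) (b js)"
          unfolding be(2)[OF i, symmetric] by (simp add: Hr_def b_def con_apply)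
        finally show ?thesis .
      qed
      then show ?thesis unfolding y_def DN_minus DN_sum by simp
    qed
    have x_js: "c' js = \<alpha> js - vmap prim (b js)" using js by (simp add: c'_def x_def eps_positive)
    have "dval (\<alpha> js) = 0" by (rule dval_VC[OF cocFD(1)[OF al(1)]])
    then have d\<alpha>: "d (coo (\<alpha> js) a) = 0" for a by (metis coo_dval coo_simps(1))
    \<comment> \<open>In de Rham degree 1, differentiating the integral of b recovers b up to its
      residues, by \<open>d_prim\<close>; these are supplied by the differential of y.\<close>
    have "DN c' (0 # js) = b js"
      unfolding DN_zero c'0 Dy x_js
    proof (rule val_eqI)
      fix a
      show "coo (- dval (\<alpha> js - vmap prim (b js)) - - (\<Sum>i=1..m. vmap (\<lambda>f. u i * f) (vmap (\<lambda>f. \<iota> (res i f)) (b js)))) a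
        = coo (b js) a"
      proof (cases "a < n")
        case True
        then show ?thesis using d_prim[OF bV[OF True]] by (simp add: d_diff d\<alpha> mult.commute)
      next
        case False
        then show ?thesis using cocD(1)[OF b, of js] by (simp add: d_diff d\<alpha> VA_def)
      qed
    qed
    then show "DN c' (0 # js) = c (0 # js)" by (simp add: b_def con_apply del: dee.simps)
  qed
  then show ?thesis using c' by blast
qed

text \<open>The cocycle is \<alpha> plus the sum of the forms u_i dz \<and> \<beta>_i. It is closed
  because \<alpha> has constant values and each u_i only multiplies the cocycle \<beta>_i; by
  \<open>res_u\<close> its residues are the \<beta>_i.\<close>

theorem coc_surjective:
  assumes al: "\<alpha> \<in> cocF k" "DN \<alpha> = 0"
    and be: "\<And>i. i \<in> {1..m} \<Longrightarrow> \<beta> i \<in> cocF (k - 1)" "\<And>i. i \<in> {1..m} \<Longrightarrow> DN (\<beta> i) = 0"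
  shows "\<exists>c\<in>coc k. DN c = 0 \<and> H0 c = \<alpha> \<and> (\<forall>i\<in>{1..m}. Hr i c = \<beta> i)"
proof -
  define b where "b = (\<Sum>i\<in>{1..m}. (\<lambda>js. vmap (\<lambda>f. u i * f) (\<beta> i js)))"
  have ub: "(\<lambda>js. vmap (\<lambda>f. u i * f) (\<beta> i js)) \<in> coc (k - 1)" if "i \<in> {1..m}" for i
    by (rule coc_vmap[OF cocF_coc[OF be(1)[OF that]] linA_mult A_mult[OF u_A[OF that]]])
  have b: "b \<in> coc (k - 1)" unfolding b_def by (rule coc_sum[OF ub])
  have bz: "b js = 0" if "0 \<in> set js" for js
    unfolding b_def using cocFD(2)[OF be(1) that]
    by (simp add: sum_fun_apply vmap_0[OF linA_mult])
  have "eps b \<in> coc (k - 1 + 1)" by (rule eps_coc[OF b bz])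
  then have eb: "eps b \<in> coc k" by simp
  define c where "c = \<alpha> + eps b"
  have c: "c \<in> coc k" unfolding c_def by (rule coc_add[OF cocF_coc[OF al(1)] eb])
  have c0: "con 0 c = b"
  proof
    fix js
    have "\<alpha> (0 # js) = 0" by (rule cocFD(2)[OF al(1)]) simp
    then show "con 0 c js = b js" by (simp add: c_def con_apply)
  qed
  have d\<alpha>: "dval (\<alpha> js) = 0" for js by (rule dval_VC[OF cocFD(1)[OF al(1)]])
  have "DN c = 0"
  proof (rule antisym_eqI[OF antisym_fun_DN[OF cocD(3)[OF c]] cocD(3)[OF coc_0]])
    fix js :: "nat list" assume js: "0 \<notin> set js"
    have "DN c js = DN \<alpha> js"
      using js by (intro DN_cong_pos) (auto simp: c_def eps_positive)
    then show "DN c js = 0 js" using al(2) by simp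
    have "DN b js = (\<Sum>i=1..m. vmap (\<lambda>f. u i * f) (DN (\<beta> i) js))"
      unfolding b_def DN_sum
      by (intro sum.cong refl vmap_DN[OF linA_mult cocD(1)[OF cocF_coc[OF be(1)]] js])
    also have "\<dots> = 0" using be(2) by (simp add: vmap_0[OF linA_mult])
    finally have "DN b js = 0" .
    moreover have "c js = \<alpha> js" using js by (simp add: c_def eps_positive)
    ultimately have "DN c (0 # js) = 0" unfolding DN_zero c0 by (simp add: d\<alpha>)
    then show "DN c (0 # js) = 0 (0 # js)" by (simp del: dee.simps)
  qed
  moreover have "H0 c = \<alpha>"
  proof
    fix js
    show "H0 c js = \<alpha> js"
    proof (cases "0 \<in> set js")
      case True
      then show ?thesis using cocFD(2)[OF al(1) True] by (simp add: H0_def pos_def vmap_0[OF linA_ev])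
    next
      case False
      have v: "\<alpha> js \<in> VC" by (rule cocFD(1)[OF al(1)])
      have "vmap ev (\<alpha> js) = \<alpha> js"
      proof (rule val_eqI)
        fix a show "coo (vmap ev (\<alpha> js)) a = coo (\<alpha> js) a"
          using v by (cases "a < n") (auto simp: VC_def ev_\<iota>)
      qed
      then show ?thesis using False by (simp add: H0_def pos_def c_def eps_positive)
    qed
  qed
  moreover have "Hr i c = \<beta> i" if i: "i \<in> {1..m}" for i
  proof
    fix js
    have bj: "coo (\<beta> j js) a = 0" if "\<not> a < n" "j \<in> {1..m}" for j a
      using cocFD(1)[OF be(1)[OF that(2)], of js] that(1) by (simp add: VC_def)
    have "Hr i c js = vmap (\<lambda>f. \<iota> (res i f)) (b js)"
      using c0 by (simp add: Hr_def con_def fun_eq_iff)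
    also have "\<dots> = \<beta> i js"
    proof (rule val_eqI)
      fix a
      show "coo (vmap (\<lambda>f. \<iota> (res i f)) (b js)) a = coo (\<beta> i js) a"
      proof (cases "a < n")
        case True
        have "\<forall>j\<in>{1..m}. \<exists>p. coo (\<beta> j js) a = \<iota> p"
          using cocFD(1)[OF be(1), of _ js] True unfolding VC_def by blast
        then obtain p where p: "\<And>j. j \<in> {1..m} \<Longrightarrow> coo (\<beta> j js) a = \<iota> (p j)" by metis
        have "coo (b js) a = (\<Sum>j=1..m. \<iota> (p j) * u j)"
          using True p by (simp add: b_def sum_fun_apply mult.commute)
        moreover have "\<iota> (res i (\<Sum>j=1..m. \<iota> (p j) * u j)) = (\<Sum>j=1..m. \<iota> (res i (\<iota> (p j) * u j)))"
          using u_A by (intro linA_sum[OF linA_res]) (simp add: A_mult A_const)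
        moreover have "\<dots> = (\<Sum>j=1..m. if j = i then \<iota> (p i) else 0)"
          using i by (intro sum.cong refl) (auto simp: res_scale u_A res_u \<iota>_0)
        ultimately show ?thesis using True i p by simp
      next
        case False
        then show ?thesis using bj[OF False i] by simp
      qed
    qed
    finally show "Hr i c js = \<beta> i js" .
  qed
  ultimately show ?thesis using c by blast
qed

end

subsection \<open>The coordinate ring of the punctured line\<close>

lemma of_nat_Fract: "of_nat k = Fract (of_nat k) (1::'a::idom)"
  by (induction k) (simp_all add: Zero_fract_def One_fract_def)

text \<open>Divided derivatives require division by natural numbers in the field of rational
  functions.\<close>

instance fract :: ("{idom, ring_char_0}") ring_char_0
proof
  show "inj (of_nat :: nat \<Rightarrow> 'a fract)"
    by (rule injI) (simp add: of_nat_Fract eq_fract)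
qed

instance fract :: ("{idom, ring_char_0}") field_char_0 ..

lemma rat_const_add: "rat_const (c + e) = rat_const c + rat_const e"
  by (simp add: rat_const_def)

lemma rat_const_mult: "rat_const (c * e) = rat_const c * rat_const e"
  by (simp add: rat_const_def mult.commute)

lemma rat_const_0 [simp]: "rat_const 0 = 0"
  by (simp add: rat_const_def Zero_fract_def)

lemma rat_const_1 [simp]: "rat_const 1 = 1"
  unfolding rat_const_def One_fract_def by (rule arg_cong2[where f = Fract]) (simp_all add: one_pCons)

lemma rat_const_minus: "rat_const (- c) = - rat_const c"
  by (simp add: rat_const_def)

lemma rat_const_diff: "rat_const (c - e) = rat_const c - rat_const e"
  using rat_const_add[of c "- e"] by (simp add: rat_const_minus)

lemma rat_const_eq_iff: "rat_const c = rat_const e \<longleftrightarrow> c = e"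
  by (simp add: rat_const_def eq_fract)

lemma rat_const_sum: "rat_const (\<Sum>i\<in>I. f i) = (\<Sum>i\<in>I. rat_const (f i))"
  by (induction I rule: infinite_finite_induct) (auto simp: rat_const_add)

lemma rat_deriv_add: "rat_deriv (f + g) = rat_deriv f + rat_deriv g"
proof -
  obtain p q r s where f: "f = Fract p q" "q \<noteq> 0" and g: "g = Fract r s" "s \<noteq> 0"
    by (metis Fract_cases)
  have "rat_deriv (f + g) = Fract (pderiv (p * s + r * q) * (q * s) - (p * s + r * q) * pderiv (q * s)) ((q * s) * (q * s))"
    using f g by (simp add: rat_deriv_Fract del: mult_pCons_left)
  also have "\<dots> = Fract (pderiv p * q - p * pderiv q) (q * q) + Fract (pderiv r * s - r * pderiv s) (s * s)"
    using f g by (simp add: eq_fract pderiv_mult pderiv_add) (simp add: algebra_simps)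
  finally show ?thesis using f g by (simp add: rat_deriv_Fract)
qed

lemma rat_deriv_mult: "rat_deriv (f * g) = rat_deriv f * g + f * rat_deriv g"
proof -
  obtain p q r s where f: "f = Fract p q" "q \<noteq> 0" and g: "g = Fract r s" "s \<noteq> 0"
    by (metis Fract_cases)
  have "rat_deriv (f * g) = Fract (pderiv (p * r) * (q * s) - (p * r) * pderiv (q * s)) ((q * s) * (q * s))"
    using f g by (simp add: rat_deriv_Fract)
  also have "\<dots> = Fract (pderiv p * q - p * pderiv q) (q * q) * Fract r s
      + Fract p q * Fract (pderiv r * s - r * pderiv s) (s * s)"
    using f g by (simp add: eq_fract pderiv_mult) (simp add: algebra_simps)
  finally show ?thesis using f g by (simp add: rat_deriv_Fract)
qed

interpretation rat: derivation rat_deriv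
  by unfold_locales (rule rat_deriv_add, rule rat_deriv_mult)

lemma rat_deriv_const: "rat_deriv (rat_const c) = 0"
  by (simp add: rat_const_def rat_deriv_Fract pderiv_pCons fract_collapse)

lemma rat_deriv_z: "rat_deriv rat_z = 1"
  using rat_const_1 unfolding rat_const_def
  by (simp add: rat_z_def rat_deriv_Fract pderiv_pCons fract_collapse)

lemma rat_deriv_const_mult: "rat_deriv (rat_const c * f) = rat_const c * rat_deriv f"
  by (simp add: rat_deriv_mult rat_deriv_const)

lemma z_minus_const: "rat_z - rat_const c = Fract [:- c, 1:] 1"
  by (simp add: rat_z_def rat_const_def)

lemma z_minus_const_nz: "rat_z - rat_const c \<noteq> 0"
  unfolding z_minus_const by (simp add: Zero_fract_def eq_fract)

lemma inverse_z_minus_const: "inverse (rat_z - rat_const c) = Fract 1 [:- c, 1:]"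
  unfolding z_minus_const by simp

lemma rat_deriv_inverse: "rat_deriv (inverse (rat_z - rat_const c)) = - (inverse (rat_z - rat_const c) ^ 2)"
proof -
  let ?y = "rat_z - rat_const c"
  have "0 = rat_deriv (?y * inverse ?y)" using z_minus_const_nz by simp
  also have "\<dots> = inverse ?y + ?y * rat_deriv (inverse ?y)"
    unfolding rat_deriv_mult by (simp add: rat.d_diff rat_deriv_z rat_deriv_const)
  finally have "?y * rat_deriv (inverse ?y) = - inverse ?y" by (simp add: eq_neg_iff_add_eq_0 add.commute)
  then have "inverse ?y * (?y * rat_deriv (inverse ?y)) = - (inverse ?y ^ 2)" by (simp add: power2_eq_square)
  then show ?thesis using z_minus_const_nz[of c] by (simp add: mult.assoc[symmetric])
qed

text \<open>If p/q is nonzero with derivative 0, the coefficient of degree deg p + deg q - 1 in p' q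
  = p q' forces deg p = deg q. Subtracting the quotient of the leading coefficients lowers the
  degree of the numerator, so the difference must be 0.\<close>

lemma rat_deriv_zero_const:
  assumes "rat_deriv f = 0"
  shows "f \<in> range rat_const"
proof -
  have deg: "degree p = degree q" if "p \<noteq> 0" "q \<noteq> 0" "rat_deriv (Fract p q) = 0" for p q
  proof (rule ccontr)
    assume ne: "degree p \<noteq> degree q"
    have "pderiv p * q = p * pderiv q"
      using that by (simp add: rat_deriv_Fract Zero_fract_def eq_fract)
    \<comment> \<open>If p has degree 0, both sides are 0, whatever the truncated subtraction
      gives.\<close>
    moreover have top: "coeff (pderiv p * q) (degree p + degree q - 1) = of_nat (degree p) * lead_coeff p * lead_coeff q"
      for p q :: "complex poly"
    proof (cases "degree p = 0")
      case True
      then have "pderiv p = 0" by (simp add: pderiv_eq_0_iff)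
      then show ?thesis using True by simp
    next
      case False
      then have "degree p + degree q - 1 = degree (pderiv p) + degree q" by (simp add: degree_pderiv)
      then have "coeff (pderiv p * q) (degree p + degree q - 1) = lead_coeff (pderiv p) * lead_coeff q"
        by (simp only: coeff_mult_degree_sum)
      then show ?thesis using False by (simp add: degree_pderiv coeff_pderiv)
    qed
    ultimately have "of_nat (degree p) * lead_coeff p * lead_coeff q = of_nat (degree q) * lead_coeff q * lead_coeff p"
      using top[of p q] top[of q p] by (simp add: mult.commute add.commute)
    then have "(of_nat (degree p) :: complex) = of_nat (degree q)" using that(1,2) by simp
    then show False using ne by simp
  qed
  obtain p q where f: "f = Fract p q" "q \<noteq> 0" by (metis Fract_cases)
  show ?thesis
  proof (cases "p = 0")
    case True
    then have "f = rat_const 0" using f by (simp add: fract_collapse)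
    then show ?thesis by blast
  next
    case False
    define c where "c = lead_coeff p / lead_coeff q"
    have dpq: "degree p = degree q" using deg[OF False f(2)] assms f by simp
    define r where "r = p - [:c:] * q"
    have fc: "f - rat_const c = Fract r q" using f by (simp add: rat_const_def r_def)
    have "rat_deriv (Fract r q) = 0"
      unfolding fc[symmetric] using assms by (simp add: rat.d_diff rat_deriv_const)
    moreover have r0: "coeff r (degree q) = 0"
      using f dpq by (simp add: r_def c_def)
    ultimately have "r = 0" using deg[of r q] f(2) by (metis leading_coeff_0_iff)
    then have "f = rat_const c" using fc f by (simp add: fract_collapse)
    then show ?thesis by blast
  qed
qed

context
  fixes a :: "nat \<Rightarrow> complex" and m :: nat
  assumes inj: "inj_on a {1..m}"
begin

abbreviation "pole i \<equiv> inverse (rat_z - rat_const (a i))"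

lemma coord_0: "0 \<in> coord_ring a m" and coord_1: "1 \<in> coord_ring a m"
  using coord_ring.const[of 0 a m] coord_ring.const[of 1 a m] by simp_all

lemma coord_minus: "f \<in> coord_ring a m \<Longrightarrow> - f \<in> coord_ring a m"
  using coord_ring.mult[OF coord_ring.const[of "-1"], of f a m] by (simp add: rat_const_minus)

lemma coord_power: "f \<in> coord_ring a m \<Longrightarrow> f ^ i \<in> coord_ring a m"
  by (induction i) (simp_all add: coord_1 coord_ring.mult)

lemma coord_deriv: "f \<in> coord_ring a m \<Longrightarrow> rat_deriv f \<in> coord_ring a m"
proof (induction rule: coord_ring.induct)
  case (pole j)
  then show ?case unfolding rat_deriv_inverse by (intro coord_minus coord_power coord_ring.pole)
qed (auto simp: rat_deriv_const rat_deriv_z rat_deriv_add rat_deriv_mult coord_0 coord_1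
    intro: coord_ring.add coord_ring.mult)

text \<open>For the generator 1/(z - a_j) write g = (z - a_j) h. Since T commutes with z and with
  constants, T g = (z - a_j) T h, and one can divide.\<close>

lemma coord_linear:
  fixes T :: "complex poly fract \<Rightarrow> complex poly fract val"
  assumes add: "\<And>f g. f \<in> coord_ring a m \<Longrightarrow> g \<in> coord_ring a m \<Longrightarrow> T (f + g) = T f + T g"
    and scale: "\<And>c f. f \<in> coord_ring a m \<Longrightarrow> T (rat_const c * f) = sc (rat_const c) (T f)"
    and z: "\<And>f. f \<in> coord_ring a m \<Longrightarrow> T (rat_z * f) = sc rat_z (T f)"
    and f: "f \<in> coord_ring a m"
  shows "T f = sc f (T 1)"
proof -
  have "\<forall>g\<in>coord_ring a m. T (f * g) = sc f (T g)"
    using f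
  proof (induction rule: coord_ring.induct)
    case (pole j)
    let ?y = "rat_z - rat_const (a j)"
    have y: "?y * inverse ?y = 1" by (rule right_inverse[OF z_minus_const_nz])
    show ?case
    proof
      fix g assume g: "g \<in> coord_ring a m"
      let ?h = "inverse ?y * g"
      have h: "?h \<in> coord_ring a m" by (intro coord_ring.mult coord_ring.pole pole g)
      have neg: "T (rat_const (- a j) * ?h) = sc (rat_const (- a j)) (T ?h)" by (rule scale[OF h])
      have "T g = T (rat_z * ?h + rat_const (- a j) * ?h)"
      proof -
        have "rat_z * ?h + rat_const (- a j) * ?h = (?y * inverse ?y) * g"
          by (simp only: rat_const_minus) (simp add: algebra_simps)
        then show ?thesis unfolding y by simp
      qed
      also have "\<dots> = sc rat_z (T ?h) + sc (rat_const (- a j)) (T ?h)"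
        using add[of "rat_z * ?h" "rat_const (- a j) * ?h"] z[OF h] neg h
        by (simp add: coord_ring.mult coord_ring.var coord_ring.const)
      also have "\<dots> = sc ?y (T ?h)" by (simp add: rat_const_minus sc_left)
      finally have "sc (inverse ?y) (T g) = sc (inverse ?y * ?y) (T ?h)" by simp
      then show "T (inverse ?y * g) = sc (inverse ?y) (T g)" using y by (simp add: mult.commute)
    qed
  next
    case (add f1 f2)
    then show ?case using assms(1)[of "f1 * _" "f2 * _"] by (simp add: distrib_right coord_ring.mult sc_left)
  next
    case (mult f1 f2)
    then show ?case by (simp add: mult.assoc coord_ring.mult)
  qed (auto simp: scale z)
  then show ?thesis using coord_1 by fastforce
qed

text \<open>Partial fractions: the span of the powers of z and of the 1/(z - a_i). It is stable
  under multiplication by the generators of the coordinate ring and therefore contains the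
  ring.\<close>

inductive_set pf :: "complex poly fract set" where
  pf_z: "rat_z ^ n \<in> pf"
| pf_pole: "i \<in> {1..m} \<Longrightarrow> pole i ^ n \<in> pf"
| pf_add: "f \<in> pf \<Longrightarrow> g \<in> pf \<Longrightarrow> f + g \<in> pf"
| pf_scale: "f \<in> pf \<Longrightarrow> rat_const c * f \<in> pf"

lemma z_times_pole: "rat_z * pole i = 1 + rat_const (a i) * pole i"
  using right_inverse[OF z_minus_const_nz[of "a i"]] by (simp add: algebra_simps)

text \<open>Distinctness of the points enters here: two different simple poles are separated at the
  cost of dividing by a_i - a_j.\<close>

lemma pole_times_pole: "i \<in> {1..m} \<Longrightarrow> j \<in> {1..m} \<Longrightarrow> i \<noteq> j \<Longrightarrow>
   pole i * pole j = rat_const (1 / (a i - a j)) * (pole i - pole j)"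
proof -
  assume "i \<in> {1..m}" "j \<in> {1..m}" "i \<noteq> j"
  then have ne: "a i - a j \<noteq> 0" using inj_onD[OF inj, of i j] by auto
  have gen: "inverse p - inverse q = (q - p) * (inverse p * inverse q)" if "p \<noteq> 0" "q \<noteq> 0"
    for p q :: "complex poly fract"
    using that by (simp add: field_simps)
  have "pole i - pole j = ((rat_z - rat_const (a j)) - (rat_z - rat_const (a i))) * (pole i * pole j)"
    by (rule gen[OF z_minus_const_nz z_minus_const_nz])
  also have "(rat_z - rat_const (a j)) - (rat_z - rat_const (a i)) = rat_const (a i - a j)"
    by (simp add: rat_const_diff)
  finally have "rat_const (1 / (a i - a j)) * (pole i - pole j)
      = rat_const (1 / (a i - a j) * (a i - a j)) * (pole i * pole j)"
    unfolding rat_const_mult by (simp only: mult.assoc)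
  moreover have "1 / (a i - a j) * (a i - a j) = 1" using ne by simp
  ultimately show ?thesis by (simp only: rat_const_1 mult_1)
qed

lemma z_times_pf: "f \<in> pf \<Longrightarrow> rat_z * f \<in> pf"
proof (induction rule: pf.induct)
  case (pf_z n)
  show ?case using pf.pf_z[of "Suc n"] by simp
next
  case (pf_pole i n)
  show ?case
  proof (cases n)
    case 0
    then show ?thesis using pf.pf_z[of 1] by simp
  next
    case (Suc k)
    have "rat_z * pole i ^ n = pole i ^ k + rat_const (a i) * pole i ^ Suc k"
      unfolding Suc power_Suc mult.assoc[symmetric] z_times_pole by (simp add: distrib_right)
    then show ?thesis using pf.pf_add[OF pf.pf_pole[OF pf_pole] pf.pf_scale[OF pf.pf_pole[OF pf_pole]]] by metis
  qed
next
  case (pf_scale f c)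
  then show ?case using pf.pf_scale[of "rat_z * f" c] by (simp only: mult.left_commute)
qed (simp add: distrib_left pf.pf_add)

lemma pole_times_pf: "f \<in> pf \<Longrightarrow> i \<in> {1..m} \<Longrightarrow> pole i * f \<in> pf"
proof (induction rule: pf.induct)
  case (pf_z n)
  show ?case
  proof (induction n)
    case 0
    then show ?case using pf.pf_pole[OF pf_z, of 1] by simp
  next
    case (Suc n)
    have "pole i * rat_z ^ Suc n = rat_z ^ n + rat_const (a i) * (pole i * rat_z ^ n)"
    proof -
      have "pole i * rat_z ^ Suc n = (rat_z * pole i) * rat_z ^ n" by (simp add: mult_ac)
      then show ?thesis unfolding z_times_pole by (simp add: distrib_right mult.assoc)
    qed
    then show ?case using pf.pf_add[OF pf.pf_z pf.pf_scale[OF Suc]] by metis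
  qed
next
  case (pf_pole j n)
  show ?case
  proof (cases "i = j")
    case True
    then show ?thesis using pf.pf_pole[OF pf_pole(2), of "Suc n"] by simp
  next
    case False
    show ?thesis
    proof (induction n)
      case 0
      then show ?case using pf.pf_pole[OF pf_pole(2), of 1] by simp
    next
      case (Suc n)
      have "pole i * pole j ^ Suc n = rat_const (1 / (a i - a j)) * (pole i * pole j ^ n + rat_const (-1) * pole j ^ Suc n)"
      proof -
        have "pole i * pole j ^ Suc n = (pole i * pole j) * pole j ^ n" by (simp add: mult_ac)
        then show ?thesis
          unfolding pole_times_pole[OF pf_pole(2) pf_pole(1) False]
          by (simp add: algebra_simps rat_const_minus)
      qed
      then show ?case
        using pf.pf_scale[OF pf.pf_add[OF Suc pf.pf_scale[OF pf.pf_pole[OF pf_pole(1)]]]] by metis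
    qed
  qed
next
  case (pf_scale f c)
  then show ?case using pf.pf_scale[of "pole i * f" c] by (simp only: mult.left_commute)
qed (simp add: distrib_left pf.pf_add)

lemma coord_pf: "f \<in> coord_ring a m \<Longrightarrow> f \<in> pf"
proof -
  assume "f \<in> coord_ring a m"
  then have "\<forall>s\<in>pf. f * s \<in> pf"
    by (induction rule: coord_ring.induct)
      (auto simp: pf_scale z_times_pf pole_times_pf distrib_right pf_add mult.assoc)
  moreover have "1 \<in> pf" using pf_z[of 0] by simp
  ultimately show ?thesis by fastforce
qed

lemma partial_fractionI:
  "g \<in> coord_ring a m \<Longrightarrow> f = rat_deriv g + (\<Sum>i=1..m. rat_const (r i) * pole i) \<Longrightarrow>
   \<exists>g\<in>coord_ring a m. \<exists>r. f = rat_deriv g + (\<Sum>i=1..m. rat_const (r i) * pole i)"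
  by blast

lemma rat_const_of_nat: "rat_const (of_nat k) = of_nat k"
  by (simp add: rat_const_def of_nat_Fract of_nat_poly)

text \<open>Every partial fraction except the simple poles is a derivative within the ring.\<close>

lemma partial_fraction:
  assumes "f \<in> coord_ring a m"
  shows "\<exists>g\<in>coord_ring a m. \<exists>r. f = rat_deriv g + (\<Sum>i=1..m. rat_const (r i) * pole i)"
  using coord_pf[OF assms]
proof (induction rule: pf.induct)
  case (pf_z n)
  let ?g = "rat_const (1 / of_nat (Suc n)) * rat_z ^ Suc n"
  have "rat_deriv ?g = (rat_const (1 / of_nat (Suc n)) * of_nat (Suc n)) * rat_z ^ n"
    unfolding rat_deriv_const_mult rat.d_power rat_deriv_z by (simp add: mult.assoc del: of_nat_Suc)
  also have "rat_const (1 / of_nat (Suc n)) * of_nat (Suc n) = 1"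
    by (simp only: rat_const_of_nat[symmetric] rat_const_mult[symmetric]) (simp del: of_nat_Suc)
  finally have "rat_z ^ n = rat_deriv ?g + (\<Sum>i=1..m. rat_const ((\<lambda>_. 0) i) * pole i)" by simp
  moreover have "?g \<in> coord_ring a m" by (intro coord_ring.mult coord_ring.const coord_power coord_ring.var)
  ultimately show ?case by (rule partial_fractionI[rotated])
next
  case (pf_pole i n)
  consider "n = 0" | "n = 1" | k where "n = Suc (Suc k)"
    by (metis One_nat_def not0_implies_Suc)
  then show ?case
  proof cases
    case 1
    have "pole i ^ n = rat_deriv rat_z + (\<Sum>i=1..m. rat_const ((\<lambda>_. 0) i) * pole i)"
      using 1 by (simp add: rat_deriv_z)
    then show ?thesis by (rule partial_fractionI[OF coord_ring.var])
  next
    case 2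
    have "(\<Sum>j=1..m. rat_const (if j = i then 1 else 0) * pole j) = (\<Sum>j=1..m. if j = i then pole j else 0)"
      by (intro sum.cong) auto
    then have "pole i ^ n = rat_deriv 0 + (\<Sum>j=1..m. rat_const ((\<lambda>j. if j = i then 1 else 0) j) * pole j)"
      using 2 pf_pole by simp
    then show ?thesis by (rule partial_fractionI[OF coord_0])
  next
    case 3
    let ?g = "rat_const (- 1 / of_nat (Suc k)) * pole i ^ Suc k"
    have "rat_deriv ?g = (rat_const (- 1 / of_nat (Suc k)) * - of_nat (Suc k)) * (pole i ^ k * pole i ^ 2)"
      unfolding rat_deriv_const_mult rat.d_power rat_deriv_inverse by (simp add: mult.assoc del: of_nat_Suc)
    also have "rat_const (- 1 / of_nat (Suc k)) * - of_nat (Suc k) = 1"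
      by (simp only: rat_const_of_nat[symmetric] rat_const_minus[symmetric] rat_const_mult[symmetric])
        (simp del: of_nat_Suc)
    also have "pole i ^ k * pole i ^ 2 = pole i ^ n" by (simp add: 3 power2_eq_square)
    finally have "pole i ^ n = rat_deriv ?g + (\<Sum>i=1..m. rat_const ((\<lambda>_. 0) i) * pole i)" by simp
    moreover have "?g \<in> coord_ring a m"
      by (intro coord_ring.mult coord_ring.const coord_power coord_ring.pole pf_pole)
    ultimately show ?thesis by (rule partial_fractionI[rotated])
  qed
next
  case (pf_add f1 f2)
  then obtain g1 r1 g2 r2 where g: "g1 \<in> coord_ring a m" "g2 \<in> coord_ring a m"
    and f: "f1 = rat_deriv g1 + (\<Sum>i=1..m. rat_const (r1 i) * pole i)"
      "f2 = rat_deriv g2 + (\<Sum>i=1..m. rat_const (r2 i) * pole i)" by blast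
  have "f1 + f2 = rat_deriv (g1 + g2) + (\<Sum>i=1..m. rat_const ((\<lambda>i. r1 i + r2 i) i) * pole i)"
    unfolding f by (simp add: rat_deriv_add rat_const_add distrib_right sum.distrib)
  then show ?case by (rule partial_fractionI[OF coord_ring.add[OF g]])
next
  case (pf_scale f c)
  then obtain g r where g: "g \<in> coord_ring a m"
    and f: "f = rat_deriv g + (\<Sum>i=1..m. rat_const (r i) * pole i)" by blast
  have "rat_const c * f = rat_deriv (rat_const c * g) + (\<Sum>i=1..m. rat_const ((\<lambda>i. c * r i) i) * pole i)"
    unfolding f by (simp add: rat_deriv_const_mult rat_const_mult distrib_left sum_distrib_left mult.assoc)
  then show ?case by (rule partial_fractionI[OF coord_ring.mult[OF coord_ring.const g]])
qed

text \<open>If f is regular at a0, so is f'; if f has a pole of order k there, f' has one of order k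
  + 1. A simple pole never arises. P/Q is the part of f' that is regular at a0.\<close>

lemma simple_pole_not_derivative:
  assumes Q: "poly Q a0 \<noteq> 0" and eq: "rat_deriv f = Fract P Q + rat_const r * inverse (rat_z - rat_const a0)"
  shows "r = 0"
proof -
  let ?x = "[:- a0, 1:] :: complex poly"
  \<comment> \<open>A denominator of least degree replaces a reduced fraction: all that is used is
    that p and q do not both vanish at a0.\<close>
  have "\<exists>q p. q \<noteq> 0 \<and> f = Fract p q" by (metis Fract_cases)
  then obtain q where q: "\<exists>p. q \<noteq> 0 \<and> f = Fract p q"
      and min: "\<And>q'. \<exists>p. q' \<noteq> 0 \<and> f = Fract p q' \<Longrightarrow> degree q \<le> degree q'"
    using exists_least_iff[of "\<lambda>n. \<exists>q. degree q = n \<and> (\<exists>p. q \<noteq> 0 \<and> f = Fract p q)"]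
    by (metis not_less)
  then obtain p where f: "q \<noteq> 0" "f = Fract p q" by blast
  have cop: "poly p a0 \<noteq> 0 \<or> poly q a0 \<noteq> 0"
  proof (rule ccontr)
    assume "\<not> ?thesis"
    then obtain p' q' where pq: "p = ?x * p'" "q = ?x * q'"
      by (auto simp: poly_eq_0_iff_dvd dvd_def)
    then have "q' \<noteq> 0" "f = Fract p' q'" using f by (auto simp: eq_fract simp del: mult_pCons_left)
    then have "degree q \<le> degree q'" using min by blast
    moreover have "degree q = Suc (degree q')" using pq(2) \<open>q' \<noteq> 0\<close> by (simp add: degree_mult_eq del: mult_pCons_left)
    ultimately show False by simp
  qed
  have Q0: "Q \<noteq> 0" using Q by auto
  have x0: "?x \<noteq> 0" by simp
  have "Fract (pderiv p * q - p * pderiv q) (q * q) = Fract (P * ?x + [:r:] * Q) (Q * ?x)"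
    using eq f Q0 unfolding inverse_z_minus_const unfolding rat_const_def
    by (simp add: rat_deriv_Fract del: mult_pCons_left mult_pCons_right)
  then have E: "(pderiv p * q - p * pderiv q) * (Q * ?x) = (P * ?x + [:r:] * Q) * (q * q)"
    using f(1) Q0 x0 by (subst (asm) eq_fract) (auto simp del: mult_pCons_left mult_pCons_right)
  show ?thesis
  proof (cases "poly q a0 = 0")
    case False
    have "poly ((pderiv p * q - p * pderiv q) * (Q * ?x)) a0 = poly ((P * ?x + [:r:] * Q) * (q * q)) a0"
      unfolding E ..
    then show ?thesis using False Q by simp
  next
    case True
    obtain s where s: "q = ?x ^ order a0 q * s" "\<not> ?x dvd s" using order_decomp[OF f(1)] by blast
    define k where "k = order a0 q"
    have "k \<noteq> 0" using True f(1) order_root[of q a0] by (simp add: k_def)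
    then obtain l where l: "k = Suc l" by (cases k) auto
    have sn: "poly s a0 \<noteq> 0" using s(2) by (simp add: poly_eq_0_iff_dvd)
    have pq: "pderiv q = ?x ^ l * (of_nat k * s + ?x * pderiv s)"
    proof -
      have "pderiv q = ?x ^ k * pderiv s + s * pderiv (?x ^ k)"
        unfolding s(1)[folded k_def] by (subst pderiv_mult) simp
      also have "pderiv (?x ^ k) = of_nat k * ?x ^ l"
        unfolding l pderiv_power_Suc by (simp add: pderiv_pCons of_nat_poly del: of_nat_Suc)
      finally show ?thesis unfolding l by (simp add: algebra_simps del: mult_pCons_left mult_pCons_right of_nat_Suc)
    qed
    have q': "q = ?x ^ l * (?x * s)" using s(1) unfolding k_def[symmetric] l by (simp add: mult_ac del: mult_pCons_left mult_pCons_right)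
    \<comment> \<open>What is left of the numerator of f' after a power of \<open>?x\<close> is
      cancelled. At a0 its value is - k p(a0) s(a0), and neither k nor s(a0) is 0.\<close>
    let ?t = "?x * (pderiv p * s - p * pderiv s) - of_nat k * p * s"
    have "(?x ^ k) * (?t * Q) = (?x ^ k) * (?x * ((P * ?x + [:r:] * Q) * ?x ^ l * s * s))"
    proof -
      have "(pderiv p * q - p * pderiv q) * (Q * ?x) = (?x ^ k) * (?t * Q)"
        unfolding pq unfolding q' l by (simp only: power_Suc ring_distribs mult_ac right_diff_distrib left_diff_distrib) (simp only: algebra_simps)
      moreover have "(P * ?x + [:r:] * Q) * (q * q) = (?x ^ k) * (?x * ((P * ?x + [:r:] * Q) * ?x ^ l * s * s))"
        unfolding q' l by (simp only: power_Suc mult_ac)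
      ultimately show ?thesis using E by simp
    qed
    then have "?t * Q = ?x * ((P * ?x + [:r:] * Q) * ?x ^ l * s * s)"
      using x0 by (metis mult_left_cancel power_not_zero)
    then have "poly (?t * Q) a0 = poly (?x * ((P * ?x + [:r:] * Q) * ?x ^ l * s * s)) a0" by simp
    then have "poly ?t a0 * poly Q a0 = 0" by (simp only: poly_mult) simp
    then have "of_nat k * poly p a0 * poly s a0 = 0" using Q by simp
    then have "poly p a0 = 0" using sn \<open>k \<noteq> 0\<close> by simp
    then show ?thesis using cop True by simp
  qed
qed

section \<open>Residues\<close>

lemma residue_unique:
  assumes "rat_deriv f = (\<Sum>i=1..m. rat_const (r i) * pole i)" "i \<in> {1..m}"
  shows "r i = 0"
proof -
  \<comment> \<open>The remaining poles sum to a function that is regular at a_i, because the points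
    are distinct.\<close>
  have reg: "\<exists>P Q. (\<Sum>j\<in>J. rat_const (r j) * pole j) = Fract P Q \<and> poly Q (a i) \<noteq> 0"
    if "finite J" "J \<subseteq> {1..m} - {i}" for J
    using that
  proof (induction J rule: finite_induct)
    case empty
    show ?case by (intro exI[of _ 0] exI[of _ 1]) (simp add: fract_collapse)
  next
    case (insert j J)
    then obtain P Q where PQ: "(\<Sum>j\<in>J. rat_const (r j) * pole j) = Fract P Q" "poly Q (a i) \<noteq> 0" by auto
    have Q0: "Q \<noteq> 0" using PQ(2) by auto
    have "a j \<noteq> a i" using insert.prems assms(2) inj_onD[OF inj, of i j] by auto
    then have "poly ([:- a j, 1:] * Q) (a i) \<noteq> 0" using PQ(2) by simp
    moreover have "(\<Sum>j\<in>insert j J. rat_const (r j) * pole j) = Fract ([:r j:] * Q + P * [:- a j, 1:]) ([:- a j, 1:] * Q)"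
    proof -
      have "(\<Sum>j\<in>insert j J. rat_const (r j) * pole j) = rat_const (r j) * pole j + Fract P Q"
        using insert.hyps PQ(1) by simp
      also have "\<dots> = Fract ([:r j:] * Q + P * [:- a j, 1:]) ([:- a j, 1:] * Q)"
        using Q0 unfolding inverse_z_minus_const unfolding rat_const_def
        by (simp del: mult_pCons_left mult_pCons_right)
      finally show ?thesis .
    qed
    ultimately show ?case by blast
  qed
  obtain P Q where PQ: "(\<Sum>j\<in>{1..m} - {i}. rat_const (r j) * pole j) = Fract P Q" "poly Q (a i) \<noteq> 0"
    using reg[of "{1..m} - {i}"] by auto
  have "rat_deriv f = Fract P Q + rat_const (r i) * pole i"
    unfolding assms(1) PQ(1)[symmetric] using assms(2) by (simp add: sum.remove[of _ i])
  then show ?thesis by (rule simple_pole_not_derivative[OF PQ(2)])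
qed

lemma partial_fraction_unique:
  assumes "g \<in> coord_ring a m" "g' \<in> coord_ring a m"
    and eq: "rat_deriv g + (\<Sum>i=1..m. rat_const (r i) * pole i) = rat_deriv g' + (\<Sum>i=1..m. rat_const (r' i) * pole i)"
    and i: "i \<in> {1..m}"
  shows "r i = r' i"
proof -
  have "rat_deriv (g' - g) = (\<Sum>i=1..m. rat_const (r i - r' i) * pole i)"
    using eq by (simp add: rat.d_diff rat_const_diff left_diff_distrib sum_subtractf algebra_simps)
  from residue_unique[of _ "\<lambda>i. r i - r' i", OF this i] show ?thesis by simp
qed

text \<open>The residue is introduced algebraically, as the coefficient of 1/(z - a_i) modulo
  derivatives; \<open>partial_fraction_unique\<close> makes the choice immaterial.\<close>

definition residue_at :: "nat \<Rightarrow> complex poly fract \<Rightarrow> complex" where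
  "residue_at i f = (SOME r. \<exists>g\<in>coord_ring a m. f = rat_deriv g + (\<Sum>i=1..m. rat_const (r i) * pole i)) i"

lemma residue_atI:
  assumes "g \<in> coord_ring a m" "f = rat_deriv g + (\<Sum>i=1..m. rat_const (r i) * pole i)" "i \<in> {1..m}"
  shows "residue_at i f = r i"
proof -
  let ?r = "SOME r. \<exists>g\<in>coord_ring a m. f = rat_deriv g + (\<Sum>i=1..m. rat_const (r i) * pole i)"
  have "\<exists>g\<in>coord_ring a m. f = rat_deriv g + (\<Sum>i=1..m. rat_const (?r i) * pole i)"
    by (rule someI[of _ r]) (use assms in blast)
  then obtain g' where g': "g' \<in> coord_ring a m" "f = rat_deriv g' + (\<Sum>i=1..m. rat_const (?r i) * pole i)"
    by blast
  have "?r i = r i"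
    by (rule partial_fraction_unique[OF g'(1) assms(1) _ assms(3)]) (use g'(2) assms(2) in metis)
  then show ?thesis unfolding residue_at_def .
qed

lemma residue_at_decomp:
  assumes "f \<in> coord_ring a m"
  shows "\<exists>g\<in>coord_ring a m. f = rat_deriv g + (\<Sum>i=1..m. rat_const (residue_at i f) * pole i)"
proof -
  obtain g r where g: "g \<in> coord_ring a m" "f = rat_deriv g + (\<Sum>i=1..m. rat_const (r i) * pole i)"
    using partial_fraction[OF assms] by blast
  have "(\<Sum>i=1..m. rat_const (r i) * pole i) = (\<Sum>i=1..m. rat_const (residue_at i f) * pole i)"
    using residue_atI[OF g] by (intro sum.cong) auto
  then show ?thesis using g by auto
qed

lemma residue_at_props:
  assumes i: "i \<in> {1..m}"
  shows "f \<in> coord_ring a m \<Longrightarrow> g \<in> coord_ring a m \<Longrightarrow> residue_at i (f + g) = residue_at i f + residue_at i g"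
    "f \<in> coord_ring a m \<Longrightarrow> residue_at i (rat_const c * f) = c * residue_at i f"
    "f \<in> coord_ring a m \<Longrightarrow> residue_at i (rat_deriv f) = 0"
    "j \<in> {1..m} \<Longrightarrow> residue_at i (pole j) = (if i = j then 1 else 0)"
proof -
  assume f: "f \<in> coord_ring a m" and g: "g \<in> coord_ring a m"
  obtain f' g' where f': "f' \<in> coord_ring a m" "f = rat_deriv f' + (\<Sum>i=1..m. rat_const (residue_at i f) * pole i)"
    and g': "g' \<in> coord_ring a m" "g = rat_deriv g' + (\<Sum>i=1..m. rat_const (residue_at i g) * pole i)"
    using residue_at_decomp[OF f] residue_at_decomp[OF g] by blast
  have "f + g = (rat_deriv f' + (\<Sum>i=1..m. rat_const (residue_at i f) * pole i)) +
      (rat_deriv g' + (\<Sum>i=1..m. rat_const (residue_at i g) * pole i))"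
    using f'(2) g'(2) by (rule arg_cong2)
  also have "\<dots> = rat_deriv (f' + g') + (\<Sum>i=1..m. rat_const (residue_at i f + residue_at i g) * pole i)"
    by (simp add: rat_deriv_add rat_const_add distrib_right sum.distrib)
  finally show "residue_at i (f + g) = residue_at i f + residue_at i g"
    by (rule residue_atI[OF coord_ring.add[OF f'(1) g'(1)] _ i])
next
  assume f: "f \<in> coord_ring a m"
  obtain f' where f': "f' \<in> coord_ring a m" "f = rat_deriv f' + (\<Sum>i=1..m. rat_const (residue_at i f) * pole i)"
    using residue_at_decomp[OF f] by blast
  have "rat_const c * f = rat_const c * (rat_deriv f' + (\<Sum>i=1..m. rat_const (residue_at i f) * pole i))"
    using f'(2) by (rule arg_cong)
  also have "\<dots> = rat_deriv (rat_const c * f') + (\<Sum>i=1..m. rat_const (c * residue_at i f) * pole i)"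
    by (simp add: rat_deriv_const_mult rat_const_mult distrib_left sum_distrib_left mult.assoc)
  finally show "residue_at i (rat_const c * f) = c * residue_at i f"
    by (rule residue_atI[OF coord_ring.mult[OF coord_ring.const f'(1)] _ i])
next
  assume f: "f \<in> coord_ring a m"
  show "residue_at i (rat_deriv f) = 0"
    by (rule residue_atI[OF f _ i]) simp
next
  assume j: "j \<in> {1..m}"
  have "(\<Sum>i=1..m. rat_const (if i = j then 1 else 0) * pole i) = (\<Sum>i=1..m. if i = j then pole i else 0)"
    by (intro sum.cong) auto
  then have "pole j = rat_deriv 0 + (\<Sum>i=1..m. rat_const (if i = j then 1 else 0) * pole i)"
    using j by simp
  then show "residue_at i (pole j) = (if i = j then 1 else 0)"
    by (rule residue_atI[OF coord_0 _ i])
qed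

section \<open>Antiderivatives\<close>

lemma vector_space_fract: "vector_space (\<lambda>c f. rat_const c * f)"
  by unfold_locales (simp_all add: algebra_simps rat_const_add rat_const_mult)

text \<open>Antiderivatives are unique only up to constants, so choosing one for each function need
  not be linear. Linear algebra supplies a linear right inverse of the derivative with values in the
  ring.\<close>

lemma antiderivative_exists:
  "\<exists>P. (\<forall>f g. P (f + g) = P f + P g) \<and> (\<forall>c f. P (rat_const c * f) = rat_const c * P f) \<and>
     (\<forall>f. P f \<in> coord_ring a m) \<and> (\<forall>f\<in>coord_ring a m. rat_deriv (P (rat_deriv f)) = rat_deriv f)"
proof -
  let ?s = "\<lambda>c f. rat_const c * f"
  interpret V: vector_space ?s by (rule vector_space_fract)
  interpret VP: vector_space_pair ?s ?s ..
  have lin: "Vector_Spaces.linear ?s ?s rat_deriv"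
    unfolding Vector_Spaces.linear_iff by (simp add: V.vector_space_axioms rat_deriv_add rat_deriv_const_mult)
  have sub: "V.subspace (coord_ring a m)"
    by (rule V.subspaceI) (auto simp: coord_0 coord_ring.add coord_ring.mult coord_ring.const)
  obtain P where P: "P ` UNIV \<subseteq> coord_ring a m" "Vector_Spaces.linear ?s ?s P"
      "\<forall>v\<in>rat_deriv ` coord_ring a m. rat_deriv (P v) = v"
    using VP.linear_exists_right_inverse_on[OF lin sub] by blast
  then show ?thesis unfolding Vector_Spaces.linear_iff by (intro exI[of _ P]) auto
qed

end

subsection \<open>Type-level models of vector space records\<close>

text \<open>h identifies the record M with the subset S of a type that has its own addition, s being
  the scalar multiplication there. Closure of the carrier is included, so that the vector space
  axioms of M can be pulled back from the type (\<open>models_vectorspace\<close>).\<close>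

definition models :: "(complex \<Rightarrow> 't \<Rightarrow> 't::ab_group_add) \<Rightarrow> (complex, 'b, 'e) module_scheme \<Rightarrow> ('b \<Rightarrow> 't) \<Rightarrow> 't set \<Rightarrow> bool" where
  "models s M h S \<longleftrightarrow> vector_space s \<and> bij_betw h (carrier M) S \<and>
     \<zero>\<^bsub>M\<^esub> \<in> carrier M \<and> h \<zero>\<^bsub>M\<^esub> = 0 \<and>
     (\<forall>x\<in>carrier M. \<forall>y\<in>carrier M. x \<oplus>\<^bsub>M\<^esub> y \<in> carrier M \<and> h (x \<oplus>\<^bsub>M\<^esub> y) = h x + h y) \<and>
     (\<forall>c. \<forall>x\<in>carrier M. c \<odot>\<^bsub>M\<^esub> x \<in> carrier M \<and> h (c \<odot>\<^bsub>M\<^esub> x) = s c (h x))"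

context
  fixes s :: "complex \<Rightarrow> 't \<Rightarrow> 't::ab_group_add" and M :: "(complex, 'b, 'e) module_scheme" and h S
  assumes mod: "models s M h S"
begin

lemma models_vs: "vector_space s"
  using mod by (simp add: models_def)

lemma models_bij: "bij_betw h (carrier M) S"
  using mod by (simp add: models_def)

lemma models_zero: "\<zero>\<^bsub>M\<^esub> \<in> carrier M" "h \<zero>\<^bsub>M\<^esub> = 0"
  using mod by (simp_all add: models_def)

lemma models_add: "x \<in> carrier M \<Longrightarrow> y \<in> carrier M \<Longrightarrow> x \<oplus>\<^bsub>M\<^esub> y \<in> carrier M"
  "x \<in> carrier M \<Longrightarrow> y \<in> carrier M \<Longrightarrow> h (x \<oplus>\<^bsub>M\<^esub> y) = h x + h y"
  using mod by (simp_all add: models_def)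

lemma models_smult: "x \<in> carrier M \<Longrightarrow> c \<odot>\<^bsub>M\<^esub> x \<in> carrier M"
  "x \<in> carrier M \<Longrightarrow> h (c \<odot>\<^bsub>M\<^esub> x) = s c (h x)"
  using mod by (simp_all add: models_def)

lemma models_inj: "x \<in> carrier M \<Longrightarrow> y \<in> carrier M \<Longrightarrow> h x = h y \<Longrightarrow> x = y"
  using models_bij by (auto simp: bij_betw_def inj_on_def)

lemma models_in: "x \<in> carrier M \<Longrightarrow> h x \<in> S"
  using models_bij by (auto simp: bij_betw_def)

lemma models_obtain: "v \<in> S \<Longrightarrow> (\<And>x. x \<in> carrier M \<Longrightarrow> h x = v \<Longrightarrow> P) \<Longrightarrow> P"
  using models_bij by (auto simp: bij_betw_def)

lemma models_abelian_group: "abelian_group M"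
proof -
  interpret V: vector_space s by (rule models_vs)
  show ?thesis
  proof (rule abelian_groupI)
    fix x assume x: "x \<in> carrier M"
    have "(-1) \<odot>\<^bsub>M\<^esub> x \<oplus>\<^bsub>M\<^esub> x = \<zero>\<^bsub>M\<^esub>"
      by (rule models_inj) (simp_all add: x models_add models_smult models_zero)
    then show "\<exists>y\<in>carrier M. y \<oplus>\<^bsub>M\<^esub> x = \<zero>\<^bsub>M\<^esub>" using models_smult(1)[OF x, of "-1"] by blast
  qed (auto intro!: models_inj simp: models_add models_zero add.assoc add.commute add.left_commute)
qed

lemma models_module: "Module.module (class_ring :: complex ring) M"
proof -
  interpret V: vector_space s by (rule models_vs)
  show ?thesis
  proof (rule moduleI)
    show "cring (class_ring :: complex ring)" by (rule class_cring.cring_axioms)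
  qed (auto simp: models_abelian_group models_smult models_add V.scale_left_distrib V.scale_right_distrib intro!: models_inj)
qed

lemma models_vectorspace: "vectorspace (class_ring :: complex ring) M"
  unfolding vectorspace_def using models_module class_field.field_axioms by blast

lemma models_finsum:
  assumes "finite I" "\<And>i. i \<in> I \<Longrightarrow> f i \<in> carrier M"
  shows "finsum M f I \<in> carrier M" "h (finsum M f I) = (\<Sum>i\<in>I. h (f i))"
proof -
  interpret abelian_group M by (rule models_abelian_group)
  have "finsum M f I \<in> carrier M \<and> h (finsum M f I) = (\<Sum>i\<in>I. h (f i))"
    using assms
  proof (induction I rule: finite_induct)
    case empty
    then show ?case by (simp add: models_zero)
  next
    case (insert i I)
    then show ?case by (subst finsum_insert) (auto simp: models_add)
  qed
  then show "finsum M f I \<in> carrier M" "h (finsum M f I) = (\<Sum>i\<in>I. h (f i))" by auto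
qed

lemma models_a_inv:
  assumes "x \<in> carrier M"
  shows "\<ominus>\<^bsub>M\<^esub> x \<in> carrier M" "h (\<ominus>\<^bsub>M\<^esub> x) = - h x"
proof -
  interpret abelian_group M by (rule models_abelian_group)
  show c: "\<ominus>\<^bsub>M\<^esub> x \<in> carrier M" using assms by simp
  have "h (\<ominus>\<^bsub>M\<^esub> x) + h x = 0"
    using models_add(2)[OF c assms] assms by (simp add: l_neg models_zero)
  then show "h (\<ominus>\<^bsub>M\<^esub> x) = - h x" by (simp add: eq_neg_iff_add_eq_0)
qed

lemma models_minus:
  assumes "x \<in> carrier M" "y \<in> carrier M"
  shows "x \<ominus>\<^bsub>M\<^esub> y \<in> carrier M" "h (x \<ominus>\<^bsub>M\<^esub> y) = h x - h y"
  using models_a_inv[OF assms(2)] assms(1) by (simp_all add: a_minus_def models_add)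

lemma models_S: "0 \<in> S" "v \<in> S \<Longrightarrow> w \<in> S \<Longrightarrow> v + w \<in> S" "v \<in> S \<Longrightarrow> s c v \<in> S"
  "v \<in> S \<Longrightarrow> - v \<in> S" "v \<in> S \<Longrightarrow> w \<in> S \<Longrightarrow> v - w \<in> S"
  using models_in models_zero models_add models_smult models_a_inv models_minus
  by (metis models_obtain)+

end

text \<open>A common model suffices for an isomorphism: go to the model by h and come back by the
  inverse of g. The final isomorphism is obtained in this way.\<close>

lemma models_linear_isomorphic:
  assumes M: "models s M h S" and N: "models s N g S"
  shows "linear_isomorphic M N"
proof -
  let ?f = "\<lambda>x. inv_into (carrier N) g (h x)"
  have f: "?f x \<in> carrier N" "g (?f x) = h x" if "x \<in> carrier M" for x
    using models_bij[OF N] models_in[OF M that] by (auto simp: bij_betw_def inv_into_into f_inv_into_f)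
  have add: "?f (x \<oplus>\<^bsub>M\<^esub> y) = ?f x \<oplus>\<^bsub>N\<^esub> ?f y" if "x \<in> carrier M" "y \<in> carrier M" for x y
    by (rule models_inj[OF N])
      (use f[OF models_add(1)[OF M that]] f[OF that(1)] f[OF that(2)] models_add[OF M that] in
        \<open>simp_all only: models_add[OF N]\<close>)
  have smult: "?f (c \<odot>\<^bsub>M\<^esub> x) = c \<odot>\<^bsub>N\<^esub> ?f x" if "x \<in> carrier M" for x c
    by (rule models_inj[OF N])
      (use f[OF models_smult(1)[OF M that]] f[OF that] models_smult[OF M that] in
        \<open>simp_all only: models_smult[OF N]\<close>)
  have "linear_map class_ring M N ?f"
    unfolding linear_map_def mod_hom_def mod_hom_axioms_def LinearCombinations.module_hom_def
    using models_vectorspace[OF M] models_vectorspace[OF N] models_module[OF M] models_module[OF N] f(1) add smult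
    by auto
  moreover have "bij_betw ?f (carrier M) (carrier N)"
    using bij_betw_trans[OF models_bij[OF M] bij_betw_inv_into[OF models_bij[OF N]]] by (simp add: comp_def)
  ultimately show ?thesis unfolding linear_isomorphic_def by blast
qed

lemma models_restrict:
  assumes M: "models s M h S" and C: "C \<subseteq> carrier M" "\<zero>\<^bsub>M\<^esub> \<in> C"
    "\<And>x y. x \<in> C \<Longrightarrow> y \<in> C \<Longrightarrow> x \<oplus>\<^bsub>M\<^esub> y \<in> C" "\<And>c x. x \<in> C \<Longrightarrow> c \<odot>\<^bsub>M\<^esub> x \<in> C"
  shows "models s (M\<lparr>carrier := C\<rparr>) h (h ` C)"
  using C models_vs[OF M] models_zero[OF M] models_add[OF M] models_smult[OF M]
    inj_on_subset[OF bij_betw_imp_inj_on[OF models_bij[OF M]] C(1)]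
  unfolding models_def by (auto simp: bij_betw_def subset_iff)

text \<open>The first isomorphism theorem: the cosets are the fibres of q after h. The value on a
  coset is taken at an arbitrary element, on which it does not depend.\<close>

lemma models_quotient:
  assumes M: "models s M h S" and s': "vector_space s'"
    and q_add: "\<And>v w. v \<in> S \<Longrightarrow> w \<in> S \<Longrightarrow> q (v + w) = q v + q w"
    and q_scale: "\<And>c v. v \<in> S \<Longrightarrow> q (s c v) = s' c (q v)"
    and N: "N = {x \<in> carrier M. q (h x) = 0}"
  shows "models s' (quotient_space M N) (\<lambda>X. q (h (SOME x. x \<in> X))) (q ` S)"
    "x \<in> carrier M \<Longrightarrow> q (h (SOME y. y \<in> N +>\<^bsub>M\<^esub> x)) = q (h x)"
proof -
  interpret V: vector_space s' by (rule s')
  let ?C = "\<lambda>x. {y \<in> carrier M. q (h y) = q (h x)}"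
  have qd: "q (v - w) = q v - q w" if "v \<in> S" "w \<in> S" for v w
    using q_add[of "v - w" w] models_S[OF M] that by simp
  have q0: "q 0 = 0" using q_add[of 0 0] models_S(1)[OF M] by simp
  have coset: "N +>\<^bsub>M\<^esub> x = ?C x" if x: "x \<in> carrier M" for x
  proof (intro Set.set_eqI iffI)
    fix y assume "y \<in> N +>\<^bsub>M\<^esub> x"
    then obtain k where "k \<in> carrier M" "q (h k) = 0" "y = k \<oplus>\<^bsub>M\<^esub> x" by (auto simp: a_r_coset_def' N)
    then show "y \<in> ?C x" using x by (simp add: models_add[OF M] q_add models_in[OF M])
  next
    fix y assume "y \<in> ?C x"
    then have y: "y \<in> carrier M" "q (h y) = q (h x)" by auto
    have "y \<ominus>\<^bsub>M\<^esub> x \<in> N" using x y by (simp add: N models_minus[OF M] qd models_in[OF M])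
    moreover have "y = (y \<ominus>\<^bsub>M\<^esub> x) \<oplus>\<^bsub>M\<^esub> x"
      by (rule models_inj[OF M]) (use x y in \<open>simp_all add: models_minus[OF M] models_add[OF M]\<close>)
    ultimately show "y \<in> N +>\<^bsub>M\<^esub> x" unfolding a_r_coset_def' by blast
  qed
  have some: "q (h (SOME y. y \<in> ?C x)) = q (h x)" if "x \<in> carrier M" for x
    using someI[of "\<lambda>y. y \<in> ?C x" x] that by auto
  then show "x \<in> carrier M \<Longrightarrow> q (h (SOME y. y \<in> N +>\<^bsub>M\<^esub> x)) = q (h x)" by (simp add: coset)
  have car: "carrier (quotient_space M N) = ?C ` carrier M"
    unfolding quotient_space_def by (auto simp: A_RCOSETS_def' coset)
  have add: "?C x <+>\<^bsub>M\<^esub> ?C y = ?C (x \<oplus>\<^bsub>M\<^esub> y)" if x: "x \<in> carrier M" and y: "y \<in> carrier M" for x y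
  proof (intro Set.set_eqI iffI)
    fix w assume "w \<in> ?C x <+>\<^bsub>M\<^esub> ?C y"
    then show "w \<in> ?C (x \<oplus>\<^bsub>M\<^esub> y)"
      using x y by (auto simp: set_add_def' models_add[OF M] q_add models_in[OF M])
  next
    fix w assume "w \<in> ?C (x \<oplus>\<^bsub>M\<^esub> y)"
    then have w: "w \<in> carrier M" "q (h w) = q (h x) + q (h y)"
      using x y by (auto simp: models_add[OF M] q_add models_in[OF M])
    have "w = (w \<ominus>\<^bsub>M\<^esub> y) \<oplus>\<^bsub>M\<^esub> y"
      by (rule models_inj[OF M]) (use w y in \<open>simp_all add: models_minus[OF M] models_add[OF M]\<close>)
    moreover have "w \<ominus>\<^bsub>M\<^esub> y \<in> ?C x" using w y by (simp add: models_minus[OF M] qd models_in[OF M])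
    ultimately show "w \<in> ?C x <+>\<^bsub>M\<^esub> ?C y" using y unfolding set_add_def' by blast
  qed
  have smult: "(\<Union>y\<in>?C x. N +>\<^bsub>M\<^esub> (c \<odot>\<^bsub>M\<^esub> y)) = ?C (c \<odot>\<^bsub>M\<^esub> x)" if x: "x \<in> carrier M" for c x
    using x by (auto simp: coset models_smult[OF M] q_scale models_in[OF M])
  have zero: "N = ?C \<zero>\<^bsub>M\<^esub>" by (simp add: N models_zero[OF M] q0)
  have "bij_betw (\<lambda>X. q (h (SOME x. x \<in> X))) (?C ` carrier M) (q ` S)"
  proof (rule bij_betwI')
    fix X Y assume "X \<in> ?C ` carrier M" "Y \<in> ?C ` carrier M"
    then obtain x y where x: "x \<in> carrier M" "X = ?C x" and y: "y \<in> carrier M" "Y = ?C y" by blast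
    have "(q (h x) = q (h y)) = (?C x = ?C y)" using x(1) y(1) by force
    then show "(q (h (SOME x. x \<in> X)) = q (h (SOME x. x \<in> Y))) = (X = Y)"
      unfolding x(2) y(2) some[OF x(1)] some[OF y(1)] .
  next
    fix X assume "X \<in> ?C ` carrier M"
    then obtain x where x: "x \<in> carrier M" "X = ?C x" by blast
    show "q (h (SOME x. x \<in> X)) \<in> q ` S"
      unfolding x(2) some[OF x(1)] by (rule imageI[OF models_in[OF M x(1)]])
  next
    fix v assume "v \<in> q ` S"
    then obtain x where x: "x \<in> carrier M" "v = q (h x)" using models_obtain[OF M] by blast
    show "\<exists>X\<in>?C ` carrier M. v = q (h (SOME x. x \<in> X))"
      by (rule bexI[of _ "?C x"]) (use x some[OF x(1)] in auto)
  qed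
  moreover have "\<zero>\<^bsub>quotient_space M N\<^esub> = ?C \<zero>\<^bsub>M\<^esub>"
    using zero by (simp add: quotient_space_def)
  moreover have "?C x \<oplus>\<^bsub>quotient_space M N\<^esub> ?C y = ?C (x \<oplus>\<^bsub>M\<^esub> y)"
    if "x \<in> carrier M" "y \<in> carrier M" for x y
    using add[OF that] by (simp add: quotient_space_def)
  moreover have "c \<odot>\<^bsub>quotient_space M N\<^esub> ?C x = ?C (c \<odot>\<^bsub>M\<^esub> x)" if "x \<in> carrier M" for c x
    using smult[OF that] by (simp add: quotient_space_def)
  ultimately show "models s' (quotient_space M N) (\<lambda>X. q (h (SOME x. x \<in> X))) (q ` S)"
    unfolding models_def car ball_simps
    using s' some[OF models_zero(1)[OF M]] some[OF models_add(1)[OF M]] some[OF models_smult(1)[OF M]] some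
      models_zero[OF M] models_add[OF M] models_smult[OF M] models_in[OF M] q_add q_scale q0
      imageI[OF models_zero(1)[OF M], where f = ?C] imageI[OF models_add(1)[OF M], where f = ?C]
      imageI[OF models_smult(1)[OF M], where f = ?C]
    by (intro conjI allI ballI) (simp_all only:)
qed

lemma models_direct_sum:
  assumes M: "models s M h S" and N: "models s' N g S'"
  shows "models (\<lambda>c p. (s c (fst p), s' c (snd p))) (direct_sum M N) (\<lambda>p. (h (fst p), g (snd p))) (S \<times> S')"
proof -
  interpret V: vector_space s by (rule models_vs[OF M])
  interpret W: vector_space s' by (rule models_vs[OF N])
  have vs: "vector_space (\<lambda>c p. (s c (fst p), s' c (snd p)))"
    by unfold_locales (auto simp: V.scale_right_distrib V.scale_left_distrib W.scale_right_distrib W.scale_left_distrib plus_prod_def)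
  have "bij_betw (\<lambda>p. (h (fst p), g (snd p))) (carrier M \<times> carrier N) (S \<times> S')"
    using bij_betw_map_prod[OF models_bij[OF M] models_bij[OF N]] by (simp add: map_prod_def case_prod_unfold)
  then show ?thesis
    unfolding models_def direct_sum_def
    using vs models_zero[OF M] models_zero[OF N] models_add[OF M] models_add[OF N] models_smult[OF M] models_smult[OF N]
    by (auto simp: plus_prod_def zero_prod_def)
qed

lemma vector_space_fun:
  assumes "vector_space s"
  shows "vector_space (\<lambda>c f x. s c (f x))"
proof -
  interpret V: vector_space s by fact
  show ?thesis
    by unfold_locales (auto simp: V.scale_right_distrib V.scale_left_distrib fun_eq_iff)
qed

lemma vector_space_complex: "vector_space ((*) :: complex \<Rightarrow> complex \<Rightarrow> complex)"
  by unfold_locales (simp_all add: algebra_simps)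

subsection \<open>Tensor products\<close>

context
  fixes M :: "(complex, 'b, 'd) module_scheme" and N :: "(complex, 'c, 'e) module_scheme"
    and sM :: "complex \<Rightarrow> 'u::ab_group_add \<Rightarrow> 'u" and hM SM and sN :: "complex \<Rightarrow> 'v::ab_group_add \<Rightarrow> 'v" and hN SN
  assumes M: "models sM M hM SM" and N: "models sN N hN SN"
begin

abbreviation "FS \<equiv> free_space (carrier M \<times> carrier N)"

lemma models_free_space: "models (\<lambda>c f x. c * f x) FS (\<lambda>r. r) (carrier FS)"
  unfolding models_def
proof (intro conjI ballI allI)
  show "bij_betw (\<lambda>r. r) (carrier FS) (carrier FS)" by (simp add: bij_betw_def)
  show "vector_space (\<lambda>c (f :: 'b \<times> 'c \<Rightarrow> complex) x. c * f x)"
    by (rule vector_space_fun[OF vector_space_complex])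
  fix r r' assume r: "r \<in> carrier FS" "r' \<in> carrier FS"
  have "{x. r x + r' x \<noteq> 0} \<subseteq> {x. r x \<noteq> 0} \<union> {x. r' x \<noteq> 0}" by auto
  then show "r \<oplus>\<^bsub>FS\<^esub> r' \<in> carrier FS"
    using r by (auto simp: free_space_def intro: finite_subset)
next
  fix c r assume r: "r \<in> carrier FS"
  have "{x. c * r x \<noteq> 0} \<subseteq> {x. r x \<noteq> 0}" by auto
  then show "c \<odot>\<^bsub>FS\<^esub> r \<in> carrier FS"
    using r by (auto simp: free_space_def intro: finite_subset)
qed (auto simp: free_space_def fun_eq_iff)

lemma delta_FS: "x \<in> carrier M \<Longrightarrow> y \<in> carrier N \<Longrightarrow> delta (x, y) \<in> carrier FS"
  by (auto simp: free_space_def delta_def)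

lemma FS_simps: "r \<oplus>\<^bsub>FS\<^esub> r' = r + r'" "c \<odot>\<^bsub>FS\<^esub> r = (\<lambda>x. c * r x)" "\<zero>\<^bsub>FS\<^esub> = 0"
  by (auto simp: free_space_def fun_eq_iff)

lemma FS_closed: "r \<in> carrier FS \<Longrightarrow> r' \<in> carrier FS \<Longrightarrow> r + r' \<in> carrier FS"
  "r \<in> carrier FS \<Longrightarrow> r' \<in> carrier FS \<Longrightarrow> r - r' \<in> carrier FS"
  "r \<in> carrier FS \<Longrightarrow> (\<lambda>x. c * r x) \<in> carrier FS" "0 \<in> carrier FS"
  using models_S[OF models_free_space] by auto

lemma relators_FS: "tensor_relators M N \<subseteq> carrier FS"
proof -
  have e: "(\<lambda>p. f p - g p) = f - g" "(\<lambda>p. f p - g p - k p) = f - g - k"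
    for f g k :: "'b \<times> 'c \<Rightarrow> complex" by (auto simp: fun_eq_iff)
  show ?thesis
    unfolding tensor_relators_def e
    by (auto intro!: FS_closed delta_FS models_add(1)[OF M] models_add(1)[OF N] models_smult(1)[OF M] models_smult(1)[OF N])
qed

lemma kernel_submodule: "submodule class_ring (tensor_kernel M N) FS"
  unfolding tensor_kernel_def
  by (rule LinearCombinations.module.span_is_submodule[OF models_module[OF models_free_space] relators_FS])

lemma kernel_closed:
  "tensor_kernel M N \<subseteq> carrier FS" "0 \<in> tensor_kernel M N"
  "r \<in> tensor_kernel M N \<Longrightarrow> r' \<in> tensor_kernel M N \<Longrightarrow> r + r' \<in> tensor_kernel M N"
  "r \<in> tensor_kernel M N \<Longrightarrow> (\<lambda>x. c * r x) \<in> tensor_kernel M N"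
  "tensor_relators M N \<subseteq> tensor_kernel M N"
  using submodule.subset[OF kernel_submodule] submodule.zero_closed[OF kernel_submodule]
    submodule.m_closed[OF kernel_submodule] submodule.smult_closed[OF kernel_submodule]
    LinearCombinations.module.in_own_span[OF models_module[OF models_free_space] relators_FS]
  unfolding FS_simps tensor_kernel_def by auto

lemma kernel_minimal:
  assumes "\<And>r r'. r \<in> carrier FS \<Longrightarrow> r' \<in> carrier FS \<Longrightarrow> q (r + r') = q r + (q r' :: 't::ab_group_add)"
    and "\<And>c r. r \<in> carrier FS \<Longrightarrow> q r = 0 \<Longrightarrow> q (\<lambda>x. c * r x) = 0"
    and "\<And>r. r \<in> tensor_relators M N \<Longrightarrow> q r = 0" and r: "r \<in> tensor_kernel M N"
  shows "q r = 0"
proof -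
  interpret F: Module.module "class_ring :: complex ring" FS
    by (rule models_module[OF models_free_space])
  obtain a B where B: "finite B" "B \<subseteq> tensor_relators M N" "r = F.lincomb a B"
    using r unfolding tensor_kernel_def F.span_def by auto
  have q0: "q 0 = 0" using assms(1)[OF FS_closed(4) FS_closed(4)] by simp
  have "finsum FS (\<lambda>v. a v \<odot>\<^bsub>FS\<^esub> v) B \<in> carrier FS \<and> q (finsum FS (\<lambda>v. a v \<odot>\<^bsub>FS\<^esub> v) B) = 0"
    using B(1,2)
  proof (induction B rule: finite_induct)
    case empty
    show "finsum FS (\<lambda>v. a v \<odot>\<^bsub>FS\<^esub> v) {} \<in> carrier FS \<and> q (finsum FS (\<lambda>v. a v \<odot>\<^bsub>FS\<^esub> v) {}) = 0"
      unfolding F.finsum_empty FS_simps(3) using q0 FS_closed(4) by blast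
  next
    case (insert v B)
    have v: "v \<in> carrier FS" "v \<in> tensor_relators M N" using insert.prems relators_FS by auto
    let ?S = "finsum FS (\<lambda>v. a v \<odot>\<^bsub>FS\<^esub> v) B"
    have IH: "?S \<in> carrier FS" "q ?S = 0" using insert.IH insert.prems by auto
    have "finsum FS (\<lambda>v. a v \<odot>\<^bsub>FS\<^esub> v) (insert v B) = a v \<odot>\<^bsub>FS\<^esub> v \<oplus>\<^bsub>FS\<^esub> ?S"
    proof (rule F.finsum_insert[OF insert.hyps])
      show "(\<lambda>v. a v \<odot>\<^bsub>FS\<^esub> v) \<in> B \<rightarrow> carrier FS"
        using insert.prems relators_FS by (auto simp: FS_simps intro!: FS_closed(3))
      show "a v \<odot>\<^bsub>FS\<^esub> v \<in> carrier FS" using v by (auto simp: FS_simps intro!: FS_closed(3))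
    qed
    then have e: "finsum FS (\<lambda>v. a v \<odot>\<^bsub>FS\<^esub> v) (insert v B) = (\<lambda>x. a v * v x) + ?S"
      by (simp only: FS_simps)
    have c: "(\<lambda>x. a v * v x) \<in> carrier FS" by (rule FS_closed(3)[OF v(1)])
    show "finsum FS (\<lambda>v. a v \<odot>\<^bsub>FS\<^esub> v) (insert v B) \<in> carrier FS
       \<and> q (finsum FS (\<lambda>v. a v \<odot>\<^bsub>FS\<^esub> v) (insert v B)) = 0"
      unfolding e assms(1)[OF c IH(1)] IH(2) assms(2)[OF v(1) assms(3)[OF v(2)]]
      using FS_closed(1)[OF c IH(1)] by simp
  qed
  then show ?thesis unfolding B(3) F.lincomb_def by blast
qed

lemma kernel_diff: "r \<in> tensor_kernel M N \<Longrightarrow> r' \<in> tensor_kernel M N \<Longrightarrow> r - r' \<in> tensor_kernel M N"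
proof -
  assume r: "r \<in> tensor_kernel M N" "r' \<in> tensor_kernel M N"
  have "r - r' = r + (\<lambda>x. - 1 * r' x)" by (simp add: fun_eq_iff)
  then show ?thesis using kernel_closed(3)[OF r(1) kernel_closed(4)[OF r(2), of "-1"]] by (simp only:)
qed

lemma kernel_uminus: "r \<in> tensor_kernel M N \<Longrightarrow> - r \<in> tensor_kernel M N"
  using kernel_diff[OF kernel_closed(2), of r] by simp

lemma kernel_sum: "(\<And>i. i \<in> I \<Longrightarrow> f i \<in> tensor_kernel M N) \<Longrightarrow> (\<Sum>i\<in>I. f i) \<in> tensor_kernel M N"
  by (induction I rule: infinite_finite_induct) (auto intro: kernel_closed)

lemma kernel_relators:
  "x \<in> carrier M \<Longrightarrow> x' \<in> carrier M \<Longrightarrow> y \<in> carrier N \<Longrightarrow>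
     delta (x \<oplus>\<^bsub>M\<^esub> x', y) - delta (x, y) - delta (x', y) \<in> tensor_kernel M N"
  "x \<in> carrier M \<Longrightarrow> y \<in> carrier N \<Longrightarrow> y' \<in> carrier N \<Longrightarrow>
     delta (x, y \<oplus>\<^bsub>N\<^esub> y') - delta (x, y) - delta (x, y') \<in> tensor_kernel M N"
  "x \<in> carrier M \<Longrightarrow> y \<in> carrier N \<Longrightarrow>
     delta (c \<odot>\<^bsub>M\<^esub> x, y) - (\<lambda>p. c * delta (x, y) p) \<in> tensor_kernel M N"
  "x \<in> carrier M \<Longrightarrow> y \<in> carrier N \<Longrightarrow>
     delta (x, c \<odot>\<^bsub>N\<^esub> y) - (\<lambda>p. c * delta (x, y) p) \<in> tensor_kernel M N"
  by (rule subsetD[OF kernel_closed(5)], unfold tensor_relators_def fun_diff_def,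
      intro UnI1 CollectI exI conjI, rule refl, assumption+)
    (rule subsetD[OF kernel_closed(5)], unfold tensor_relators_def fun_diff_def,
      rule UnI1, rule UnI1, rule UnI2, intro CollectI exI conjI, rule refl, assumption+,
     rule subsetD[OF kernel_closed(5)], unfold tensor_relators_def fun_diff_def,
      rule UnI1, rule UnI2, intro CollectI exI conjI, rule refl, assumption+,
     rule subsetD[OF kernel_closed(5)], unfold tensor_relators_def fun_diff_def,
      rule UnI2, intro CollectI exI conjI, rule refl, assumption+)

end

definition tensor_eval :: "(complex \<Rightarrow> 't \<Rightarrow> 't::ab_group_add) \<Rightarrow> ('b \<Rightarrow> 'c \<Rightarrow> 't) \<Rightarrow> ('b \<times> 'c \<Rightarrow> complex) \<Rightarrow> 't" where
  "tensor_eval s b r = (\<Sum>p | r p \<noteq> 0. s (r p) (b (fst p) (snd p)))"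

lemma tensor_eval_delta:
  assumes "vector_space s"
  shows "tensor_eval s b (delta (x, y)) = b x y"
proof -
  interpret V: vector_space s by fact
  have "{p. delta (x, y) p \<noteq> 0} = {(x, y)}" by (auto simp: delta_def)
  then show ?thesis by (simp add: tensor_eval_def delta_def)
qed

lemma tensor_eval_superset:
  assumes "vector_space s" "finite P" "{p. r p \<noteq> 0} \<subseteq> P"
  shows "tensor_eval s b r = (\<Sum>p\<in>P. s (r p) (b (fst p) (snd p)))"
proof -
  interpret V: vector_space s by fact
  show ?thesis unfolding tensor_eval_def
    using assms(2,3) by (intro sum.mono_neutral_left) auto
qed

lemma tensor_eval_add:
  assumes "vector_space s" "finite {p. r p \<noteq> 0}" "finite {p. r' p \<noteq> 0}"
  shows "tensor_eval s b (r + r') = tensor_eval s b r + tensor_eval s b r'"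
proof -
  interpret V: vector_space s by fact
  let ?P = "{p. r p \<noteq> 0} \<union> {p. r' p \<noteq> 0}"
  have P: "finite ?P" "{p. (r + r') p \<noteq> 0} \<subseteq> ?P" "{p. r p \<noteq> 0} \<subseteq> ?P" "{p. r' p \<noteq> 0} \<subseteq> ?P"
    using assms by auto
  show ?thesis
    unfolding tensor_eval_superset[OF assms(1) P(1,2)] tensor_eval_superset[OF assms(1) P(1,3)]
      tensor_eval_superset[OF assms(1) P(1,4)]
    by (simp add: V.scale_left_distrib sum.distrib)
qed

lemma tensor_eval_scale:
  assumes "vector_space s" "finite {p. r p \<noteq> 0}"
  shows "tensor_eval s b (\<lambda>x. c * r x) = s c (tensor_eval s b r)"
proof -
  interpret V: vector_space s by fact
  have P: "{p. c * r p \<noteq> 0} \<subseteq> {p. r p \<noteq> 0}" by auto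
  have "tensor_eval s b (\<lambda>x. c * r x) = (\<Sum>p | r p \<noteq> 0. s (c * r p) (b (fst p) (snd p)))"
    by (rule tensor_eval_superset[OF assms(1,2) P])
  then show ?thesis by (simp add: tensor_eval_def V.scale_sum_right)
qed

text \<open>A criterion for a bilinear map b to exhibit the tensor product. It suffices to have a
  section \<sigma> of the evaluation that is linear modulo the relations and, modulo them, inverse
  to b on pairs. Then each formal combination is congruent to \<sigma> of its value, so the
  evaluation vanishes only on the relations.\<close>

lemma models_tensor:
  assumes M: "models sM M hM SM" and N: "models sN N hN SN" and vs: "vector_space s"
    and bil: "\<And>x x' y. x \<in> carrier M \<Longrightarrow> x' \<in> carrier M \<Longrightarrow> y \<in> carrier N \<Longrightarrow> b (x \<oplus>\<^bsub>M\<^esub> x') y = b x y + b x' y"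
      "\<And>x y y'. x \<in> carrier M \<Longrightarrow> y \<in> carrier N \<Longrightarrow> y' \<in> carrier N \<Longrightarrow> b x (y \<oplus>\<^bsub>N\<^esub> y') = b x y + b x y'"
      "\<And>c x y. x \<in> carrier M \<Longrightarrow> y \<in> carrier N \<Longrightarrow> b (c \<odot>\<^bsub>M\<^esub> x) y = s c (b x y)"
      "\<And>c x y. x \<in> carrier M \<Longrightarrow> y \<in> carrier N \<Longrightarrow> b x (c \<odot>\<^bsub>N\<^esub> y) = s c (b x y)"
    and S: "\<And>x y. x \<in> carrier M \<Longrightarrow> y \<in> carrier N \<Longrightarrow> b x y \<in> S" "0 \<in> S"
      "\<And>v w. v \<in> S \<Longrightarrow> w \<in> S \<Longrightarrow> v + w \<in> S" "\<And>c v. v \<in> S \<Longrightarrow> s c v \<in> S"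
    and \<sigma>: "\<And>v. v \<in> S \<Longrightarrow> \<sigma> v \<in> carrier (free_space (carrier M \<times> carrier N))"
      "\<And>v w. v \<in> S \<Longrightarrow> w \<in> S \<Longrightarrow> \<sigma> (v + w) - \<sigma> v - \<sigma> w \<in> tensor_kernel M N"
      "\<And>c v. v \<in> S \<Longrightarrow> \<sigma> (s c v) - (\<lambda>p. c * \<sigma> v p) \<in> tensor_kernel M N"
      "\<And>x y. x \<in> carrier M \<Longrightarrow> y \<in> carrier N \<Longrightarrow> delta (x, y) - \<sigma> (b x y) \<in> tensor_kernel M N"
      "\<And>v. v \<in> S \<Longrightarrow> tensor_eval s b (\<sigma> v) = v"
  shows "models s (tensor_space M N) (\<lambda>X. tensor_eval s b (SOME r. r \<in> X)) S"
    "x \<in> carrier M \<Longrightarrow> y \<in> carrier N \<Longrightarrow> tensor_eval s b (SOME r. r \<in> pure_tensor M N x y) = b x y"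
proof -
  interpret V: vector_space s by (rule vs)
  let ?FS = "free_space (carrier M \<times> carrier N)" and ?K = "tensor_kernel M N" and ?t = "tensor_eval s b"
  note F = models_free_space[OF M N] and K = kernel_closed[OF M N]
  have fin: "r \<in> carrier ?FS \<Longrightarrow> finite {p. r p \<noteq> 0}" for r by (simp add: free_space_def)
  have t_add: "?t (r + r') = ?t r + ?t r'" if "r \<in> carrier ?FS" "r' \<in> carrier ?FS" for r r'
    by (rule tensor_eval_add[OF vs fin[OF that(1)] fin[OF that(2)]])
  have t_scale: "?t (\<lambda>x. c * r x) = s c (?t r)" if "r \<in> carrier ?FS" for c r
    by (rule tensor_eval_scale[OF vs fin[OF that]])
  have t_diff: "?t (r - r') = ?t r - ?t r'" if "r \<in> carrier ?FS" "r' \<in> carrier ?FS" for r r'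
    using t_add[OF FS_closed(2)[OF M N that] that(2)] by simp
  note dl = delta_FS[OF M N] and td = tensor_eval_delta[OF vs]
  have t_rel1: "?t (delta (x \<oplus>\<^bsub>M\<^esub> x', y) - delta (x, y) - delta (x', y)) = 0"
    if "x \<in> carrier M" "x' \<in> carrier M" "y \<in> carrier N" for x x' y
    using that by (simp add: t_diff td dl FS_closed[OF M N] bil models_add(1)[OF M])
  have t_rel2: "?t (delta (x, y \<oplus>\<^bsub>N\<^esub> y') - delta (x, y) - delta (x, y')) = 0"
    if "x \<in> carrier M" "y \<in> carrier N" "y' \<in> carrier N" for x y y'
    using that by (simp add: t_diff td dl FS_closed[OF M N] bil models_add(1)[OF N])
  have t_rel3: "?t (delta (c \<odot>\<^bsub>M\<^esub> x, y) - (\<lambda>p. c * delta (x, y) p)) = 0"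
    if "x \<in> carrier M" "y \<in> carrier N" for c x y
    using that by (simp add: t_diff t_scale td dl FS_closed[OF M N] bil models_smult(1)[OF M])
  have t_rel4: "?t (delta (x, c \<odot>\<^bsub>N\<^esub> y) - (\<lambda>p. c * delta (x, y) p)) = 0"
    if "x \<in> carrier M" "y \<in> carrier N" for c x y
    using that by (simp add: t_diff t_scale td dl FS_closed[OF M N] bil models_smult(1)[OF N])
  have t_rel: "?t r = 0" if "r \<in> tensor_relators M N" for r
    using that unfolding tensor_relators_def
    by (elim UnE CollectE exE conjE)
      (use t_rel1 t_rel2 t_rel3 t_rel4 in \<open>simp_all only: fun_diff_def\<close>)
  have t_K: "?t r = 0" if "r \<in> ?K" for r
    by (rule kernel_minimal[OF M N t_add _ t_rel that]) (simp_all add: t_scale)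
  have \<sigma>0: "\<sigma> 0 \<in> ?K"
  proof -
    have "\<sigma> (s 0 0) - (\<lambda>p. 0 * \<sigma> 0 p) \<in> ?K" by (rule \<sigma>(3)[OF S(2)])
    moreover have "\<sigma> (s 0 0) - (\<lambda>p. 0 * \<sigma> 0 p) = \<sigma> 0" by (simp add: fun_eq_iff)
    ultimately show ?thesis by simp
  qed
  \<comment> \<open>P need not be the whole support of r, so that one pair at a time can be
    added.\<close>
  have key: "(\<lambda>x. if x \<in> P then r x else 0) - \<sigma> (\<Sum>p\<in>P. s (r p) (b (fst p) (snd p))) \<in> ?K
      \<and> (\<Sum>p\<in>P. s (r p) (b (fst p) (snd p))) \<in> S"
    if "finite P" "P \<subseteq> carrier M \<times> carrier N" for P r
    using that
  proof (induction P rule: finite_induct)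
    case empty
    have e: "(\<lambda>x. if x \<in> {} then r x else 0) - \<sigma> 0 = - \<sigma> 0" by (rule ext) simp
    show "(\<lambda>x. if x \<in> {} then r x else 0) - \<sigma> (\<Sum>p\<in>{}. s (r p) (b (fst p) (snd p))) \<in> ?K
      \<and> (\<Sum>p\<in>{}. s (r p) (b (fst p) (snd p))) \<in> S"
      unfolding sum.empty e by (intro conjI kernel_uminus[OF M N \<sigma>0] S(2))
  next
    case (insert p P)
    obtain x y where p: "p = (x, y)" "x \<in> carrier M" "y \<in> carrier N" using insert.prems by auto
    let ?v = "s (r p) (b x y)" and ?w = "\<Sum>p\<in>P. s (r p) (b (fst p) (snd p))"
    let ?R = "\<lambda>P x. if x \<in> P then r x else 0"
    have "P \<subseteq> carrier M \<times> carrier N" using insert.prems by blast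
    note IH = insert.IH[OF this]
    note w = conjunct1[OF IH] conjunct2[OF IH]
    have v: "?v \<in> S" by (rule S(4)[OF S(1)[OF p(2,3)]])
    have "?R (insert p P) q = ?R P q + r p * delta (x, y) q" for q
      using insert.hyps(2) p(1) by (simp add: delta_def)
    then have R: "?R (insert p P) = ?R P + (\<lambda>q. r p * delta (x, y) q)" by (intro ext) (simp only: plus_fun_def)
    have "?R P + (\<lambda>q. r p * delta (x, y) q) - \<sigma> (?v + ?w) = (?R P - \<sigma> ?w) - (\<sigma> (?v + ?w) - \<sigma> ?v - \<sigma> ?w)
      - (\<sigma> ?v - (\<lambda>q. r p * \<sigma> (b x y) q)) + (\<lambda>q. r p * (delta (x, y) - \<sigma> (b x y)) q)"
      by (rule ext) (simp add: algebra_simps)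
    also have "\<dots> \<in> ?K"
      by (rule K(3)[OF kernel_diff[OF M N kernel_diff[OF M N w(1) \<sigma>(2)[OF v w(2)]] \<sigma>(3)[OF S(1)[OF p(2,3)]]] K(4)[OF \<sigma>(4)[OF p(2,3)]]])
    finally have k: "?R (insert p P) - \<sigma> (?v + ?w) \<in> ?K" unfolding R .
    have sm: "(\<Sum>p\<in>insert p P. s (r p) (b (fst p) (snd p))) = ?v + ?w"
      using sum.insert[OF insert.hyps(1,2), of "\<lambda>p. s (r p) (b (fst p) (snd p))"] unfolding p(1) fst_conv snd_conv .
    show "?R (insert p P) - \<sigma> (\<Sum>p\<in>insert p P. s (r p) (b (fst p) (snd p))) \<in> ?K
      \<and> (\<Sum>p\<in>insert p P. s (r p) (b (fst p) (snd p))) \<in> S"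
      unfolding sm by (rule conjI[OF k S(3)[OF v w(2)]])
  qed
  have key': "r - \<sigma> (?t r) \<in> ?K" "?t r \<in> S" if r: "r \<in> carrier ?FS" for r
  proof -
    have P: "finite {p. r p \<noteq> 0}" "{p. r p \<noteq> 0} \<subseteq> carrier M \<times> carrier N" using r by (auto simp: free_space_def)
    have "(\<lambda>x. if x \<in> {p. r p \<noteq> 0} then r x else 0) = r" by (auto simp: fun_eq_iff)
    then show "r - \<sigma> (?t r) \<in> ?K" "?t r \<in> S" using key[OF P, of r] unfolding tensor_eval_def by auto
  qed
  have Keq: "?K = {r \<in> carrier ?FS. ?t r = 0}"
  proof (intro equalityI subsetI)
    fix r assume "r \<in> ?K"
    then show "r \<in> {r \<in> carrier ?FS. ?t r = 0}" using t_K K(1) by auto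
  next
    fix r assume "r \<in> {r \<in> carrier ?FS. ?t r = 0}"
    then have "r - \<sigma> 0 \<in> ?K" using key'(1)[of r] by auto
    then have "r - \<sigma> 0 + \<sigma> 0 \<in> ?K" using \<sigma>0 K(3) by blast
    then show "r \<in> ?K" by simp
  qed
  have img: "?t ` carrier ?FS = S"
  proof (intro equalityI subsetI)
    fix v assume "v \<in> S"
    then have "v = ?t (\<sigma> v)" "\<sigma> v \<in> carrier ?FS" using \<sigma>(1,5) by auto
    then show "v \<in> ?t ` carrier ?FS" by blast
  qed (use key'(2) in auto)
  have "models s (quotient_space ?FS ?K) (\<lambda>X. ?t (SOME r. r \<in> X)) (?t ` carrier ?FS)"
    by (rule models_quotient(1)[where q = ?t, OF F vs])
      (erule (1) t_add, erule t_scale, rule Keq)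
  then show "models s (tensor_space M N) (\<lambda>X. ?t (SOME r. r \<in> X)) S"
    unfolding img tensor_space_def .
  have "?t (SOME r. r \<in> ?K +>\<^bsub>?FS\<^esub> delta (x, y)) = ?t (delta (x, y))" if "x \<in> carrier M" "y \<in> carrier N"
    by (rule models_quotient(2)[where q = ?t, OF F vs])
      (erule (1) t_add, erule t_scale, rule Keq, rule dl[OF that])
  then show "?t (SOME r. r \<in> pure_tensor M N x y) = b x y" if "x \<in> carrier M" "y \<in> carrier N"
    using that unfolding td pure_tensor_def by blast
qed


lemma models_inv:
  assumes M: "models s M h S"
  shows "v \<in> S \<Longrightarrow> inv_into (carrier M) h v \<in> carrier M" "v \<in> S \<Longrightarrow> h (inv_into (carrier M) h v) = v"
    "x \<in> carrier M \<Longrightarrow> inv_into (carrier M) h (h x) = x"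
    "v \<in> S \<Longrightarrow> w \<in> S \<Longrightarrow> inv_into (carrier M) h (v + w) = inv_into (carrier M) h v \<oplus>\<^bsub>M\<^esub> inv_into (carrier M) h w"
    "v \<in> S \<Longrightarrow> inv_into (carrier M) h (s c v) = c \<odot>\<^bsub>M\<^esub> inv_into (carrier M) h v"
proof -
  have 1: "inv_into (carrier M) h v \<in> carrier M" "h (inv_into (carrier M) h v) = v" if "v \<in> S" for v
    using models_bij[OF M] that by (auto simp: bij_betw_def inv_into_into f_inv_into_f)
  have 2: "inv_into (carrier M) h (h x) = x" if "x \<in> carrier M" for x
    using models_bij[OF M] that by (auto simp: bij_betw_def)
  show "v \<in> S \<Longrightarrow> inv_into (carrier M) h v \<in> carrier M" "v \<in> S \<Longrightarrow> h (inv_into (carrier M) h v) = v"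
    "x \<in> carrier M \<Longrightarrow> inv_into (carrier M) h (h x) = x" using 1 2 by auto
  show "inv_into (carrier M) h (v + w) = inv_into (carrier M) h v \<oplus>\<^bsub>M\<^esub> inv_into (carrier M) h w"
    if "v \<in> S" "w \<in> S" using 2[OF models_add(1)[OF M 1(1)[OF that(1)] 1(1)[OF that(2)]]] 1 that
    by (simp add: models_add[OF M])
  show "inv_into (carrier M) h (s c v) = c \<odot>\<^bsub>M\<^esub> inv_into (carrier M) h v" if "v \<in> S"
    using 2[OF models_smult(1)[OF M 1(1)[OF that]]] 1 that by (simp add: models_smult[OF M])
qed

section \<open>Tensor product with a finite-dimensional factor\<close>

definition unit_at :: "nat \<Rightarrow> nat \<Rightarrow> complex" where
  "unit_at a = (\<lambda>b. if b = a then 1 else 0)"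

lemma models_basis:
  fixes \<kappa> :: "'c \<Rightarrow> nat \<Rightarrow> complex"
  assumes N: "models (\<lambda>c f x. c * f x) N \<kappa> {u. \<forall>a\<ge>n. u a = 0}" and y: "y \<in> carrier N"
  shows "a < n \<Longrightarrow> inv_into (carrier N) \<kappa> (unit_at a) \<in> carrier N"
    "finsum N (\<lambda>a. \<kappa> y a \<odot>\<^bsub>N\<^esub> inv_into (carrier N) \<kappa> (unit_at a)) {..<n} = y"
    "a < n \<Longrightarrow> \<kappa> (inv_into (carrier N) \<kappa> (unit_at a)) = unit_at a"
proof -
  have u: "unit_at a \<in> {u. \<forall>a\<ge>n. u a = 0}" if "a < n" for a using that by (auto simp: unit_at_def)
  note e = models_inv(1)[OF N u] models_inv(2)[OF N u]
  show "a < n \<Longrightarrow> inv_into (carrier N) \<kappa> (unit_at a) \<in> carrier N"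
    "a < n \<Longrightarrow> \<kappa> (inv_into (carrier N) \<kappa> (unit_at a)) = unit_at a" by (rule e(1) e(2), assumption)+
  have c: "\<And>a. a \<in> {..<n} \<Longrightarrow> \<kappa> y a \<odot>\<^bsub>N\<^esub> inv_into (carrier N) \<kappa> (unit_at a) \<in> carrier N"
    using models_smult(1)[OF N] e(1) by auto
  let ?F = "\<lambda>a. \<kappa> y a \<odot>\<^bsub>N\<^esub> inv_into (carrier N) \<kappa> (unit_at a)"
  have S: "finsum N ?F {..<n} \<in> carrier N" "\<kappa> (finsum N ?F {..<n}) = (\<Sum>a<n. \<kappa> (?F a))"
    by (rule models_finsum[OF N finite_lessThan], erule c)+
  show "finsum N (\<lambda>a. \<kappa> y a \<odot>\<^bsub>N\<^esub> inv_into (carrier N) \<kappa> (unit_at a)) {..<n} = y"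
  proof (rule models_inj[OF N S(1) y])
    have "\<kappa> (\<kappa> y a \<odot>\<^bsub>N\<^esub> inv_into (carrier N) \<kappa> (unit_at a)) = (\<lambda>b. \<kappa> y a * unit_at a b)" if "a < n" for a
      using models_smult(2)[OF N e(1)[OF that]] e(2)[OF that] by simp
    then have "(\<Sum>a<n. \<kappa> (\<kappa> y a \<odot>\<^bsub>N\<^esub> inv_into (carrier N) \<kappa> (unit_at a))) = (\<Sum>a<n. (\<lambda>b. \<kappa> y a * unit_at a b))"
      by (intro sum.cong) auto
    also have "\<dots> = \<kappa> y"
    proof (rule ext)
      fix b
      have "(\<Sum>a<n. (\<lambda>b. \<kappa> y a * unit_at a b)) b = (\<Sum>a<n. if b = a then \<kappa> y a else 0)"
        by (induction n) (simp_all add: unit_at_def)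
      then show "(\<Sum>a<n. (\<lambda>b. \<kappa> y a * unit_at a b)) b = \<kappa> y b"
        using models_in[OF N y] by (simp add: sum.delta)
    qed
    finally show "\<kappa> (finsum N (\<lambda>a. \<kappa> y a \<odot>\<^bsub>N\<^esub> inv_into (carrier N) \<kappa> (unit_at a)) {..<n}) = \<kappa> y"
      unfolding S(2) .
  qed
qed

lemma kernel_finsum:
  assumes M: "models sM M hM SM" and N: "models sN N hN SN" and "finite I"
  shows "x \<in> carrier M \<Longrightarrow> (\<And>i. i \<in> I \<Longrightarrow> g i \<in> carrier N) \<Longrightarrow>
      delta (x, finsum N g I) - (\<Sum>i\<in>I. delta (x, g i)) \<in> tensor_kernel M N"
    "y \<in> carrier N \<Longrightarrow> (\<And>i. i \<in> I \<Longrightarrow> f i \<in> carrier M) \<Longrightarrow>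
      delta (finsum M f I, y) - (\<Sum>i\<in>I. delta (f i, y)) \<in> tensor_kernel M N"
proof -
  interpret A: abelian_group M by (rule models_abelian_group[OF M])
  interpret B: abelian_group N by (rule models_abelian_group[OF N])
  note K = kernel_closed[OF M N] and R = kernel_relators[OF M N]
  show "delta (x, finsum N g I) - (\<Sum>i\<in>I. delta (x, g i)) \<in> tensor_kernel M N"
    if x: "x \<in> carrier M" and g: "\<And>i. i \<in> I \<Longrightarrow> g i \<in> carrier N"
    using \<open>finite I\<close> g
  proof (induction I rule: finite_induct)
    case empty
    have "delta (x, \<zero>\<^bsub>N\<^esub> \<oplus>\<^bsub>N\<^esub> \<zero>\<^bsub>N\<^esub>) - delta (x, \<zero>\<^bsub>N\<^esub>) - delta (x, \<zero>\<^bsub>N\<^esub>) \<in> tensor_kernel M N"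
      by (rule R(2)[OF x]) simp_all
    then have "- (delta (x, \<zero>\<^bsub>N\<^esub>)) \<in> tensor_kernel M N" by simp
    from kernel_uminus[OF M N this] show ?case by simp
  next
    case (insert i I)
    have g: "g i \<in> carrier N" "\<And>j. j \<in> I \<Longrightarrow> g j \<in> carrier N" using insert.prems by auto
    have s: "finsum N g I \<in> carrier N" using g by (intro B.finsum_closed) auto
    have f: "finsum N g (insert i I) = g i \<oplus>\<^bsub>N\<^esub> finsum N g I"
      using g insert.hyps by (intro B.finsum_insert) auto
    have "(delta (x, g i \<oplus>\<^bsub>N\<^esub> finsum N g I) - delta (x, g i) - delta (x, finsum N g I))
        + (delta (x, finsum N g I) - (\<Sum>i\<in>I. delta (x, g i))) \<in> tensor_kernel M N"
      by (rule K(3)[OF R(2)[OF x g(1) s] insert.IH[OF g(2)]])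
    then show "delta (x, finsum N g (insert i I)) - (\<Sum>i\<in>insert i I. delta (x, g i)) \<in> tensor_kernel M N"
      unfolding f sum.insert[OF insert.hyps] by (simp add: algebra_simps)
  qed
  show "delta (finsum M f I, y) - (\<Sum>i\<in>I. delta (f i, y)) \<in> tensor_kernel M N"
    if y: "y \<in> carrier N" and f: "\<And>i. i \<in> I \<Longrightarrow> f i \<in> carrier M"
    using \<open>finite I\<close> f
  proof (induction I rule: finite_induct)
    case empty
    have "delta (\<zero>\<^bsub>M\<^esub> \<oplus>\<^bsub>M\<^esub> \<zero>\<^bsub>M\<^esub>, y) - delta (\<zero>\<^bsub>M\<^esub>, y) - delta (\<zero>\<^bsub>M\<^esub>, y) \<in> tensor_kernel M N"
      by (rule R(1)[OF _ _ y]) simp_all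
    then have "- (delta (\<zero>\<^bsub>M\<^esub>, y)) \<in> tensor_kernel M N" by simp
    from kernel_uminus[OF M N this] show ?case by simp
  next
    case (insert i I)
    have g: "f i \<in> carrier M" "\<And>j. j \<in> I \<Longrightarrow> f j \<in> carrier M" using insert.prems by auto
    have s: "finsum M f I \<in> carrier M" using g by (intro A.finsum_closed) auto
    have e: "finsum M f (insert i I) = f i \<oplus>\<^bsub>M\<^esub> finsum M f I"
      using g insert.hyps by (intro A.finsum_insert) auto
    have "(delta (f i \<oplus>\<^bsub>M\<^esub> finsum M f I, y) - delta (f i, y) - delta (finsum M f I, y))
        + (delta (finsum M f I, y) - (\<Sum>i\<in>I. delta (f i, y))) \<in> tensor_kernel M N"
      by (rule K(3)[OF R(1)[OF g(1) s y] insert.IH[OF g(2)]])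
    then show "delta (finsum M f (insert i I), y) - (\<Sum>i\<in>insert i I. delta (f i, y)) \<in> tensor_kernel M N"
      unfolding e sum.insert[OF insert.hyps] by (simp add: algebra_simps)
  qed
qed

lemma sum_FS:
  assumes M: "models sM M hM SM" and N: "models sN N hN SN"
    and "\<And>i. i \<in> I \<Longrightarrow> f i \<in> carrier (free_space (carrier M \<times> carrier N))"
  shows "(\<Sum>i\<in>I. f i) \<in> carrier (free_space (carrier M \<times> carrier N))"
  using assms(3)
  by (induction I rule: infinite_finite_induct)
    (simp_all add: FS_closed(1)[OF M N], simp_all add: free_space_def)

lemma tensor_eval_sum_delta:
  assumes vs: "vector_space s" and "finite I"
  shows "tensor_eval s b (\<Sum>i\<in>I. delta (f i, g i)) = (\<Sum>i\<in>I. b (f i) (g i))"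
  using \<open>finite I\<close>
proof (induction I rule: finite_induct)
  case empty
  show ?case by (simp add: tensor_eval_def)
next
  case (insert i I)
  have fin: "finite {p. (\<Sum>i\<in>I. delta (f i, g i)) p \<noteq> 0}"
    by (rule finite_subset[of _ "(\<lambda>i. (f i, g i)) ` I"])
      (use insert.hyps in \<open>auto simp: sum_fun_apply delta_def elim!: sum.not_neutral_contains_not_neutral split: if_splits\<close>)
  have fin1: "finite {p. delta (f i, g i) p \<noteq> 0}"
    by (rule finite_subset[of _ "{(f i, g i)}"]) (auto simp: delta_def)
  show ?case
    unfolding sum.insert[OF insert.hyps] tensor_eval_add[OF vs fin1 fin] tensor_eval_delta[OF vs] insert.IH ..
qed

context
  fixes sM :: "complex \<Rightarrow> 'u \<Rightarrow> 'u::ab_group_add" and M :: "(complex, 'b, 'e) module_scheme" and hM SM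
    and N :: "(complex, 'c, 'f) module_scheme" and \<kappa> :: "'c \<Rightarrow> nat \<Rightarrow> complex" and n :: nat
  assumes M: "models sM M hM SM" and N: "models (\<lambda>c f x. c * f x) N \<kappa> {u. \<forall>a\<ge>n. u a = 0}"
begin

text \<open>Expanding N in its basis identifies the tensor product with n-tuples in M. Both orders
  of the factors are treated: one serves A \<otimes> W, the other the tensor product of \<complex>^m
  with cohomology.\<close>

lemma models_tensor_finite:
  defines "b \<equiv> \<lambda>x y a. sM (\<kappa> y a) (hM x)"
    and "s \<equiv> \<lambda>c f a. sM c (f a)"
  shows "models s (tensor_space M N) (\<lambda>X. tensor_eval s b (SOME r. r \<in> X))
      {f. (\<forall>a<n. f a \<in> SM) \<and> (\<forall>a\<ge>n. f a = 0)}"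
    and "x \<in> carrier M \<Longrightarrow> y \<in> carrier N \<Longrightarrow> tensor_eval s b (SOME r. r \<in> pure_tensor M N x y) = b x y"
    and "models s (tensor_space N M) (\<lambda>X. tensor_eval s (\<lambda>y x. b x y) (SOME r. r \<in> X))
      {f. (\<forall>a<n. f a \<in> SM) \<and> (\<forall>a\<ge>n. f a = 0)}"
proof -
  interpret V: vector_space sM by (rule models_vs[OF M])
  let ?S = "{f. (\<forall>a<n. f a \<in> SM) \<and> (\<forall>a\<ge>n. f a = 0)}"
  let ?i = "inv_into (carrier M) hM" and ?e = "\<lambda>a. inv_into (carrier N) \<kappa> (unit_at a)"
  have vs: "vector_space s" unfolding s_def by (rule vector_space_fun[OF models_vs[OF M]])
  note y0 = models_zero(1)[OF N] and i = models_inv[OF M]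
  note e = models_basis(1)[OF N y0] and \<kappa>e = models_basis(3)[OF N y0]
  have \<kappa>0: "\<kappa> y a = 0" if "y \<in> carrier N" "a \<ge> n" for y a using models_in[OF N that(1)] that(2) by auto
  have bil: "b (x \<oplus>\<^bsub>M\<^esub> x') y = b x y + b x' y" "b x (y \<oplus>\<^bsub>N\<^esub> y') = b x y + b x y'"
    "b (c \<odot>\<^bsub>M\<^esub> x) y = s c (b x y)" "b x (c \<odot>\<^bsub>N\<^esub> y) = s c (b x y)"
    if "x \<in> carrier M" "x' \<in> carrier M" "y \<in> carrier N" "y' \<in> carrier N" for x x' y y' c
    using that
    by (simp_all add: b_def s_def fun_eq_iff models_add[OF M] models_add[OF N] models_smult[OF M]
        models_smult[OF N] V.scale_right_distrib V.scale_left_distrib mult.commute)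
  have S: "b x y \<in> ?S" if "x \<in> carrier M" "y \<in> carrier N" for x y
    using models_in[OF M that(1)] models_S[OF M] \<kappa>0[OF that(2)] by (simp add: b_def)
  have S0: "0 \<in> ?S" using models_S[OF M] by simp
  have S': "v + w \<in> ?S" if "v \<in> ?S" "w \<in> ?S" for v w using that models_S[OF M] by simp
  have S'': "s c v \<in> ?S" if "v \<in> ?S" for c v using that models_S[OF M] by (simp add: s_def)
  have ib: "?i (b x y a) = \<kappa> y a \<odot>\<^bsub>M\<^esub> x" if "x \<in> carrier M" for x y a
    using i(5)[OF models_in[OF M that]] i(3)[OF that] by (simp add: b_def)
  have be: "(\<Sum>a<n. b (?i (v a)) (?e a)) = v" if "v \<in> ?S" for v
  proof
    fix c
    have "b (?i (v a)) (?e a) c = (if c = a then v a else 0)" if a: "a < n" for a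
    proof -
      have "hM (?i (v a)) = v a" by (rule i(2)) (use \<open>v \<in> ?S\<close> a in blast)
      then show ?thesis unfolding b_def \<kappa>e[OF a] by (simp add: unit_at_def)
    qed
    then have "(\<Sum>a<n. b (?i (v a)) (?e a) c) = (\<Sum>a<n. if c = a then v a else 0)"
      by (intro sum.cong) simp_all
    then show "(\<Sum>a<n. b (?i (v a)) (?e a)) c = v c"
      using that by (simp add: sum_fun_apply sum.delta)
  qed
  show "models s (tensor_space M N) (\<lambda>X. tensor_eval s b (SOME r. r \<in> X)) ?S"
    and "x \<in> carrier M \<Longrightarrow> y \<in> carrier N \<Longrightarrow> tensor_eval s b (SOME r. r \<in> pure_tensor M N x y) = b x y"
  proof -
    \<comment> \<open>The section sends a tuple to the sum of its entries tensored with the basis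
      vectors of N.\<close>
    let ?\<sigma> = "\<lambda>f. \<Sum>a<n. delta (?i (f a), ?e a)"
    note K = kernel_closed[OF M N] and R = kernel_relators[OF M N] and Ks = kernel_sum[OF M N]
    have \<sigma>1: "?\<sigma> v \<in> carrier (free_space (carrier M \<times> carrier N))" if "v \<in> ?S" for v
      using that by (intro sum_FS[OF M N] delta_FS[OF M N] i(1) e) auto
    have \<sigma>2: "?\<sigma> (v + w) - ?\<sigma> v - ?\<sigma> w \<in> tensor_kernel M N" if v: "v \<in> ?S" "w \<in> ?S" for v w
      unfolding sum_subtractf[symmetric]
    proof (rule Ks)
      fix a assume "a \<in> {..<n}"
      then have a: "v a \<in> SM" "w a \<in> SM" "a < n" using v by auto
      show "delta (?i ((v + w) a), ?e a) - delta (?i (v a), ?e a) - delta (?i (w a), ?e a) \<in> tensor_kernel M N"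
        unfolding plus_fun_apply i(4)[OF a(1,2)] by (rule R(1)[OF i(1)[OF a(1)] i(1)[OF a(2)] e[OF a(3)]])
    qed
    have \<sigma>3: "?\<sigma> (s c v) - (\<lambda>p. c * ?\<sigma> v p) \<in> tensor_kernel M N" if v: "v \<in> ?S" for c v
    proof -
      have "(\<lambda>p. c * ?\<sigma> v p) = (\<Sum>a<n. (\<lambda>p. c * delta (?i (v a), ?e a) p))"
        by (rule ext) (simp add: sum_fun_apply sum_distrib_left)
      moreover have "?\<sigma> (s c v) - (\<Sum>a<n. (\<lambda>p. c * delta (?i (v a), ?e a) p)) \<in> tensor_kernel M N"
        unfolding sum_subtractf[symmetric]
      proof (rule Ks)
        fix a assume "a \<in> {..<n}"
        then have a: "v a \<in> SM" "a < n" using v by auto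
        show "delta (?i (s c v a), ?e a) - (\<lambda>p. c * delta (?i (v a), ?e a) p) \<in> tensor_kernel M N"
          unfolding s_def i(5)[OF a(1)] by (rule R(3)[OF i(1)[OF a(1)] e[OF a(2)]])
      qed
      ultimately show ?thesis by simp
    qed
    have \<sigma>4: "delta (x, y) - ?\<sigma> (b x y) \<in> tensor_kernel M N" if x: "x \<in> carrier M" and y: "y \<in> carrier N" for x y
    proof -
      have c: "\<And>a. a \<in> {..<n} \<Longrightarrow> \<kappa> y a \<odot>\<^bsub>N\<^esub> ?e a \<in> carrier N" using models_smult(1)[OF N e] by auto
      have "delta (x, finsum N (\<lambda>a. \<kappa> y a \<odot>\<^bsub>N\<^esub> ?e a) {..<n})
          - (\<Sum>a<n. delta (x, \<kappa> y a \<odot>\<^bsub>N\<^esub> ?e a)) \<in> tensor_kernel M N"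
        by (rule kernel_finsum(1)[OF M N finite_lessThan x], erule c)
      then have 1: "delta (x, y) - (\<Sum>a<n. delta (x, \<kappa> y a \<odot>\<^bsub>N\<^esub> ?e a)) \<in> tensor_kernel M N"
        unfolding models_basis(2)[OF N y] .
      have 2: "(\<Sum>a<n. (delta (x, \<kappa> y a \<odot>\<^bsub>N\<^esub> ?e a) - (\<lambda>p. \<kappa> y a * delta (x, ?e a) p))
          - (delta (\<kappa> y a \<odot>\<^bsub>M\<^esub> x, ?e a) - (\<lambda>p. \<kappa> y a * delta (x, ?e a) p))) \<in> tensor_kernel M N"
        by (rule Ks, rule kernel_diff[OF M N R(4)[OF x e] R(3)[OF x e]]) auto
      have 3: "(\<Sum>a<n. (delta (x, \<kappa> y a \<odot>\<^bsub>N\<^esub> ?e a) - (\<lambda>p. \<kappa> y a * delta (x, ?e a) p))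
          - (delta (\<kappa> y a \<odot>\<^bsub>M\<^esub> x, ?e a) - (\<lambda>p. \<kappa> y a * delta (x, ?e a) p)))
          = (\<Sum>a<n. delta (x, \<kappa> y a \<odot>\<^bsub>N\<^esub> ?e a)) - (\<Sum>a<n. delta (\<kappa> y a \<odot>\<^bsub>M\<^esub> x, ?e a))"
        unfolding sum_subtractf[symmetric] by (rule sum.cong) simp_all
      show ?thesis using K(3)[OF 1 2[unfolded 3]] unfolding ib[OF x] by simp
    qed
    have \<sigma>5: "tensor_eval s b (?\<sigma> v) = v" if "v \<in> ?S" for v
      unfolding tensor_eval_sum_delta[OF vs finite_lessThan] by (rule be[OF that])
    show "models s (tensor_space M N) (\<lambda>X. tensor_eval s b (SOME r. r \<in> X)) ?S"
      by (rule models_tensor(1)[OF M N vs bil(1) bil(2) bil(3) bil(4) S S0 S' S'' \<sigma>1 \<sigma>2 \<sigma>3 \<sigma>4 \<sigma>5]) assumption+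
    show "tensor_eval s b (SOME r. r \<in> pure_tensor M N x y) = b x y" if "x \<in> carrier M" "y \<in> carrier N"
      by (rule models_tensor(2)[OF M N vs bil(1) bil(2) bil(3) bil(4) S S0 S' S'' \<sigma>1 \<sigma>2 \<sigma>3 \<sigma>4 \<sigma>5 that]) assumption+
  qed
  let ?\<sigma> = "\<lambda>f. \<Sum>a<n. delta (?e a, ?i (f a))"
  note K = kernel_closed[OF N M] and R = kernel_relators[OF N M] and Ks = kernel_sum[OF N M]
  have \<sigma>1: "?\<sigma> v \<in> carrier (free_space (carrier N \<times> carrier M))" if "v \<in> ?S" for v
    using that by (intro sum_FS[OF N M] delta_FS[OF N M] i(1) e) auto
  have \<sigma>2: "?\<sigma> (v + w) - ?\<sigma> v - ?\<sigma> w \<in> tensor_kernel N M" if v: "v \<in> ?S" "w \<in> ?S" for v w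
    unfolding sum_subtractf[symmetric]
  proof (rule Ks)
    fix a assume "a \<in> {..<n}"
    then have a: "v a \<in> SM" "w a \<in> SM" "a < n" using v by auto
    show "delta (?e a, ?i ((v + w) a)) - delta (?e a, ?i (v a)) - delta (?e a, ?i (w a)) \<in> tensor_kernel N M"
      unfolding plus_fun_apply i(4)[OF a(1,2)] by (rule R(2)[OF e[OF a(3)] i(1)[OF a(1)] i(1)[OF a(2)]])
  qed
  have \<sigma>3: "?\<sigma> (s c v) - (\<lambda>p. c * ?\<sigma> v p) \<in> tensor_kernel N M" if v: "v \<in> ?S" for c v
  proof -
    have "(\<lambda>p. c * ?\<sigma> v p) = (\<Sum>a<n. (\<lambda>p. c * delta (?e a, ?i (v a)) p))"
      by (rule ext) (simp add: sum_fun_apply sum_distrib_left)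
    moreover have "?\<sigma> (s c v) - (\<Sum>a<n. (\<lambda>p. c * delta (?e a, ?i (v a)) p)) \<in> tensor_kernel N M"
      unfolding sum_subtractf[symmetric]
    proof (rule Ks)
      fix a assume "a \<in> {..<n}"
      then have a: "v a \<in> SM" "a < n" using v by auto
      show "delta (?e a, ?i (s c v a)) - (\<lambda>p. c * delta (?e a, ?i (v a)) p) \<in> tensor_kernel N M"
        unfolding s_def i(5)[OF a(1)] by (rule R(4)[OF e[OF a(2)] i(1)[OF a(1)]])
    qed
    ultimately show ?thesis by simp
  qed
  have \<sigma>4: "delta (y, x) - ?\<sigma> (b x y) \<in> tensor_kernel N M" if y: "y \<in> carrier N" and x: "x \<in> carrier M" for x y
  proof -
    have c: "\<And>a. a \<in> {..<n} \<Longrightarrow> \<kappa> y a \<odot>\<^bsub>N\<^esub> ?e a \<in> carrier N" using models_smult(1)[OF N e] by auto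
    have "delta (finsum N (\<lambda>a. \<kappa> y a \<odot>\<^bsub>N\<^esub> ?e a) {..<n}, x)
        - (\<Sum>a<n. delta (\<kappa> y a \<odot>\<^bsub>N\<^esub> ?e a, x)) \<in> tensor_kernel N M"
      by (rule kernel_finsum(2)[OF N M finite_lessThan x], erule c)
    then have 1: "delta (y, x) - (\<Sum>a<n. delta (\<kappa> y a \<odot>\<^bsub>N\<^esub> ?e a, x)) \<in> tensor_kernel N M"
      unfolding models_basis(2)[OF N y] .
    have 2: "(\<Sum>a<n. (delta (\<kappa> y a \<odot>\<^bsub>N\<^esub> ?e a, x) - (\<lambda>p. \<kappa> y a * delta (?e a, x) p))
        - (delta (?e a, \<kappa> y a \<odot>\<^bsub>M\<^esub> x) - (\<lambda>p. \<kappa> y a * delta (?e a, x) p))) \<in> tensor_kernel N M"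
      by (rule Ks, rule kernel_diff[OF N M R(3)[OF e x] R(4)[OF e x]]) auto
    have 3: "(\<Sum>a<n. (delta (\<kappa> y a \<odot>\<^bsub>N\<^esub> ?e a, x) - (\<lambda>p. \<kappa> y a * delta (?e a, x) p))
        - (delta (?e a, \<kappa> y a \<odot>\<^bsub>M\<^esub> x) - (\<lambda>p. \<kappa> y a * delta (?e a, x) p)))
        = (\<Sum>a<n. delta (\<kappa> y a \<odot>\<^bsub>N\<^esub> ?e a, x)) - (\<Sum>a<n. delta (?e a, \<kappa> y a \<odot>\<^bsub>M\<^esub> x))"
      unfolding sum_subtractf[symmetric] by (rule sum.cong) simp_all
    show ?thesis using K(3)[OF 1 2[unfolded 3]] unfolding ib[OF x] by simp
  qed
  have \<sigma>5: "tensor_eval s (\<lambda>y x. b x y) (?\<sigma> v) = v" if "v \<in> ?S" for v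
    unfolding tensor_eval_sum_delta[OF vs finite_lessThan] by (rule be[OF that])
  show "models s (tensor_space N M) (\<lambda>X. tensor_eval s (\<lambda>y x. b x y) (SOME r. r \<in> X)) ?S"
    by (rule models_tensor(1)[where b = "\<lambda>y x. b x y", OF N M vs bil(2) bil(1) bil(4) bil(3) S S0 S' S'' \<sigma>1 \<sigma>2 \<sigma>3 \<sigma>4 \<sigma>5]) assumption+
qed

end

section \<open>Coordinates of finite-dimensional spaces\<close>

lemma models_coordinates:
  fixes W :: "(complex, 'w, 'e) module_scheme"
  assumes W: "vectorspace class_ring W" and fd: "vectorspace.fin_dim class_ring W"
  obtains n and \<kappa> :: "'w \<Rightarrow> nat \<Rightarrow> complex" where "models (\<lambda>c f x. c * f x) W \<kappa> {u. \<forall>a\<ge>n. u a = 0}"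
proof -
  interpret vectorspace "class_ring :: complex ring" W by (rule W)
  obtain B where B: "finite B" "basis B" using finite_basis_exists[OF fd] by blast
  have Bc: "B \<subseteq> carrier W" using B(2) by (simp add: basis_def)
  obtain \<beta> where \<beta>: "bij_betw \<beta> {..<card B} B"
    using ex_bij_betw_nat_finite[OF B(1)] by (auto simp: atLeast0LessThan)
  let ?n = "card B" and ?S = "{u :: nat \<Rightarrow> complex. \<forall>a\<ge>card B. u a = 0}"
  let ?g = "\<lambda>u. \<Oplus>\<^bsub>W\<^esub>a\<in>{..<?n}. u a \<odot>\<^bsub>W\<^esub> \<beta> a"
  have bc: "\<beta> a \<in> carrier W" if "a < ?n" for a using \<beta> Bc that by (auto simp: bij_betw_def)
  have ux: "\<exists>!u. u \<in> ?S \<and> ?g u = v" if v: "v \<in> carrier W" for v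
  proof -
    have "\<exists>!c. c \<in> B \<rightarrow>\<^sub>E carrier (class_ring :: complex ring) \<and> lincomb c B = v"
      using basis_criterion[OF B(1) Bc] B(2) v by blast
    then obtain c where c: "c \<in> extensional B" "lincomb c B = v"
      "\<And>c'. c' \<in> extensional B \<Longrightarrow> lincomb c' B = v \<Longrightarrow> c' = c"
      by (auto simp: class_ring_simps PiE_def)
    have lin: "?g u = lincomb (\<lambda>b\<in>B. u (inv_into {..<?n} \<beta> b)) B" for u
    proof -
      have "lincomb (\<lambda>b\<in>B. u (inv_into {..<?n} \<beta> b)) B
          = (\<Oplus>\<^bsub>W\<^esub>b\<in>\<beta> ` {..<?n}. (\<lambda>b\<in>B. u (inv_into {..<?n} \<beta> b)) b \<odot>\<^bsub>W\<^esub> b)"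
        using \<beta> by (simp add: lincomb_def bij_betw_def)
      also have "\<dots> = (\<Oplus>\<^bsub>W\<^esub>a\<in>{..<?n}. (\<lambda>b\<in>B. u (inv_into {..<?n} \<beta> b)) (\<beta> a) \<odot>\<^bsub>W\<^esub> \<beta> a)"
        using \<beta> bc Bc by (intro finsum_reindex) (auto simp: bij_betw_def class_ring_simps)
      also have "\<dots> = ?g u"
        using \<beta> bc by (intro finsum_cong') (auto simp: bij_betw_def class_ring_simps)
      finally show ?thesis ..
    qed
    show ?thesis
    proof (rule ex1I[of _ "\<lambda>a. if a < ?n then c (\<beta> a) else 0"])
      have "(\<lambda>b\<in>B. (\<lambda>a. if a < ?n then c (\<beta> a) else 0) (inv_into {..<?n} \<beta> b)) = c"
      proof (rule ext)
        fix b
        show "(\<lambda>b\<in>B. (\<lambda>a. if a < ?n then c (\<beta> a) else 0) (inv_into {..<?n} \<beta> b)) b = c b"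
          using \<beta> c(1) inv_into_into[of b \<beta> "{..<?n}"] f_inv_into_f[of b \<beta> "{..<?n}"]
          by (cases "b \<in> B") (auto simp: bij_betw_def extensional_def)
      qed
      then show "(\<lambda>a. if a < ?n then c (\<beta> a) else 0) \<in> ?S \<and> ?g (\<lambda>a. if a < ?n then c (\<beta> a) else 0) = v"
        unfolding lin using c(2) by simp
    next
      fix u assume u: "u \<in> ?S \<and> ?g u = v"
      then have "(\<lambda>b\<in>B. u (inv_into {..<?n} \<beta> b)) = c" by (intro c(3)) (auto simp: lin)
      then have "u a = c (\<beta> a)" if "a < ?n" for a
        using that \<beta> fun_cong[of "\<lambda>b\<in>B. u (inv_into {..<?n} \<beta> b)" c "\<beta> a"] by (auto simp: bij_betw_def)
      then show "u = (\<lambda>a. if a < ?n then c (\<beta> a) else 0)" using u by (auto simp: fun_eq_iff)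
    qed
  qed
  have gc: "?g u \<in> carrier W" for u by (rule finsum_closed) (use bc in \<open>auto simp: class_ring_simps\<close>)
  have g_add: "?g (u + v) = ?g u \<oplus>\<^bsub>W\<^esub> ?g v" for u v
  proof -
    have "?g (u + v) = (\<Oplus>\<^bsub>W\<^esub>a\<in>{..<?n}. u a \<odot>\<^bsub>W\<^esub> \<beta> a \<oplus>\<^bsub>W\<^esub> v a \<odot>\<^bsub>W\<^esub> \<beta> a)"
      using bc smult_l_distr by (intro finsum_cong') (auto simp: class_ring_simps)
    also have "\<dots> = ?g u \<oplus>\<^bsub>W\<^esub> ?g v" by (rule finsum_addf) (use bc in \<open>auto simp: class_ring_simps\<close>)
    finally show ?thesis .
  qed
  have g_smult: "?g (\<lambda>a. c * u a) = c \<odot>\<^bsub>W\<^esub> ?g u" for c u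
  proof -
    have "?g (\<lambda>a. c * u a) = (\<Oplus>\<^bsub>W\<^esub>a\<in>{..<?n}. c \<odot>\<^bsub>W\<^esub> (u a \<odot>\<^bsub>W\<^esub> \<beta> a))"
      using bc smult_assoc1 by (intro finsum_cong') (auto simp: class_ring_simps)
    also have "\<dots> = c \<odot>\<^bsub>W\<^esub> ?g u"
      by (rule finsum_smult[symmetric]) (use bc in \<open>auto simp: class_ring_simps\<close>)
    finally show ?thesis .
  qed
  let ?k = "inv_into ?S ?g"
  have bij: "bij_betw ?g ?S (carrier W)"
    unfolding bij_betw_def inj_on_def using ux gc by (safe; blast?) 
  have k: "?k v \<in> ?S" "?g (?k v) = v" if "v \<in> carrier W" for v
  proof -
    have "v \<in> ?g ` ?S" using bij that unfolding bij_betw_def by blast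
    then show "?k v \<in> ?S" "?g (?k v) = v" by (rule inv_into_into, rule f_inv_into_f)
  qed
  have uniq: "?k v = u" if "v \<in> carrier W" "u \<in> ?S" "?g u = v" for u v
    using ux[OF that(1)] k[OF that(1)] that by blast
  have "models (\<lambda>c f x. c * f x) W ?k ?S"
    unfolding models_def
  proof (intro conjI ballI allI)
    show "vector_space (\<lambda>c (f :: nat \<Rightarrow> complex) x. c * f x)" by (rule vector_space_fun[OF vector_space_complex])
    show "bij_betw ?k (carrier W) ?S" by (rule bij_betw_inv_into[OF bij])
    have "?g (\<lambda>a. 0 * 0) = 0 \<odot>\<^bsub>W\<^esub> ?g (\<lambda>a. 0)" by (rule g_smult)
    then have "?g 0 = \<zero>\<^bsub>W\<^esub>" using lmult_0[OF gc[of 0]] by (simp add: class_ring_simps zero_fun_def)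
    then show "?k \<zero>\<^bsub>W\<^esub> = 0" by (intro uniq) auto
    fix x y assume xy: "x \<in> carrier W" "y \<in> carrier W"
    show "?k (x \<oplus>\<^bsub>W\<^esub> y) = ?k x + ?k y"
    proof (rule uniq)
      show "x \<oplus>\<^bsub>W\<^esub> y \<in> carrier W" using xy by simp
      show "?k x + ?k y \<in> ?S" using k(1)[OF xy(1)] k(1)[OF xy(2)] by simp
      show "?g (?k x + ?k y) = x \<oplus>\<^bsub>W\<^esub> y" unfolding g_add k(2)[OF xy(1)] k(2)[OF xy(2)] ..
    qed
  next
    fix c x assume x: "x \<in> carrier W"
    show "c \<odot>\<^bsub>W\<^esub> x \<in> carrier W" using x by (simp add: class_ring_simps)
    show "?k (c \<odot>\<^bsub>W\<^esub> x) = (\<lambda>a. c * ?k x a)"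
    proof (rule uniq)
      show "c \<odot>\<^bsub>W\<^esub> x \<in> carrier W" using x by (simp add: class_ring_simps)
      show "(\<lambda>a. c * ?k x a) \<in> ?S" using k(1)[OF x] by simp
      show "?g (\<lambda>a. c * ?k x a) = c \<odot>\<^bsub>W\<^esub> x" unfolding g_smult k(2)[OF x] ..
    qed
  qed auto
  then show ?thesis by (rule that)
qed

lemma models_module_vec:
  "models (\<lambda>c f x. c * f x) (module_vec TYPE(complex) m) (\<lambda>v a. if a < m then v $ a else 0) {u. \<forall>a\<ge>m. u a = 0}"
  unfolding models_def
proof (intro conjI ballI allI)
  show "vector_space (\<lambda>c (f :: nat \<Rightarrow> complex) x. c * f x)" by (rule vector_space_fun[OF vector_space_complex])
  show "bij_betw (\<lambda>v a. if a < m then v $ a else 0 :: complex) (carrier (module_vec TYPE(complex) m)) {u. \<forall>a\<ge>m. u a = 0}"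
  proof (rule bij_betw_byWitness[where f' = "\<lambda>u. vec m u"])
    show "\<forall>v\<in>carrier (module_vec TYPE(complex) m). vec m (\<lambda>a. if a < m then v $ a else 0) = v"
      by (auto simp: module_vec_def intro!: eq_vecI)
    show "\<forall>u\<in>{u. \<forall>a\<ge>m. u a = 0}. (\<lambda>a. if a < m then vec m u $ a else 0) = u"
      by (auto simp: fun_eq_iff)
  qed (auto simp: module_vec_def)
qed (auto simp: module_vec_def fun_eq_iff)

subsection \<open>The Chevalley--Eilenberg differential\<close>

definition sg :: "nat \<Rightarrow> 'b \<Rightarrow> 'b::ab_group_add" where
  "sg e v = (if even e then v else - v)"

lemma sg_Suc: "sg (Suc e) v = - sg e v" and sg_minus: "sg e (- v) = - sg e v"
  and sg_0: "sg 0 v = v"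
  by (auto simp: sg_def)

lemma nths_Cons_compl:
  "nths (y # ys) (- {0}) = ys" "nths (y # ys) (- {Suc t}) = y # nths ys (- {t})"
  "nths (y # ys) (- {0, Suc t}) = nths ys (- {t})"
  "nths (y # ys) (- {Suc s, Suc t}) = y # nths ys (- {s, t})"
proof -
  have "{j. Suc j \<in> - {0}} = UNIV" "{j. Suc j \<in> - {Suc t}} = - {t}"
    "{j. Suc j \<in> - {0, Suc t}} = - {t}" "{j. Suc j \<in> - {Suc s, Suc t}} = - {s, t}" by auto
  then show "nths (y # ys) (- {0}) = ys" "nths (y # ys) (- {Suc t}) = y # nths ys (- {t})"
    "nths (y # ys) (- {0, Suc t}) = nths ys (- {t})"
    "nths (y # ys) (- {Suc s, Suc t}) = y # nths ys (- {s, t})"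
    by (simp_all only: nths_Cons) (simp_all add: nths_all)
qed

context
  fixes bc :: "'l \<Rightarrow> 'l \<Rightarrow> ('l list \<Rightarrow> 'b) \<Rightarrow> 'l list \<Rightarrow> 'b::ab_group_add"
  assumes bc: "\<And>x y w \<psi> ys. antisym_fun \<psi> \<Longrightarrow> bc x y (con w \<psi>) ys = - bc x y \<psi> (w # ys)"
begin

lemma lied_sum:
  assumes "antisym_fun \<psi>"
  shows "lied bc act x \<psi> xs = act x (\<psi> xs) - (\<Sum>t<length xs. sg t (bc x (xs ! t) \<psi> (nths xs (- {t}))))"
  using assms
proof (induction xs arbitrary: \<psi>)
  case Nil
  show ?case by simp
next
  case (Cons y ys)
  have "(\<Sum>t<length ys. sg t (bc x (ys ! t) (con y \<psi>) (nths ys (- {t}))))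
      = - (\<Sum>t<length ys. sg t (bc x (ys ! t) \<psi> (y # nths ys (- {t}))))"
    by (simp add: bc[OF Cons.prems] sg_minus sum_negf)
  then show ?case
    unfolding lied.simps Cons.IH[OF antisym_fun_con[OF Cons.prems]] length_Cons sum.lessThan_Suc_shift
    by (simp add: nths_Cons_compl sg_Suc sg_0 sum_negf con_apply)
qed

text \<open>The recursion agrees with the explicit sums. The pairs (s, t) with s = 0 and the term s
  = 0 of the action come from the Lie derivative along the first argument; the others belong to the
  contracted cochain, with a change of sign.\<close>

lemma dee_sum:
  assumes "antisym_fun \<psi>"
  shows "dee bc act \<psi> xs =
    (\<Sum>p\<in>{(s, t). s < t \<and> t < length xs}.
       sg (fst p + snd p + 1) (bc (xs ! fst p) (xs ! snd p) \<psi> (nths xs (- {fst p, snd p}))))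
    + (\<Sum>s<length xs. sg (s + 1) (act (xs ! s) (\<psi> (nths xs (- {s})))))"
  using assms
proof (induction xs arbitrary: \<psi>)
  case Nil
  show ?case by simp
next
  case (Cons x xs)
  let ?n = "length xs"
  let ?P = "\<lambda>n. {(s, t). s < t \<and> t < n} :: (nat \<times> nat) set"
  let ?g = "\<lambda>p. sg (fst p + snd p + 1) (bc ((x # xs) ! fst p) ((x # xs) ! snd p) \<psi> (nths (x # xs) (- {fst p, snd p})))"
  have P: "?P (Suc ?n) = (\<lambda>t. (0, Suc t)) ` {..<?n} \<union> map_prod Suc Suc ` ?P ?n"
  proof (intro Set.set_eqI iffI)
    fix p assume "p \<in> ?P (Suc ?n)"
    then obtain s t where p: "p = (s, t)" "s < t" "t < Suc ?n" by blast
    then obtain t' where t': "t = Suc t'" by (cases t) auto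
    show "p \<in> (\<lambda>t. (0, Suc t)) ` {..<?n} \<union> map_prod Suc Suc ` ?P ?n"
      using p t' by (cases s) (auto intro: image_eqI)
  qed auto
  have fin: "finite (?P ?n)" by (rule finite_subset[of _ "{..<?n} \<times> {..<?n}"]) auto
  have "sum ?g (?P (Suc ?n)) = sum ?g ((\<lambda>t. (0, Suc t)) ` {..<?n}) + sum ?g (map_prod Suc Suc ` ?P ?n)"
    unfolding P by (rule sum.union_disjoint) (use fin in auto)
  also have "sum ?g ((\<lambda>t. (0, Suc t)) ` {..<?n}) = (\<Sum>t<?n. sg t (bc x (xs ! t) \<psi> (nths xs (- {t}))))"
    by (subst sum.reindex) (auto simp: inj_on_def nths_Cons_compl sg_Suc)
  also have "sum ?g (map_prod Suc Suc ` ?P ?n) = (\<Sum>p\<in>?P ?n. ?g (map_prod Suc Suc p))"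
    by (subst sum.reindex) (auto simp: inj_on_def)
  also have "\<dots> = - (\<Sum>p\<in>?P ?n. sg (fst p + snd p + 1) (bc (xs ! fst p) (xs ! snd p) (con x \<psi>) (nths xs (- {fst p, snd p}))))"
    unfolding sum_negf[symmetric] by (simp add: bc[OF Cons.prems] sg_minus nths_Cons_compl sg_Suc)
  finally have 1: "sum ?g (?P (Suc ?n)) = (\<Sum>t<?n. sg t (bc x (xs ! t) \<psi> (nths xs (- {t}))))
    - (\<Sum>p\<in>?P ?n. sg (fst p + snd p + 1) (bc (xs ! fst p) (xs ! snd p) (con x \<psi>) (nths xs (- {fst p, snd p}))))"
    by simp
  have 2: "(\<Sum>s<Suc ?n. sg (s + 1) (act ((x # xs) ! s) (\<psi> (nths (x # xs) (- {s})))))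
    = - act x (\<psi> xs) - (\<Sum>s<?n. sg (s + 1) (act (xs ! s) (con x \<psi> (nths xs (- {s})))))"
    unfolding sum.lessThan_Suc_shift by (simp add: nths_Cons_compl sg_Suc sg_0 con_apply sum_negf)
  show ?case
    unfolding dee.simps Cons.IH[OF antisym_fun_con[OF Cons.prems]] lied_sum[OF Cons.prems] length_Cons 1 2
    by simp
qed

end

lemma lied_cong:
  assumes "\<And>x y. x \<in> B \<Longrightarrow> y \<in> B \<Longrightarrow> brk x y \<in> B" "\<And>ys. set ys \<subseteq> B \<Longrightarrow> \<phi> ys = \<psi> ys" "x \<in> B" "set xs \<subseteq> B"
  shows "lied (\<lambda>x y. con (brk x y)) act x \<phi> xs = lied (\<lambda>x y. con (brk x y)) act x \<psi> xs"
  using assms(2,4)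
proof (induction xs arbitrary: \<phi> \<psi>)
  case (Cons y ys)
  have y: "y \<in> B" "set ys \<subseteq> B" using Cons.prems by auto
  have "lied (\<lambda>x y. con (brk x y)) act x (con y \<phi>) ys = lied (\<lambda>x y. con (brk x y)) act x (con y \<psi>) ys"
    by (rule Cons.IH) (use Cons.prems y in \<open>auto simp: con_apply\<close>)
  moreover have "con (brk x y) \<phi> ys = con (brk x y) \<psi> ys"
    unfolding con_apply by (rule Cons.prems(1)) (use assms(1,3) y in auto)
  ultimately show ?case by simp
qed simp

lemma dee_cong:
  assumes "\<And>x y. x \<in> B \<Longrightarrow> y \<in> B \<Longrightarrow> brk x y \<in> B" "\<And>ys. set ys \<subseteq> B \<Longrightarrow> \<phi> ys = \<psi> ys" "set xs \<subseteq> B"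
  shows "dee (\<lambda>x y. con (brk x y)) act \<phi> xs = dee (\<lambda>x y. con (brk x y)) act \<psi> xs"
  using assms(2,3)
proof (induction xs arbitrary: \<phi> \<psi>)
  case (Cons y ys)
  have y: "y \<in> B" "set ys \<subseteq> B" using Cons.prems by auto
  have "dee (\<lambda>x y. con (brk x y)) act (con y \<phi>) ys = dee (\<lambda>x y. con (brk x y)) act (con y \<psi>) ys"
    by (rule Cons.IH) (use Cons.prems y in \<open>auto simp: con_apply\<close>)
  moreover have "lied (\<lambda>x y. con (brk x y)) act y \<phi> ys = lied (\<lambda>x y. con (brk x y)) act y \<psi> ys"
    by (rule lied_cong[OF assms(1) Cons.prems(1) y(1) y(2)])
  ultimately show ?case by simp
qed simp

section \<open>Cochains of a record in coordinates\<close>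

lemma antisym_fun_repeat:
  assumes vs: "vector_space (s :: complex \<Rightarrow> 't \<Rightarrow> 't::ab_group_add)" and \<psi>: "antisym_fun \<psi>" and "\<not> distinct xs"
  shows "\<psi> xs = (0 :: 't)"
proof -
  interpret V: vector_space s by (rule vs)
  have half: "v = 0" if "v = - v" for v :: 't
  proof -
    have "s 2 v = s 1 v + s 1 v" using V.scale_left_distrib[of 1 1 v] by simp
    also have "\<dots> = 0" using that by (metis V.scale_one add.right_inverse)
    finally show ?thesis by simp
  qed
  obtain us x ws vs where xs: "xs = us @ [x] @ ws @ [x] @ vs"
    using not_distinct_decomp[OF assms(3)] by blast
  have "\<psi> (x # us @ ws @ x # vs) = con x \<psi> ((us @ ws) @ x # vs)" by (simp add: con_apply)
  also have "\<dots> = (if even (length (us @ ws)) then con x \<psi> (x # (us @ ws) @ vs) else - con x \<psi> (x # (us @ ws) @ vs))"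
    by (rule antisym_fun_append[OF antisym_fun_con[OF \<psi>]])
  also have "con x \<psi> (x # (us @ ws) @ vs) = 0"
    unfolding con_apply by (rule half[OF antisym_fun_swap[OF \<psi>]])
  finally have "\<psi> (x # us @ ws @ x # vs) = 0" by simp
  moreover have "\<psi> (us @ x # (ws @ x # vs)) = (if even (length us) then \<psi> (x # us @ ws @ x # vs) else - \<psi> (x # us @ ws @ x # vs))"
    by (rule antisym_fun_append[OF \<psi>])
  ultimately show ?thesis unfolding xs by simp
qed

text \<open>E parametrizes the Lie algebra L by a subset B of a type, in which the bracket becomes
  \<open>brk\<close>. It is used with f d/dz for functions f on the punctured sphere and with p d/dZ
  for polynomials p without constant term.\<close>

locale lie_model =
  fixes L :: "(complex, 'l, 'e) lie_algebra_scheme" and B :: "'x::ab_group_add set" and t :: "complex \<Rightarrow> 'x \<Rightarrow> 'x"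
    and E :: "'x \<Rightarrow> 'l" and brk :: "'x \<Rightarrow> 'x \<Rightarrow> 'x" and M :: "(complex, 'b, 'c) module_scheme"
    and s :: "complex \<Rightarrow> 't \<Rightarrow> 't::ab_group_add" and h :: "'b \<Rightarrow> 't" and S :: "'t set"
  assumes mod: "models s M h S" and E_bij: "bij_betw E B (carrier L)"
    and B_add: "x \<in> B \<Longrightarrow> y \<in> B \<Longrightarrow> x + y \<in> B" and B_scale: "x \<in> B \<Longrightarrow> t c x \<in> B"
    and B_brk: "x \<in> B \<Longrightarrow> y \<in> B \<Longrightarrow> brk x y \<in> B"
    and E_add: "x \<in> B \<Longrightarrow> y \<in> B \<Longrightarrow> E (x + y) = E x \<oplus>\<^bsub>L\<^esub> E y"
    and E_scale: "x \<in> B \<Longrightarrow> E (t c x) = c \<odot>\<^bsub>L\<^esub> E x"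
    and E_brk: "x \<in> B \<Longrightarrow> y \<in> B \<Longrightarrow> bracket L (E x) (E y) = E (brk x y)"
begin

sublocale V: vector_space s by (rule models_vs[OF mod])

definition hat :: "int \<Rightarrow> ('l list \<Rightarrow> 'b) \<Rightarrow> 'x list \<Rightarrow> 't" where
  "hat k \<phi> xs = (if int (length xs) = k \<and> set xs \<subseteq> B then h (\<phi> (map E xs)) else 0)"

text \<open>Linearity in the first argument is enough, as antisymmetry moves any argument
  there.\<close>

definition multi :: "int \<Rightarrow> ('x list \<Rightarrow> 't) set" where
  "multi k = {\<psi>. (\<forall>xs. \<psi> xs \<in> S) \<and> (\<forall>xs. \<not> (int (length xs) = k \<and> set xs \<subseteq> B) \<longrightarrow> \<psi> xs = 0) \<and>
     antisym_fun \<psi> \<and>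
     (\<forall>x\<in>B. \<forall>y\<in>B. \<forall>xs. set xs \<subseteq> B \<longrightarrow> \<psi> ((x + y) # xs) = \<psi> (x # xs) + \<psi> (y # xs)) \<and>
     (\<forall>c. \<forall>x\<in>B. \<forall>xs. set xs \<subseteq> B \<longrightarrow> \<psi> (t c x # xs) = s c (\<psi> (x # xs)))}"

lemma multiD:
  assumes "\<psi> \<in> multi k"
  shows "\<psi> xs \<in> S" "\<not> (int (length xs) = k \<and> set xs \<subseteq> B) \<Longrightarrow> \<psi> xs = 0" "antisym_fun \<psi>"
    "x \<in> B \<Longrightarrow> y \<in> B \<Longrightarrow> set xs \<subseteq> B \<Longrightarrow> \<psi> ((x + y) # xs) = \<psi> (x # xs) + \<psi> (y # xs)"
    "x \<in> B \<Longrightarrow> set xs \<subseteq> B \<Longrightarrow> \<psi> (t c x # xs) = s c (\<psi> (x # xs))"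
  using assms unfolding multi_def by blast+

lemma E_carrier: "x \<in> B \<Longrightarrow> E x \<in> carrier L"
  using E_bij by (auto simp: bij_betw_def)

lemma map_E: "set xs \<subseteq> B \<Longrightarrow> int (length xs) = k \<Longrightarrow> map E xs \<in> tuples L k"
  using E_carrier by (auto simp: tuples_def subset_iff)

abbreviation "Ei \<equiv> inv_into B E"

lemma Ei: "D \<in> carrier L \<Longrightarrow> Ei D \<in> B" "D \<in> carrier L \<Longrightarrow> E (Ei D) = D" "x \<in> B \<Longrightarrow> Ei (E x) = x"
  using E_bij by (auto simp: bij_betw_def inv_into_into f_inv_into_f)

lemma Ei_add: "D \<in> carrier L \<Longrightarrow> D' \<in> carrier L \<Longrightarrow> Ei (D \<oplus>\<^bsub>L\<^esub> D') = Ei D + Ei D'"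
  "D \<in> carrier L \<Longrightarrow> D' \<in> carrier L \<Longrightarrow> D \<oplus>\<^bsub>L\<^esub> D' \<in> carrier L"
  using E_add[of "Ei D" "Ei D'"] Ei(3)[of "Ei D + Ei D'"] E_carrier[of "Ei D + Ei D'"] by (simp_all add: Ei B_add)

lemma Ei_scale: "D \<in> carrier L \<Longrightarrow> Ei (c \<odot>\<^bsub>L\<^esub> D) = t c (Ei D)" "D \<in> carrier L \<Longrightarrow> c \<odot>\<^bsub>L\<^esub> D \<in> carrier L"
  using E_scale[of "Ei D" c] Ei(3)[of "t c (Ei D)"] E_carrier[of "t c (Ei D)"] by (simp_all add: Ei B_scale)

lemma map_Ei:
  assumes "Ds \<in> tuples L k"
  shows "set (map Ei Ds) \<subseteq> B" "int (length (map Ei Ds)) = k" "map E (map Ei Ds) = Ds"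
proof -
  have Ds: "set Ds \<subseteq> carrier L" "int (length Ds) = k" using assms by (auto simp: tuples_def)
  then show "set (map Ei Ds) \<subseteq> B" "int (length (map Ei Ds)) = k" using Ei(1) by auto
  show "map E (map Ei Ds) = Ds" using Ds(1) Ei(2) by (simp add: map_idI subset_iff)
qed

lemma hat_map_Ei:
  assumes "Ds \<in> tuples L k"
  shows "hat k \<phi> (map Ei Ds) = h (\<phi> Ds)"
  using map_Ei[OF assms] by (simp only: hat_def) simp

lemma hat_inj:
  assumes "\<phi> \<in> tuples L k \<rightarrow>\<^sub>E carrier M" "\<phi>' \<in> tuples L k \<rightarrow>\<^sub>E carrier M" "hat k \<phi> = hat k \<phi>'"
  shows "\<phi> = \<phi>'"
proof (rule PiE_ext[OF assms(1,2)])
  fix Ds assume Ds: "Ds \<in> tuples L k"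
  show "\<phi> Ds = \<phi>' Ds"
    by (rule models_inj[OF mod PiE_mem[OF assms(1) Ds] PiE_mem[OF assms(2) Ds]])
      (metis hat_map_Ei[OF Ds] assms(3))
qed

lemma cochain_PiE: "\<phi> \<in> carrier (cochain_space L M k) \<Longrightarrow> \<phi> \<in> tuples L k \<rightarrow>\<^sub>E carrier M"
  by (simp add: cochain_space_def)

lemma cochainD:
  assumes "\<phi> \<in> carrier (cochain_space L M k)" "Ds \<in> tuples L k"
  shows "i < length Ds \<Longrightarrow> D \<in> carrier L \<Longrightarrow> D' \<in> carrier L \<Longrightarrow>
      \<phi> (Ds[i := D \<oplus>\<^bsub>L\<^esub> D']) = \<phi> (Ds[i := D]) \<oplus>\<^bsub>M\<^esub> \<phi> (Ds[i := D'])"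
    "i < length Ds \<Longrightarrow> D \<in> carrier L \<Longrightarrow> \<phi> (Ds[i := c \<odot>\<^bsub>L\<^esub> D]) = c \<odot>\<^bsub>M\<^esub> \<phi> (Ds[i := D])"
    "\<not> distinct Ds \<Longrightarrow> \<phi> Ds = \<zero>\<^bsub>M\<^esub>"
  using assms by (simp_all add: cochain_space_def)

lemma hat_multi:
  assumes \<phi>: "\<phi> \<in> carrier (cochain_space L M k)"
  shows "hat k \<phi> \<in> multi k"
proof -
  note PE = cochain_PiE[OF \<phi>]
  have val: "h (\<phi> (map E xs)) \<in> S" if "set xs \<subseteq> B" "int (length xs) = k" for xs
    by (rule models_in[OF mod PiE_mem[OF PE map_E[OF that]]])
  have S: "hat k \<phi> xs \<in> S" for xs using val models_S(1)[OF mod] by (simp add: hat_def)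
  have hatE: "hat k \<phi> xs = h (\<phi> (map E xs))" if "set xs \<subseteq> B" "int (length xs) = k" for xs
    using that by (simp add: hat_def)
  have add: "hat k \<phi> (us @ (x + y) # vs) = hat k \<phi> (us @ x # vs) + hat k \<phi> (us @ y # vs)"
    if "set us \<subseteq> B" "x \<in> B" "y \<in> B" "set vs \<subseteq> B" for us x y vs
  proof (cases "int (length (us @ x # vs)) = k")
    case True
    let ?Ds = "map E (us @ x # vs)"
    have t: "?Ds \<in> tuples L k" by (rule map_E) (use that True in auto)
    have upd: "?Ds[length us := D] = map E us @ D # map E vs" for D
      using list_update_length[of "map E us" "E x" "map E vs" D] by simp
    have "\<phi> (?Ds[length us := E x \<oplus>\<^bsub>L\<^esub> E y]) = \<phi> (?Ds[length us := E x]) \<oplus>\<^bsub>M\<^esub> \<phi> (?Ds[length us := E y])"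
      by (rule cochainD(1)[OF \<phi> t]) (use that E_carrier in auto)
    then have "\<phi> (map E (us @ (x + y) # vs)) = \<phi> (map E (us @ x # vs)) \<oplus>\<^bsub>M\<^esub> \<phi> (map E (us @ y # vs))"
      unfolding upd using that by (simp add: E_add)
    moreover have "\<phi> (map E (us @ x # vs)) \<in> carrier M" "\<phi> (map E (us @ y # vs)) \<in> carrier M"
      by (rule PiE_mem[OF PE map_E]; use that True in auto)+
    ultimately have "h (\<phi> (map E (us @ (x + y) # vs))) = h (\<phi> (map E (us @ x # vs))) + h (\<phi> (map E (us @ y # vs)))"
      using models_add(2)[OF mod] by simp
    then show ?thesis using that B_add True by (simp add: hat_def)
  next
    case False
    then show ?thesis by (simp add: hat_def)
  qed
  have rep: "hat k \<phi> (us @ x # x # vs) = 0" for us x vs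
  proof (cases "int (length (us @ x # x # vs)) = k \<and> set (us @ x # x # vs) \<subseteq> B")
    case True
    have "map E (us @ x # x # vs) \<in> tuples L k" by (rule map_E) (use True in auto)
    moreover have "\<not> distinct (map E (us @ x # x # vs))" by simp
    ultimately have "\<phi> (map E (us @ x # x # vs)) = \<zero>\<^bsub>M\<^esub>"
      by (rule cochainD(3)[OF \<phi>])
    then show ?thesis using models_zero(2)[OF mod] by (simp add: hat_def)
  next
    case False
    then show ?thesis unfolding hat_def by (simp only: if_False)
  qed
  have anti: "antisym_fun (hat k \<phi>)"
    unfolding antisym_fun_def
  proof (intro allI)
    fix us x y vs
    show "hat k \<phi> (us @ x # y # vs) = - hat k \<phi> (us @ y # x # vs)"
    proof (cases "set (us @ x # y # vs) \<subseteq> B")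
      case True
      then have B: "set us \<subseteq> B" "x \<in> B" "y \<in> B" "set vs \<subseteq> B" by auto
      \<comment> \<open>Polarization: vanishing on repeated arguments becomes antisymmetry.\<close>
      have "0 = hat k \<phi> (us @ (x + y) # (x + y) # vs)" unfolding rep ..
      also have "\<dots> = hat k \<phi> (us @ x # (x + y) # vs) + hat k \<phi> (us @ y # (x + y) # vs)"
        by (rule add) (use B B_add in auto)
      also have "hat k \<phi> (us @ x # (x + y) # vs) = hat k \<phi> (us @ x # x # vs) + hat k \<phi> (us @ x # y # vs)"
        using add[of "us @ [x]" x y vs] B by simp
      also have "hat k \<phi> (us @ y # (x + y) # vs) = hat k \<phi> (us @ y # x # vs) + hat k \<phi> (us @ y # y # vs)"
        using add[of "us @ [y]" x y vs] B by simp
      finally have "0 = hat k \<phi> (us @ x # y # vs) + hat k \<phi> (us @ y # x # vs)" unfolding rep by simp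
      then show ?thesis by (simp add: eq_neg_iff_add_eq_0)
    next
      case False
      then have "\<not> set (us @ y # x # vs) \<subseteq> B" by auto
      with False show ?thesis by (simp only: hat_def simp_thms if_False minus_zero)
    qed
  qed
  have scale: "hat k \<phi> (t c x # vs) = s c (hat k \<phi> (x # vs))" if "x \<in> B" "set vs \<subseteq> B" for c x vs
  proof (cases "int (length (x # vs)) = k")
    case True
    let ?Ds = "map E (x # vs)"
    have t: "?Ds \<in> tuples L k" by (rule map_E) (use that True in auto)
    have "\<phi> (?Ds[0 := c \<odot>\<^bsub>L\<^esub> E x]) = c \<odot>\<^bsub>M\<^esub> \<phi> (?Ds[0 := E x])"
      by (rule cochainD(2)[OF \<phi> t]) (use that E_carrier in auto)
    then have "\<phi> (map E (t c x # vs)) = c \<odot>\<^bsub>M\<^esub> \<phi> ?Ds" using that by (simp add: E_scale)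
    then have "h (\<phi> (map E (t c x # vs))) = s c (h (\<phi> ?Ds))"
      using models_smult(2)[OF mod PiE_mem[OF PE t]] by simp
    then show ?thesis using that B_scale True by (simp add: hat_def)
  next
    case False
    then show ?thesis by (simp add: hat_def)
  qed
  show ?thesis unfolding multi_def
    using S anti add[of "[]"] scale by (auto simp: hat_def)
qed

text \<open>The converse of \<open>hat_multi\<close>. The argument at position i is moved to the
  front at the cost of a sign, which is additive and commutes with scalars.\<close>

lemma cochainI:
  assumes PE: "\<phi> \<in> tuples L k \<rightarrow>\<^sub>E carrier M" and \<psi>: "hat k \<phi> \<in> multi k"
  shows "\<phi> \<in> carrier (cochain_space L M k)"
proof -
  have h\<phi>: "h (\<phi> Ds) = hat k \<phi> (map Ei Ds)" if "Ds \<in> tuples L k" for Ds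
    using hat_map_Ei[OF that] by simp
  have upd: "Ds[i := D] \<in> tuples L k" "map Ei (Ds[i := D]) = map Ei (take i Ds) @ Ei D # map Ei (drop (Suc i) Ds)"
    if "Ds \<in> tuples L k" "i < length Ds" "D \<in> carrier L" for Ds i D
    using that set_update_subset_insert[of Ds i D] by (auto simp: tuples_def upd_conv_take_nth_drop)
  have sub: "set (map Ei (take i Ds)) \<subseteq> B" "set (map Ei (drop (Suc i) Ds)) \<subseteq> B" if "Ds \<in> tuples L k" for i Ds
    using that Ei(1) by (auto simp: tuples_def dest: in_set_takeD in_set_dropD)
  have app: "hat k \<phi> (us @ x # vs) = sg (length us) (hat k \<phi> (x # us @ vs))" for us x vs
    using antisym_fun_append[OF multiD(3)[OF \<psi>], of us x vs] by (simp add: sg_def)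
  have sg_add: "sg e (v + w) = sg e v + sg e w" for e and v w :: 't by (simp add: sg_def)
  have sg_s: "sg e (s c v) = s c (sg e v)" for e c v by (simp add: sg_def)
  have "\<phi> (Ds[i := x \<oplus>\<^bsub>L\<^esub> y]) = \<phi> (Ds[i := x]) \<oplus>\<^bsub>M\<^esub> \<phi> (Ds[i := y])"
    if D: "Ds \<in> tuples L k" "i < length Ds" "x \<in> carrier L" "y \<in> carrier L" for Ds i x y
  proof -
    note t = upd(1)[OF D(1,2,3)] upd(1)[OF D(1,2,4)] upd(1)[OF D(1,2) Ei_add(2)[OF D(3,4)]]
    note c = PiE_mem[OF PE t(1)] PiE_mem[OF PE t(2)] PiE_mem[OF PE t(3)]
    have "hat k \<phi> (map Ei (Ds[i := x \<oplus>\<^bsub>L\<^esub> y])) = hat k \<phi> (map Ei (Ds[i := x])) + hat k \<phi> (map Ei (Ds[i := y]))"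
      unfolding upd(2)[OF D(1,2,3)] upd(2)[OF D(1,2,4)] upd(2)[OF D(1,2) Ei_add(2)[OF D(3,4)]] app
        Ei_add(1)[OF D(3,4)] sg_add[symmetric]
      by (rule arg_cong, rule multiD(4)[OF \<psi>]) (use D Ei(1) sub[OF D(1)] in \<open>auto simp del: set_map\<close>)
    then have "h (\<phi> (Ds[i := x \<oplus>\<^bsub>L\<^esub> y])) = h (\<phi> (Ds[i := x]) \<oplus>\<^bsub>M\<^esub> \<phi> (Ds[i := y]))"
      unfolding models_add(2)[OF mod c(1,2)] h\<phi>[OF t(1)] h\<phi>[OF t(2)] h\<phi>[OF t(3)] .
    then show ?thesis by (rule models_inj[OF mod c(3) models_add(1)[OF mod c(1,2)]])
  qed
  moreover have "\<phi> (Ds[i := r \<odot>\<^bsub>L\<^esub> x]) = r \<odot>\<^bsub>M\<^esub> \<phi> (Ds[i := x])"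
    if D: "Ds \<in> tuples L k" "i < length Ds" "x \<in> carrier L" for Ds i x r
  proof -
    note t = upd(1)[OF D] upd(1)[OF D(1,2) Ei_scale(2)[OF D(3)]]
    note c = PiE_mem[OF PE t(1)] PiE_mem[OF PE t(2)]
    have "hat k \<phi> (map Ei (Ds[i := r \<odot>\<^bsub>L\<^esub> x])) = s r (hat k \<phi> (map Ei (Ds[i := x])))"
      unfolding upd(2)[OF D] upd(2)[OF D(1,2) Ei_scale(2)[OF D(3)]] app Ei_scale(1)[OF D(3)] sg_s[symmetric]
      by (rule arg_cong, rule multiD(5)[OF \<psi>]) (use D Ei(1) sub[OF D(1)] in \<open>auto simp del: set_map\<close>)
    then have "h (\<phi> (Ds[i := r \<odot>\<^bsub>L\<^esub> x])) = h (r \<odot>\<^bsub>M\<^esub> \<phi> (Ds[i := x]))"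
      unfolding models_smult(2)[OF mod c(1)] h\<phi>[OF t(1)] h\<phi>[OF t(2)] .
    then show ?thesis by (rule models_inj[OF mod c(2) models_smult(1)[OF mod c(1)]])
  qed
  moreover have "\<phi> Ds = \<zero>\<^bsub>M\<^esub>" if D: "Ds \<in> tuples L k" "\<not> distinct Ds" for Ds
  proof -
    have "\<not> distinct (map Ei Ds)" using D(2) by (simp add: distinct_map)
    then have "h (\<phi> Ds) = 0"
      unfolding h\<phi>[OF D(1)] by (rule antisym_fun_repeat[OF models_vs[OF mod] multiD(3)[OF \<psi>]])
    then show ?thesis
      by (intro models_inj[OF mod PiE_mem[OF PE D(1)] models_zero(1)[OF mod]]) (simp add: models_zero(2)[OF mod])
  qed
  ultimately show ?thesis using PE unfolding cochain_space_def by simp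
qed

lemma hat_surj:
  assumes \<psi>: "\<psi> \<in> multi k"
  shows "\<exists>\<phi>\<in>carrier (cochain_space L M k). hat k \<phi> = \<psi>"
proof -
  let ?\<phi> = "\<lambda>Ds\<in>tuples L k. inv_into (carrier M) h (\<psi> (map Ei Ds))"
  have PE: "?\<phi> \<in> tuples L k \<rightarrow>\<^sub>E carrier M"
    using models_inv(1)[OF mod multiD(1)[OF \<psi>]] by simp
  have "hat k ?\<phi> = \<psi>"
  proof (rule ext)
    fix xs
    show "hat k ?\<phi> xs = \<psi> xs"
    proof (cases "int (length xs) = k \<and> set xs \<subseteq> B")
      case True
      then have "map Ei (map E xs) = xs" using Ei(3) by (simp add: map_idI subset_iff)
      then show ?thesis
        using True map_E[of xs k] models_inv(2)[OF mod multiD(1)[OF \<psi>]] by (simp add: hat_def del: map_map)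
    next
      case False
      then show ?thesis using multiD(2)[OF \<psi> False] by (auto simp: hat_def)
    qed
  qed
  then show ?thesis using cochainI[OF PE] \<psi> by auto
qed

lemma models_cochains: "models (\<lambda>c f x. s c (f x)) (cochain_space L M k) (hat k) (multi k)"
proof -
  let ?C = "cochain_space L M k"
  have sum: "\<phi> \<oplus>\<^bsub>?C\<^esub> \<phi>' \<in> carrier ?C \<and> hat k (\<phi> \<oplus>\<^bsub>?C\<^esub> \<phi>') = hat k \<phi> + hat k \<phi>'"
    if \<phi>: "\<phi> \<in> carrier ?C" and \<phi>': "\<phi>' \<in> carrier ?C" for \<phi> \<phi>'
  proof -
    note PE = cochain_PiE[OF \<phi>] cochain_PiE[OF \<phi>']
    have e: "\<phi> \<oplus>\<^bsub>?C\<^esub> \<phi>' = (\<lambda>xs\<in>tuples L k. \<phi> xs \<oplus>\<^bsub>M\<^esub> \<phi>' xs)" by (simp add: cochain_space_def)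
    have m: "\<phi> \<oplus>\<^bsub>?C\<^esub> \<phi>' \<in> tuples L k \<rightarrow>\<^sub>E carrier M"
      unfolding e using models_add(1)[OF mod] PiE_mem[OF PE(1)] PiE_mem[OF PE(2)] by simp
    have h: "hat k (\<phi> \<oplus>\<^bsub>?C\<^esub> \<phi>') = hat k \<phi> + hat k \<phi>'"
    proof (rule ext)
      fix xs
      show "hat k (\<phi> \<oplus>\<^bsub>?C\<^esub> \<phi>') xs = (hat k \<phi> + hat k \<phi>') xs"
        using map_E[of xs k] models_add(2)[OF mod PiE_mem[OF PE(1)] PiE_mem[OF PE(2)]]
        unfolding e by (simp add: hat_def)
    qed
    have "hat k \<phi> + hat k \<phi>' \<in> multi k"
      using multiD[OF hat_multi[OF \<phi>]] multiD[OF hat_multi[OF \<phi>']] models_S(2)[OF mod]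
        antisym_fun_add[of "hat k \<phi>" "hat k \<phi>'"]
      unfolding multi_def by (simp add: V.scale_right_distrib)
    then show ?thesis using cochainI[OF m] h by simp
  qed
  have scale: "c \<odot>\<^bsub>?C\<^esub> \<phi> \<in> carrier ?C \<and> hat k (c \<odot>\<^bsub>?C\<^esub> \<phi>) = (\<lambda>xs. s c (hat k \<phi> xs))"
    if \<phi>: "\<phi> \<in> carrier ?C" for c \<phi>
  proof -
    note PE = cochain_PiE[OF \<phi>]
    have e: "c \<odot>\<^bsub>?C\<^esub> \<phi> = (\<lambda>xs\<in>tuples L k. c \<odot>\<^bsub>M\<^esub> \<phi> xs)" by (simp add: cochain_space_def)
    have m: "c \<odot>\<^bsub>?C\<^esub> \<phi> \<in> tuples L k \<rightarrow>\<^sub>E carrier M"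
      unfolding e using models_smult(1)[OF mod] PiE_mem[OF PE] by simp
    have h: "hat k (c \<odot>\<^bsub>?C\<^esub> \<phi>) = (\<lambda>xs. s c (hat k \<phi> xs))"
    proof (rule ext)
      fix xs
      show "hat k (c \<odot>\<^bsub>?C\<^esub> \<phi>) xs = s c (hat k \<phi> xs)"
        using map_E[of xs k] models_smult(2)[OF mod PiE_mem[OF PE]]
        unfolding e by (simp add: hat_def)
    qed
    have "antisym_fun (\<lambda>xs. s c (hat k \<phi> xs))"
      by (rule antisym_fun_comp[OF multiD(3)[OF hat_multi[OF \<phi>]]]) simp
    then have "(\<lambda>xs. s c (hat k \<phi> xs)) \<in> multi k"
      using multiD[OF hat_multi[OF \<phi>]] models_S(3)[OF mod]
      unfolding multi_def by (simp add: V.scale_right_distrib mult.commute)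
    then show ?thesis using cochainI[OF m] h by simp
  qed
  have z: "\<zero>\<^bsub>?C\<^esub> \<in> tuples L k \<rightarrow>\<^sub>E carrier M" "hat k \<zero>\<^bsub>?C\<^esub> = 0"
  proof -
    have e: "\<zero>\<^bsub>?C\<^esub> = (\<lambda>xs\<in>tuples L k. \<zero>\<^bsub>M\<^esub>)" by (simp add: cochain_space_def)
    show "\<zero>\<^bsub>?C\<^esub> \<in> tuples L k \<rightarrow>\<^sub>E carrier M" unfolding e using models_zero(1)[OF mod] by simp
    show "hat k \<zero>\<^bsub>?C\<^esub> = 0"
    proof (rule ext)
      fix xs show "hat k \<zero>\<^bsub>?C\<^esub> xs = 0 xs"
        using map_E[of xs k] models_zero(2)[OF mod] unfolding e by (simp add: hat_def)
    qed
  qed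
  have z': "\<zero>\<^bsub>?C\<^esub> \<in> carrier ?C"
    by (rule cochainI[OF z(1)]) (use models_S(1)[OF mod] in \<open>simp add: z(2) multi_def antisym_fun_def\<close>)
  have "bij_betw (hat k) (carrier ?C) (multi k)"
  proof (rule bij_betw_imageI)
    show "inj_on (hat k) (carrier ?C)" by (rule inj_onI) (erule (2) hat_inj[OF cochain_PiE cochain_PiE])
    show "hat k ` carrier ?C = multi k" using hat_multi hat_surj by blast
  qed
  then show ?thesis unfolding models_def
    using vector_space_fun[OF models_vs[OF mod]] z(2) z' sum scale by blast
qed

context
  fixes act :: "'l \<Rightarrow> 'b \<Rightarrow> 'b" and act' :: "'x \<Rightarrow> 't \<Rightarrow> 't"
  assumes act: "\<And>x v. x \<in> B \<Longrightarrow> v \<in> carrier M \<Longrightarrow> act (E x) v \<in> carrier M"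
    "\<And>x v. x \<in> B \<Longrightarrow> v \<in> carrier M \<Longrightarrow> h (act (E x) v) = act' x (h v)"
begin

text \<open>The explicit formula is transported term by term; \<open>dee_sum\<close> then turns it
  into the recursive differential.\<close>

lemma coboundary_value:
  assumes \<phi>: "\<phi> \<in> carrier (cochain_space L M k)" and xs: "set xs \<subseteq> B" "int (length xs) = k + 1"
  shows "coboundary L M act k \<phi> (map E xs) \<in> carrier M"
    "h (coboundary L M act k \<phi> (map E xs)) = dee (\<lambda>x y. con (brk x y)) act' (hat k \<phi>) xs"
proof -
  note PE = cochain_PiE[OF \<phi>]
  let ?n = "length xs" and ?P = "{(s, t). s < t \<and> t < length xs}"
  have bc: "con (brk x y) (con w \<psi>) ys = - con (brk x y) \<psi> (w # ys)" if "antisym_fun \<psi>" for x y w ys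
    and \<psi> :: "'x list \<Rightarrow> 't" unfolding con_apply by (rule antisym_fun_swap[OF that])
  have fin: "finite ?P" by (rule finite_subset[of _ "{..<?n} \<times> {..<?n}"]) auto
  have nB: "set (nths xs I) \<subseteq> B" for I using set_nths_subset[of xs I] xs(1) by blast
  have xB: "xs ! i \<in> B" if "i < ?n" for i using that xs(1) by auto
  have len1: "int (length (nths xs (- {i}))) = k" if "i < ?n" for i
  proof -
    have "{j. j < ?n \<and> j \<in> - {i}} = {..<?n} - {i}" by auto
    then show ?thesis using that xs(2) by (simp add: length_nths)
  qed
  have len2: "int (length (brk (xs ! fst p) (xs ! snd p) # nths xs (- {fst p, snd p}))) = k" if "p \<in> ?P" for p
  proof -
    have "{j. j < ?n \<and> j \<in> - {fst p, snd p}} = {..<?n} - {fst p, snd p}" by auto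
    moreover have "card ({..<?n} - {fst p, snd p}) = ?n - 2"
      using that by (subst card_Diff_subset) auto
    moreover have "?n \<ge> 2" using that by auto
    ultimately show ?thesis using xs(2) by (simp add: length_nths)
  qed
  let ?X = "map E xs"
  let ?f = "\<lambda>p. (-1) ^ (fst p + snd p + 1) \<odot>\<^bsub>M\<^esub> \<phi> (bracket L (?X ! fst p) (?X ! snd p) # nths ?X (- {fst p, snd p}))"
  let ?g = "\<lambda>s. (-1) ^ (s + 1) \<odot>\<^bsub>M\<^esub> act (?X ! s) (\<phi> (nths ?X (- {s})))"
  have sgn: "s ((-1) ^ e) v = sg e v" for e v by (cases "even e") (simp_all add: sg_def)
  have f: "?f p \<in> carrier M \<and> h (?f p) = sg (fst p + snd p + 1)
      (con (brk (xs ! fst p) (xs ! snd p)) (hat k \<phi>) (nths xs (- {fst p, snd p})))" if p: "p \<in> ?P" for p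
  proof -
    have i: "fst p < ?n" "snd p < ?n" using p by auto
    let ?ys = "brk (xs ! fst p) (xs ! snd p) # nths xs (- {fst p, snd p})"
    have ys: "set ?ys \<subseteq> B" using nB B_brk[OF xB[OF i(1)] xB[OF i(2)]] by auto
    have m: "bracket L (?X ! fst p) (?X ! snd p) # nths ?X (- {fst p, snd p}) = map E ?ys"
      using i xB by (simp add: nths_map E_brk)
    have c: "\<phi> (map E ?ys) \<in> carrier M" by (rule PiE_mem[OF PE map_E[OF ys len2[OF p]]])
    have hh: "h (\<phi> (map E ?ys)) = hat k \<phi> ?ys" unfolding hat_def using ys len2[OF p] by (simp only: simp_thms if_True)
    show ?thesis unfolding m models_smult(2)[OF mod c] hh con_apply sgn
      using models_smult(1)[OF mod c] by simp
  qed
  have g: "?g i \<in> carrier M \<and> h (?g i) = sg (i + 1) (act' (xs ! i) (hat k \<phi> (nths xs (- {i}))))" if i: "i < ?n" for i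
  proof -
    have c: "\<phi> (map E (nths xs (- {i}))) \<in> carrier M" by (rule PiE_mem[OF PE map_E[OF nB len1[OF i]]])
    have hh: "h (\<phi> (map E (nths xs (- {i})))) = hat k \<phi> (nths xs (- {i}))" unfolding hat_def using nB len1[OF i] by simp
    have m: "?X ! i = E (xs ! i)" "nths ?X (- {i}) = map E (nths xs (- {i}))" using i by (simp_all add: nths_map)
    note a = act(1)[OF xB[OF i] c] act(2)[OF xB[OF i] c]
    show ?thesis unfolding m models_smult(2)[OF mod a(1)] a(2) hh sgn
      using models_smult(1)[OF mod a(1)] by simp
  qed
  have F: "finsum M ?f ?P \<in> carrier M" "h (finsum M ?f ?P) = (\<Sum>p\<in>?P. h (?f p))"
    by (rule models_finsum[OF mod fin], drule f, erule conjunct1)+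
  have G: "finsum M ?g {..<?n} \<in> carrier M" "h (finsum M ?g {..<?n}) = (\<Sum>i<?n. h (?g i))"
    by (rule models_finsum[OF mod finite_lessThan], rule g[THEN conjunct1], simp)+
  have co: "coboundary L M act k \<phi> ?X = finsum M ?f ?P \<oplus>\<^bsub>M\<^esub> finsum M ?g {..<?n}"
    unfolding coboundary_def using map_E[OF xs] by (simp only: restrict_apply' length_map)
  show "coboundary L M act k \<phi> (map E xs) \<in> carrier M"
    unfolding co by (rule models_add(1)[OF mod F(1) G(1)])
  have "(\<Sum>p\<in>?P. h (?f p)) = (\<Sum>p\<in>?P. sg (fst p + snd p + 1)
      (con (brk (xs ! fst p) (xs ! snd p)) (hat k \<phi>) (nths xs (- {fst p, snd p}))))"
    by (rule sum.cong[OF refl], drule f, erule conjunct2)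
  moreover have "(\<Sum>i<?n. h (?g i)) = (\<Sum>i<?n. sg (i + 1) (act' (xs ! i) (hat k \<phi> (nths xs (- {i})))))"
    by (rule sum.cong[OF refl], rule g[THEN conjunct2]) simp
  moreover have "dee (\<lambda>x y. con (brk x y)) act' (hat k \<phi>) xs =
      (\<Sum>p\<in>?P. sg (fst p + snd p + 1) (con (brk (xs ! fst p) (xs ! snd p)) (hat k \<phi>) (nths xs (- {fst p, snd p}))))
      + (\<Sum>i<?n. sg (i + 1) (act' (xs ! i) (hat k \<phi> (nths xs (- {i})))))"
    by (rule dee_sum[OF bc multiD(3)[OF hat_multi[OF \<phi>]]])
  ultimately show "h (coboundary L M act k \<phi> (map E xs)) = dee (\<lambda>x y. con (brk x y)) act' (hat k \<phi>) xs"
    unfolding co models_add(2)[OF mod F(1) G(1)] F(2) G(2) by (simp only:)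
qed

lemma coboundary_PiE:
  assumes "\<phi> \<in> carrier (cochain_space L M k)"
  shows "coboundary L M act k \<phi> \<in> tuples L (k + 1) \<rightarrow>\<^sub>E carrier M"
proof (rule PiE_I)
  fix Ds assume D: "Ds \<in> tuples L (k + 1)"
  show "coboundary L M act k \<phi> Ds \<in> carrier M"
    using coboundary_value(1)[OF assms map_Ei(1,2)[OF D]] unfolding map_Ei(3)[OF D] .
next
  fix Ds assume "Ds \<notin> tuples L (k + 1)"
  then show "coboundary L M act k \<phi> Ds = undefined" by (simp add: coboundary_def)
qed

text \<open>
  It suffices to identify the differential on lists over \<open>B\<close>: multilinearity of
  \<open>coboundary \<phi>\<close> is then inherited from \<open>\<psi>\<close>.
\<close>

lemma coboundary_hat:
  assumes \<phi>: "\<phi> \<in> carrier (cochain_space L M k)" and \<psi>: "\<psi> \<in> multi (k + 1)"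
    and eq: "\<And>xs. set xs \<subseteq> B \<Longrightarrow> int (length xs) = k + 1 \<Longrightarrow> dee (\<lambda>x y. con (brk x y)) act' (hat k \<phi>) xs = \<psi> xs"
  shows "coboundary L M act k \<phi> \<in> carrier (cochain_space L M (k + 1))"
    "hat (k + 1) (coboundary L M act k \<phi>) = \<psi>"
proof -
  show 1: "hat (k + 1) (coboundary L M act k \<phi>) = \<psi>"
  proof (rule ext)
    fix xs
    show "hat (k + 1) (coboundary L M act k \<phi>) xs = \<psi> xs"
    proof (cases "int (length xs) = k + 1 \<and> set xs \<subseteq> B")
      case True
      then show ?thesis using coboundary_value(2)[OF \<phi>, of xs] eq[of xs] by (simp add: hat_def)
    next
      case False
      then show ?thesis using multiD(2)[OF \<psi> False] by (auto simp: hat_def)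
    qed
  qed
  show "coboundary L M act k \<phi> \<in> carrier (cochain_space L M (k + 1))"
    by (rule cochainI[OF coboundary_PiE[OF \<phi>]]) (simp add: 1 \<psi>)
qed

end

end

subsection \<open>Cohomology of modelled complexes\<close>

lemma models_comp:
  assumes M: "models s M h S" and s': "vector_space s'" and g: "bij_betw g S S'"
    and add: "\<And>v w. v \<in> S \<Longrightarrow> w \<in> S \<Longrightarrow> g (v + w) = g v + g w"
    and scale: "\<And>c v. v \<in> S \<Longrightarrow> g (s c v) = s' c (g v)"
  shows "models s' M (\<lambda>x. g (h x)) S'"
proof -
  have "g 0 = 0" using add[OF models_S(1)[OF M] models_S(1)[OF M]] by simp
  moreover have "bij_betw (\<lambda>x. g (h x)) (carrier M) S'"
    using bij_betw_trans[OF models_bij[OF M] g] by (simp add: comp_def)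
  ultimately show ?thesis
    unfolding models_def
    using s' models_zero[OF M] models_add[OF M] models_smult[OF M] models_in[OF M] add scale by simp
qed

text \<open>If q is linear and vanishes on a cocycle exactly when it is a boundary, then cohomology
  is modelled by the image of the cocycles under q. The differential D is one operator for all
  degrees, since the elements of the models need not carry their degree in their type.\<close>

lemma models_cohomology:
  fixes C :: "int \<Rightarrow> (complex, 'x) module" and \<theta> :: "int \<Rightarrow> 'x \<Rightarrow> 't::ab_group_add"
  assumes C: "\<And>k. models s (C k) (\<theta> k) (S k)"
    and d: "\<And>k \<phi>. \<phi> \<in> carrier (C k) \<Longrightarrow> d k \<phi> \<in> carrier (C (k + 1))"
      "\<And>k \<phi>. \<phi> \<in> carrier (C k) \<Longrightarrow> \<theta> (k + 1) (d k \<phi>) = D (\<theta> k \<phi>)"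
    and D: "\<And>v w. D (v + w) = D v + D w" "\<And>c v. D (s c v) = s c (D v)" "\<And>v. D (D v) = 0"
    and s': "vector_space s'"
    and q: "\<And>v w. v \<in> S k \<Longrightarrow> w \<in> S k \<Longrightarrow> q (v + w) = q v + q w" "\<And>c v. v \<in> S k \<Longrightarrow> q (s c v) = s' c (q v)"
    and ker: "\<And>v. v \<in> S k \<Longrightarrow> D v = 0 \<Longrightarrow> q v = 0 \<longleftrightarrow> v \<in> D ` S (k - 1)"
  shows "models s' (cohomology C d k) (\<lambda>X. q (\<theta> k (SOME x. x \<in> X))) (q ` {v \<in> S k. D v = 0})"
proof -
  let ?Z = "{\<phi> \<in> carrier (C k). d k \<phi> = \<zero>\<^bsub>C (k + 1)\<^esub>}"
  have cyc: "d k \<phi> = \<zero>\<^bsub>C (k + 1)\<^esub> \<longleftrightarrow> D (\<theta> k \<phi>) = 0" if "\<phi> \<in> carrier (C k)" for \<phi>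
    using d(2)[OF that] models_zero[OF C] models_inj[OF C d(1)[OF that] models_zero(1)[OF C]] by metis
  have Z: "?Z = {\<phi> \<in> carrier (C k). D (\<theta> k \<phi>) = 0}" using cyc by blast
  have D0: "D 0 = 0" using D(1)[of 0 0] by simp
  interpret V: vector_space s by (rule models_vs[OF C])
  have im: "\<theta> k ` {\<phi> \<in> carrier (C k). D (\<theta> k \<phi>) = 0} = {v \<in> S k. D v = 0}"
    using models_bij[OF C[of k]] unfolding bij_betw_def by auto
  have R: "models s ((C k)\<lparr>carrier := ?Z\<rparr>) (\<theta> k) {v \<in> S k. D v = 0}"
    unfolding Z im[symmetric]
    by (rule models_restrict[OF C])
      (use models_zero[OF C[of k]] models_add[OF C[of k]] models_smult[OF C[of k]] in \<open>auto simp: D D0\<close>)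
  have N: "d (k - 1) ` carrier (C (k - 1)) = {x \<in> carrier ((C k)\<lparr>carrier := ?Z\<rparr>). q (\<theta> k x) = 0}"
  proof (intro equalityI subsetI)
    fix x assume "x \<in> d (k - 1) ` carrier (C (k - 1))"
    then obtain \<phi> where \<phi>: "\<phi> \<in> carrier (C (k - 1))" "x = d (k - 1) \<phi>" by blast
    then have x: "x \<in> carrier (C k)" "\<theta> k x = D (\<theta> (k - 1) \<phi>)"
      using d[OF \<phi>(1)] by simp_all
    then have "D (\<theta> k x) = 0" by (simp add: D)
    moreover from this have "q (\<theta> k x) = 0"
      using ker[OF models_in[OF C x(1)]] x(2) models_in[OF C \<phi>(1)] by blast
    ultimately show "x \<in> {x \<in> carrier ((C k)\<lparr>carrier := ?Z\<rparr>). q (\<theta> k x) = 0}" using x(1) cyc by simp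
  next
    fix x assume "x \<in> {x \<in> carrier ((C k)\<lparr>carrier := ?Z\<rparr>). q (\<theta> k x) = 0}"
    then have x: "x \<in> carrier (C k)" "D (\<theta> k x) = 0" "q (\<theta> k x) = 0" using cyc by auto
    then obtain v where v: "v \<in> S (k - 1)" "\<theta> k x = D v" using ker[OF models_in[OF C x(1)]] by blast
    obtain \<phi> where \<phi>: "\<phi> \<in> carrier (C (k - 1))" "\<theta> (k - 1) \<phi> = v" by (rule models_obtain[OF C v(1)])
    have "d (k - 1) \<phi> = x"
      by (rule models_inj[OF C[of k]]) (use d[OF \<phi>(1)] x v \<phi> in simp_all)
    then show "x \<in> d (k - 1) ` carrier (C (k - 1))" using \<phi>(1) by blast
  qed
  show ?thesis
    unfolding cohomology_def
    by (rule models_quotient(1)[where q = q, OF R s' _ _ N]) (use q in auto)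
qed

text \<open>A quotient realized without changing the type: v is sent to v - g v, where g is a linear
  projection onto U.\<close>

lemma quotient_map_exists:
  fixes s :: "complex \<Rightarrow> 't \<Rightarrow> 't::ab_group_add"
  assumes vs: "vector_space s" and U: "0 \<in> U" "\<And>v w. v \<in> U \<Longrightarrow> w \<in> U \<Longrightarrow> v + w \<in> U" "\<And>c v. v \<in> U \<Longrightarrow> s c v \<in> U"
  shows "\<exists>q. (\<forall>v w. q (v + w) = q v + q w) \<and> (\<forall>c v. q (s c v) = s c (q v)) \<and> (\<forall>v. q v = 0 \<longleftrightarrow> v \<in> U)"
proof -
  interpret V: vector_space s by (rule vs)
  interpret VP: vector_space_pair s s ..
  have lin: "Vector_Spaces.linear s s (\<lambda>v. v)"
    unfolding Vector_Spaces.linear_iff using vs by simp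
  have sub: "V.subspace U" by (rule V.subspaceI) (use U in auto)
  obtain g where g: "g ` UNIV \<subseteq> U" "Vector_Spaces.linear s s g" "\<forall>v\<in>U. g v = v"
    using VP.linear_exists_left_inverse_on[OF lin sub] by auto
  have l: "g (v + w) = g v + g w" "g (s c v) = s c (g v)" for v w c
    using g(2) unfolding Vector_Spaces.linear_iff by auto
  have z: "v - g v = 0 \<longleftrightarrow> v \<in> U" for v
  proof
    assume "v - g v = 0"
    then have "v = g v" by simp
    then show "v \<in> U" using g(1) by (metis image_subset_iff UNIV_I)
  qed (use g(3) in simp)
  show ?thesis
    by (rule exI[of _ "\<lambda>v. v - g v"]) (simp only: z, simp add: l V.scale_right_diff_distrib)
qed

lemma antisym_fun_restrict:
  fixes \<psi> :: "'l list \<Rightarrow> 'b::ab_group_add"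
  assumes "antisym_fun \<psi>"
  shows "antisym_fun (\<lambda>xs. if P (set xs) then \<psi> xs else 0)"
  unfolding antisym_fun_def
proof (intro allI)
  fix xs ys :: "'l list" and x y
  have e: "set (xs @ x # y # ys) = set (xs @ y # x # ys)" by auto
  show "(if P (set (xs @ x # y # ys)) then \<psi> (xs @ x # y # ys) else 0)
    = - (if P (set (xs @ y # x # ys)) then \<psi> (xs @ y # x # ys) else 0)"
    unfolding e antisym_funD[OF assms, of xs x y ys] by (cases "P (set (xs @ y # x # ys))") (simp_all only: if_True if_False minus_zero)
qed

lemma antisym_fun_map: "antisym_fun \<psi> \<Longrightarrow> antisym_fun (\<lambda>xs. \<psi> (map f xs))"
  unfolding antisym_fun_def map_append list.map by blast

context lie_jet
begin

subsection \<open>Cochains on polynomial vector fields\<close>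

lemma act_\<iota>: "act j (sc (\<iota> c) v) = sc (\<iota> c) (act j v)"
proof (cases "j = 0")
  case True
  then show ?thesis unfolding True act_zero by (auto intro!: val_eqI simp: d_\<iota>_mult)
qed (simp add: act_lin)

text \<open>The linear map on polynomials that takes the value \<open>g j\<close> on Z^j.\<close>

definition pl :: "complex poly \<Rightarrow> (nat \<Rightarrow> 'k val) \<Rightarrow> 'k val" where
  "pl p g = (\<Sum>j\<le>degree p. sc (\<iota> (coeff p j)) (g j))"

lemma pl_superset: "degree p \<le> N \<Longrightarrow> pl p g = (\<Sum>j\<le>N. sc (\<iota> (coeff p j)) (g j))"
  unfolding pl_def by (rule sum.mono_neutral_left) (auto simp: coeff_eq_0 \<iota>_0 not_le)

lemma pl_poly_add: "pl (p + q) g = pl p g + pl q g"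
proof -
  let ?N = "max (degree p) (degree q)"
  have "degree (p + q) \<le> ?N" by (rule degree_add_le_max)
  then show ?thesis
    using pl_superset[of "p + q" ?N g] pl_superset[of p ?N g] pl_superset[of q ?N g]
    by (simp add: \<iota>_add sc_left sum.distrib)
qed

lemma pl_smult: "pl (Polynomial.smult c p) g = sc (\<iota> c) (pl p g)"
  using pl_superset[OF degree_smult_le, of c p g]
  by (simp add: pl_def \<iota>_mult sc_sum)

lemma pl_0: "pl 0 g = 0"
  by (simp add: pl_def \<iota>_0)

lemma pl_poly_sum: "pl (\<Sum>i\<in>I. P i) g = (\<Sum>i\<in>I. pl (P i) g)"
  by (induction I rule: infinite_finite_induct) (simp_all add: pl_0 pl_poly_add)

lemma pl_monom: "pl (monom c i) g = sc (\<iota> c) (g i)"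
proof -
  have "pl (monom c i) g = (\<Sum>j\<le>i. sc (\<iota> (coeff (monom c i) j)) (g j))"
    by (rule pl_superset[OF degree_monom_le])
  also have "\<dots> = (\<Sum>j\<le>i. if j = i then sc (\<iota> c) (g j) else 0)"
    by (rule sum.cong) (auto simp: \<iota>_0)
  finally show ?thesis by simp
qed

lemma pl_add: "pl p (\<lambda>j. g j + g' j) = pl p g + pl p g'"
  by (simp add: pl_def sum.distrib)

lemma pl_zero: "pl p (\<lambda>j. 0) = 0"
  by (simp add: pl_def)

lemma pl_minus: "pl p (\<lambda>j. - g j) = - pl p g"
  by (simp add: pl_def sum_negf)

lemma pl_diff: "pl p (\<lambda>j. g j - g' j) = pl p g - pl p g'"
  by (simp add: pl_def sum_subtractf)

lemma pl_sc: "pl p (\<lambda>j. sc k (g j)) = sc k (pl p g)"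
  by (simp add: pl_def sc_sum mult.commute)

lemma pl_swap: "pl p (\<lambda>i. pl q (\<lambda>j. G i j)) = pl q (\<lambda>j. pl p (\<lambda>i. G i j))"
  unfolding pl_def sc_sum by (subst sum.swap) (simp add: mult.commute)

lemma act_pl: "act i (pl p g) = pl p (\<lambda>j. act i (g j))"
proof -
  have "act i (\<Sum>j\<in>I. f j) = (\<Sum>j\<in>I. act i (f j))" for f :: "nat \<Rightarrow> 'k val" and I
    by (induction I rule: infinite_finite_induct) (simp_all add: act_add)
  then show ?thesis by (simp add: pl_def act_\<iota>)
qed

lemma pl_in:
  assumes "\<And>j. g j \<in> VC" shows "pl p g \<in> VC"
proof -
  have "(\<Sum>j\<in>I. sc (\<iota> (coeff p j)) (g j)) \<in> VC" for I
    using assms by (induction I rule: infinite_finite_induct) (simp_all add: VC_0 VC_add VC_sc)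
  then show ?thesis unfolding pl_def by blast
qed

definition PB :: "complex poly set" where
  "PB = {p. coeff p 0 = 0}"

definition pbr :: "complex poly \<Rightarrow> complex poly \<Rightarrow> complex poly" where
  "pbr p q = p * pderiv q - q * pderiv p"

lemma PB_closed:
  "p \<in> PB \<Longrightarrow> q \<in> PB \<Longrightarrow> p + q \<in> PB" "p \<in> PB \<Longrightarrow> Polynomial.smult c p \<in> PB" "p \<in> PB \<Longrightarrow> q \<in> PB \<Longrightarrow> pbr p q \<in> PB"
  by (simp_all add: PB_def pbr_def coeff_mult)

lemma monom_PB: "monom c i \<in> PB \<longleftrightarrow> c = 0 \<or> i \<noteq> 0"
  by (auto simp: PB_def)

text \<open>Constant terms must be excluded: d/dZ does not commute with Z^j d/dZ for j > 0, whereas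
  the index 0 is made to commute with all others.\<close>

lemma pl_pbr:
  assumes p: "p \<in> PB" and q: "q \<in> PB"
  shows "pl (pbr p q) g = pl p (\<lambda>i. pl q (\<lambda>j. if i = 0 \<or> j = 0 then 0 else sc (of_int (int j - int i)) (g (i + j - 1))))"
    (is "_ = pl p (\<lambda>i. pl q (\<lambda>j. ?G i j))")
proof -
  let ?P = "\<lambda>i. monom (coeff p i) i" and ?Q = "\<lambda>j. monom (coeff q j) j"
  have sp: "p = (\<Sum>i\<le>degree p. ?P i)" and sq: "q = (\<Sum>j\<le>degree q. ?Q j)"
    by (simp_all add: poly_as_sum_of_monoms)
  have pd: "pderiv p = (\<Sum>i\<le>degree p. pderiv (?P i))" and qd: "pderiv q = (\<Sum>j\<le>degree q. pderiv (?Q j))"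
    using arg_cong[OF sp, of pderiv] arg_cong[OF sq, of pderiv] higher_pderiv_sum[of 1 ?P] higher_pderiv_sum[of 1 ?Q]
    by simp_all
  have br: "pbr (?P i) (?Q j) = (if i = 0 \<or> j = 0 then 0
      else monom (coeff p i * coeff q j * of_int (int j - int i)) (i + j - 1))" for i j
  proof (cases "i = 0 \<or> j = 0")
    case True
    then show ?thesis using p q by (auto simp: pbr_def PB_def)
  next
    case False
    have "i + (j - 1) = i + j - 1" "j + (i - 1) = i + j - 1" using False by auto
    then have "pbr (?P i) (?Q j) = monom (coeff p i * (of_nat j * coeff q j)) (i + j - 1)
        - monom (coeff q j * (of_nat i * coeff p i)) (i + j - 1)"
      by (simp add: pbr_def pderiv_monom mult_monom)
    also have "\<dots> = monom (coeff p i * coeff q j * of_int (int j - int i)) (i + j - 1)"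
      by (simp add: diff_monom algebra_simps)
    finally show ?thesis using False by simp
  qed
  have "pbr p q = (\<Sum>i\<le>degree p. ?P i) * (\<Sum>j\<le>degree q. pderiv (?Q j))
      - (\<Sum>j\<le>degree q. ?Q j) * (\<Sum>i\<le>degree p. pderiv (?P i))"
    unfolding pbr_def using sp sq pd qd by (simp only:)
  also have "\<dots> = (\<Sum>i\<le>degree p. \<Sum>j\<le>degree q. ?P i * pderiv (?Q j)) - (\<Sum>i\<le>degree p. \<Sum>j\<le>degree q. ?Q j * pderiv (?P i))"
    unfolding sum_product by (subst (2) sum.swap) (rule refl)
  also have "\<dots> = (\<Sum>i\<le>degree p. \<Sum>j\<le>degree q. pbr (?P i) (?Q j))"
    unfolding pbr_def sum_subtractf ..
  finally have "pl (pbr p q) g = (\<Sum>i\<le>degree p. \<Sum>j\<le>degree q. pl (pbr (?P i) (?Q j)) g)"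
    by (simp only: pl_poly_sum)
  also have "\<dots> = (\<Sum>i\<le>degree p. \<Sum>j\<le>degree q. sc (\<iota> (coeff p i)) (sc (\<iota> (coeff q j)) (?G i j)))"
    unfolding br by (intro sum.cong refl) (simp add: pl_0 pl_monom \<iota>_mult \<iota>_of_int del: of_int_diff of_int_of_nat_eq)
  finally show ?thesis by (simp add: pl_def sc_sum)
qed

text \<open>The multilinear form with the values c on monomials; the analogue of \<open>Phi\<close>
  for polynomial vector fields, where no cut-off arises because a polynomial has finitely many
  coefficients.\<close>

fun ext :: "(nat list \<Rightarrow> 'k val) \<Rightarrow> complex poly list \<Rightarrow> 'k val" where
  "ext c [] = c []"
| "ext c (p # ps) = pl p (\<lambda>j. ext (con j c) ps)"

definition cp :: "complex poly \<Rightarrow> (nat list \<Rightarrow> 'k val) \<Rightarrow> nat list \<Rightarrow> 'k val" where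
  "cp p c js = pl p (\<lambda>j. c (j # js))"

lemma con_pl: "con k (\<lambda>js. pl p (\<lambda>j. f j js)) = (\<lambda>js. pl p (\<lambda>j. con k (f j) js))"
  by (simp add: fun_eq_iff con_apply)

lemma ext_pl: "ext (\<lambda>js. pl p (\<lambda>j. f j js)) ps = pl p (\<lambda>j. ext (f j) ps)"
proof (induction ps arbitrary: f)
  case (Cons q qs)
  show ?case unfolding ext.simps con_pl Cons.IH by (rule pl_swap)
qed simp

lemma con_ext: "con p (ext c) = ext (cp p c)"
proof (rule HOL.ext)
  fix ps
  have "cp p c = (\<lambda>js. pl p (\<lambda>j. con j c js))" by (simp add: fun_eq_iff cp_def con_apply)
  then have "ext (cp p c) ps = pl p (\<lambda>j. ext (con j c) ps)" by (simp only: ext_pl)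
  then show "con p (ext c) ps = ext (cp p c) ps" by (simp add: con_apply)
qed

lemma ext_add: "ext (c + c') ps = ext c ps + ext c' ps"
  by (induction ps arbitrary: c c') (simp_all add: con_add pl_add)

lemma ext_0: "ext 0 ps = 0"
  using ext_add[of 0 0 ps] by simp

lemma ext_minus: "ext (- c) ps = - ext c ps"
  using ext_add[of c "- c" ps] by (simp add: eq_neg_iff_add_eq_0 add.commute ext_0)

lemma ext_diff: "ext (c - c') ps = ext c ps - ext c' ps"
  using ext_add[of c "- c'" ps] by (simp add: ext_minus)

lemma ext_scale: "ext (\<lambda>js. sc k (c js)) ps = sc k (ext c ps)"
  by (induction ps arbitrary: c) (simp_all add: con_scale pl_sc)

lemma ext_brn: "ext (brn i j c) ps =
    (if i = 0 \<or> j = 0 then 0 else sc (of_int (int j - int i)) (ext (con (i + j - 1) c) ps))"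
proof (cases "i = 0 \<or> j = 0")
  case True
  then have "brn i j c = 0" by (auto simp: brn_def fun_eq_iff)
  then show ?thesis using True by (simp add: ext_0)
next
  case False
  then have "brn i j c = (\<lambda>js. sc (of_int (int j - int i)) (con (i + j - 1) c js))"
    by (simp add: brn_def fun_eq_iff con_apply)
  then show ?thesis using False by (simp add: ext_scale)
qed

lemma antisym_cp:
  assumes "antisym_fun c"
  shows "antisym_fun (cp p c)"
  unfolding antisym_fun_def
proof (intro allI)
  fix xs x y ys
  have "c (j # xs @ x # y # ys) = - c (j # xs @ y # x # ys)" for j
    by (rule antisym_funD[OF assms, of "j # xs", unfolded append_Cons])
  then show "cp p c (xs @ x # y # ys) = - cp p c (xs @ y # x # ys)"
    unfolding cp_def pl_minus[symmetric] by (intro arg_cong[where f = "pl p"] HOL.ext)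
qed

lemma antisym_ext:
  assumes "antisym_fun c"
  shows "antisym_fun (ext c)"
  unfolding antisym_fun_def
proof (intro allI)
  fix xs x y ys
  show "ext c (xs @ x # y # ys) = - ext c (xs @ y # x # ys)"
    using assms
  proof (induction xs arbitrary: c)
    case Nil
    have e: "ext (con j (con i c)) ys = - ext (con i (con j c)) ys" for i j
    proof -
      have "con j (con i c) = - con i (con j c)"
        by (rule HOL.ext) (simp only: con_apply fun_Compl_def, rule antisym_fun_swap[OF Nil])
      from arg_cong[OF this, of "\<lambda>c. ext c ys"] show ?thesis unfolding ext_minus .
    qed
    have "pl x (\<lambda>i. pl y (\<lambda>j. ext (con j (con i c)) ys)) = pl x (\<lambda>i. pl y (\<lambda>j. - ext (con i (con j c)) ys))"
      by (intro arg_cong[where f = "pl x"] arg_cong[where f = "pl y"] HOL.ext e)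
    also have "\<dots> = - pl x (\<lambda>i. pl y (\<lambda>j. ext (con i (con j c)) ys))"
      unfolding pl_minus ..
    also have "pl x (\<lambda>i. pl y (\<lambda>j. ext (con i (con j c)) ys)) = pl y (\<lambda>j. pl x (\<lambda>i. ext (con i (con j c)) ys))"
      by (rule pl_swap)
    finally show ?case by simp
  next
    case (Cons z zs)
    have e: "ext c ((z # zs) @ us) = ext (cp z c) (zs @ us)" for us
      using fun_cong[OF con_ext[of z c], of "zs @ us"] by (simp add: con_apply)
    show ?case unfolding e by (rule Cons.IH[OF antisym_cp[OF Cons.prems]])
  qed
qed

lemma brn_pl: "brn i y (\<lambda>js. pl q (\<lambda>j. f j js)) js = pl q (\<lambda>j. brn i y (f j) js)"
  by (cases "i = 0 \<or> y = 0") (simp_all add: brn_def pl_zero pl_sc)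

lemma LN_pl: "LN i (\<lambda>js. pl q (\<lambda>j. f j js)) js = pl q (\<lambda>j. LN i (f j) js)"
proof (induction js arbitrary: f)
  case Nil
  show ?case by (simp add: act_pl)
next
  case (Cons y ys)
  show ?case unfolding lied.simps con_pl Cons.IH brn_pl pl_diff ..
qed

lemma DN_pl: "DN (\<lambda>js. pl q (\<lambda>j. f j js)) js = pl q (\<lambda>j. DN (f j) js)"
proof (induction js arbitrary: f)
  case Nil
  show ?case by (simp add: pl_zero)
next
  case (Cons y ys)
  show ?case unfolding dee.simps con_pl Cons.IH LN_pl pl_diff pl_minus ..
qed

lemma DN_\<iota>_scale: "DN (\<lambda>js. sc (\<iota> c) (f js)) = (\<lambda>js. sc (\<iota> c) (DN f js))"
  using DN_pl[of "monom c 0" "\<lambda>_. f"] by (simp add: fun_eq_iff pl_monom)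

abbreviation "actp p v \<equiv> pl p (\<lambda>j. act j v)"

text \<open>In contrast to \<open>LV_Phi\<close> there are no wedge terms, since the coefficients of
  a polynomial are constants.\<close>

lemma lied_ext:
  assumes p: "p \<in> PB" and "set qs \<subseteq> PB"
  shows "lied (\<lambda>p q. con (pbr p q)) actp p (ext c) qs = pl p (\<lambda>i. ext (LN i c) qs)"
  using assms(2)
proof (induction qs arbitrary: c)
  case Nil
  show ?case by simp
next
  case (Cons q qs)
  have q: "q \<in> PB" "set qs \<subseteq> PB" using Cons.prems by auto
  have cq: "cp q c = (\<lambda>js. pl q (\<lambda>j. con j c js))" by (simp add: fun_eq_iff cp_def con_apply)
  have LNcq: "ext (LN i (cp q c)) qs = pl q (\<lambda>j. ext (LN i (con j c)) qs)" for i
  proof -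
    have "LN i (cp q c) = (\<lambda>js. pl q (\<lambda>j. LN i (con j c) js))" unfolding cq LN_pl[abs_def] ..
    then show ?thesis by (simp only: ext_pl)
  qed
  have "lied (\<lambda>p q. con (pbr p q)) actp p (ext c) (q # qs)
      = lied (\<lambda>p q. con (pbr p q)) actp p (ext (cp q c)) qs - con (pbr p q) (ext c) qs"
    by (simp only: lied.simps con_ext)
  also have "\<dots> = pl p (\<lambda>i. pl q (\<lambda>j. ext (LN i (con j c)) qs))
      - pl p (\<lambda>i. pl q (\<lambda>j. ext (brn i j c) qs))"
    unfolding Cons.IH[OF q(2)] LNcq con_apply ext.simps pl_pbr[OF p q(1)] ext_brn ..
  also have "\<dots> = pl p (\<lambda>i. pl q (\<lambda>j. ext (con j (LN i c)) qs))"
    unfolding con_LN ext_diff pl_diff ..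
  finally show ?case by (simp only: ext.simps)
qed

theorem dee_ext:
  assumes "set ps \<subseteq> PB"
  shows "dee (\<lambda>p q. con (pbr p q)) actp (ext c) ps = ext (DN c) ps"
  using assms
proof (induction ps arbitrary: c)
  case Nil
  show ?case by simp
next
  case (Cons p ps)
  have p: "p \<in> PB" "set ps \<subseteq> PB" using Cons.prems by auto
  have "DN (cp p c) = (\<lambda>js. pl p (\<lambda>j. DN (con j c) js))"
    unfolding DN_pl[symmetric] by (rule arg_cong[where f = DN]) (simp add: fun_eq_iff cp_def con_apply)
  then have e: "ext (DN (cp p c)) ps = pl p (\<lambda>j. ext (DN (con j c)) ps)" by (simp only: ext_pl)
  show ?case
    unfolding dee.simps con_ext Cons.IH[OF p(2)] lied_ext[OF p] e ext.simps con_DN ext_diff ext_minus pl_diff pl_minus ..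
qed

definition polyc :: "int \<Rightarrow> (complex poly list \<Rightarrow> 'k val) set" where
  "polyc k = {\<psi>. (\<forall>xs. \<psi> xs \<in> VC) \<and> (\<forall>xs. \<not> (int (length xs) = k \<and> set xs \<subseteq> PB) \<longrightarrow> \<psi> xs = 0) \<and>
     antisym_fun \<psi> \<and>
     (\<forall>x\<in>PB. \<forall>y\<in>PB. \<forall>xs. set xs \<subseteq> PB \<longrightarrow> \<psi> ((x + y) # xs) = \<psi> (x # xs) + \<psi> (y # xs)) \<and>
     (\<forall>c. \<forall>x\<in>PB. \<forall>xs. set xs \<subseteq> PB \<longrightarrow> \<psi> (Polynomial.smult c x # xs) = sc (\<iota> c) (\<psi> (x # xs)))}"

definition pcoef :: "(complex poly list \<Rightarrow> 'k val) \<Rightarrow> nat list \<Rightarrow> 'k val" where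
  "pcoef \<psi> js = (if 0 \<in> set js then 0 else \<psi> (map (monom 1) js))"

definition extB :: "(nat list \<Rightarrow> 'k val) \<Rightarrow> complex poly list \<Rightarrow> 'k val" where
  "extB c ps = (if set ps \<subseteq> PB then ext c ps else 0)"

lemma pcoef_cocC:
  assumes "\<psi> \<in> polyc k"
  shows "pcoef \<psi> \<in> cocC k"
proof -
  have \<psi>: "\<And>xs. \<psi> xs \<in> VC" "\<And>xs. int (length xs) \<noteq> k \<Longrightarrow> \<psi> xs = 0" "antisym_fun \<psi>"
    using assms unfolding polyc_def by blast+
  have "pcoef \<psi> = (\<lambda>js. if 0 \<notin> set js then \<psi> (map (monom 1) js) else 0)"
    by (auto simp: fun_eq_iff pcoef_def)
  then have "antisym_fun (pcoef \<psi>)"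
    using antisym_fun_restrict[OF antisym_fun_map[OF \<psi>(3)], of "\<lambda>S. 0 \<notin> S"] by (simp only:)
  then show ?thesis unfolding cocC_def using \<psi>(1,2) VC_0 by (auto simp: pcoef_def)
qed

lemma ext_in: "(\<And>js. c js \<in> VC) \<Longrightarrow> ext c ps \<in> VC"
  by (induction ps arbitrary: c) (simp_all add: pl_in con_apply)

lemma ext_length: "(\<And>js. int (length js) \<noteq> k \<Longrightarrow> c js = 0) \<Longrightarrow> int (length ps) \<noteq> k \<Longrightarrow> ext c ps = 0"
proof (induction ps arbitrary: c k)
  case (Cons p ps)
  have "ext (con j c) ps = 0" for j
    by (rule Cons.IH[of "k - 1"]) (use Cons.prems in \<open>auto simp: con_apply\<close>)
  then show ?case by (simp add: pl_zero)
qed simp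

lemma extB_polyc:
  assumes c: "c \<in> cocC k"
  shows "extB c \<in> polyc k"
proof -
  have a: "antisym_fun (extB c)"
    using antisym_fun_restrict[OF antisym_ext[OF cocCD(3)[OF c]], of "\<lambda>S. S \<subseteq> PB"] unfolding extB_def[abs_def] .
  have v: "extB c ps \<in> VC" for ps unfolding extB_def using ext_in[of c ps] cocCD(1)[OF c] VC_0 by simp
  have z: "extB c ps = 0" if "\<not> (int (length ps) = k \<and> set ps \<subseteq> PB)" for ps
    unfolding extB_def using that ext_length[of k c ps] cocCD(2)[OF c] by auto
  have "extB c ((p + q) # ps) = extB c (p # ps) + extB c (q # ps)" if "p \<in> PB" "q \<in> PB" "set ps \<subseteq> PB" for p q ps
    using that PB_closed(1) by (simp add: extB_def pl_poly_add)
  moreover have "extB c (Polynomial.smult r p # ps) = sc (\<iota> r) (extB c (p # ps))" if "p \<in> PB" "set ps \<subseteq> PB" for r p ps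
    using that PB_closed(2) by (simp add: extB_def pl_smult)
  ultimately show ?thesis unfolding polyc_def using a v z by simp
qed

lemma pcoef_extB:
  assumes c: "c \<in> cocC k"
  shows "pcoef (extB c) = c"
proof (rule HOL.ext)
  fix js
  have m: "ext c (map (monom 1) js) = c js" for c
    by (induction js arbitrary: c) (simp_all add: pl_monom \<iota>_1 con_apply)
  show "pcoef (extB c) js = c js"
  proof (cases "0 \<in> set js")
    case True
    then show ?thesis using cocCD(4)[OF c] by (simp add: pcoef_def)
  next
    case False
    then have "set (map (monom 1) js) \<subseteq> PB" by (auto simp: monom_PB) (metis gr0I)
    then show ?thesis using False m by (simp add: pcoef_def extB_def)
  qed
qed

text \<open>The properties of \<open>polyc\<close> are listed without those of degree and values, so
  that they pass to the contractions that occur in the induction.\<close>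

lemma ext_pcoef:
  assumes "antisym_fun \<psi>"
    "\<And>x y xs. x \<in> PB \<Longrightarrow> y \<in> PB \<Longrightarrow> set xs \<subseteq> PB \<Longrightarrow> \<psi> ((x + y) # xs) = \<psi> (x # xs) + \<psi> (y # xs)"
    "\<And>c x xs. x \<in> PB \<Longrightarrow> set xs \<subseteq> PB \<Longrightarrow> \<psi> (Polynomial.smult c x # xs) = sc (\<iota> c) (\<psi> (x # xs))"
    and "set ps \<subseteq> PB"
  shows "ext (pcoef \<psi>) ps = \<psi> ps"
  using assms
proof (induction ps arbitrary: \<psi>)
  case Nil
  show ?case by (simp add: pcoef_def)
next
  case (Cons p ps)
  note \<psi> = Cons.prems(1-3)
  have p: "p \<in> PB" "set ps \<subseteq> PB" using Cons.prems(4) by auto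
  have z: "\<psi> (0 # ps) = 0" using \<psi>(3)[of 0 ps 0] p by (simp add: PB_def \<iota>_0)
  have e: "ext (con j (pcoef \<psi>)) ps = (if j = 0 then 0 else \<psi> (monom 1 j # ps))" for j
  proof (cases "j = 0")
    case True
    then have "con j (pcoef \<psi>) = 0" by (simp add: fun_eq_iff con_apply pcoef_def)
    then show ?thesis using True by (simp add: ext_0)
  next
    case False
    have m: "monom 1 j \<in> PB" using False by (simp add: monom_PB)
    have "con j (pcoef \<psi>) = pcoef (con (monom 1 j) \<psi>)"
      using False by (auto simp: fun_eq_iff con_apply pcoef_def)
    moreover have "ext (pcoef (con (monom 1 j) \<psi>)) ps = con (monom 1 j) \<psi> ps"
    proof (rule Cons.IH[OF antisym_fun_con[OF \<psi>(1)] _ _ p(2)])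
      fix x y xs assume "x \<in> PB" "y \<in> PB" "set xs \<subseteq> PB"
      then have "\<psi> ((x + y) # monom 1 j # xs) = \<psi> (x # monom 1 j # xs) + \<psi> (y # monom 1 j # xs)"
        using \<psi>(2)[of x y "monom 1 j # xs"] m by simp
      then show "con (monom 1 j) \<psi> ((x + y) # xs) = con (monom 1 j) \<psi> (x # xs) + con (monom 1 j) \<psi> (y # xs)"
        unfolding con_apply antisym_fun_swap[OF \<psi>(1), of "monom 1 j" x xs]
          antisym_fun_swap[OF \<psi>(1), of "monom 1 j" y xs] antisym_fun_swap[OF \<psi>(1), of "monom 1 j" "x + y" xs]
        by simp
    next
      fix c x xs assume "x \<in> PB" "set xs \<subseteq> PB"
      then have "\<psi> (Polynomial.smult c x # monom 1 j # xs) = sc (\<iota> c) (\<psi> (x # monom 1 j # xs))"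
        using \<psi>(3)[of x "monom 1 j # xs" c] m by simp
      then show "con (monom 1 j) \<psi> (Polynomial.smult c x # xs) = sc (\<iota> c) (con (monom 1 j) \<psi> (x # xs))"
        unfolding con_apply antisym_fun_swap[OF \<psi>(1), of "monom 1 j" x xs]
          antisym_fun_swap[OF \<psi>(1), of "monom 1 j" "Polynomial.smult c x" xs]
        by simp
    qed
    ultimately show ?thesis using False by (simp add: con_apply)
  qed
  have sub: "(\<Sum>j\<in>I. monom (coeff p j) j) \<in> PB \<and> \<psi> ((\<Sum>j\<in>I. monom (coeff p j) j) # ps) = (\<Sum>j\<in>I. sc (\<iota> (coeff p j)) (if j = 0 then 0 else \<psi> (monom 1 j # ps)))"
    if "finite I" for I
    using that
  proof (induction I rule: finite_induct)
    case empty
    show ?case using z by (simp add: PB_def)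
  next
    case (insert j I)
    have m: "monom (coeff p j) j \<in> PB" using p(1) by (auto simp: monom_PB PB_def)
    have "\<psi> (monom (coeff p j) j # ps) = sc (\<iota> (coeff p j)) (if j = 0 then 0 else \<psi> (monom 1 j # ps))"
    proof (cases "j = 0")
      case True
      then show ?thesis using p(1) z by (simp add: PB_def)
    next
      case False
      then show ?thesis using \<psi>(3)[of "monom 1 j" ps "coeff p j"] p(2) by (simp add: monom_PB smult_monom)
    qed
    then show ?case
      unfolding sum.insert[OF insert.hyps] using insert.IH \<psi>(2)[OF m _ p(2)] PB_closed(1)[OF m] by simp
  qed
  have "\<psi> (p # ps) = \<psi> ((\<Sum>j\<le>degree p. monom (coeff p j) j) # ps)" by (simp add: poly_as_sum_of_monoms)
  then show ?case using sub[OF finite_atMost] by (simp add: e pl_def)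
qed

lemma polyc_ext:
  assumes "\<psi> \<in> polyc k" "set ps \<subseteq> PB"
  shows "ext (pcoef \<psi>) ps = \<psi> ps"
  by (rule ext_pcoef[OF _ _ _ assms(2)]) (use assms(1) in \<open>unfold polyc_def, blast+\<close>)

lemma pcoef_bij: "bij_betw pcoef (polyc k) (cocC k)"
proof (rule bij_betwI[where g = extB])
  fix \<psi> assume \<psi>: "\<psi> \<in> polyc k"
  show "extB (pcoef \<psi>) = \<psi>"
  proof (rule HOL.ext)
    fix ps
    have "\<not> set ps \<subseteq> PB \<Longrightarrow> \<psi> ps = 0" using \<psi> unfolding polyc_def by blast
    then show "extB (pcoef \<psi>) ps = \<psi> ps" using polyc_ext[OF \<psi>, of ps] by (simp add: extB_def)
  qed
qed (use pcoef_cocC extB_polyc pcoef_extB in auto)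

lemma polyc_dee:
  assumes "\<psi> \<in> polyc k"
  shows "extB (DN (pcoef \<psi>)) \<in> polyc (k + 1)" "pcoef (extB (DN (pcoef \<psi>))) = DN (pcoef \<psi>)"
    "set ps \<subseteq> PB \<Longrightarrow> dee (\<lambda>p q. con (pbr p q)) actp \<psi> ps = extB (DN (pcoef \<psi>)) ps"
proof -
  note D = DN_cocC[OF pcoef_cocC[OF assms]]
  show "extB (DN (pcoef \<psi>)) \<in> polyc (k + 1)" by (rule extB_polyc[OF D])
  show "pcoef (extB (DN (pcoef \<psi>))) = DN (pcoef \<psi>)" by (rule pcoef_extB[OF D])
  assume ps: "set ps \<subseteq> PB"
  have "dee (\<lambda>p q. con (pbr p q)) actp \<psi> ps = dee (\<lambda>p q. con (pbr p q)) actp (ext (pcoef \<psi>)) ps"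
    by (rule dee_cong[where B = PB, OF PB_closed(3) _ ps]) (simp_all add: polyc_ext[OF assms])
  then show "dee (\<lambda>p q. con (pbr p q)) actp \<psi> ps = extB (DN (pcoef \<psi>)) ps"
    using dee_ext[OF ps] ps by (simp add: extB_def)
qed

subsection \<open>Gelfand--Fuks cochains and their coefficients\<close>

lemma coef_PhiA:
  assumes c: "c \<in> coc k" and N: "supp_below N c" "N > 0"
  shows "coef (PhiA N c) = c"
proof (rule HOL.ext)
  fix js
  obtain p where p: "PhiA N c \<in> ordc p k" using gfc_ordc[OF PhiA_gfc[OF assms]] by blast
  let ?N = "max N p" and ?c = "coef (PhiA N c)"
  have s: "supp_below p ?c" by (rule coef_coc(2)[OF p])
  have "(?c - c) js = 0"
  proof (rule Phi_inject[of ?N])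
    show "supp_below ?N (?c - c)" using s N(1) unfolding supp_below_def by (metis fun_diff_def diff_self max.bounded_iff)
    fix fs assume fs: "set fs \<subseteq> A"
    have "Phi ?N ?c fs = Phi ?N c fs"
      using Phi_mono[OF s, of ?N fs] Phi_mono[OF N(1), of ?N fs] Phi_coef[OF p fs] fs by (simp add: PhiA_def)
    then show "Phi ?N (?c - c) fs = 0" by (simp add: Phi_diff)
  qed
  then show "?c js = c js" by simp
qed

lemma coef_bij: "bij_betw coef (gfc k) (coc k)"
  unfolding bij_betw_def
proof (intro conjI equalityI subsetI inj_onI)
  fix \<psi> \<psi>' assume \<psi>: "\<psi> \<in> gfc k" "\<psi>' \<in> gfc k" "coef \<psi> = coef \<psi>'"
  obtain p p' where p: "\<psi> \<in> ordc p k" "\<psi>' \<in> ordc p' k" using gfc_ordc \<psi>(1,2) by meson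
  show "\<psi> = \<psi>'"
  proof (rule HOL.ext)
    fix fs
    show "\<psi> fs = \<psi>' fs"
    proof (cases "set fs \<subseteq> A")
      case True
      let ?N = "max p p'"
      show ?thesis
        using Phi_coef[OF p(1) True] Phi_coef[OF p(2) True] \<psi>(3)
          Phi_mono[OF coef_coc(2)[OF p(1)], of ?N fs] Phi_mono[OF coef_coc(2)[OF p(2)], of ?N fs] by simp
    next
      case False
      then have n: "\<not> (int (length fs) = k \<and> set fs \<subseteq> A)" by blast
      show ?thesis unfolding ordcD(2)[OF p(1) n] ordcD(2)[OF p(2) n] ..
    qed
  qed
next
  fix c assume "c \<in> coef ` gfc k"
  then show "c \<in> coc k" using gfc_ordc coef_coc(1) by blast
next
  fix c assume c: "c \<in> coc k"
  then obtain N where N: "supp_below N c" using coc_supp by blast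
  have N': "supp_below (Suc N) c" using N unfolding supp_below_def by (meson Suc_leD)
  have "PhiA (Suc N) c \<in> gfc k" "coef (PhiA (Suc N) c) = c"
    by (rule PhiA_gfc[OF c N'] coef_PhiA[OF c N'], simp)+
  then show "c \<in> coef ` gfc k" by (metis imageI)
qed

text \<open>A cut-off for the action that does not depend on the cochain; at this value
  \<open>actv\<close> is compared with the action on the tensor module.\<close>

definition act_order :: nat where
  "act_order = (SOME J. 0 < J \<and> (\<forall>j\<ge>J. \<forall>v. act j v = 0))"

lemma act_order: "0 < act_order" "act_order \<le> j \<Longrightarrow> act j v = 0"
proof -
  obtain J where J: "\<And>j v. J \<le> j \<Longrightarrow> act j v = 0" using act_large by blast
  have "\<exists>J. 0 < J \<and> (\<forall>j\<ge>J. \<forall>v. act j v = 0)" by (rule exI[of _ "Suc J"]) (use J in simp)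
  then have "0 < act_order \<and> (\<forall>j\<ge>act_order. \<forall>v. act j v = 0)" unfolding act_order_def by (rule someI_ex)
  then show "0 < act_order" "act_order \<le> j \<Longrightarrow> act j v = 0" by blast+
qed

lemma actv_order: "act_order \<le> N \<Longrightarrow> actv N f v = actv act_order f v"
  unfolding actv_def by (rule sum.mono_neutral_right) (auto simp: act_order(2))

lemma gfc_dee:
  assumes "\<psi> \<in> gfc k"
  obtains \<chi> where "\<chi> \<in> gfc (k + 1)" "coef \<chi> = DN (coef \<psi>)"
    "\<And>fs. set fs \<subseteq> A \<Longrightarrow> dee (\<lambda>f g. con (f * d g - g * d f)) (actv act_order) \<psi> fs = \<chi> fs"
proof -
  obtain p where p: "p > 0" "\<psi> \<in> ordc p k" using gfc_ordc[OF assms] by blast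
  let ?c = "coef \<psi>"
  have c: "?c \<in> coc k" "supp_below p ?c" using coef_coc[OF p(2)] by auto
  have Dc: "DN ?c \<in> coc (k + 1)" by (rule DN_coc[OF c(1)])
  obtain q where q: "supp_below q (DN ?c)" using coc_supp[OF Dc] by blast
  \<comment> \<open>One cut-off beyond the support of the coefficients, of their differential, and
    of the action.\<close>
  let ?N = "max p (max q act_order)"
  have s: "supp_below ?N ?c" "supp_below ?N (DN ?c)" "?N > 0"
    using c(2) q p(1) unfolding supp_below_def by auto
  have br: "brv = (\<lambda>f g. con (f * d g - g * d f))" by (simp add: fun_eq_iff brv_def)
  have av: "actv ?N = actv act_order" by (intro HOL.ext actv_order) simp
  have cl: "f * d g - g * d f \<in> A" if "f \<in> A" "g \<in> A" for f g
    using A_add[OF A_mult[OF that(1) A_d[OF that(2)]] A_mult[OF A_const[of "-1"] A_mult[OF that(2) A_d[OF that(1)]]]]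
    by (simp add: \<iota>_minus \<iota>_1)
  show ?thesis
  proof (rule that[of "PhiA ?N (DN ?c)"])
    show "PhiA ?N (DN ?c) \<in> gfc (k + 1)" by (rule PhiA_gfc[OF Dc s(2,3)])
    show "coef (PhiA ?N (DN ?c)) = DN ?c" by (rule coef_PhiA[OF Dc s(2,3)])
    fix fs assume fs: "set fs \<subseteq> A"
    have "dee (\<lambda>f g. con (f * d g - g * d f)) (actv act_order) \<psi> fs
        = dee (\<lambda>f g. con (f * d g - g * d f)) (actv act_order) (Phi ?N ?c) fs"
      by (rule dee_cong[where B = A, OF cl _ fs])
        (use Phi_coef[OF p(2)] Phi_mono[OF c(2), of ?N] in simp_all)
    also have "\<dots> = Phi ?N (DN ?c) fs"
      using DV_Phi[OF s(3) s(1) cocD(3)[OF c(1)], of fs] unfolding br av .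
    finally show "dee (\<lambda>f g. con (f * d g - g * d f)) (actv act_order) \<psi> fs = PhiA ?N (DN ?c) fs"
      using fs by (simp add: PhiA_def)
  qed
qed

subsection \<open>Comparison of the two cohomologies\<close>

lemma vector_space_\<iota>: "vector_space (\<lambda>c v. sc (\<iota> c) v)"
  by unfold_locales (simp_all add: \<iota>_add \<iota>_mult \<iota>_1 sc_left)

lemma boundary_map_exists:
  "\<exists>q :: (nat list \<Rightarrow> 'k val) \<Rightarrow> nat list \<Rightarrow> 'k val. (\<forall>v w. q (v + w) = q v + q w) \<and> (\<forall>c v. q (\<lambda>js. sc (\<iota> c) (v js)) = (\<lambda>js. sc (\<iota> c) (q v js)) )
     \<and> (\<forall>v. q v = 0 \<longleftrightarrow> v \<in> DN ` cocC (k - 1))"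
proof (rule quotient_map_exists[OF vector_space_fun[OF vector_space_\<iota>]])
  have add: "c + c' \<in> cocC j" if "c \<in> cocC j" "c' \<in> cocC j" for c c' j
    using cocCD[OF that(1)] cocCD[OF that(2)] antisym_fun_add VC_add unfolding cocC_def by simp
  have scale: "(\<lambda>js. sc (\<iota> r) (c js)) \<in> cocC j" if "c \<in> cocC j" for r c j
    using cocCD[OF that] antisym_fun_comp[OF cocCD(3)[OF that], of "sc (\<iota> r)"] VC_sc unfolding cocC_def by simp
  have zero: "0 \<in> cocC j" for j
    unfolding cocC_def antisym_fun_def using VC_0 by simp
  have D0: "DN 0 = 0" using DN_0 by (simp add: fun_eq_iff)
  show "0 \<in> DN ` cocC (k - 1)" using zero D0 by (metis imageI)
  show "v + w \<in> DN ` cocC (k - 1)" if vw: "v \<in> DN ` cocC (k - 1)" "w \<in> DN ` cocC (k - 1)" for v w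
  proof -
    obtain c c' where c: "c \<in> cocC (k - 1)" "v = DN c" "c' \<in> cocC (k - 1)" "w = DN c'" using vw by blast
    have "DN (c + c') = v + w" unfolding c by (rule HOL.ext) (simp add: DN_add)
    then show ?thesis using add[OF c(1,3)] by (metis imageI)
  qed
  show "(\<lambda>js. sc (\<iota> r) (v js)) \<in> DN ` cocC (k - 1)" if v: "v \<in> DN ` cocC (k - 1)" for r v
  proof -
    obtain c where c: "c \<in> cocC (k - 1)" "v = DN c" using v by blast
    show ?thesis using scale[OF c(1), of r] DN_\<iota>_scale[of r c] unfolding c(2) by (metis imageI)
  qed
qed

text \<open>A linear map whose kernel is the space of coboundaries of degree k; on cocycles it plays
  the part of taking cohomology classes.\<close>

definition bmap :: "int \<Rightarrow> (nat list \<Rightarrow> 'k val) \<Rightarrow> nat list \<Rightarrow> 'k val" where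
  "bmap k = (SOME q. (\<forall>v w. q (v + w) = q v + q w) \<and> (\<forall>c v. q (\<lambda>js. sc (\<iota> c) (v js)) = (\<lambda>js. sc (\<iota> c) (q v js)) )
     \<and> (\<forall>v. q v = 0 \<longleftrightarrow> v \<in> DN ` cocC (k - 1)))"

lemma bmap:
  "bmap k (v + w) = bmap k v + bmap k w" "bmap k (\<lambda>js. sc (\<iota> c) (v js)) = (\<lambda>js. sc (\<iota> c) (bmap k v js))"
  "bmap k v = 0 \<longleftrightarrow> v \<in> DN ` cocC (k - 1)"
  using someI_ex[OF boundary_map_exists[of k]] unfolding bmap_def[symmetric] by blast+

text \<open>The model of H^k(\<open>L_plus\<close>, W).\<close>

definition hC :: "int \<Rightarrow> (nat list \<Rightarrow> 'k val) set" where
  "hC k = bmap k ` {v \<in> cocC k. DN v = 0}"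

text \<open>On a cocycle: its class in de Rham degree 0 and the classes of its residues. The
  punctures are numbered from 1, the coordinates of \<complex>^m from 0; hence
  \<open>Suc j\<close>.\<close>

definition gmap :: "int \<Rightarrow> (nat list \<Rightarrow> 'k val) \<Rightarrow> (nat list \<Rightarrow> 'k val) \<times> (nat \<Rightarrow> nat list \<Rightarrow> 'k val)" where
  "gmap k c = (bmap k (H0 c), \<lambda>j. if j < m then bmap (k - 1) (Hr (Suc j) c) else 0)"

lemma vmap_\<iota>: "linA h \<Longrightarrow> v \<in> VA \<Longrightarrow> vmap h (sc (\<iota> c) v) = sc (\<iota> c) (vmap h v)"
  by (rule val_eqI) (auto simp: linA_def VA_def)

lemma gmap_add:
  assumes "c \<in> coc k" "c' \<in> coc k"
  shows "gmap k (c + c') = gmap k c + gmap k c'"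
proof -
  have h0: "H0 (c + c') = H0 c + H0 c'"
    by (rule HOL.ext) (use vmap_add[OF linA_ev cocD(1)[OF assms(1)] cocD(1)[OF assms(2)]] in
        \<open>simp add: H0_def pos_def vmap_0[OF linA_ev]\<close>)
  have hr: "Hr i (c + c') = Hr i c + Hr i c'" for i
    by (rule HOL.ext) (use vmap_add[OF linA_res cocD(1)[OF assms(1)] cocD(1)[OF assms(2)]] in \<open>simp add: Hr_def\<close>)
  show ?thesis unfolding gmap_def h0 hr bmap(1) by (auto simp: plus_prod_def fun_eq_iff)
qed

lemma gmap_scale:
  assumes "c \<in> coc k"
  shows "gmap k (\<lambda>js. sc (\<iota> r) (c js)) =
    ((\<lambda>js. sc (\<iota> r) (fst (gmap k c) js)), (\<lambda>j js. sc (\<iota> r) (snd (gmap k c) j js)))"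
proof -
  have h0: "H0 (\<lambda>js. sc (\<iota> r) (c js)) = (\<lambda>js. sc (\<iota> r) (H0 c js))"
    by (rule HOL.ext) (use vmap_\<iota>[OF linA_ev cocD(1)[OF assms]] in \<open>simp add: H0_def pos_def vmap_0[OF linA_ev]\<close>)
  have hr: "Hr i (\<lambda>js. sc (\<iota> r) (c js)) = (\<lambda>js. sc (\<iota> r) (Hr i c js))" for i
    by (rule HOL.ext) (use vmap_\<iota>[OF linA_res cocD(1)[OF assms]] in \<open>simp add: Hr_def\<close>)
  show ?thesis unfolding gmap_def h0 hr bmap(2) by (auto simp: fun_eq_iff)
qed

lemma H_cycle:
  assumes "c \<in> coc k" "DN c = 0"
  shows "DN (H0 c) = 0" "i \<in> {1..m} \<Longrightarrow> DN (Hr i c) = 0"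
proof -
  have "H0 0 = 0" by (rule HOL.ext) (simp add: H0_def pos_def vmap_0[OF linA_ev])
  then show "DN (H0 c) = 0" using H0_DN[OF assms(1)] unfolding assms(2) by simp
  assume "i \<in> {1..m}"
  moreover have "Hr i 0 = 0" by (rule HOL.ext) (simp add: Hr_def vmap_0[OF linA_res])
  ultimately show "DN (Hr i c) = 0" using Hr_DN[OF assms(1), of i] unfolding assms(2) by simp
qed

lemma finite_representative:
  assumes v: "v \<in> cocC k" "\<exists>N. supp_below N (DN v)"
  obtains y where "y \<in> cocC (k - 1)" "v - DN y \<in> cocF k" "DN (v - DN y) = DN v"
proof -
  obtain y where y: "y \<in> cocC (k - 1)" "\<exists>N. supp_below N (v - DN y)" using cocC_continuous[OF v] by blast
  have Dy: "DN y \<in> cocC k" using DN_cocC[OF y(1)] by simp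
  have "antisym_fun (v - DN y)"
    using antisym_fun_add[OF cocCD(3)[OF v(1)] antisym_fun_minus[OF cocCD(3)[OF Dy]]] by simp
  then have "v - DN y \<in> cocC k"
    unfolding cocC_def using cocCD[OF v(1)] cocCD[OF Dy] VC_diff by simp
  then have "v - DN y \<in> cocF k" using y(2) unfolding cocF_def by simp
  moreover have "DN (v - DN y) = DN v"
    by (rule HOL.ext) (use DN_add[of v "- DN y"] DN_minus[of "DN y"] DN_DN in simp)
  ultimately show ?thesis using that y(1) by blast
qed

lemma gmap_kernel:
  assumes c: "c \<in> coc k" "DN c = 0"
  shows "gmap k c = 0 \<longleftrightarrow> c \<in> DN ` coc (k - 1)"
proof
  assume "gmap k c = 0"
  then have 0: "bmap k (H0 c) = 0" and r: "\<And>j. j < m \<Longrightarrow> bmap (k - 1) (Hr (Suc j) c) = 0"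
    by (auto simp: gmap_def zero_prod_def fun_eq_iff[of _ "0 :: nat \<Rightarrow> _"] split: if_splits)
  \<comment> \<open>A finitely supported boundary has a finitely supported primitive:
    \<open>cocC_continuous\<close> applies to the given primitive w, whose differential v has
    bounded support.\<close>
  have fin: "\<exists>w\<in>cocF (j - 1). v = DN w" if v: "v \<in> cocF j" "bmap j v = 0" for v j
  proof -
    obtain w where w: "w \<in> cocC (j - 1)" "v = DN w" using v(2) unfolding bmap(3) by blast
    have "\<exists>N. supp_below N (DN w)" using v(1) w(2) unfolding cocF_def by blast
    then show ?thesis using finite_representative[OF w(1)] w(2) by metis
  qed
  obtain \<alpha> where \<alpha>: "\<alpha> \<in> cocF (k - 1)" "H0 c = DN \<alpha>" using fin[OF H0_cocF[OF c(1)] 0] by blast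
  have "\<exists>\<beta>. i \<in> {1..m} \<longrightarrow> \<beta> \<in> cocF (k - 2) \<and> Hr i c = DN \<beta>" for i
  proof (cases "i \<in> {1..m}")
    case True
    then obtain j where "i = Suc j" "j < m" by (cases i) auto
    then show ?thesis using fin[OF Hr_cocF[OF c(1), of i]] r[of j] by force
  qed blast
  then obtain \<beta> where "\<And>i. i \<in> {1..m} \<Longrightarrow> \<beta> i \<in> cocF (k - 2) \<and> Hr i c = DN (\<beta> i)" by metis
  then have "\<exists>c'\<in>coc (k - 1). DN c' = c" by (intro coc_injective[OF c \<alpha>, of \<beta>]) auto
  then show "c \<in> DN ` coc (k - 1)" by blast
next
  assume "c \<in> DN ` coc (k - 1)"
  then obtain c' where c': "c' \<in> coc (k - 1)" "c = DN c'" by blast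
  have "bmap k (H0 c) = 0"
    unfolding bmap(3) c'(2) H0_DN[OF c'(1)] using cocFD(3)[OF H0_cocF[OF c'(1)]] by blast
  moreover have "bmap (k - 1) (Hr (Suc j) c) = 0" if "j < m" for j
  proof -
    have i: "Suc j \<in> {1..m}" using that by simp
    have "Hr (Suc j) c' \<in> cocC (k - 1 - 1)" by (rule cocFD(3)[OF Hr_cocF[OF c'(1)]])
    \<comment> \<open>The residue of a boundary is minus a boundary; the sign is treated as a
      scalar, which \<open>bmap\<close> respects.\<close>
    then have "(\<lambda>js. sc (\<iota> (-1)) (DN (Hr (Suc j) c') js)) = Hr (Suc j) c \<and> bmap (k - 1) (DN (Hr (Suc j) c')) = 0"
      unfolding bmap(3) c'(2) Hr_DN[OF c'(1) i] by (auto simp: fun_eq_iff \<iota>_minus \<iota>_1 sc_left)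
    then show ?thesis using bmap(2)[of "k - 1" "-1" "DN (Hr (Suc j) c')"] by (auto simp: fun_eq_iff)
  qed
  ultimately show "gmap k c = 0" by (simp add: gmap_def zero_prod_def fun_eq_iff)
qed

lemma gmap_image:
  "gmap k ` {c \<in> coc k. DN c = 0} = hC k \<times> {f. (\<forall>j<m. f j \<in> hC (k - 1)) \<and> (\<forall>j\<ge>m. f j = 0)}"
proof (intro equalityI subsetI)
  fix x assume "x \<in> gmap k ` {c \<in> coc k. DN c = 0}"
  then obtain c where c: "c \<in> coc k" "DN c = 0" "x = gmap k c" by blast
  have "bmap k (H0 c) \<in> hC k"
    unfolding hC_def using cocFD(3)[OF H0_cocF[OF c(1)]] H_cycle(1)[OF c(1,2)] by blast
  moreover have "bmap (k - 1) (Hr (Suc j) c) \<in> hC (k - 1)" if "j < m" for j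
    unfolding hC_def using cocFD(3)[OF Hr_cocF[OF c(1)]] H_cycle(2)[OF c(1,2), of "Suc j"] that by auto
  ultimately show "x \<in> hC k \<times> {f. (\<forall>j<m. f j \<in> hC (k - 1)) \<and> (\<forall>j\<ge>m. f j = 0)}"
    unfolding c(3) gmap_def by simp
next
  fix x assume x: "x \<in> hC k \<times> {f. (\<forall>j<m. f j \<in> hC (k - 1)) \<and> (\<forall>j\<ge>m. f j = 0)}"
  \<comment> \<open>\<open>cocC_continuous\<close> replaces a cocycle by a finitely supported one
    without changing its class.\<close>
  have rep: "\<exists>w\<in>cocF j. DN w = 0 \<and> bmap j w = y" if y: "y \<in> hC j" for y j
  proof -
    obtain v where v: "v \<in> cocC j" "DN v = 0" "y = bmap j v" using y unfolding hC_def by blast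
    have "\<exists>N. supp_below N (DN v)" unfolding v(2) supp_below_def by simp
    then obtain u where u: "u \<in> cocC (j - 1)" "v - DN u \<in> cocF j" "DN (v - DN u) = DN v"
      using finite_representative[OF v(1)] by metis
    have "bmap j (DN u) = 0" unfolding bmap(3) using u(1) by blast
    then have "bmap j (v - DN u) = bmap j v" using bmap(1)[of j "v - DN u" "DN u"] by simp
    then show ?thesis using u v by auto
  qed
  obtain \<alpha> where \<alpha>: "\<alpha> \<in> cocF k" "DN \<alpha> = 0" "bmap k \<alpha> = fst x" using rep[of "fst x" k] x by auto
  have "\<exists>w. i \<in> {1..m} \<longrightarrow> w \<in> cocF (k - 1) \<and> DN w = 0 \<and> bmap (k - 1) w = snd x (i - 1)" for i
  proof (cases "i \<in> {1..m}")
    case True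
    then have "snd x (i - 1) \<in> hC (k - 1)" using x by auto
    then show ?thesis using rep by blast
  qed blast
  then obtain \<beta> where \<beta>: "\<And>i. i \<in> {1..m} \<Longrightarrow> \<beta> i \<in> cocF (k - 1) \<and> DN (\<beta> i) = 0 \<and> bmap (k - 1) (\<beta> i) = snd x (i - 1)"
    by metis
  have "\<exists>c\<in>coc k. DN c = 0 \<and> H0 c = \<alpha> \<and> (\<forall>i\<in>{1..m}. Hr i c = \<beta> i)"
    by (rule coc_surjective[OF \<alpha>(1,2)]) (use \<beta> in auto)
  then obtain c where c: "c \<in> coc k" "DN c = 0" "H0 c = \<alpha>" "\<And>i. i \<in> {1..m} \<Longrightarrow> Hr i c = \<beta> i" by blast
  have "(\<lambda>j. if j < m then bmap (k - 1) (Hr (Suc j) c) else 0) = snd x"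
  proof (rule HOL.ext)
    fix j
    have "\<not> j < m \<Longrightarrow> snd x j = 0" using x by auto
    then show "(if j < m then bmap (k - 1) (Hr (Suc j) c) else 0) = snd x j"
      using c(4)[of "Suc j"] \<beta>[of "Suc j"] by simp
  qed
  then have "gmap k c = x" unfolding gmap_def c(3) \<alpha>(3) by simp
  then show "x \<in> gmap k ` {c \<in> coc k. DN c = 0}" using c(1,2) by blast
qed

end

context lie_jet
begin

section \<open>Gelfand--Fuks cochains form a subspace\<close>

lemma gfc_PhiA:
  assumes "\<psi> \<in> gfc k"
  shows "\<exists>N0>0. \<forall>N\<ge>N0. \<psi> = PhiA N (coef \<psi>) \<and> supp_below N (coef \<psi>)"
proof -
  obtain p where p: "p > 0" "\<psi> \<in> ordc p k" using gfc_ordc[OF assms] by blast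
  have s: "supp_below p (coef \<psi>)" by (rule coef_coc(2)[OF p(2)])
  have "\<psi> = PhiA N (coef \<psi>) \<and> supp_below N (coef \<psi>)" if N: "N \<ge> p" for N
  proof (intro conjI HOL.ext)
    fix fs
    show "\<psi> fs = PhiA N (coef \<psi>) fs"
    proof (cases "set fs \<subseteq> A")
      case True
      then show ?thesis using Phi_coef[OF p(2) True] Phi_mono[OF s N, of fs] by (simp add: PhiA_def)
    next
      case False
      then have f: "\<not> (int (length fs) = k \<and> set fs \<subseteq> A)" by blast
      show ?thesis using ordcD(2)[OF p(2) f] False by (simp add: PhiA_def)
    qed
  qed (use s N in \<open>unfold supp_below_def, meson order_trans\<close>)
  then show ?thesis using p(1) by blast
qed

text \<open>The orders p of the two summands differ in general. For coefficient functions one may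
  pass to the larger bound at once, so the sum is formed there.\<close>

lemma gfc_add:
  assumes "\<psi> \<in> gfc k" "\<psi>' \<in> gfc k"
  shows "\<psi> + \<psi>' \<in> gfc k"
proof -
  obtain N0 N0' where N0: "N0 > 0" "\<And>N. N \<ge> N0 \<Longrightarrow> \<psi> = PhiA N (coef \<psi>) \<and> supp_below N (coef \<psi>)"
    "\<And>N. N \<ge> N0' \<Longrightarrow> \<psi>' = PhiA N (coef \<psi>') \<and> supp_below N (coef \<psi>')"
    using gfc_PhiA[OF assms(1)] gfc_PhiA[OF assms(2)] by blast
  let ?N = "max N0 N0'"
  have c: "coef \<psi> \<in> coc k" "coef \<psi>' \<in> coc k" using coef_bij assms unfolding bij_betw_def by blast+
  have a: "\<psi> = PhiA ?N (coef \<psi>)" "\<psi>' = PhiA ?N (coef \<psi>')" "supp_below ?N (coef \<psi>)" "supp_below ?N (coef \<psi>')"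
    using N0(2,3)[of ?N] by simp_all
  have s: "supp_below ?N (coef \<psi> + coef \<psi>')" using a(3,4) by (auto simp: supp_below_def)
  have "PhiA ?N (coef \<psi> + coef \<psi>') = PhiA ?N (coef \<psi>) + PhiA ?N (coef \<psi>')"
    by (simp add: fun_eq_iff PhiA_def Phi_add)
  also have "\<dots> = \<psi> + \<psi>'" using a(1,2) by simp
  finally show ?thesis using PhiA_gfc[OF coc_add[OF c] s] N0(1) by simp
qed

lemma gfc_scale:
  assumes "\<psi> \<in> gfc k"
  shows "(\<lambda>fs. sc (\<iota> r) (\<psi> fs)) \<in> gfc k"
proof -
  obtain N where N: "N > 0" "\<psi> = PhiA N (coef \<psi>)" "supp_below N (coef \<psi>)"
    using gfc_PhiA[OF assms] by blast
  have c: "coef \<psi> \<in> coc k" using coef_bij assms unfolding bij_betw_def by blast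
  let ?c = "\<lambda>js. sc (\<iota> r) (coef \<psi> js)"
  have s: "supp_below N ?c" using N(3) by (simp add: supp_below_def)
  have "antisym_fun ?c" by (rule antisym_fun_comp[OF cocD(3)[OF c]]) simp
  then have cc: "?c \<in> coc k" by (intro cocI[OF _ _ _ s]) (simp_all add: cocD[OF c] VA_sc A_const)
  have "PhiA N ?c = (\<lambda>fs. sc (\<iota> r) (PhiA N (coef \<psi>) fs))"
    by (simp add: fun_eq_iff PhiA_def Phi_scale)
  also have "\<dots> = (\<lambda>fs. sc (\<iota> r) (\<psi> fs))" using N(2) by simp
  finally show ?thesis using PhiA_gfc[OF cc s N(1)] by simp
qed

lemma gfc_0: "0 \<in> gfc k"
proof -
  have "PhiA 1 0 = 0" by (simp add: fun_eq_iff PhiA_def Phi_0)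
  then show ?thesis using PhiA_gfc[OF coc_0, of 1] by (simp add: supp_below_def)
qed

end

subsection \<open>Matrices of the weight action\<close>

lemma sum_norm_mult:
  fixes P Q :: "nat \<Rightarrow> nat \<Rightarrow> complex"
  shows "(\<Sum>x<n. \<Sum>y<n. norm (\<Sum>b<n. P x b * Q b y)) \<le> (\<Sum>x<n. \<Sum>b<n. norm (P x b)) * (\<Sum>b<n. \<Sum>y<n. norm (Q b y))"
proof -
  have row: "(\<Sum>y<n. norm (\<Sum>b<n. P x b * Q b y)) \<le> (\<Sum>b<n. norm (P x b)) * (\<Sum>b<n. \<Sum>y<n. norm (Q b y))" for x
  proof -
    have "(\<Sum>y<n. norm (\<Sum>b<n. P x b * Q b y)) \<le> (\<Sum>y<n. \<Sum>b<n. norm (P x b) * norm (Q b y))"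
      by (rule sum_mono, rule order_trans[OF norm_sum]) (simp add: norm_mult)
    also have "\<dots> = (\<Sum>b<n. norm (P x b) * (\<Sum>y<n. norm (Q b y)))"
      by (subst sum.swap) (simp add: sum_distrib_left)
    also have "\<dots> \<le> (\<Sum>b<n. norm (P x b) * (\<Sum>b<n. \<Sum>y<n. norm (Q b y)))"
      by (rule sum_mono, rule mult_left_mono, rule member_le_sum) (auto intro: sum_nonneg)
    finally show ?thesis by (simp add: sum_distrib_right)
  qed
  have "(\<Sum>x<n. \<Sum>y<n. norm (\<Sum>b<n. P x b * Q b y)) \<le> (\<Sum>x<n. (\<Sum>b<n. norm (P x b)) * (\<Sum>b<n. \<Sum>y<n. norm (Q b y)))"
    by (rule sum_mono[OF row])
  then show ?thesis by (simp add: sum_distrib_right)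
qed

text \<open>
  \<open>X 1\<close> is the Euler field and \<open>X j\<close> has weight \<open>j - 1\<close>, which cannot exceed the norm of the commutator with \<open>X 1\<close>.
\<close>

lemma weight_matrix_zero:
  fixes X :: "nat \<Rightarrow> nat \<Rightarrow> nat \<Rightarrow> complex"
  assumes comm: "\<And>j x y. 1 \<le> j \<Longrightarrow> x < n \<Longrightarrow> y < n \<Longrightarrow>
    (\<Sum>b<n. X 1 x b * X j b y) - (\<Sum>b<n. X j x b * X 1 b y) = of_int (int j - 1) * X j x y"
  obtains J where "\<And>j x y. J \<le> j \<Longrightarrow> x < n \<Longrightarrow> y < n \<Longrightarrow> X j x y = 0"
proof -
  let ?K = "\<Sum>x<n. \<Sum>b<n. norm (X 1 x b)" and ?N = "\<lambda>j. \<Sum>x<n. \<Sum>b<n. norm (X j x b)"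
  \<comment> \<open>The commutator with \<open>X 1\<close> has norm at most \<open>2 * ?K\<close> on
    matrices of norm 1, so an eigenvalue j - 1 beyond that forces \<open>X j\<close> to be
    0.\<close>
  obtain J :: nat where J: "2 * ?K + 1 < real J" using reals_Archimedean2 by blast
  have K0: "?K \<ge> 0" by (intro sum_nonneg) auto
  show ?thesis
  proof (rule that[of J])
    fix j x y assume j: "J \<le> j" and xy: "x < n" "y < n"
    have j1: "1 \<le> j" using J j K0 by (cases j) auto
    have "real_of_int (int j - 1) * ?N j = (\<Sum>x<n. \<Sum>b<n. norm (of_int (int j - 1) * X j x b))"
      using j1 unfolding sum_distrib_left norm_mult norm_of_int by simp
    also have "\<dots> = (\<Sum>x<n. \<Sum>y<n. norm ((\<Sum>b<n. X 1 x b * X j b y) - (\<Sum>b<n. X j x b * X 1 b y)))"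
      by (intro sum.cong refl arg_cong[where f = norm] comm[symmetric]) (use j1 in auto)
    also have "\<dots> \<le> (\<Sum>x<n. \<Sum>y<n. norm (\<Sum>b<n. X 1 x b * X j b y) + norm (\<Sum>b<n. X j x b * X 1 b y))"
      by (intro sum_mono norm_triangle_ineq4)
    also have "\<dots> \<le> ?K * ?N j + ?N j * ?K"
      unfolding sum.distrib by (intro add_mono sum_norm_mult)
    finally have "(real_of_int (int j - 1) - 2 * ?K) * ?N j \<le> 0" by (simp add: algebra_simps)
    moreover have "real_of_int (int j - 1) - 2 * ?K > 0" using J j by simp
    ultimately have "?N j \<le> 0" by (simp add: mult_le_0_iff)
    moreover have "norm (X j x y) \<le> ?N j"
      by (rule order_trans[OF member_le_sum[of y "{..<n}" "\<lambda>b. norm (X j x b)"] member_le_sum[of x "{..<n}" "\<lambda>x. \<Sum>b<n. norm (X j x b)"]])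
        (use xy in \<open>auto intro: sum_nonneg\<close>)
    ultimately show "X j x y = 0" by (metis norm_le_zero_iff order_trans)
  qed
qed

text \<open>For w beyond the norm of X the matrix X - w is injective by the triangle inequality,
  hence invertible.\<close>

lemma shifted_system:
  fixes X :: "nat \<Rightarrow> nat \<Rightarrow> complex" and v :: "nat \<Rightarrow> complex"
  assumes w: "real w > (\<Sum>x<n. \<Sum>b<n. norm (X x b))"
  shows "\<exists>u. \<forall>x<n. (\<Sum>b<n. X x b * u b) - of_nat w * u x = v x"
    "(\<And>x. x < n \<Longrightarrow> (\<Sum>b<n. X x b * u b) - of_nat w * u x = 0) \<Longrightarrow> y < n \<Longrightarrow> u y = 0"
proof -
  let ?K = "\<Sum>x<n. \<Sum>b<n. norm (X x b)"
  have inj: "u y = 0" if u: "\<And>x. x < n \<Longrightarrow> (\<Sum>b<n. X x b * u b) - of_nat w * u x = 0" and y: "y < n" for u y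
  proof -
    let ?U = "\<Sum>x<n. norm (u x)"
    have "real w * ?U = (\<Sum>x<n. norm (of_nat w * u x))" by (simp add: sum_distrib_left norm_mult)
    also have "\<dots> = (\<Sum>x<n. norm (\<Sum>b<n. X x b * u b))"
      using u by (intro sum.cong refl arg_cong[where f = norm]) simp
    also have "\<dots> \<le> (\<Sum>x<n. \<Sum>b<n. norm (X x b) * ?U)"
    proof (intro sum_mono order_trans[OF norm_sum])
      fix x b assume "b \<in> {..<n}"
      then show "norm (X x b * u b) \<le> norm (X x b) * ?U"
        unfolding norm_mult by (intro mult_left_mono member_le_sum) auto
    qed
    also have "\<dots> = ?K * ?U" by (simp add: sum_distrib_right)
    finally have "(real w - ?K) * ?U \<le> 0" by (simp add: algebra_simps)
    then have "?U \<le> 0" using w by (simp add: mult_le_0_iff)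
    moreover have "norm (u y) \<le> ?U" using y by (intro member_le_sum) auto
    ultimately show "u y = 0" by (metis norm_le_zero_iff order_trans)
  qed
  then show "(\<And>x. x < n \<Longrightarrow> (\<Sum>b<n. X x b * u b) - of_nat w * u x = 0) \<Longrightarrow> y < n \<Longrightarrow> u y = 0" by blast
  define A where "A = mat n n (\<lambda>(x, b). X x b - (if x = b then of_nat w else 0))"
  have A: "A \<in> carrier_mat n n" by (simp add: A_def)
  have Av: "(A *\<^sub>v q) $ x = (\<Sum>b<n. X x b * q $ b) - of_nat w * q $ x" if "q \<in> carrier_vec n" "x < n" for q x
  proof -
    have "(A *\<^sub>v q) $ x = (\<Sum>b<n. (X x b - (if x = b then of_nat w else 0)) * q $ b)"
      using that A by (simp add: A_def scalar_prod_def atLeast0LessThan)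
    also have "\<dots> = (\<Sum>b<n. X x b * q $ b - (if x = b then of_nat w * q $ b else 0))"
      by (rule sum.cong) (auto simp: algebra_simps)
    also have "\<dots> = (\<Sum>b<n. X x b * q $ b) - of_nat w * q $ x"
      using that(2) by (simp add: sum_subtractf sum.delta)
    finally show ?thesis .
  qed
  have "det A \<noteq> 0"
  proof
    assume "det A = 0"
    then obtain q where q: "q \<in> carrier_vec n" "q \<noteq> 0\<^sub>v n" "A *\<^sub>v q = 0\<^sub>v n"
      using det_0_iff_vec_prod_zero_field[OF A] by blast
    have "(\<Sum>b<n. X x b * q $ b) - of_nat w * q $ x = 0" if "x < n" for x
      using Av[OF q(1) that] q(3) that by simp
    then have "q $ y = 0" if "y < n" for y using inj[of "\<lambda>b. q $ b" y] that by blast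
    then have "q = 0\<^sub>v n" using q(1) by (intro eq_vecI) auto
    then show False using q(2) by simp
  qed
  from det_non_zero_imp_unit[OF A this, of "()"]
  obtain B where B: "B \<in> carrier_mat n n" "A * B = 1\<^sub>m n"
    by (auto simp: Units_def ring_mat_simps)
  let ?v = "vec n v"
  have Bv: "B *\<^sub>v ?v \<in> carrier_vec n" using B(1) by (intro mult_mat_vec_carrier) auto
  have "A *\<^sub>v (B *\<^sub>v ?v) = ?v"
    using assoc_mult_mat_vec[OF A B(1), of ?v] B(2) by simp
  then have "(\<Sum>b<n. X x b * (B *\<^sub>v ?v) $ b) - of_nat w * (B *\<^sub>v ?v) $ x = v x" if "x < n" for x
    using Av[OF Bv that] that by simp
  then show "\<exists>u. \<forall>x<n. (\<Sum>b<n. X x b * u b) - of_nat w * u x = v x" by blast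
qed

subsection \<open>The Lie algebra of polynomial vector fields\<close>

lemma poly_field_inj: "inj poly_field"
proof (rule injI)
  fix p q assume "poly_field p = poly_field q"
  then have "poly_field p [:0, 1:] = poly_field q [:0, 1:]" by simp
  then show "p = q" by (simp add: poly_field_def pderiv_pCons)
qed

lemma L_plus_simps:
  "carrier L_plus = poly_field ` {p. coeff p 0 = 0}"
  "poly_field p \<oplus>\<^bsub>L_plus\<^esub> poly_field q = poly_field (p + q)"
  "c \<odot>\<^bsub>L_plus\<^esub> poly_field p = poly_field (Polynomial.smult c p)"
  "bracket L_plus (poly_field p) (poly_field q) = poly_field (p * pderiv q - q * pderiv p)"
  by (auto simp: L_plus_def der_algebra_def poly_field_def poly_0_coeff_0 fun_eq_iff algebra_simps pderiv_mult)

lemma rat_deriv_sum: "rat_deriv (\<Sum>i\<in>I. f i) = (\<Sum>i\<in>I. rat_deriv (f i))"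
  using rat.d_sum by blast

lemma models_additive_finsum:
  fixes g :: "'b \<Rightarrow> 'y::ab_group_add"
  assumes M: "models s M h S" and g: "\<And>x y. x \<in> carrier M \<Longrightarrow> y \<in> carrier M \<Longrightarrow> g (x \<oplus>\<^bsub>M\<^esub> y) = g x + g y"
    and "finite I" "\<And>i. i \<in> I \<Longrightarrow> f i \<in> carrier M"
  shows "g (finsum M f I) = (\<Sum>i\<in>I. g (f i))"
proof -
  interpret abelian_group M by (rule models_abelian_group[OF M])
  show ?thesis using assms(3,4)
  proof (induction I rule: finite_induct)
    case empty
    show ?case using g[of "\<zero>\<^bsub>M\<^esub>" "\<zero>\<^bsub>M\<^esub>"] by simp
  next
    case (insert i I)
    then show ?case by (subst finsum_insert) (auto simp: g)
  qed
qed

lemma rat_coords_range: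
  "(\<forall>x<n. coo v x \<in> range rat_const) \<and> (\<forall>x\<ge>n. coo v x = 0) \<longleftrightarrow>
     (\<exists>u. (\<forall>x\<ge>n. u x = 0) \<and> v = Val (\<lambda>x. rat_const (u x)))"
proof
  assume v: "(\<forall>x<n. coo v x \<in> range rat_const) \<and> (\<forall>x\<ge>n. coo v x = 0)"
  then have "\<forall>x. \<exists>c. coo v x = rat_const c \<and> (x \<ge> n \<longrightarrow> c = 0)"
    by (metis imageE not_le rat_const_0)
  then obtain u where "\<And>x. coo v x = rat_const (u x) \<and> (x \<ge> n \<longrightarrow> u x = 0)" by metis
  then show "\<exists>u. (\<forall>x\<ge>n. u x = 0) \<and> v = Val (\<lambda>x. rat_const (u x))"
    by (intro exI[of _ u]) (auto intro: val_eqI)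
qed auto

section \<open>The punctured sphere as an instance\<close>

locale tensor_setup =
  fixes a :: "nat \<Rightarrow> complex" and m :: nat and W :: "(complex, 'w) module"
    and \<rho> :: "(complex poly \<Rightarrow> complex poly) \<Rightarrow> 'w \<Rightarrow> 'w" and \<kappa> :: "'w \<Rightarrow> nat \<Rightarrow> complex" and n :: nat
  assumes inj: "inj_on a {1..m}" and lie: "lie_module L_plus W \<rho>"
    and \<kappa>: "models (\<lambda>c f x. c * f x) W \<kappa> {u. \<forall>a\<ge>n. u a = 0}"
begin

abbreviation "A \<equiv> coord_ring a m"
abbreviation "e j \<equiv> poly_field (monom 1 j)"
abbreviation "\<epsilon> b \<equiv> inv_into (carrier W) \<kappa> (unit_at b)"
abbreviation "pol i \<equiv> inverse (rat_z - rat_const (a i))"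

definition Mx :: "nat \<Rightarrow> nat \<Rightarrow> nat \<Rightarrow> complex" where
  "Mx j x b = \<kappa> (\<rho> (e j) (\<epsilon> b)) x"

definition acts :: "nat \<Rightarrow> complex poly fract val \<Rightarrow> complex poly fract val" where
  "acts j v = (if j = 0 then Val (\<lambda>x. rat_deriv (coo v x))
     else Val (\<lambda>x. if x < n then \<Sum>b<n. rat_const (Mx j x b) * coo v b else 0))"

definition hW :: "'w \<Rightarrow> complex poly fract val" where
  "hW w = Val (\<lambda>x. rat_const (\<kappa> w x))"

text \<open>Set to 0 outside the punctures, so that linearity holds for every i, as
  \<open>lie_jet\<close> asks.\<close>

definition resid :: "nat \<Rightarrow> complex poly fract \<Rightarrow> complex" where
  "resid i f = (if i \<in> {1..m} then residue_at a m i f else 0)"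

definition anti :: "complex poly fract \<Rightarrow> complex poly fract" where
  "anti = (SOME P. (\<forall>f g. P (f + g) = P f + P g) \<and> (\<forall>c f. P (rat_const c * f) = rat_const c * P f) \<and>
     (\<forall>f. P f \<in> A) \<and> (\<forall>f\<in>A. rat_deriv (P (rat_deriv f)) = rat_deriv f))"

text \<open>Once its residues are removed, f is a derivative, and there \<open>anti\<close> inverts
  differentiation.\<close>

definition prm :: "complex poly fract \<Rightarrow> complex poly fract" where
  "prm f = anti (f - (\<Sum>i=1..m. rat_const (resid i f) * pol i))"

lemma anti:
  "anti (f + g) = anti f + anti g" "anti (rat_const c * f) = rat_const c * anti f" "anti f \<in> A"
  "f \<in> A \<Longrightarrow> rat_deriv (anti (rat_deriv f)) = rat_deriv f"
  using someI_ex[OF antiderivative_exists[OF inj]] unfolding anti_def[symmetric] by blast+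

lemma e_carrier: "0 < j \<Longrightarrow> e j \<in> carrier L_plus"
  unfolding L_plus_simps by (rule imageI) simp

lemma \<rho>_closed: "D \<in> carrier L_plus \<Longrightarrow> w \<in> carrier W \<Longrightarrow> \<rho> D w \<in> carrier W"
  using lie by (rule lie_module.act_closed)

lemma \<epsilon>_carrier: "b < n \<Longrightarrow> \<epsilon> b \<in> carrier W"
  by (rule models_basis(1)[OF \<kappa> models_zero(1)[OF \<kappa>]])

lemma \<kappa>_\<rho>:
  assumes j: "0 < j" and w: "w \<in> carrier W"
  shows "\<kappa> (\<rho> (e j) w) x = (if x < n then \<Sum>b<n. Mx j x b * \<kappa> w b else 0)"
proof (cases "x < n")
  case True
  have c: "\<kappa> w b \<odot>\<^bsub>W\<^esub> \<epsilon> b \<in> carrier W" if "b \<in> {..<n}" for b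
    using models_smult(1)[OF \<kappa> \<epsilon>_carrier] that by simp
  have "\<kappa> (\<rho> (e j) (finsum W (\<lambda>b. \<kappa> w b \<odot>\<^bsub>W\<^esub> \<epsilon> b) {..<n})) = (\<Sum>b<n. \<kappa> (\<rho> (e j) (\<kappa> w b \<odot>\<^bsub>W\<^esub> \<epsilon> b)))"
    by (rule models_additive_finsum[OF \<kappa>, where g = "\<lambda>w. \<kappa> (\<rho> (e j) w)"])
      (simp_all add: lie_module.act_add_right[OF lie e_carrier[OF j]] models_add(2)[OF \<kappa>] \<rho>_closed e_carrier[OF j] c)
  also have "\<dots> = (\<Sum>b<n. (\<lambda>x. \<kappa> w b * \<kappa> (\<rho> (e j) (\<epsilon> b)) x))"
    by (rule sum.cong)
      (simp_all add: lie_module.act_smult_right[OF lie e_carrier[OF j]] models_smult(2)[OF \<kappa>] \<rho>_closed e_carrier[OF j] \<epsilon>_carrier)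
  finally show ?thesis
    unfolding models_basis(2)[OF \<kappa> w] using True by (simp add: sum_fun_apply Mx_def mult.commute)
next
  case False
  then show ?thesis using models_in[OF \<kappa> \<rho>_closed[OF e_carrier[OF j] w]] by simp
qed

lemma hW_\<rho>: "0 < j \<Longrightarrow> w \<in> carrier W \<Longrightarrow> hW (\<rho> (e j) w) = acts j (hW w)"
  by (rule val_eqI) (simp add: hW_def acts_def \<kappa>_\<rho> rat_const_sum rat_const_mult)

lemma Mx_comm:
  assumes i: "0 < i" and j: "0 < j" and x: "x < n" and y: "y < n"
  shows "(\<Sum>b<n. Mx i x b * Mx j b y) - (\<Sum>b<n. Mx j x b * Mx i b y) = of_int (int j - int i) * Mx (i + j - 1) x y"
proof -
  let ?l = "of_int (int j - int i) :: complex"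
  have s: "i + (j - 1) = i + j - 1" "j + (i - 1) = i + j - 1" using i j by auto
  have "monom 1 i * pderiv (monom 1 j) - monom 1 j * pderiv (monom 1 i) = Polynomial.smult ?l (monom (1 :: complex) (i + j - 1))"
    by (simp add: pderiv_monom mult_monom s smult_monom diff_monom del: One_nat_def)
  then have br: "bracket L_plus (e i) (e j) = ?l \<odot>\<^bsub>L_plus\<^esub> e (i + j - 1)"
    unfolding L_plus_simps by simp
  have k: "0 < i + j - 1" using i j by simp
  note E = \<epsilon>_carrier[OF y] and ei = e_carrier[OF i] and ej = e_carrier[OF j] and ek = e_carrier[OF k]
  have "?l \<odot>\<^bsub>W\<^esub> \<rho> (e (i + j - 1)) (\<epsilon> y) = \<rho> (e i) (\<rho> (e j) (\<epsilon> y)) \<ominus>\<^bsub>W\<^esub> \<rho> (e j) (\<rho> (e i) (\<epsilon> y))"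
    using lie_module.act_bracket[OF lie ei ej E] unfolding br lie_module.act_smult_left[OF lie ek E] .
  then have "\<kappa> (?l \<odot>\<^bsub>W\<^esub> \<rho> (e (i + j - 1)) (\<epsilon> y)) x = \<kappa> (\<rho> (e i) (\<rho> (e j) (\<epsilon> y)) \<ominus>\<^bsub>W\<^esub> \<rho> (e j) (\<rho> (e i) (\<epsilon> y))) x"
    by simp
  then have "?l * \<kappa> (\<rho> (e (i + j - 1)) (\<epsilon> y)) x = \<kappa> (\<rho> (e i) (\<rho> (e j) (\<epsilon> y))) x - \<kappa> (\<rho> (e j) (\<rho> (e i) (\<epsilon> y))) x"
    unfolding models_smult(2)[OF \<kappa> \<rho>_closed[OF ek E]]
      models_minus(2)[OF \<kappa> \<rho>_closed[OF ei \<rho>_closed[OF ej E]] \<rho>_closed[OF ej \<rho>_closed[OF ei E]]] by simp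
  then show ?thesis
    unfolding \<kappa>_\<rho>[OF i \<rho>_closed[OF ej E]] \<kappa>_\<rho>[OF j \<rho>_closed[OF ei E]] using x by (simp add: Mx_def)
qed

lemma acts_comm: "acts i (acts j v) - acts j (acts i v) =
    (if i = 0 \<or> j = 0 then 0 else sc (of_int (int j - int i)) (acts (i + j - 1) v))"
proof (cases "i = 0 \<or> j = 0")
  case True
  \<comment> \<open>Constant matrices commute with differentiation.\<close>
  have "acts 0 (acts j v) = acts j (acts 0 v)" for j
    by (rule val_eqI) (simp add: acts_def rat_deriv_sum rat_deriv_const_mult rat.d_0)
  then show ?thesis using True by auto
next
  case False
  have prod: "coo (acts i (acts j v)) x = (\<Sum>c<n. rat_const (\<Sum>b<n. Mx i x b * Mx j b c) * coo v c)"
    if "x < n" "0 < i" "0 < j" for i j x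
  proof -
    have "coo (acts i (acts j v)) x = (\<Sum>b<n. \<Sum>c<n. rat_const (Mx i x b) * (rat_const (Mx j b c) * coo v c))"
      using that by (simp add: acts_def sum_distrib_left)
    also have "\<dots> = (\<Sum>c<n. \<Sum>b<n. rat_const (Mx i x b) * (rat_const (Mx j b c) * coo v c))"
      by (rule sum.swap)
    finally show ?thesis by (simp add: rat_const_sum rat_const_mult sum_distrib_right mult.assoc)
  qed
  have io: "rat_const (of_int l) = of_int l" for l
  proof (cases "l \<ge> 0")
    case True
    then show ?thesis using rat_const_of_nat[OF inj, of "nat l"] by simp
  next
    case False
    then show ?thesis using rat_const_of_nat[OF inj, of "nat (- l)"] rat_const_minus[of "of_nat (nat (- l))"] by simp
  qed
  have "acts i (acts j v) - acts j (acts i v) = sc (of_int (int j - int i)) (acts (i + j - 1) v)"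
  proof (rule val_eqI)
    fix x
    show "coo (acts i (acts j v) - acts j (acts i v)) x = coo (sc (of_int (int j - int i)) (acts (i + j - 1) v)) x"
    proof (cases "x < n")
      case True
      have ij: "0 < i" "0 < j" "0 < i + j - 1" using False by auto
      have "coo (acts i (acts j v) - acts j (acts i v)) x
          = (\<Sum>c<n. rat_const ((\<Sum>b<n. Mx i x b * Mx j b c) - (\<Sum>b<n. Mx j x b * Mx i b c)) * coo v c)"
        using prod[OF True ij(1,2)] prod[OF True ij(2,1)]
        by (simp add: rat_const_diff left_diff_distrib sum_subtractf)
      also have "\<dots> = (\<Sum>c<n. of_int (int j - int i) * (rat_const (Mx (i + j - 1) x c) * coo v c))"
        by (rule sum.cong[OF refl])
          (simp add: Mx_comm[OF ij(1,2) True] rat_const_mult io mult.assoc del: of_int_diff of_int_of_nat_eq)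
      finally show ?thesis using True ij by (simp add: acts_def sum_distrib_left del: of_int_diff of_int_of_nat_eq)
    next
      case False
      then show ?thesis using \<open>\<not> (i = 0 \<or> j = 0)\<close> by (simp add: acts_def)
    qed
  qed
  then show ?thesis using False by simp
qed

lemma coord_diff: "f \<in> A \<Longrightarrow> g \<in> A \<Longrightarrow> f - g \<in> A"
  using coord_ring.add[OF _ coord_minus[OF inj], of f g] by simp

lemma resid_props:
  "f \<in> A \<Longrightarrow> g \<in> A \<Longrightarrow> resid i (f + g) = resid i f + resid i g"
  "f \<in> A \<Longrightarrow> resid i (rat_const c * f) = c * resid i f"
  "f \<in> A \<Longrightarrow> i \<in> {1..m} \<Longrightarrow> resid i (rat_deriv f) = 0"
  "i \<in> {1..m} \<Longrightarrow> j \<in> {1..m} \<Longrightarrow> resid i (pol j) = (if i = j then 1 else 0)"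
  using residue_at_props[OF inj, of i] by (auto simp: resid_def)

lemma prm_props:
  "prm f \<in> A" "f \<in> A \<Longrightarrow> g \<in> A \<Longrightarrow> prm (f + g) = prm f + prm g"
  "f \<in> A \<Longrightarrow> prm (rat_const c * f) = rat_const c * prm f"
  "f \<in> A \<Longrightarrow> rat_deriv (prm f) = f - (\<Sum>i=1..m. rat_const (resid i f) * pol i)"
proof -
  let ?S = "\<lambda>f. \<Sum>i=1..m. rat_const (resid i f) * pol i"
  show "prm f \<in> A" unfolding prm_def by (rule anti(3))
  show "prm (f + g) = prm f + prm g" if fg: "f \<in> A" "g \<in> A"
  proof -
    have "?S (f + g) = ?S f + ?S g"
      unfolding resid_props(1)[OF fg] rat_const_add distrib_right sum.distrib ..
    then have "f + g - ?S (f + g) = (f - ?S f) + (g - ?S g)" by (simp only: add_diff_add)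
    then show ?thesis unfolding prm_def by (simp only: anti(1))
  qed
  show "prm (rat_const c * f) = rat_const c * prm f" if f: "f \<in> A"
  proof -
    have "?S (rat_const c * f) = rat_const c * ?S f"
      unfolding resid_props(2)[OF f] rat_const_mult sum_distrib_left mult.assoc ..
    then have "rat_const c * f - ?S (rat_const c * f) = rat_const c * (f - ?S f)"
      by (simp only: right_diff_distrib)
    then show ?thesis unfolding prm_def by (simp only: anti(2))
  qed
  show "rat_deriv (prm f) = f - ?S f" if f: "f \<in> A"
  proof -
    have S: "(\<Sum>i=1..m. rat_const (residue_at a m i f) * pol i) = ?S f"
      by (rule sum.cong) (auto simp: resid_def)
    obtain g where g: "g \<in> A" "f = rat_deriv g + ?S f"
      using residue_at_decomp[OF inj f] unfolding S by blast
    have e: "f - ?S f = rat_deriv g" unfolding diff_eq_eq by (rule g(2))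
    show ?thesis unfolding prm_def e by (rule anti(4)[OF g(1)])
  qed
qed

lemma acts_large: "\<exists>J. \<forall>j\<ge>J. \<forall>v. acts j v = 0"
proof (rule weight_matrix_zero[of n Mx])
  fix j x y :: nat assume j: "1 \<le> j" and xy: "x < n" "y < n"
  have k: "1 + j - 1 = j" "0 < (1 :: nat)" "0 < j" "int 1 = 1" using j by auto
  show "(\<Sum>b<n. Mx 1 x b * Mx j b y) - (\<Sum>b<n. Mx j x b * Mx 1 b y) = of_int (int j - 1) * Mx j x y"
    using Mx_comm[OF k(2,3) xy] unfolding k(1,4) .
next
  fix J assume J: "\<And>j x y. J \<le> j \<Longrightarrow> x < n \<Longrightarrow> y < n \<Longrightarrow> Mx j x y = 0"
  show "\<exists>J. \<forall>j\<ge>J. \<forall>v. acts j v = 0"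
  proof (intro exI allI impI)
    \<comment> \<open>\<open>Suc J\<close> excludes the index 0, which acts by
      differentiation.\<close>
    fix j v assume j: "Suc J \<le> j"
    have "Mx j x b = 0" if "x < n" "b < n" for x b by (rule J) (use j that in auto)
    then show "acts j v = 0" using j by (intro val_eqI) (simp add: acts_def)
  qed
qed

lemma acts_solve:
  "\<exists>w0. \<forall>w\<ge>w0. \<forall>v. (\<forall>x<n. coo v x \<in> range rat_const) \<and> (\<forall>x\<ge>n. coo v x = 0) \<longrightarrow>
     (\<exists>!y. (\<forall>x<n. coo y x \<in> range rat_const) \<and> (\<forall>x\<ge>n. coo y x = 0) \<and> acts 1 y - sc (of_nat w) y = v)"
proof -
  obtain w0 :: nat where w0: "(\<Sum>x<n. \<Sum>b<n. norm (Mx 1 x b)) < real w0" using reals_Archimedean2 by blast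
  have eq: "acts 1 (Val (\<lambda>x. rat_const (u x))) - sc (of_nat w) (Val (\<lambda>x. rat_const (u x))) =
      Val (\<lambda>x. rat_const ((if x < n then \<Sum>b<n. Mx 1 x b * u b else 0) - of_nat w * u x))" for u w
    by (rule val_eqI) (simp add: acts_def rat_const_diff rat_const_sum rat_const_mult rat_const_of_nat[OF inj])
  have "\<exists>!y. ((\<forall>x<n. coo y x \<in> range rat_const) \<and> (\<forall>x\<ge>n. coo y x = 0)) \<and> acts 1 y - sc (of_nat w) y = v"
    if w: "w0 \<le> w" and v: "(\<forall>x<n. coo v x \<in> range rat_const) \<and> (\<forall>x\<ge>n. coo v x = 0)" for w v
  proof -
    have K: "(\<Sum>x<n. \<Sum>b<n. norm (Mx 1 x b)) < real w" using w0 w by simp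
    obtain v' where v': "\<forall>x\<ge>n. v' x = 0" "v = Val (\<lambda>x. rat_const (v' x))" using v unfolding rat_coords_range by blast
    obtain u where u: "\<And>x. x < n \<Longrightarrow> (\<Sum>b<n. Mx 1 x b * u b) - of_nat w * u x = v' x"
      using shifted_system(1)[OF K, of v'] by blast
    let ?u = "\<lambda>x. if x < n then u x else 0"
    show ?thesis unfolding rat_coords_range
    proof (rule ex1I[of _ "Val (\<lambda>x. rat_const (?u x))"])
      have sum: "(\<Sum>b<n. Mx 1 x b * ?u b) = (\<Sum>b<n. Mx 1 x b * u b)" for x by (rule sum.cong) simp_all
      have c: "(if x < n then \<Sum>b<n. Mx 1 x b * ?u b else 0) - of_nat w * ?u x = v' x" for x
      proof (cases "x < n")
        case True
        then show ?thesis using u[OF True] unfolding sum by (simp only: if_True)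
      next
        case False
        then show ?thesis using v'(1) by simp
      qed
      have e: "Val (\<lambda>x. rat_const ((if x < n then \<Sum>b<n. Mx 1 x b * ?u b else 0) - of_nat w * ?u x)) = v"
        unfolding v'(2) c ..
      show "(\<exists>u. (\<forall>x\<ge>n. u x = 0) \<and> Val (\<lambda>x. rat_const (?u x)) = Val (\<lambda>x. rat_const (u x))) \<and>
        acts 1 (Val (\<lambda>x. rat_const (?u x))) - sc (of_nat w) (Val (\<lambda>x. rat_const (?u x))) = v"
      proof (intro conjI)
        show "\<exists>u. (\<forall>x\<ge>n. u x = 0) \<and> Val (\<lambda>x. rat_const (?u x)) = Val (\<lambda>x. rat_const (u x))"
          by (rule exI[of _ ?u]) simp
        show "acts 1 (Val (\<lambda>x. rat_const (?u x))) - sc (of_nat w) (Val (\<lambda>x. rat_const (?u x))) = v"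
          unfolding eq by (rule e)
      qed
    next
      fix y assume y: "(\<exists>u. (\<forall>x\<ge>n. u x = 0) \<and> y = Val (\<lambda>x. rat_const (u x))) \<and> acts 1 y - sc (of_nat w) y = v"
      then obtain u' where u': "\<forall>x\<ge>n. u' x = 0" "y = Val (\<lambda>x. rat_const (u' x))" by blast
      have vv: "Val (\<lambda>x. rat_const ((if x < n then \<Sum>b<n. Mx 1 x b * u' b else 0) - of_nat w * u' x)) = Val (\<lambda>x. rat_const (v' x))"
        using y unfolding u'(2) eq v'(2) by blast
      have u'v: "(\<Sum>b<n. Mx 1 x b * u' b) - of_nat w * u' x = v' x" if x: "x < n" for x
        using fun_cong[OF arg_cong[OF vv, of coo], of x] unfolding val.sel rat_const_eq_iff if_P[OF x] .
      have gen: "p - q - (r - t) = 0" if "p - r = z" "q - t = z" for p q r t z :: complex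
        using that by (simp add: algebra_simps)
      have "(\<Sum>b<n. Mx 1 x b * (u' b - u b)) - of_nat w * (u' x - u x) = 0" if "x < n" for x
        unfolding right_diff_distrib sum_subtractf by (rule gen[OF u'v[OF that] u[OF that]])
      then have "u' x = u x" if "x < n" for x
        using shifted_system(2)[OF K, of "\<lambda>b. u' b - u b" x] that by simp
      then show "y = Val (\<lambda>x. rat_const (?u x))" unfolding u'(2) using u'(1) by (intro val_eqI) (auto simp: not_less)
    qed
  qed
  note ex = this[unfolded conj_assoc]
  show ?thesis by (intro exI[of _ w0] allI impI ex)
qed

sublocale lj: lie_jet acts rat_deriv A rat_z rat_const n Mx prm resid pol m
proof unfold_locales
  show "acts i (v + w) = acts i v + acts i w" for i v w
    by (rule val_eqI) (simp add: acts_def rat_deriv_add distrib_left sum.distrib)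
  show "acts i (acts j v) - acts j (acts i v) =
    (if i = 0 \<or> j = 0 then 0 else sc (of_int (int j - int i)) (acts (i + j - 1) v))" for i j v by (rule acts_comm)
  show "acts 0 v = derivation.dval rat_deriv v" for v
    by (rule val_eqI) (simp add: acts_def rat.coo_dval)
  show "acts j (sc f v) = sc f (acts j v)" if "0 < j" for j f v
    using that by (intro val_eqI) (simp add: acts_def sum_distrib_left mult.left_commute)
  show "T f = sc f (T 1)"
    if "\<And>f g. f \<in> A \<Longrightarrow> g \<in> A \<Longrightarrow> T (f + g) = T f + T g" "\<And>c f. f \<in> A \<Longrightarrow> T (rat_const c * f) = sc (rat_const c) (T f)"
      "\<And>f. f \<in> A \<Longrightarrow> T (rat_z * f) = sc rat_z (T f)" "f \<in> A" for T f
    by (rule coord_linear[OF inj that])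
  show "acts j v = Val (\<lambda>x. if x < n then \<Sum>b<n. rat_const (Mx j x b) * coo v b else 0)" if "0 < j" for j v
    using that by (simp add: acts_def)
  show "\<exists>J. \<forall>j\<ge>J. \<forall>v. acts j v = 0" by (rule acts_large)
  show "\<exists>w0. \<forall>w\<ge>w0. \<forall>v. (\<forall>x<n. coo v x \<in> range rat_const) \<and> (\<forall>x\<ge>n. coo v x = 0) \<longrightarrow>
     (\<exists>!y. (\<forall>x<n. coo y x \<in> range rat_const) \<and> (\<forall>x\<ge>n. coo y x = 0) \<and> acts 1 y - sc (of_nat w) y = v)"
    by (rule acts_solve)
qed (simp_all add: coord_ring.intros coord_deriv[OF inj] rat_const_add rat_const_mult rat_deriv_const rat_deriv_z
    rat_deriv_zero_const resid_props prm_props del: One_nat_def)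

end

section \<open>Linear maps on the tensor module\<close>

lemma pure_closed:
  assumes M: "models sM M hM SM" and N: "models sN N hN SN" and "x \<in> carrier M" "y \<in> carrier N"
  shows "pure_tensor M N x y \<in> carrier (tensor_space M N)"
  using delta_FS[OF M N assms(3,4)]
  unfolding pure_tensor_def tensor_space_def quotient_space_def by (auto simp: A_RCOSETS_def')

lemma linear_mapI:
  assumes M: "models s M h S" and "\<And>x. x \<in> carrier M \<Longrightarrow> F x \<in> carrier M"
    "\<And>x y. x \<in> carrier M \<Longrightarrow> y \<in> carrier M \<Longrightarrow> F (x \<oplus>\<^bsub>M\<^esub> y) = F x \<oplus>\<^bsub>M\<^esub> F y"
    "\<And>c x. x \<in> carrier M \<Longrightarrow> F (c \<odot>\<^bsub>M\<^esub> x) = c \<odot>\<^bsub>M\<^esub> F x"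
  shows "linear_map class_ring M M F"
  unfolding linear_map_def mod_hom_def mod_hom_axioms_def LinearCombinations.module_hom_def
  using models_vectorspace[OF M] models_module[OF M] assms(2-4) by auto

lemma linear_mapD:
  assumes "linear_map class_ring M M F"
  shows "x \<in> carrier M \<Longrightarrow> F x \<in> carrier M"
    "x \<in> carrier M \<Longrightarrow> y \<in> carrier M \<Longrightarrow> F (x \<oplus>\<^bsub>M\<^esub> y) = F x \<oplus>\<^bsub>M\<^esub> F y"
  using assms unfolding linear_map_def mod_hom_def mod_hom_axioms_def LinearCombinations.module_hom_def by auto

context tensor_setup
begin

subsection \<open>The tensor module\<close>

abbreviation "T \<equiv> tensor_module a m W"
abbreviation "pt \<equiv> pure_tensor (coord_space a m) W"
abbreviation "VF \<equiv> vector_fields a m"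

lemma models_coord: "models (\<lambda>c f. rat_const c * f) (coord_space a m) (\<lambda>f. f) A"
  unfolding models_def coord_space_def
  using vector_space_fract[OF inj] coord_0[OF inj]
  by (auto simp: bij_betw_def intro: coord_ring.intros)

lemma models_hW: "models (\<lambda>c v. sc (rat_const c) v) W hW lj.VC"
proof -
  have "models (\<lambda>c v. sc (rat_const c) v) W (\<lambda>w. (\<lambda>u. Val (\<lambda>x. rat_const (u x))) (\<kappa> w)) lj.VC"
  proof (rule models_comp[OF \<kappa> lj.vector_space_\<iota>])
    show "bij_betw (\<lambda>u. Val (\<lambda>x. rat_const (u x))) {u. \<forall>x\<ge>n. u x = 0} lj.VC"
      unfolding bij_betw_def lj.VC_def rat_coords_range
      by (auto simp: inj_on_def fun_eq_iff rat_const_eq_iff)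
  qed (auto intro!: val_eqI simp: rat_const_add rat_const_mult)
  then show ?thesis by (simp add: hW_def[abs_def])
qed

definition hT :: "(complex poly fract \<times> 'w \<Rightarrow> complex) set \<Rightarrow> complex poly fract val" where
  "hT X = Val (tensor_eval (\<lambda>c f x. rat_const c * f x) (\<lambda>s w x. rat_const (\<kappa> w x) * s) (SOME r. r \<in> X))"

lemma models_T: "models (\<lambda>c v. sc (rat_const c) v) T hT lj.VA"
proof -
  note M = models_tensor_finite(1)[OF models_coord \<kappa>]
  have "models (\<lambda>c v. sc (rat_const c) v) T (\<lambda>X. Val (tensor_eval (\<lambda>c f x. rat_const c * f x)
      (\<lambda>s w x. rat_const (\<kappa> w x) * s) (SOME r. r \<in> X))) lj.VA"
    unfolding tensor_module_def
  proof (rule models_comp[where g = Val, OF M lj.vector_space_\<iota>])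
    show "bij_betw Val {f. (\<forall>x<n. f x \<in> A) \<and> (\<forall>x\<ge>n. f x = 0)} lj.VA"
      by (rule bij_betwI[where g = coo]) (auto simp: lj.VA_def)
  qed (auto intro!: val_eqI)
  then show ?thesis by (simp add: hT_def[abs_def])
qed

lemma pt_closed: "s \<in> A \<Longrightarrow> w \<in> carrier W \<Longrightarrow> pt s w \<in> carrier T"
  unfolding tensor_module_def
  by (rule pure_closed[OF models_coord \<kappa>]) (simp_all add: coord_space_def)

lemma hT_pt:
  assumes "s \<in> A" "w \<in> carrier W"
  shows "hT (pt s w) = sc s (hW w)"
proof -
  have "s \<in> carrier (coord_space a m)" using assms(1) by (simp add: coord_space_def)
  from models_tensor_finite(2)[OF models_coord \<kappa> this assms(2)]
  show ?thesis unfolding hT_def by (intro val_eqI) (simp add: hW_def mult.commute)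
qed

lemma hT_expand:
  assumes X: "X \<in> carrier T"
  shows "hT X = (\<Sum>x<n. sc (coo (hT X) x) (hW (\<epsilon> x)))"
    "X = finsum T (\<lambda>x. pt (coo (hT X) x) (\<epsilon> x)) {..<n}"
proof -
  have v: "hT X \<in> lj.VA" by (rule models_in[OF models_T X])
  have u: "\<kappa> (\<epsilon> x) = unit_at x" if "x < n" for x
    by (rule models_basis(3)[OF \<kappa> models_zero(1)[OF \<kappa>] that])
  show e: "hT X = (\<Sum>x<n. sc (coo (hT X) x) (hW (\<epsilon> x)))"
  proof (rule val_eqI)
    fix y
    have "coo (\<Sum>x<n. sc (coo (hT X) x) (hW (\<epsilon> x))) y = (\<Sum>x<n. if y = x then coo (hT X) x else 0)"
      unfolding coo_sum by (rule sum.cong) (simp_all add: hW_def u, simp add: unit_at_def)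
    also have "\<dots> = coo (hT X) y" using v by (simp add: sum.delta lj.VA_def)
    finally show "coo (hT X) y = coo (\<Sum>x<n. sc (coo (hT X) x) (hW (\<epsilon> x))) y" ..
  qed
  have c: "coo (hT X) x \<in> A" if "x < n" for x using v that by (simp add: lj.VA_def)
  have p: "pt (coo (hT X) x) (\<epsilon> x) \<in> carrier T" if "x \<in> {..<n}" for x
    using pt_closed[OF c \<epsilon>_carrier] that by simp
  have F: "finsum T (\<lambda>x. pt (coo (hT X) x) (\<epsilon> x)) {..<n} \<in> carrier T"
    "hT (finsum T (\<lambda>x. pt (coo (hT X) x) (\<epsilon> x)) {..<n}) = (\<Sum>x<n. hT (pt (coo (hT X) x) (\<epsilon> x)))"
    by (rule models_finsum[OF models_T finite_lessThan], erule p)+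
  have "(\<Sum>x<n. hT (pt (coo (hT X) x) (\<epsilon> x))) = (\<Sum>x<n. sc (coo (hT X) x) (hW (\<epsilon> x)))"
    by (rule sum.cong) (simp_all add: hT_pt c \<epsilon>_carrier)
  then show "X = finsum T (\<lambda>x. pt (coo (hT X) x) (\<epsilon> x)) {..<n}"
    using e F(2) by (intro models_inj[OF models_T X F(1)]) simp
qed

text \<open>To compute the lift it suffices to find a linear g on coordinate vectors that agrees
  with b on pure tensors. Uniqueness holds because the pure tensors with basis vectors of W span, by
  \<open>hT_expand\<close>.\<close>

lemma tensor_lift_value:
  assumes b: "\<And>s w. s \<in> A \<Longrightarrow> w \<in> carrier W \<Longrightarrow> b s w \<in> carrier T"
      "\<And>s w. s \<in> A \<Longrightarrow> w \<in> carrier W \<Longrightarrow> hT (b s w) = g (sc s (hW w))"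
    and g: "\<And>v w. g (v + w) = g v + g w" "\<And>c v. g (sc (rat_const c) v) = sc (rat_const c) (g v)"
      "\<And>v. v \<in> lj.VA \<Longrightarrow> g v \<in> lj.VA"
    and X: "X \<in> carrier T"
  shows "tensor_lift (coord_space a m) W T b X \<in> carrier T" "hT (tensor_lift (coord_space a m) W T b X) = g (hT X)"
proof -
  note MT = models_T and iT = models_inv[OF models_T]
  let ?i = "inv_into (carrier T) hT"
  let ?F = "\<lambda>X\<in>carrier T. ?i (g (hT X))"
  have gin: "g (hT X) \<in> lj.VA" if "X \<in> carrier T" for X by (rule g(3)[OF models_in[OF MT that]])
  have Fc: "?F X \<in> carrier T" "hT (?F X) = g (hT X)" if "X \<in> carrier T" for X
    using iT(1,2)[OF gin[OF that]] that by simp_all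
  have lin: "linear_map class_ring T T ?F"
  proof (rule linear_mapI[OF MT])
    fix X Y assume XY: "X \<in> carrier T" "Y \<in> carrier T"
    show "?F (X \<oplus>\<^bsub>T\<^esub> Y) = ?F X \<oplus>\<^bsub>T\<^esub> ?F Y"
      by (rule models_inj[OF MT Fc(1)[OF models_add(1)[OF MT XY]] models_add(1)[OF MT Fc(1)[OF XY(1)] Fc(1)[OF XY(2)]]])
        (simp only: Fc(2)[OF models_add(1)[OF MT XY]] models_add(2)[OF MT Fc(1)[OF XY(1)] Fc(1)[OF XY(2)]]
          models_add(2)[OF MT XY] Fc(2)[OF XY(1)] Fc(2)[OF XY(2)] g(1))
  next
    fix c X assume X: "X \<in> carrier T"
    show "?F (c \<odot>\<^bsub>T\<^esub> X) = c \<odot>\<^bsub>T\<^esub> ?F X"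
      by (rule models_inj[OF MT Fc(1)[OF models_smult(1)[OF MT X]] models_smult(1)[OF MT Fc(1)[OF X]]])
        (simp only: Fc(2)[OF models_smult(1)[OF MT X]] models_smult(2)[OF MT Fc(1)[OF X]]
          models_smult(2)[OF MT X] Fc(2)[OF X] g(2))
  qed (rule Fc(1))
  have pure: "?F (pt s w) = b s w" if "s \<in> A" "w \<in> carrier W" for s w
    by (rule models_inj[OF MT Fc(1)[OF pt_closed[OF that]] b(1)[OF that]])
      (simp only: Fc(2)[OF pt_closed[OF that]] b(2)[OF that] hT_pt[OF that])
  have g0: "g 0 = 0" using g(1)[of 0 0] by simp
  have gsum: "g (\<Sum>i\<in>I. f i) = (\<Sum>i\<in>I. g (f i))" for f :: "nat \<Rightarrow> _" and I
    by (induction I rule: infinite_finite_induct) (simp_all add: g0 g(1))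
  have uniq: "H = ?F" if H: "H \<in> extensional (carrier T)" "linear_map class_ring T T H"
      "\<And>s w. s \<in> A \<Longrightarrow> w \<in> carrier W \<Longrightarrow> H (pt s w) = b s w" for H
  proof (rule extensionalityI[OF H(1)])
    fix X assume X: "X \<in> carrier T"
    note Hc = linear_mapD[OF H(2)]
    have c: "coo (hT X) x \<in> A" if "x < n" for x using models_in[OF MT X] that by (simp add: lj.VA_def)
    have p: "pt (coo (hT X) x) (\<epsilon> x) \<in> carrier T" if "x \<in> {..<n}" for x
      using pt_closed[OF c \<epsilon>_carrier] that by simp
    have "hT (H (finsum T (\<lambda>x. pt (coo (hT X) x) (\<epsilon> x)) {..<n})) = (\<Sum>x<n. hT (H (pt (coo (hT X) x) (\<epsilon> x))))"
      by (rule models_additive_finsum[OF MT, where g = "\<lambda>X. hT (H X)"])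
        (simp_all add: Hc models_add(2)[OF MT] p)
    then have "hT (H X) = (\<Sum>x<n. hT (H (pt (coo (hT X) x) (\<epsilon> x))))"
      unfolding hT_expand(2)[OF X, symmetric] .
    also have "\<dots> = (\<Sum>x<n. g (sc (coo (hT X) x) (hW (\<epsilon> x))))"
      by (rule sum.cong) (simp_all add: H(3) b(2) c \<epsilon>_carrier)
    also have "\<dots> = g (hT X)" unfolding gsum[symmetric] hT_expand(1)[OF X, symmetric] ..
    finally show "H X = ?F X"
      using models_inj[OF MT Hc(1)[OF X] Fc(1)[OF X]] Fc(2)[OF X] by metis
  qed simp
  have "tensor_lift (coord_space a m) W T b = ?F"
    unfolding tensor_lift_def tensor_module_def[symmetric]
  proof (rule the_equality)
    show "?F \<in> extensional (carrier T) \<and> linear_map class_ring T T ?F \<and>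
        (\<forall>x\<in>carrier (coord_space a m). \<forall>y\<in>carrier W. ?F (pt x y) = b x y)"
      using lin pure by (simp add: coord_space_def)
  next
    fix H assume "H \<in> extensional (carrier T) \<and> linear_map class_ring T T H \<and>
        (\<forall>x\<in>carrier (coord_space a m). \<forall>y\<in>carrier W. H (pt x y) = b x y)"
    then show "H = ?F" by (intro uniq) (auto simp: coord_space_def)
  qed
  then show "tensor_lift (coord_space a m) W T b X \<in> carrier T" "hT (tensor_lift (coord_space a m) W T b X) = g (hT X)"
    using Fc[OF X] by simp_all
qed

lemma tensor_scale_value:
  assumes f: "f \<in> A" and X: "X \<in> carrier T"
  shows "tensor_scale a m W f X \<in> carrier T" "hT (tensor_scale a m W f X) = sc f (hT X)"
proof -
  have fs: "f * s \<in> A" if "s \<in> A" for s using coord_ring.mult[OF f that] .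
  have "tensor_scale a m W f X \<in> carrier T \<and> hT (tensor_scale a m W f X) = sc f (hT X)"
    unfolding tensor_scale_def
    by (intro conjI tensor_lift_value[where g = "sc f", OF _ _ _ _ _ X])
      (simp_all add: pt_closed hT_pt fs lj.VA_sc[OF f] mult.commute[of f "rat_const c" for c])
  then show "tensor_scale a m W f X \<in> carrier T" "hT (tensor_scale a m W f X) = sc f (hT X)" by auto
qed

subsection \<open>Vector fields on the punctured sphere\<close>

definition EV :: "complex poly fract \<Rightarrow> complex poly fract \<Rightarrow> complex poly fract" where
  "EV f = (\<lambda>s\<in>A. f * rat_deriv s)"

lemma EV_apply: "s \<in> A \<Longrightarrow> EV f s = f * rat_deriv s"
  by (simp add: EV_def)

lemma EV_z: "EV f rat_z = f"
  by (simp add: EV_def coord_ring.var rat_deriv_z)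

lemma EV_simps:
  assumes "f \<in> A" "g \<in> A"
  shows "EV f \<oplus>\<^bsub>VF\<^esub> EV g = EV (f + g)" "c \<odot>\<^bsub>VF\<^esub> EV f = EV (rat_const c * f)"
    "bracket VF (EV f) (EV g) = EV (f * rat_deriv g - g * rat_deriv f)"
    "field_scale a m f (EV g) = EV (f * g)" "EV f \<in> carrier VF"
proof -
  have cl: "h * rat_deriv s \<in> A" if "h \<in> A" "s \<in> A" for h s
    by (rule coord_ring.mult[OF that(1) coord_deriv[OF inj that(2)]])
  show "EV f \<oplus>\<^bsub>VF\<^esub> EV g = EV (f + g)" "c \<odot>\<^bsub>VF\<^esub> EV f = EV (rat_const c * f)"
    "bracket VF (EV f) (EV g) = EV (f * rat_deriv g - g * rat_deriv f)"
    "field_scale a m f (EV g) = EV (f * g)"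
    using assms cl
    by (auto simp: vector_fields_def der_algebra_def EV_def field_scale_def fun_eq_iff restrict_def
        algebra_simps rat_deriv_mult)
  show "EV f \<in> carrier VF"
    using cl[OF assms(1)]
    by (auto simp: vector_fields_def der_algebra_def EV_def coord_ring.intros rat_deriv_add rat_deriv_mult
        rat_deriv_const algebra_simps)
qed

text \<open>A derivation of the ring is determined by its value at z. On 1/(z - a_j) the product
  rule, applied to the product of this function with z - a_j, leaves no choice.\<close>

lemma EV_surj:
  assumes D: "D \<in> carrier VF"
  shows "D rat_z \<in> A" "D = EV (D rat_z)"
proof -
  have P: "D \<in> A \<rightarrow>\<^sub>E A" and add: "\<And>s t. s \<in> A \<Longrightarrow> t \<in> A \<Longrightarrow> D (s + t) = D s + D t"
    and sm: "\<And>c s. s \<in> A \<Longrightarrow> D (rat_const c * s) = rat_const c * D s"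
    and mult: "\<And>s t. s \<in> A \<Longrightarrow> t \<in> A \<Longrightarrow> D (s * t) = D s * t + s * D t"
    using D unfolding vector_fields_def der_algebra_def by auto
  show z: "D rat_z \<in> A" by (rule PiE_mem[OF P coord_ring.var])
  have D1: "D 1 = 0" using mult[OF coord_1[OF inj] coord_1[OF inj]] by simp
  have const: "D (rat_const c) = 0" for c using sm[OF coord_1[OF inj], of c] D1 by simp
  have val: "D s = D rat_z * rat_deriv s" if "s \<in> A" for s
    using that
  proof (induction rule: coord_ring.induct)
    case (const c)
    show ?case by (simp add: \<open>\<And>c. D (rat_const c) = 0\<close> rat_deriv_const)
  next
    case var
    show ?case by (simp add: rat_deriv_z)
  next
    case (pole j)
    let ?y = "rat_z - rat_const (a j)" and ?p = "pol j"
    have nz: "?y \<noteq> 0" by (rule z_minus_const_nz)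
    have p: "?p \<in> A" by (rule coord_ring.pole[OF pole])
    have y: "?y \<in> A" by (rule coord_diff[OF coord_ring.var coord_ring.const])
    have "D ?y + D (rat_const (a j)) = D rat_z" using add[OF y coord_ring.const, of "a j"] by simp
    then have Dy: "D ?y = D rat_z" by (simp add: \<open>\<And>c. D (rat_const c) = 0\<close>)
    have "0 = D (?p * ?y)" using nz D1 by simp
    also have "\<dots> = D ?p * ?y + ?p * D rat_z" unfolding mult[OF p y] Dy ..
    finally have e: "D ?p * ?y = - (?p * D rat_z)" by (simp add: eq_neg_iff_add_eq_0)
    have "D ?p = (D ?p * ?y) * ?p" using nz by simp
    also have "\<dots> = D rat_z * rat_deriv ?p" unfolding e rat_deriv_inverse by (simp add: power2_eq_square)
    finally show ?case .
  next
    case (add f g)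
    then show ?case using \<open>\<And>s t. s \<in> A \<Longrightarrow> t \<in> A \<Longrightarrow> D (s + t) = D s + D t\<close>[OF add(1,2)]
      by (simp add: rat_deriv_add distrib_left)
  next
    case (mult f g)
    then show ?case using \<open>\<And>s t. s \<in> A \<Longrightarrow> t \<in> A \<Longrightarrow> D (s * t) = D s * t + s * D t\<close>[OF mult(1,2)]
      by (simp add: rat_deriv_mult algebra_simps)
  qed
  show "D = EV (D rat_z)"
  proof (rule HOL.ext)
    fix s
    show "D s = EV (D rat_z) s"
    proof (cases "s \<in> A")
      case True
      show ?thesis unfolding EV_apply[OF True] by (rule val[OF True])
    next
      case False
      then show ?thesis using PiE_arb[OF P False] by (simp add: EV_def)
    qed
  qed
qed

lemma EV_bij: "bij_betw EV A (carrier VF)"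
  by (rule bij_betwI[where g = "\<lambda>D. D rat_z"])
    (use EV_surj EV_simps(5) EV_z in \<open>auto simp: EV_z\<close>)

sublocale vl: lie_model VF A "\<lambda>c f. rat_const c * f" EV "\<lambda>f g. f * rat_deriv g - g * rat_deriv f"
  T "\<lambda>c v. sc (rat_const c) v" hT lj.VA
proof
  show "models (\<lambda>c v. sc (rat_const c) v) T hT lj.VA" by (rule models_T)
  show "bij_betw EV A (carrier VF)" by (rule EV_bij)
  show "f + g \<in> A" if "f \<in> A" "g \<in> A" for f g by (rule coord_ring.add[OF that])
  show "rat_const c * f \<in> A" if "f \<in> A" for c f by (rule coord_ring.mult[OF coord_ring.const that])
  show "f * rat_deriv g - g * rat_deriv f \<in> A" if "f \<in> A" "g \<in> A" for f g
    by (intro coord_diff coord_ring.mult coord_deriv[OF inj] that)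
qed (simp_all add: EV_simps)

sublocale ll: lie_model L_plus lj.PB Polynomial.smult poly_field lj.pbr W "\<lambda>c v. sc (rat_const c) v" hW lj.VC
proof
  show "models (\<lambda>c v. sc (rat_const c) v) W hW lj.VC" by (rule models_hW)
  show "bij_betw poly_field lj.PB (carrier L_plus)"
    unfolding lj.PB_def L_plus_simps by (rule inj_on_imp_bij_betw[OF inj_on_subset[OF poly_field_inj subset_UNIV]])
  show "lj.pbr p q \<in> lj.PB" if "p \<in> lj.PB" "q \<in> lj.PB" for p q by (rule lj.PB_closed(3)[OF that])
qed (simp_all add: lj.PB_closed L_plus_simps lj.pbr_def)

subsection \<open>The two actions in coordinates\<close>

lemma hW_poly_field:
  assumes p: "p \<in> lj.PB" and w: "w \<in> carrier W"
  shows "hW (\<rho> (poly_field p) w) = lj.actp p (hW w)"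
proof -
  have add: "hW (\<rho> (poly_field (p + q)) w) = hW (\<rho> (poly_field p) w) + hW (\<rho> (poly_field q) w)"
    if "p \<in> lj.PB" "q \<in> lj.PB" for p q
    using lie_module.act_add_left[OF lie ll.E_carrier[OF that(1)] ll.E_carrier[OF that(2)] w]
      models_add(2)[OF models_hW \<rho>_closed[OF ll.E_carrier[OF that(1)] w] \<rho>_closed[OF ll.E_carrier[OF that(2)] w]]
    unfolding L_plus_simps by simp
  have scale: "hW (\<rho> (poly_field (Polynomial.smult c p)) w) = sc (rat_const c) (hW (\<rho> (poly_field p) w))"
    if "p \<in> lj.PB" for p c
    using lie_module.act_smult_left[OF lie ll.E_carrier[OF that] w, of c]
      models_smult(2)[OF models_hW \<rho>_closed[OF ll.E_carrier[OF that] w], of c]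
    unfolding L_plus_simps by simp
  have z: "hW (\<rho> (poly_field 0) w) = 0" using scale[OF p, of 0] by simp
  have mon: "monom (coeff p j) j \<in> lj.PB \<and> hW (\<rho> (poly_field (monom (coeff p j) j)) w) = sc (rat_const (coeff p j)) (acts j (hW w))" for j
  proof (cases "j = 0")
    case True
    then show ?thesis using p z by (simp add: lj.PB_def)
  next
    case False
    then have m: "monom 1 j \<in> lj.PB" by (simp add: lj.monom_PB)
    show ?thesis
      using scale[OF m, of "coeff p j"] hW_\<rho>[OF _ w, of j] False by (simp add: lj.monom_PB smult_monom)
  qed
  have "(\<Sum>j\<in>I. monom (coeff p j) j) \<in> lj.PB \<and> hW (\<rho> (poly_field (\<Sum>j\<in>I. monom (coeff p j) j)) w)
      = (\<Sum>j\<in>I. sc (rat_const (coeff p j)) (acts j (hW w)))" if "finite I" for I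
    using that
  proof (induction I rule: finite_induct)
    case empty
    show ?case using z by (simp add: lj.PB_def)
  next
    case (insert j I)
    then show ?case using add[OF conjunct1[OF mon[of j]] conjunct1[OF insert.IH]] mon[of j] lj.PB_closed(1)
      by simp
  qed
  from this[OF finite_atMost[of "degree p"]] show ?thesis
    unfolding poly_as_sum_of_monoms lj.pl_def by blast
qed

text \<open>The sum in the action runs over a set of indices that depends on w. This set lies in the
  range 1 \<le> j < \<open>act_order\<close>, and the terms of the range that it misses are 0; so
  one range serves all w, and the expression becomes linear in w.\<close>

lemma tensor_act_value:
  assumes f: "f \<in> A" and X: "X \<in> carrier T"
  shows "tensor_act a m W \<rho> (EV f) X \<in> carrier T"
    "hT (tensor_act a m W \<rho> (EV f) X) = lj.actv lj.act_order f (hT X)"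
proof -
  let ?N = "lj.act_order" and ?g = "lj.actv lj.act_order f"
  let ?J = "\<lambda>w. {j. 1 \<le> j \<and> \<rho> (e j) w \<noteq> \<zero>\<^bsub>W\<^esub>}"
  let ?r = "\<lambda>j. rat_const (1 / fact j) * (rat_deriv ^^ j) (EV f rat_z)"
  let ?q = "\<lambda>s w j. pt (?r j * s) (\<rho> (e j) w)"
  have dj: "(rat_deriv ^^ j) f \<in> A" for j by (induction j) (simp_all add: f coord_deriv[OF inj])
  have rF: "?r j = rat.F j f" for j
  proof -
    have "rat_const (1 / fact j) * rat_const (fact j) = 1" by (simp add: rat_const_mult[symmetric])
    moreover have "rat_const (fact j) = of_nat (fact j)" using rat_const_of_nat[OF inj, of "fact j"] by simp
    ultimately have "rat_const (1 / fact j) = 1 / of_nat (fact j)"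
      by (metis nonzero_eq_divide_eq mult_zero_right zero_neq_one)
    then show ?thesis by (simp add: EV_z rat.F_def)
  qed
  have rA: "?r j * s \<in> A" if "s \<in> A" for j s
    unfolding EV_z by (intro coord_ring.mult coord_ring.const dj that)
  have b: "pt (EV f s) w \<oplus>\<^bsub>T\<^esub> finsum T (?q s w) (?J w) \<in> carrier T \<and>
      hT (pt (EV f s) w \<oplus>\<^bsub>T\<^esub> finsum T (?q s w) (?J w)) = ?g (sc s (hW w))"
    if s: "s \<in> A" and w: "w \<in> carrier W" for s w
  proof -
    have Ds: "EV f s \<in> A" using s f by (simp add: EV_apply coord_ring.mult coord_deriv[OF inj])
    have sub: "?J w \<subseteq> {1..<?N}"
    proof
      fix j assume j: "j \<in> ?J w"
      have "j < ?N"
      proof (rule ccontr)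
        assume "\<not> j < ?N"
        then have "acts j (hW w) = 0" by (intro lj.act_order(2)) simp
        then have "hW (\<rho> (e j) w) = hW \<zero>\<^bsub>W\<^esub>" using hW_\<rho>[of j w] j w by (simp add: models_zero(2)[OF models_hW])
        then have "\<rho> (e j) w = \<zero>\<^bsub>W\<^esub>"
          by (rule models_inj[OF models_hW \<rho>_closed[OF e_carrier w] models_zero(1)[OF models_hW], rotated]) (use j in simp)
        then show False using j by simp
      qed
      then show "j \<in> {1..<?N}" using j by simp
    qed
    then have fin: "finite (?J w)" using finite_subset by blast
    have qc: "?q s w j \<in> carrier T" if "j \<in> ?J w" for j
      using that pt_closed[OF rA[OF s] \<rho>_closed[OF e_carrier w]] by simp
    have qv: "hT (?q s w j) = sc (rat.F j f) (acts j (sc s (hW w)))" if "j \<in> {1..<?N}" for j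
      using that hT_pt[OF rA[OF s] \<rho>_closed[OF e_carrier w], of j j] hW_\<rho>[OF _ w, of j] lj.act_lin[of j s "hW w"]
      unfolding rF by simp
    have F: "finsum T (?q s w) (?J w) \<in> carrier T" "hT (finsum T (?q s w) (?J w)) = (\<Sum>j\<in>?J w. hT (?q s w j))"
      by (rule models_finsum[OF models_T fin], erule qc)+
    have "(\<Sum>j\<in>?J w. hT (?q s w j)) = (\<Sum>j\<in>{1..<?N}. sc (rat.F j f) (acts j (sc s (hW w))))"
    proof (rule sum.mono_neutral_cong_left)
      show "\<forall>j\<in>{1..<?N} - ?J w. sc (rat.F j f) (acts j (sc s (hW w))) = 0"
      proof
        fix j assume j: "j \<in> {1..<?N} - ?J w"
        then have "acts j (hW w) = 0" using hW_\<rho>[OF _ w, of j] models_zero(2)[OF models_hW] by simp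
        then show "sc (rat.F j f) (acts j (sc s (hW w))) = 0" using j lj.act_lin[of j s "hW w"] by simp
      qed
    qed (use sub qv in auto)
    moreover have "hT (pt (EV f s) w) = sc (rat.F 0 f) (acts 0 (sc s (hW w)))"
      unfolding hT_pt[OF Ds w]
      by (rule val_eqI) (use s in \<open>simp add: EV_apply acts_def hW_def rat_deriv_mult rat_deriv_const mult.assoc\<close>)
    moreover have "?g (sc s (hW w)) = sc (rat.F 0 f) (acts 0 (sc s (hW w))) + (\<Sum>j\<in>{1..<?N}. sc (rat.F j f) (acts j (sc s (hW w))))"
    proof -
      have "{..<?N} = insert 0 {1..<?N}" using lj.act_order(1) by auto
      then show ?thesis unfolding lj.actv_def by simp
    qed
    ultimately show ?thesis
      using models_add[OF models_T pt_closed[OF Ds w] F(1)] F(2) by simp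
  qed
  have g1: "?g (v + w) = ?g v + ?g w" for v w by (rule lj.actv_add)
  have g2: "?g (sc (rat_const c) v) = sc (rat_const c) (?g v)" for c v
    unfolding lj.actv_sc[OF lj.act_order(1)] by (simp add: rat_deriv_const)
  have g3: "?g v \<in> lj.VA" if "v \<in> lj.VA" for v
  proof -
    have "rat.F j f \<in> A" for j using rA[OF coord_1[OF inj], of j] unfolding rF by simp
    then show ?thesis unfolding lj.actv_def by (intro lj.VA_sum lj.VA_sc lj.act_VA[OF that])
  qed
  have "tensor_act a m W \<rho> (EV f) X \<in> carrier T \<and> hT (tensor_act a m W \<rho> (EV f) X) = ?g (hT X)"
    unfolding tensor_act_def
    by (intro conjI tensor_lift_value[where g = ?g, OF _ _ g1 g2 g3 X]) (use b in \<open>blast+\<close>)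
  then show "tensor_act a m W \<rho> (EV f) X \<in> carrier T"
    "hT (tensor_act a m W \<rho> (EV f) X) = ?g (hT X)" by auto
qed

end

context tensor_setup
begin

subsection \<open>Gelfand--Fuks cochains\<close>

abbreviation "CG \<equiv> gf_cochain_space A (field_scale a m) (tensor_scale a m W) VF T"
abbreviation "CL \<equiv> cochain_space L_plus W"

lemma gf_sum_value:
  fixes p :: nat
  assumes \<phi>: "\<phi> \<in> carrier (cochain_space VF T k)" and f: "f \<in> A" and x: "x \<in> A"
    and fs: "set fs \<subseteq> A" "int (length (x # fs)) = k"
  defines "G \<equiv> \<lambda>i. ((-1) ^ i * of_nat (p choose i)) \<odot>\<^bsub>T\<^esub>
      tensor_scale a m W (f ^ (p - i)) (\<phi> (field_scale a m (f ^ i) (EV x) # map EV fs))"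
  shows "finsum T G {0..p} \<in> carrier T"
    "hT (finsum T G {0..p}) =
      (\<Sum>i\<in>{0..p}. sc ((-1) ^ i * of_nat (p choose i) * f ^ (p - i)) (vl.hat k \<phi> ((f ^ i * x) # fs)))"
proof -
  have fi: "f ^ i \<in> A" for i by (rule coord_power[OF inj f])
  have G: "G i \<in> carrier T \<and> hT (G i) =
      sc ((-1) ^ i * of_nat (p choose i) * f ^ (p - i)) (vl.hat k \<phi> ((f ^ i * x) # fs))" for i
  proof -
    have l: "set ((f ^ i * x) # fs) \<subseteq> A" "int (length ((f ^ i * x) # fs)) = k"
      using fs coord_ring.mult[OF fi x] by auto
    have \<phi>c: "\<phi> (map EV ((f ^ i * x) # fs)) \<in> carrier T"
      by (rule PiE_mem[OF vl.cochain_PiE[OF \<phi>] vl.map_E[OF l]])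
    have h: "hT (\<phi> (map EV ((f ^ i * x) # fs))) = vl.hat k \<phi> ((f ^ i * x) # fs)"
      unfolding vl.hat_def using l by (simp only: simp_thms if_True)
    have G': "G i = ((-1) ^ i * of_nat (p choose i)) \<odot>\<^bsub>T\<^esub> tensor_scale a m W (f ^ (p - i)) (\<phi> (map EV ((f ^ i * x) # fs)))"
      unfolding G_def EV_simps(4)[OF fi x] by simp
    have c: "rat_const ((-1) ^ i * of_nat (p choose i)) = (-1) ^ i * of_nat (p choose i)"
    proof -
      have "rat_const ((-1) ^ i) = (-1) ^ i" by (cases "even i") (simp_all add: rat_const_minus)
      then show ?thesis by (simp add: rat_const_mult rat_const_of_nat[OF inj])
    qed
    note v = tensor_scale_value[OF fi[of "p - i"] \<phi>c]
    show ?thesis unfolding G' models_smult(2)[OF models_T v(1)] v(2) h c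
      using models_smult(1)[OF models_T v(1)] by simp
  qed
  have "finsum T G {0..p} \<in> carrier T" "hT (finsum T G {0..p}) = (\<Sum>i\<in>{0..p}. hT (G i))"
    by (rule models_finsum[OF models_T finite_atLeastAtMost], rule conjunct1[OF G])+
  then show "finsum T G {0..p} \<in> carrier T"
    "hT (finsum T G {0..p}) =
      (\<Sum>i\<in>{0..p}. sc ((-1) ^ i * of_nat (p choose i) * f ^ (p - i)) (vl.hat k \<phi> ((f ^ i * x) # fs)))"
    using G by simp_all
qed

definition gf_cond :: "nat \<Rightarrow> (complex poly fract list \<Rightarrow> complex poly fract val) \<Rightarrow> bool" where
  "gf_cond p \<psi> \<longleftrightarrow> (\<forall>f\<in>A. \<forall>x\<in>A. \<forall>fs. set fs \<subseteq> A \<longrightarrow>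
     (\<Sum>i\<in>{0..p}. sc ((-1) ^ i * of_nat (p choose i) * f ^ (p - i)) (\<psi> ((f ^ i * x) # fs))) = 0)"

lemma gfc_iff: "\<psi> \<in> lj.gfc k \<longleftrightarrow> \<psi> \<in> vl.multi k \<and> (\<exists>p>0. gf_cond p \<psi>)"
  unfolding lj.gfc_def vl.multi_def gf_cond_def by auto

lemma gf_cond_iff:
  assumes \<phi>: "\<phi> \<in> carrier (cochain_space VF T k)" and k: "1 \<le> k"
  shows "gf_cond p (vl.hat k \<phi>) \<longleftrightarrow> (\<forall>f\<in>A. \<forall>x xs. x # xs \<in> tuples VF k \<longrightarrow>
     (\<Oplus>\<^bsub>T\<^esub>i\<in>{0..p}. ((-1) ^ i * of_nat (p choose i)) \<odot>\<^bsub>T\<^esub>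
        tensor_scale a m W (f ^ (p - i)) (\<phi> (field_scale a m (f ^ i) x # xs))) = \<zero>\<^bsub>T\<^esub>)"
    (is "_ \<longleftrightarrow> ?R")
proof
  assume c: "gf_cond p (vl.hat k \<phi>)"
  show ?R
  proof (intro ballI allI impI)
    fix f D Ds assume f: "f \<in> A" and D: "D # Ds \<in> tuples VF k"
    note m = vl.map_Ei[OF D]
    let ?x = "vl.Ei D" and ?fs = "map vl.Ei Ds"
    have x: "?x \<in> A" "set ?fs \<subseteq> A" "int (length (?x # ?fs)) = k" "EV ?x = D" "map EV ?fs = Ds"
      using m by simp_all
    note s = gf_sum_value[OF \<phi> f x(1-3), of p, unfolded x(4,5)]
    have "hT (\<Oplus>\<^bsub>T\<^esub>i\<in>{0..p}. ((-1) ^ i * of_nat (p choose i)) \<odot>\<^bsub>T\<^esub>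
        tensor_scale a m W (f ^ (p - i)) (\<phi> (field_scale a m (f ^ i) D # Ds))) = 0"
      unfolding s(2) using c f x(1,2) unfolding gf_cond_def by blast
    then show "(\<Oplus>\<^bsub>T\<^esub>i\<in>{0..p}. ((-1) ^ i * of_nat (p choose i)) \<odot>\<^bsub>T\<^esub>
        tensor_scale a m W (f ^ (p - i)) (\<phi> (field_scale a m (f ^ i) D # Ds))) = \<zero>\<^bsub>T\<^esub>"
      using models_inj[OF models_T s(1) models_zero(1)[OF models_T]] models_zero(2)[OF models_T] by simp
  qed
next
  assume R: ?R
  show "gf_cond p (vl.hat k \<phi>)"
    unfolding gf_cond_def
  proof (intro ballI allI impI)
    fix f x fs assume f: "f \<in> A" and x: "x \<in> A" and fs: "set fs \<subseteq> A"
    show "(\<Sum>i\<in>{0..p}. sc ((-1) ^ i * of_nat (p choose i) * f ^ (p - i)) (vl.hat k \<phi> ((f ^ i * x) # fs))) = 0"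
    proof (cases "int (length (x # fs)) = k")
      case True
      have "map EV (x # fs) \<in> tuples VF k" by (rule vl.map_E) (use x fs True in auto)
      then have t: "EV x # map EV fs \<in> tuples VF k" by simp
      show ?thesis
        using R[rule_format, OF f t] gf_sum_value(2)[OF \<phi> f x fs True, of p] models_zero(2)[OF models_T] by simp
    next
      case False
      then have "vl.hat k \<phi> ((f ^ i * x) # fs) = 0" for i by (simp add: vl.hat_def)
      then show ?thesis by simp
    qed
  qed
qed

lemma CG_iff: "\<phi> \<in> carrier (CG k) \<longleftrightarrow> \<phi> \<in> carrier (cochain_space VF T k) \<and> vl.hat k \<phi> \<in> lj.gfc k"
proof (cases "\<phi> \<in> carrier (cochain_space VF T k)")
  case True
  note h = vl.hat_multi[OF True]
  show ?thesis
  proof (cases "1 \<le> k")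
    case k: True
    show ?thesis
      unfolding gfc_iff gf_cochain_space_def using True h k gf_cond_iff[OF True k] by simp
  next
    case False
    \<comment> \<open>For k < 1 the record imposes no order condition, and there is no first
      argument to which the condition in \<open>gfc\<close> could apply.\<close>
    then have "vl.hat k \<phi> (x # xs) = 0" for x xs by (simp add: vl.hat_def)
    then have "gf_cond 1 (vl.hat k \<phi>)" by (simp add: gf_cond_def)
    then have "\<exists>p>0. gf_cond p (vl.hat k \<phi>)" by blast
    then show ?thesis unfolding gfc_iff gf_cochain_space_def using True h False by simp
  qed
next
  case False
  then show ?thesis by (simp add: gf_cochain_space_def)
qed

lemma CG_space: "CG k = (cochain_space VF T k)\<lparr>carrier := {\<phi> \<in> carrier (cochain_space VF T k). vl.hat k \<phi> \<in> lj.gfc k}\<rparr>"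
proof -
  have "carrier (CG k) = {\<phi> \<in> carrier (cochain_space VF T k). vl.hat k \<phi> \<in> lj.gfc k}"
    using CG_iff by blast
  moreover have "CG k = (cochain_space VF T k)\<lparr>carrier := carrier (CG k)\<rparr>"
    by (simp add: gf_cochain_space_def)
  ultimately show ?thesis by simp
qed

lemma models_CG: "models (\<lambda>c f x. sc (rat_const c) (f x)) (CG k) (\<lambda>\<phi>. lj.coef (vl.hat k \<phi>)) (lj.coc k)"
proof -
  note MC = vl.models_cochains[of k]
  let ?C = "{\<phi> \<in> carrier (cochain_space VF T k). vl.hat k \<phi> \<in> lj.gfc k}"
  have sub: "lj.gfc k \<subseteq> vl.multi k" using gfc_iff by blast
  have im: "vl.hat k ` ?C = lj.gfc k"
  proof
    show "lj.gfc k \<subseteq> vl.hat k ` ?C"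
    proof
      fix \<psi> assume \<psi>: "\<psi> \<in> lj.gfc k"
      then obtain \<phi> where "\<phi> \<in> carrier (cochain_space VF T k)" "vl.hat k \<phi> = \<psi>"
        using vl.hat_surj sub by blast
      then show "\<psi> \<in> vl.hat k ` ?C" using \<psi> by blast
    qed
  qed auto
  have "models (\<lambda>c f x. sc (rat_const c) (f x)) (CG k) (vl.hat k) (vl.hat k ` ?C)"
    unfolding CG_space
  proof (rule models_restrict[OF MC])
    show "\<zero>\<^bsub>cochain_space VF T k\<^esub> \<in> ?C" using models_zero[OF MC] lj.gfc_0 by simp
  next
    fix \<phi> \<phi>' assume "\<phi> \<in> ?C" "\<phi>' \<in> ?C"
    then show "\<phi> \<oplus>\<^bsub>cochain_space VF T k\<^esub> \<phi>' \<in> ?C" using models_add[OF MC] lj.gfc_add by simp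
  next
    fix c \<phi> assume "\<phi> \<in> ?C"
    then show "c \<odot>\<^bsub>cochain_space VF T k\<^esub> \<phi> \<in> ?C" using models_smult[OF MC] lj.gfc_scale by simp
  qed auto
  then have "models (\<lambda>c f x. sc (rat_const c) (f x)) (CG k) (vl.hat k) (lj.gfc k)" unfolding im .
  then show ?thesis
    by (rule models_comp[OF _ vector_space_fun[OF lj.vector_space_\<iota>] lj.coef_bij])
      (simp_all add: fun_eq_iff lj.coef_add lj.coef_scale)
qed

lemma CG_coboundary:
  assumes \<phi>: "\<phi> \<in> carrier (CG k)"
  shows "coboundary VF T (tensor_act a m W \<rho>) k \<phi> \<in> carrier (CG (k + 1))"
    "lj.coef (vl.hat (k + 1) (coboundary VF T (tensor_act a m W \<rho>) k \<phi>)) = dee brn acts (lj.coef (vl.hat k \<phi>))"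
proof -
  have c: "\<phi> \<in> carrier (cochain_space VF T k)" "vl.hat k \<phi> \<in> lj.gfc k" using \<phi> CG_iff by blast+
  obtain \<chi> where \<chi>: "\<chi> \<in> lj.gfc (k + 1)" "lj.coef \<chi> = dee brn acts (lj.coef (vl.hat k \<phi>))"
    "\<And>fs. set fs \<subseteq> A \<Longrightarrow> dee (\<lambda>f g. con (f * rat_deriv g - g * rat_deriv f)) (lj.actv lj.act_order) (vl.hat k \<phi>) fs = \<chi> fs"
    by (rule lj.gfc_dee[OF c(2)]) blast
  have m: "\<chi> \<in> vl.multi (k + 1)" using \<chi>(1) gfc_iff by blast
  note co = vl.coboundary_hat[where act = "tensor_act a m W \<rho>" and act' = "lj.actv lj.act_order",
      OF tensor_act_value(1) tensor_act_value(2) c(1) m \<chi>(3)]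
  have h: "vl.hat (k + 1) (coboundary VF T (tensor_act a m W \<rho>) k \<phi>) = \<chi>" by (rule co(2))
  show "coboundary VF T (tensor_act a m W \<rho>) k \<phi> \<in> carrier (CG (k + 1))"
    unfolding CG_iff h using co(1) \<chi>(1) by blast
  show "lj.coef (vl.hat (k + 1) (coboundary VF T (tensor_act a m W \<rho>) k \<phi>)) = dee brn acts (lj.coef (vl.hat k \<phi>))"
    unfolding h by (rule \<chi>(2))
qed

subsection \<open>Cochains of polynomial vector fields\<close>

lemma polyc_multi: "ll.multi k = lj.polyc k"
  unfolding ll.multi_def lj.polyc_def ..

lemma models_CL: "models (\<lambda>c f x. sc (rat_const c) (f x)) (CL k) (\<lambda>\<phi>. lj.pcoef (ll.hat k \<phi>)) (lj.cocC k)"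
  by (rule models_comp[OF ll.models_cochains[unfolded polyc_multi] vector_space_fun[OF lj.vector_space_\<iota>] lj.pcoef_bij])
    (simp_all add: fun_eq_iff lj.pcoef_def)

lemma CL_coboundary:
  assumes \<phi>: "\<phi> \<in> carrier (CL k)"
  shows "coboundary L_plus W \<rho> k \<phi> \<in> carrier (CL (k + 1))"
    "lj.pcoef (ll.hat (k + 1) (coboundary L_plus W \<rho> k \<phi>)) = dee brn acts (lj.pcoef (ll.hat k \<phi>))"
proof -
  have p: "ll.hat k \<phi> \<in> lj.polyc k" using ll.hat_multi[OF \<phi>] unfolding polyc_multi .
  note D = lj.polyc_dee[OF p]
  have m: "lj.extB (dee brn acts (lj.pcoef (ll.hat k \<phi>))) \<in> ll.multi (k + 1)"
    using D(1) unfolding polyc_multi .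
  note co = ll.coboundary_hat[where act = \<rho> and act' = "lj.actp",
      OF \<rho>_closed[OF ll.E_carrier] hW_poly_field \<phi> m D(3)]
  have h: "ll.hat (k + 1) (coboundary L_plus W \<rho> k \<phi>) = lj.extB (dee brn acts (lj.pcoef (ll.hat k \<phi>)))"
    by (rule co(2))
  show "coboundary L_plus W \<rho> k \<phi> \<in> carrier (CL (k + 1))" by (rule co(1))
  show "lj.pcoef (ll.hat (k + 1) (coboundary L_plus W \<rho> k \<phi>)) = dee brn acts (lj.pcoef (ll.hat k \<phi>))"
    unfolding h by (rule D(2))
qed

subsection \<open>The comparison\<close>

lemma DN_laws:
  "dee brn acts (v + w) = dee brn acts v + dee brn acts w"
  "dee brn acts (\<lambda>js. sc (rat_const c) (v js)) = (\<lambda>js. sc (rat_const c) (dee brn acts v js))"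
  "dee brn acts (dee brn acts v) = 0"
  by (simp_all add: fun_eq_iff lj.DN_add lj.DN_\<iota>_scale lj.DN_DN)

lemma models_lie_cohomology:
  "models (\<lambda>c f x. sc (rat_const c) (f x)) (lie_cohomology L_plus W \<rho> k)
     (\<lambda>X. lj.bmap k (lj.pcoef (ll.hat k (SOME x. x \<in> X)))) (lj.hC k)"
  unfolding lie_cohomology_def lj.hC_def
  by (rule models_cohomology[where \<theta> = "\<lambda>k \<phi>. lj.pcoef (ll.hat k \<phi>)" and q = "lj.bmap k",
        OF models_CL CL_coboundary DN_laws vector_space_fun[OF lj.vector_space_\<iota>]])
    (simp_all add: lj.bmap)

text \<open>Both sides are modelled by pairs of an element of \<open>hC k\<close> and m elements of
  \<open>hC (k - 1)\<close>: the left by \<open>gmap_image\<close>, the right by the models of the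
  direct sum and of the tensor product.\<close>

lemma tensor_comparison:
  "linear_isomorphic (gf_cohomology a m W \<rho> k)
     (direct_sum (lie_cohomology L_plus W \<rho> k)
        (tensor_space (module_vec TYPE(complex) m) (lie_cohomology L_plus W \<rho> (k - 1))))"
proof -
  let ?s = "\<lambda>c (f :: nat list \<Rightarrow> complex poly fract val) x. sc (rat_const c) (f x)"
  let ?S = "\<lambda>c (p :: (nat list \<Rightarrow> complex poly fract val) \<times> (nat \<Rightarrow> nat list \<Rightarrow> complex poly fract val)).
      (?s c (fst p), \<lambda>j. ?s c (snd p j))"
  note R = models_direct_sum[OF models_lie_cohomology[of k]
      models_tensor_finite(3)[OF models_lie_cohomology[of "k - 1"] models_module_vec[of m]]]
  have vs: "vector_space ?S" by (rule models_vs[OF R])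
  have L: "models ?S (gf_cohomology a m W \<rho> k) (\<lambda>X. lj.gmap k (lj.coef (vl.hat k (SOME x. x \<in> X))))
      (lj.gmap k ` {c \<in> lj.coc k. dee brn acts c = 0})"
    unfolding gf_cohomology_def
  proof (rule models_cohomology[where \<theta> = "\<lambda>k \<phi>. lj.coef (vl.hat k \<phi>)" and q = "lj.gmap k",
        OF models_CG CG_coboundary DN_laws vs])
    show "lj.gmap k (v + w) = lj.gmap k v + lj.gmap k w" if "v \<in> lj.coc k" "w \<in> lj.coc k" for v w
      by (rule lj.gmap_add[OF that])
    show "lj.gmap k (?s c v) = ?S c (lj.gmap k v)" if "v \<in> lj.coc k" for c v
      by (rule lj.gmap_scale[OF that])
    show "lj.gmap k v = 0 \<longleftrightarrow> v \<in> dee brn acts ` lj.coc (k - 1)" if "v \<in> lj.coc k" "dee brn acts v = 0" for v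
      by (rule lj.gmap_kernel[OF that])
  qed assumption+
  show ?thesis
    by (rule models_linear_isomorphic[OF L[unfolded lj.gmap_image] R])
qed

end

theorem corollary7p4:
  fixes a :: "nat \<Rightarrow> complex" and m :: nat
    and W :: "(complex, 'w) module"
    and \<rho> :: "(complex poly \<Rightarrow> complex poly) \<Rightarrow> 'w \<Rightarrow> 'w"
    and k :: int
  assumes "inj_on a {1..m}"
    and "lie_module L_plus W \<rho>"
    and "vectorspace.fin_dim class_ring W"
  shows "linear_isomorphic
           (gf_cohomology a m W \<rho> k)
           (direct_sum (lie_cohomology L_plus W \<rho> k)
              (tensor_space (module_vec TYPE(complex) m) (lie_cohomology L_plus W \<rho> (k - 1))))"
proof -
  have "vectorspace class_ring W" using assms(2) by (simp add: lie_module_def)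
  then obtain n and \<kappa> :: "'w \<Rightarrow> nat \<Rightarrow> complex"
    where \<kappa>: "models (\<lambda>c f x. c * f x) W \<kappa> {u. \<forall>a\<ge>n. u a = 0}"
    using models_coordinates assms(3) by blast
  interpret tensor_setup a m W \<rho> \<kappa> n
    by (rule tensor_setup.intro[OF assms(1,2) \<kappa>])
  show ?thesis by (rule tensor_comparison)
qed

end
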